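(* Let $\Bbbk$ be an algebraically closed field of characteristic $p>0$, let $G$ be a finite group, and let $\mathcal{G}_{G}$ be the constant finite group scheme over $\Bbbk$ with $\mathcal{G}_{G}(\Bbbk)=G$. Then $\operatorname{srk}(\mathcal{G}_{G})$ is the minimal rank of a maximal elementary abelian $p$-subgroup of $G$.
   Context: For a finite group scheme $\mathcal{G}$ over $\Bbbk$ with coordinate algebra $\Bbbk[\mathcal{G}]$, put $\Bbbk\mathcal{G}:=\Bbbk[\mathcal{G}]^{*}$ (a finite-dimensional cocommutative Hopf algebra). For $\mathcal{G}=\mathcal{G}_G$ this is the group algebra $\Bbbk G$. A $p$-point of $\mathcal{G}$ is a $\Bbbk$-algebra homomorphism $\alpha:\Bbbk[t]/(t^{p})\to\Bbbk\mathcal{G}$ that is left flat and factors through $\Bbbk\mathcal{U}$ for some abelian unipotent subgroup scheme $\mathcal{U}\subseteq\mathcal{G}$. Two $p$-points $\alpha,\beta$ are equivalent if for every finite-dimensional $\Bbbk\mathcal{G}$-module $M$, the pull-back $\alpha^{*}(M)$ is projective if and only if $\beta^{*}(M)$ is projective. $\mathrm{P}(\mathcal{G})$ is the set of equivalence classes of $p$-points. For a subgroup scheme $\mathcal{H}\subseteq\mathcal{G}$ the inclusion $\iota_{\mathcal H}$ induces $\iota_{*,\Bbbk\mathcal{H}}:\mathrm{P}(\mathcal{H})\to\mathrm{P}(\mathcal{G})$ by composing $p$-points with $\Bbbk\mathcal{H}\hookrightarrow\Bbbk\mathcal{G}$. For a finite group scheme $\mathcal{U}$, $\operatorname{cx}_{\mathcal{U}}(\Bbbk)$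 is the complexity of the trivial module $\Bbbk$, i.e. the polynomial rate of growth of a minimal projective resolution (equivalently, the Krull dimension of the even cohomology ring of $\mathcal{U}$). Let $\mathrm{Max}_{au}(\mathcal{G})$ be the set of maximal abelian unipotent subgroup schemes of $\mathcal{G}$; for $\ell\ge 1$ let $\mathrm{Max}_{au}(\mathcal{G})_{\ell}=\{\mathcal{U}\in\mathrm{Max}_{au}(\mathcal{G}) : \operatorname{cx}_{\mathcal{U}}(\Bbbk)\ge\ell\}$ and $\mathrm{P}(\mathcal{G})_{\ell}=\bigcup_{\mathcal{U}\in\mathrm{Max}_{au}(\mathcal{G})_{\ell}}\iota_{*,\Bbbk\mathcal{U}}(\mathrm{P}(\mathcal{U}))$. The saturation rank of $\mathcal{G}$ is $\operatorname{srk}(\mathcal{G})=\max\{\ell\ge1 : \mathrm{P}(\mathcal{G})=\mathrm{P}(\mathcal{G})_{\ell}\}$. It is considered only when $\mathrm{P}(\mathcal{G})\neq\emptyset$, so that the maximum exists (for $\mathcal{G}_G$: when $p$ divides $|G|$). The rank of an elementary abelian $p$-group $(\mathbb{Z}/p\mathbb{Z})^{n}$ is $n$; "maximal" means maximal with respect to inclusion among elementary abelian $p$-subgroups of $G$. *)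

theory Defs
  imports
    "HOL-Library.Function_Algebras"
    "HOL-Library.Extended_Nat"
    "HOL-Computational_Algebra.Polynomial"
    "HOL-Algebra.Elementary_Groups"
    "HOL-Algebra.Product_Groups"
begin

section \<open>Finite-dimensional vector spaces and tensor products\<close>

text \<open>
  Every finite-dimensional vector space over a field is isomorphic to a subspace of a space of
  functions with pointwise operations, so vector spaces are taken to be finite-dimensional
  subspaces of \<open>'b \<Rightarrow> 'k\<close>. The tensor product of \<open>V \<subseteq> k\<^sup>I\<close> and \<open>W \<subseteq> k\<^sup>J\<close> is then
  the span of the products \<open>(i, j) \<mapsto> v i * w j\<close> in \<open>k\<^sup>I\<^sup>\<times>\<^sup>J\<close>: over a field the canonical map
  from the tensor product into that function space is injective.
\<close>

definition fscale :: "'k::field \<Rightarrow> ('b \<Rightarrow> 'k) \<Rightarrow> ('b \<Rightarrow> 'k)" where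
  "fscale c f = (\<lambda>x. c * f x)"

global_interpretation fvs: vector_space fscale
  by unfold_locales (auto simp: fscale_def fun_eq_iff algebra_simps)

definition fin_dim :: "('b \<Rightarrow> 'k::field) set \<Rightarrow> bool" where
  "fin_dim V \<longleftrightarrow> (\<exists>B. finite B \<and> V = fvs.span B)"

definition linear_on :: "('b \<Rightarrow> 'k::field) set \<Rightarrow> (('b \<Rightarrow> 'k) \<Rightarrow> ('c \<Rightarrow> 'k)) \<Rightarrow> bool" where
  "linear_on V f \<longleftrightarrow>
     (\<forall>x\<in>V. \<forall>y\<in>V. f (x + y) = f x + f y) \<and> (\<forall>c. \<forall>x\<in>V. f (fscale c x) = fscale c (f x))"

definition linear_form_on :: "('b \<Rightarrow> 'k::field) set \<Rightarrow> (('b \<Rightarrow> 'k) \<Rightarrow> 'k) \<Rightarrow> bool" where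
  "linear_form_on V f \<longleftrightarrow>
     (\<forall>x\<in>V. \<forall>y\<in>V. f (x + y) = f x + f y) \<and> (\<forall>c. \<forall>x\<in>V. f (fscale c x) = c * f x)"

definition bilinear_on ::
  "('b \<Rightarrow> 'k::field) set \<Rightarrow> ('c \<Rightarrow> 'k) set \<Rightarrow> (('b \<Rightarrow> 'k) \<Rightarrow> ('c \<Rightarrow> 'k) \<Rightarrow> ('d \<Rightarrow> 'k)) \<Rightarrow> bool" where
  "bilinear_on V W f \<longleftrightarrow>
     (\<forall>x\<in>V. linear_on W (f x)) \<and> (\<forall>y\<in>W. linear_on V (\<lambda>x. f x y))"

definition tens :: "('b \<Rightarrow> 'k::field) \<Rightarrow> ('c \<Rightarrow> 'k) \<Rightarrow> ('b \<times> 'c \<Rightarrow> 'k)" where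
  "tens x y = (\<lambda>(i, j). x i * y j)"

definition tensor_space ::
  "('b \<Rightarrow> 'k::field) set \<Rightarrow> ('c \<Rightarrow> 'k) set \<Rightarrow> ('b \<times> 'c \<Rightarrow> 'k) set" where
  "tensor_space V W = fvs.span {tens x y |x y. x \<in> V \<and> y \<in> W}"


section \<open>Finite-dimensional algebras and their modules\<close>

definition fd_algebra :: "('b \<Rightarrow> 'k::field, 'm) monoid_scheme \<Rightarrow> bool" where
  "fd_algebra A \<longleftrightarrow>
     monoid A \<and> fin_dim (carrier A) \<and> bilinear_on (carrier A) (carrier A) (monoid.mult A)"

definition alg_hom ::
  "('b \<Rightarrow> 'k::field, 'm) monoid_scheme \<Rightarrow> ('c \<Rightarrow> 'k, 'n) monoid_scheme
    \<Rightarrow> (('b \<Rightarrow> 'k) \<Rightarrow> ('c \<Rightarrow> 'k)) set" where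
  "alg_hom A B = {f \<in> hom A B. linear_on (carrier A) f \<and> f \<one>\<^bsub>A\<^esub> = \<one>\<^bsub>B\<^esub>}"

definition opposite :: "('a, 'm) monoid_scheme \<Rightarrow> ('a, 'm) monoid_scheme" where
  "opposite A = A\<lparr>monoid.mult := (\<lambda>x y. y \<otimes>\<^bsub>A\<^esub> x)\<rparr>"

record ('a, 'c, 'k) amod =
  space :: "('c \<Rightarrow> 'k) set"
  act :: "'a \<Rightarrow> ('c \<Rightarrow> 'k) \<Rightarrow> ('c \<Rightarrow> 'k)"

definition fd_module ::
  "('b \<Rightarrow> 'k::field, 'm) monoid_scheme \<Rightarrow> ('b \<Rightarrow> 'k, 'c, 'k) amod \<Rightarrow> bool" where
  "fd_module A M \<longleftrightarrow>
     fin_dim (space M) \<and>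
     (\<forall>a\<in>carrier A. \<forall>v\<in>space M. act M a v \<in> space M) \<and>
     bilinear_on (carrier A) (space M) (act M) \<and>
     (\<forall>v\<in>space M. act M \<one>\<^bsub>A\<^esub> v = v) \<and>
     (\<forall>a\<in>carrier A. \<forall>b\<in>carrier A. \<forall>v\<in>space M. act M (a \<otimes>\<^bsub>A\<^esub> b) v = act M a (act M b v))"

definition fd_right_module ::
  "('b \<Rightarrow> 'k::field, 'm) monoid_scheme \<Rightarrow> ('b \<Rightarrow> 'k, 'c, 'k) amod \<Rightarrow> bool" where
  "fd_right_module A M \<longleftrightarrow> fd_module (opposite A) M"

definition submod ::
  "('b \<Rightarrow> 'k::field, 'm) monoid_scheme \<Rightarrow> ('b \<Rightarrow> 'k, 'c, 'k) amod \<Rightarrow> ('c \<Rightarrow> 'k) set \<Rightarrow> bool" where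
  "submod A M W \<longleftrightarrow>
     fvs.subspace W \<and> W \<subseteq> space M \<and> (\<forall>a\<in>carrier A. \<forall>w\<in>W. act M a w \<in> W)"

definition mod_hom ::
  "('b \<Rightarrow> 'k::field, 'm) monoid_scheme \<Rightarrow> ('b \<Rightarrow> 'k, 'c, 'k) amod \<Rightarrow> ('b \<Rightarrow> 'k, 'd, 'k) amod
    \<Rightarrow> (('c \<Rightarrow> 'k) \<Rightarrow> ('d \<Rightarrow> 'k)) set" where
  "mod_hom A M N =
     {f. f \<in> space M \<rightarrow> space N \<and> linear_on (space M) f \<and>
         (\<forall>a\<in>carrier A. \<forall>v\<in>space M. f (act M a v) = act N a (f v))}"

definition regular_module ::
  "('b \<Rightarrow> 'k::field, 'm) monoid_scheme \<Rightarrow> ('b \<Rightarrow> 'k, 'b, 'k) amod" where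
  "regular_module A = \<lparr>space = carrier A, act = monoid.mult A\<rparr>"

definition pullback :: "('a \<Rightarrow> 'b) \<Rightarrow> ('b, 'c, 'k) amod \<Rightarrow> ('a, 'c, 'k) amod" where
  "pullback \<alpha> M = \<lparr>space = space M, act = (\<lambda>a. act M (\<alpha> a))\<rparr>"

text \<open>
  The test modules range over the finite-dimensional subspaces of \<open>nat \<Rightarrow> 'k\<close>, hence over all
  finite-dimensional modules up to isomorphism. For a finite-dimensional module over a
  finite-dimensional algebra this is projectivity in the category of all modules.
\<close>

definition projective ::
  "('b \<Rightarrow> 'k::field, 'm) monoid_scheme \<Rightarrow> ('b \<Rightarrow> 'k, 'c, 'k) amod \<Rightarrow> bool" where
  "projective A M \<longleftrightarrow> fd_module A M \<and>
     (\<forall>(X :: ('b \<Rightarrow> 'k, nat, 'k) amod) (Y :: ('b \<Rightarrow> 'k, nat, 'k) amod).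
        \<forall>g\<in>mod_hom A X Y. \<forall>f\<in>mod_hom A M Y.
          fd_module A X \<and> fd_module A Y \<and> g ` space X = space Y \<longrightarrow>
          (\<exists>h\<in>mod_hom A M X. \<forall>v\<in>space M. g (h v) = f v))"

text \<open>
  For a right module \<open>N\<close> and a left module \<open>M\<close>, the tensor product over \<open>A\<close> is the quotient of
  \<open>tensor_space (space N) (space M)\<close> by \<open>balanced A N M\<close>. Thus the condition in \<open>flat\<close> says
  that the map of tensor products over \<open>A\<close> induced by the inclusion of a submodule \<open>W\<close> of \<open>N\<close> is
  injective. Testing finite-dimensional right modules suffices, since these include the right
  ideals of \<open>A\<close>.
\<close>

definition balanced ::
  "('b \<Rightarrow> 'k::field, 'm) monoid_scheme \<Rightarrow> ('b \<Rightarrow> 'k, 'c, 'k) amod \<Rightarrow> ('b \<Rightarrow> 'k, 'd, 'k) amod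
    \<Rightarrow> ('c \<times> 'd \<Rightarrow> 'k) set" where
  "balanced A N M =
     fvs.span {tens (act N a x) y - tens x (act M a y) |a x y.
                 a \<in> carrier A \<and> x \<in> space N \<and> y \<in> space M}"

definition flat ::
  "('b \<Rightarrow> 'k::field, 'm) monoid_scheme \<Rightarrow> ('b \<Rightarrow> 'k, 'c, 'k) amod \<Rightarrow> bool" where
  "flat A M \<longleftrightarrow> fd_module A M \<and>
     (\<forall>(N :: ('b \<Rightarrow> 'k, nat, 'k) amod) W.
        fd_right_module A N \<and> submod (opposite A) N W \<longrightarrow>
        tensor_space W (space M) \<inter> balanced A N M \<subseteq> balanced A (N\<lparr>space := W\<rparr>) M)"


section \<open>Complexity\<close>

definition ker_on :: "('b \<Rightarrow> 'k::field, 'c, 'k) amod \<Rightarrow> (('c \<Rightarrow> 'k) \<Rightarrow> ('d \<Rightarrow> 'k)) \<Rightarrow> ('c \<Rightarrow> 'k) set" where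
  "ker_on M f = {v \<in> space M. f v = 0}"

definition superfluous ::
  "('b \<Rightarrow> 'k::field, 'm) monoid_scheme \<Rightarrow> ('b \<Rightarrow> 'k, 'c, 'k) amod \<Rightarrow> ('c \<Rightarrow> 'k) set \<Rightarrow> bool" where
  "superfluous A M K \<longleftrightarrow>
     (\<forall>W. submod A M W \<and> {w + x |w x. w \<in> W \<and> x \<in> K} = space M \<longrightarrow> W = space M)"

text \<open>
  \<open>\<dots> \<rightarrow> P 1 \<rightarrow> P 0 \<rightarrow> M \<rightarrow> 0\<close> with augmentation \<open>e\<close> and \<open>d n\<close> from \<open>P (Suc n)\<close> to \<open>P n\<close>;
  minimality means that each map is a projective cover of its image.
\<close>

definition minimal_projective_resolution ::
  "('b \<Rightarrow> 'k::field, 'm) monoid_scheme \<Rightarrow> ('b \<Rightarrow> 'k, 'c, 'k) amod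
    \<Rightarrow> (nat \<Rightarrow> ('b \<Rightarrow> 'k, nat, 'k) amod) \<Rightarrow> (nat \<Rightarrow> (nat \<Rightarrow> 'k) \<Rightarrow> (nat \<Rightarrow> 'k))
    \<Rightarrow> ((nat \<Rightarrow> 'k) \<Rightarrow> ('c \<Rightarrow> 'k)) \<Rightarrow> bool" where
  "minimal_projective_resolution A M P d e \<longleftrightarrow>
     (\<forall>n. projective A (P n)) \<and>
     e \<in> mod_hom A (P 0) M \<and> (\<forall>n. d n \<in> mod_hom A (P (Suc n)) (P n)) \<and>
     e ` space (P 0) = space M \<and>
     d 0 ` space (P 1) = ker_on (P 0) e \<and>
     (\<forall>n. d (Suc n) ` space (P (Suc (Suc n))) = ker_on (P (Suc n)) (d n)) \<and>
     superfluous A (P 0) (ker_on (P 0) e) \<and>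
     (\<forall>n. superfluous A (P (Suc n)) (ker_on (P (Suc n)) (d n)))"

text \<open>
  The least \<open>c\<close> such that \<open>dim P\<^sub>n \<le> C n\<^sup>c\<^sup>-\<^sup>1\<close> for some \<open>C\<close> and all \<open>n \<ge> 1\<close>. Minimal
  resolutions are unique up to isomorphism, so the choice of \<open>P\<close> does not matter. For \<open>c = 0\<close> the
  bound \<open>C / n\<close> forces \<open>P\<^sub>n = 0\<close> for large \<open>n\<close>.
\<close>

definition complexity ::
  "('b \<Rightarrow> 'k::field, 'm) monoid_scheme \<Rightarrow> ('b \<Rightarrow> 'k, 'c, 'k) amod \<Rightarrow> enat" where
  "complexity A M =
     Inf {enat c |c. \<exists>P d e. minimal_projective_resolution A M P d e \<and>
            (\<exists>C::real. \<forall>n\<ge>1. real (fvs.dim (space (P n))) \<le> C * real n powi (int c - 1))}"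


section \<open>Finite group schemes\<close>

text \<open>
  A finite group scheme is represented by the finite-dimensional cocommutative Hopf algebra
  dual to its coordinate algebra.
\<close>

record ('b, 'k) hopf = "('b \<Rightarrow> 'k) monoid" +
  comult :: "('b \<Rightarrow> 'k) \<Rightarrow> ('b \<times> 'b \<Rightarrow> 'k)"
  counit :: "('b \<Rightarrow> 'k) \<Rightarrow> 'k"
  antipode :: "('b \<Rightarrow> 'k) \<Rightarrow> ('b \<Rightarrow> 'k)"

definition sweedler ::
  "('b, 'k::field) hopf \<Rightarrow> ('b \<Rightarrow> 'k) \<Rightarrow> nat \<Rightarrow> (nat \<Rightarrow> 'b \<Rightarrow> 'k) \<Rightarrow> (nat \<Rightarrow> 'b \<Rightarrow> 'k) \<Rightarrow> bool" where
  "sweedler H a n x y \<longleftrightarrow>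
     (\<forall>i<n. x i \<in> carrier H \<and> y i \<in> carrier H) \<and> comult H a = (\<Sum>i<n. tens (x i) (y i))"

text \<open>
  In \<open>coassoc\<close> the two sides live in functions on \<open>('b \<times> 'b) \<times> 'b\<close> and \<open>'b \<times> ('b \<times> 'b)\<close>
  respectively, and are compared entrywise.
\<close>

locale finite_group_scheme =
  fixes H :: "('b, 'k::field) hopf" (structure)
  assumes algebra: "fd_algebra H"
    and comult_closed: "a \<in> carrier H \<Longrightarrow> comult H a \<in> tensor_space (carrier H) (carrier H)"
    and comult_linear: "linear_on (carrier H) (comult H)"
    and counit_linear: "linear_form_on (carrier H) (counit H)"
    and coassoc: "\<lbrakk>a \<in> carrier H; sweedler H a n x y\<rbrakk> \<Longrightarrow>
          (\<Sum>i<n. tens (comult H (x i)) (y i)) ((u, v), w) =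
          (\<Sum>i<n. tens (x i) (comult H (y i))) (u, (v, w))"
    and counit_left: "\<lbrakk>a \<in> carrier H; sweedler H a n x y\<rbrakk> \<Longrightarrow>
          (\<Sum>i<n. fscale (counit H (x i)) (y i)) = a"
    and counit_right: "\<lbrakk>a \<in> carrier H; sweedler H a n x y\<rbrakk> \<Longrightarrow>
          (\<Sum>i<n. fscale (counit H (y i)) (x i)) = a"
    and comult_mult:
      "\<lbrakk>a \<in> carrier H; b \<in> carrier H; sweedler H a n x y; sweedler H b m x' y'\<rbrakk> \<Longrightarrow>
          comult H (a \<otimes> b) = (\<Sum>i<n. \<Sum>j<m. tens (x i \<otimes> x' j) (y i \<otimes> y' j))"
    and comult_one: "comult H \<one> = tens \<one> \<one>"
    and counit_mult: "\<lbrakk>a \<in> carrier H; b \<in> carrier H\<rbrakk> \<Longrightarrow>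
          counit H (a \<otimes> b) = counit H a * counit H b"
    and counit_one: "counit H \<one> = 1"
    and antipode_closed: "a \<in> carrier H \<Longrightarrow> antipode H a \<in> carrier H"
    and antipode_linear: "linear_on (carrier H) (antipode H)"
    and antipode_left: "\<lbrakk>a \<in> carrier H; sweedler H a n x y\<rbrakk> \<Longrightarrow>
          (\<Sum>i<n. antipode H (x i) \<otimes> y i) = fscale (counit H a) \<one>"
    and antipode_right: "\<lbrakk>a \<in> carrier H; sweedler H a n x y\<rbrakk> \<Longrightarrow>
          (\<Sum>i<n. x i \<otimes> antipode H (y i)) = fscale (counit H a) \<one>"
    and cocomm: "a \<in> carrier H \<Longrightarrow> comult H a (u, v) = comult H a (v, u)"

text \<open>Subgroup schemes correspond to Hopf subalgebras.\<close>

definition subgroup_scheme :: "('b, 'k::field) hopf \<Rightarrow> ('b, 'k) hopf \<Rightarrow> bool" where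
  "subgroup_scheme U H \<longleftrightarrow>
     carrier U \<subseteq> carrier H \<and> U = H\<lparr>carrier := carrier U\<rparr> \<and> finite_group_scheme U"

definition trivial_module :: "('b, 'k::field) hopf \<Rightarrow> ('b \<Rightarrow> 'k, unit, 'k) amod" where
  "trivial_module H = \<lparr>space = UNIV, act = (\<lambda>a. fscale (counit H a))\<rparr>"

definition abelian_scheme :: "('b, 'k::field) hopf \<Rightarrow> bool" where
  "abelian_scheme H \<longleftrightarrow> comm_monoid H"

definition unipotent_scheme :: "('b, 'k::field) hopf \<Rightarrow> bool" where
  "unipotent_scheme H \<longleftrightarrow>
     (\<forall>M :: ('b \<Rightarrow> 'k, nat, 'k) amod. fd_module H M \<and> space M \<noteq> {0} \<longrightarrow>
        (\<exists>v\<in>space M. v \<noteq> 0 \<and> (\<forall>a\<in>carrier H. act M a v = fscale (counit H a) v)))"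

definition au_subgroup_schemes :: "('b, 'k::field) hopf \<Rightarrow> ('b, 'k) hopf set" where
  "au_subgroup_schemes H = {U. subgroup_scheme U H \<and> abelian_scheme U \<and> unipotent_scheme U}"


section \<open>p-points and the saturation rank\<close>

text \<open>The algebra \<open>k[t]/(t\<^sup>p)\<close>, \<open>p\<close> the characteristic of \<open>k\<close>, in the basis \<open>1, t, \<dots>, t\<^sup>p\<^sup>-\<^sup>1\<close>.\<close>

definition trunc_poly :: "(nat \<Rightarrow> 'k::field) monoid" where
  "trunc_poly =
     \<lparr>carrier = {f. \<forall>n\<ge>CHAR('k). f n = 0},
      monoid.mult = (\<lambda>f g n. if n < CHAR('k) then \<Sum>i\<le>n. f i * g (n - i) else 0),
      one = (\<lambda>n. if n = 0 then 1 else 0)\<rparr>"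

definition p_points :: "('b, 'k::field) hopf \<Rightarrow> ((nat \<Rightarrow> 'k) \<Rightarrow> ('b \<Rightarrow> 'k)) set" where
  "p_points H =
     {\<alpha> \<in> alg_hom trunc_poly H.
        flat trunc_poly (pullback \<alpha> (regular_module H)) \<and>
        (\<exists>U\<in>au_subgroup_schemes H. \<alpha> ` carrier trunc_poly \<subseteq> carrier U)}"

definition p_equiv ::
  "('b, 'k::field) hopf \<Rightarrow> (((nat \<Rightarrow> 'k) \<Rightarrow> ('b \<Rightarrow> 'k)) \<times> ((nat \<Rightarrow> 'k) \<Rightarrow> ('b \<Rightarrow> 'k))) set" where
  "p_equiv H =
     {(\<alpha>, \<beta>). \<alpha> \<in> p_points H \<and> \<beta> \<in> p_points H \<and>
        (\<forall>M :: ('b \<Rightarrow> 'k, nat, 'k) amod. fd_module H M \<longrightarrow>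
           (projective trunc_poly (pullback \<alpha> M) \<longleftrightarrow> projective trunc_poly (pullback \<beta> M)))}"

definition P_space :: "('b, 'k::field) hopf \<Rightarrow> ((nat \<Rightarrow> 'k) \<Rightarrow> ('b \<Rightarrow> 'k)) set set" where
  "P_space H = p_points H // p_equiv H"

text \<open>
  The map induced by the inclusion of a subgroup scheme: composition with the inclusion of
  algebras is the identity on representatives, so a class of \<open>p\<close>-points of the subgroup scheme is
  sent to the \<open>p_equiv H\<close>-class of its elements.
\<close>

definition P_incl ::
  "('b, 'k::field) hopf \<Rightarrow> ((nat \<Rightarrow> 'k) \<Rightarrow> ('b \<Rightarrow> 'k)) set \<Rightarrow> ((nat \<Rightarrow> 'k) \<Rightarrow> ('b \<Rightarrow> 'k)) set" where
  "P_incl H X = p_equiv H `` X"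

definition Max_au :: "('b, 'k::field) hopf \<Rightarrow> ('b, 'k) hopf set" where
  "Max_au H =
     {U \<in> au_subgroup_schemes H.
        \<forall>U'\<in>au_subgroup_schemes H. carrier U \<subseteq> carrier U' \<longrightarrow> U' = U}"

definition Max_au_ge :: "('b, 'k::field) hopf \<Rightarrow> nat \<Rightarrow> ('b, 'k) hopf set" where
  "Max_au_ge H l = {U \<in> Max_au H. complexity U (trivial_module U) \<ge> enat l}"

definition P_space_ge :: "('b, 'k::field) hopf \<Rightarrow> nat \<Rightarrow> ((nat \<Rightarrow> 'k) \<Rightarrow> ('b \<Rightarrow> 'k)) set set" where
  "P_space_ge H l = (\<Union>U\<in>Max_au_ge H l. P_incl H ` P_space U)"

definition srk :: "('b, 'k::field) hopf \<Rightarrow> nat" where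
  "srk H = Max {l. l \<ge> 1 \<and> P_space H = P_space_ge H l}"


section \<open>Constant group schemes and elementary abelian subgroups\<close>

text \<open>
  The dual of the algebra of functions on \<open>G\<close>, i.e. the group algebra of \<open>G\<close>, whose elements
  are the functions supported on \<open>carrier G\<close>.
\<close>

definition constant_scheme :: "('g, 'm) monoid_scheme \<Rightarrow> ('g, 'k::field) hopf" where
  "constant_scheme G =
     \<lparr>carrier = {f. \<forall>x. x \<notin> carrier G \<longrightarrow> f x = 0},
      monoid.mult = (\<lambda>f h x. \<Sum>(y, z) | y \<in> carrier G \<and> z \<in> carrier G \<and> y \<otimes>\<^bsub>G\<^esub> z = x. f y * h z),
      one = (\<lambda>x. if x = \<one>\<^bsub>G\<^esub> then 1 else 0),
      comult = (\<lambda>f (x, y). if x = y then f x else 0),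
      counit = (\<lambda>f. \<Sum>x\<in>carrier G. f x),
      antipode = (\<lambda>f x. if x \<in> carrier G then f (inv\<^bsub>G\<^esub> x) else 0)\<rparr>"

definition elem_abelian_of_rank :: "nat \<Rightarrow> nat \<Rightarrow> ('g, 'm) monoid_scheme \<Rightarrow> 'g set \<Rightarrow> bool" where
  "elem_abelian_of_rank p n G E \<longleftrightarrow>
     subgroup E G \<and> G\<lparr>carrier := E\<rparr> \<cong> product_group {..<n} (\<lambda>_. integer_mod_group p)"

definition elem_abelian :: "nat \<Rightarrow> ('g, 'm) monoid_scheme \<Rightarrow> 'g set \<Rightarrow> bool" where
  "elem_abelian p G E \<longleftrightarrow> (\<exists>n. elem_abelian_of_rank p n G E)"

definition elem_rank :: "nat \<Rightarrow> ('g, 'm) monoid_scheme \<Rightarrow> 'g set \<Rightarrow> nat" where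
  "elem_rank p G E = (THE n. elem_abelian_of_rank p n G E)"

definition max_elem_abelian :: "nat \<Rightarrow> ('g, 'm) monoid_scheme \<Rightarrow> 'g set \<Rightarrow> bool" where
  "max_elem_abelian p G E \<longleftrightarrow>
     elem_abelian p G E \<and> (\<forall>F. elem_abelian p G F \<and> E \<subseteq> F \<longrightarrow> F = E)"

end

theory Submission
  imports Defs "HOL-Number_Theory.Cong" "HOL-Algebra.Multiplicative_Group" "HOL-Algebra.Sylow"
begin

text \<open>
  By definition a \<open>p\<close>-point is an algebra map out of \<open>k[t]/(t\<^sup>p)\<close>, so it is the choice of an element
  \<open>u\<close> with \<open>u\<^sup>p = 0\<close>, and all module conditions on it reduce to linear algebra: a module over
  \<open>k[t]/(t\<^sup>p)\<close> is projective, and likewise flat, iff every vector killed by \<open>t\<close> is in the image of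
  \<open>t\<^sup>p\<^sup>-\<^sup>1\<close> (\<open>projective_iff_p_exact\<close>, \<open>p_exact_imp_flat\<close>, \<open>flat_imp_p_exact\<close>). This
  condition is called \<open>p_exact\<close> below. Two \<open>p\<close>-points are equivalent iff their elements are
  \<open>p_exact\<close> on the same modules.

  Hopf subalgebras of a group algebra are spanned by group elements, so the abelian unipotent
  subgroup schemes are the group algebras of the abelian \<open>p\<close>-subgroups \<open>A\<close> (\<open>au_iff\<close>). The
  complexity of the trivial module of \<open>A\<close> is the rank of its subgroup \<open>Om A\<close> of elements with
  \<open>a\<^sup>p = 1\<close> (\<open>complexity_Om\<close>): tensoring the periodic resolutions of the cyclic factors gives a
  minimal resolution whose \<open>n\<close>-th term is free of rank \<open>n + s - 1\<close> choose \<open>n\<close>, where \<open>s\<close> is that rank. Let \<open>r\<close> be the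
  minimal rank of a maximal elementary abelian subgroup.

  For \<open>l \<le> r\<close> every \<open>p\<close>-point must be moved into a suitable \<open>A\<close> of complexity at least \<open>l\<close>
  (\<open>P_space_covered\<close>). If \<open>u\<close> lies in \<open>kA\<close> and \<open>u\<^sup>p = 0\<close>, then by the Frobenius map the
  coefficients of \<open>u\<close> sum to zero over each coset of \<open>Om A\<close>. Hence \<open>u = v + \<Sum> y g\<close> with \<open>v\<close> in
  \<open>k(Om A)\<close>, \<open>v\<^sup>p = y\<^sup>p = 0\<close> and \<open>g\<close> nilpotent, and adding a product \<open>y g\<close> does not change on which
  modules an element is \<open>p_exact\<close> (\<open>p_exact_perturb\<close>). So \<open>u\<close> is equivalent to \<open>v\<close>
  (\<open>p_point_reduce\<close>). Now \<open>Om A\<close> lies in a maximal elementary abelian \<open>E\<close>, and \<open>E\<close> in a maximal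
  abelian \<open>p\<close>-subgroup \<open>B\<close>; maximality gives \<open>Om B = E\<close>, so \<open>B\<close> has complexity at least \<open>r\<close>.

  For \<open>l > r\<close> a \<open>p\<close>-point is exhibited that cannot be moved (\<open>P_space_not_covered\<close>): take \<open>E\<close>
  maximal elementary abelian of rank \<open>r\<close> and \<open>v = \<Sum> c\<^sub>e (e - 1)\<close> over \<open>e \<in> E\<close> with generic coefficients. If \<open>A\<close>
  has complexity above \<open>r\<close>, then \<open>E\<close> is not conjugate into \<open>A\<close>, for otherwise it would be
  conjugate to \<open>Om A\<close> by maximality. On the permutation module \<open>k[G/A]\<close> no \<open>u \<in> kA\<close> with
  \<open>u\<^sup>p = 0\<close> is \<open>p_exact\<close> (\<open>rinv_not_exact\<close>), whereas \<open>v\<close> is (\<open>generic_exact\<close>): on each double coset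
  \<open>E x A\<close> there is a function, additive along \<open>E\<close>, such that multiplication by it has an invertible
  commutator with \<open>v\<close>, and an operator satisfying a Weyl relation is exact in characteristic \<open>p\<close>
  (\<open>p_exact_if_commutator_one\<close>). So \<open>v\<close> is not equivalent to a \<open>p\<close>-point of \<open>A\<close>.
\<close>

section \<open>Nilpotent operators and exactness\<close>

text \<open>
  Operators are only required to be additive on a subgroup \<open>V\<close> of the ambient group; outside of
  \<open>V\<close> nothing is assumed, which suits module actions that are specified on their carrier.
\<close>

definition addsub :: "'v::ab_group_add set \<Rightarrow> bool" where
  "addsub V \<longleftrightarrow> 0 \<in> V \<and> (\<forall>x\<in>V. \<forall>y\<in>V. x - y \<in> V)"

definition endo :: "'v::ab_group_add set \<Rightarrow> ('v \<Rightarrow> 'v) \<Rightarrow> bool" where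
  "endo V f \<longleftrightarrow> (\<forall>x\<in>V. f x \<in> V) \<and> (\<forall>x\<in>V. \<forall>y\<in>V. f (x + y) = f x + f y)"

definition commute_on :: "'v set \<Rightarrow> ('v \<Rightarrow> 'v) \<Rightarrow> ('v \<Rightarrow> 'v) \<Rightarrow> bool" where
  "commute_on V f g \<longleftrightarrow> (\<forall>x\<in>V. f (g x) = g (f x))"

text \<open>
  For an operator with \<open>t\<^sup>p = 0\<close> on a finite-dimensional space: all its Jordan blocks have length \<open>p\<close>.
\<close>

definition p_exact :: "nat \<Rightarrow> 'v::ab_group_add set \<Rightarrow> ('v \<Rightarrow> 'v) \<Rightarrow> bool" where
  "p_exact p V t \<longleftrightarrow> (\<forall>x\<in>V. t x = 0 \<longrightarrow> (\<exists>y\<in>V. x = (t ^^ (p - 1)) y))"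

lemma addsub_zero: "addsub V \<Longrightarrow> 0 \<in> V"
  and addsub_diff: "addsub V \<Longrightarrow> x \<in> V \<Longrightarrow> y \<in> V \<Longrightarrow> x - y \<in> V"
  by (auto simp: addsub_def)

lemma addsub_uminus: "addsub V \<Longrightarrow> x \<in> V \<Longrightarrow> - x \<in> V"
  using addsub_diff[of V 0 x] addsub_zero[of V] by simp

lemma addsub_add: "addsub V \<Longrightarrow> x \<in> V \<Longrightarrow> y \<in> V \<Longrightarrow> x + y \<in> V"
  using addsub_diff[of V x "- y"] addsub_uminus[of V y] by simp

lemma addsub_sum: "addsub V \<Longrightarrow> (\<And>i. i \<in> S \<Longrightarrow> f i \<in> V) \<Longrightarrow> sum f S \<in> V"
  by (induction S rule: infinite_finite_induct) (auto simp: addsub_zero addsub_add)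

lemma addsub_of_nat: "addsub V \<Longrightarrow> x \<in> V \<Longrightarrow> of_nat n * (x::'v::{semiring_1,ab_group_add}) \<in> V"
  by (induction n) (auto simp: addsub_zero addsub_add distrib_right)

lemma endo_in: "endo V f \<Longrightarrow> x \<in> V \<Longrightarrow> f x \<in> V"
  and endo_add: "endo V f \<Longrightarrow> x \<in> V \<Longrightarrow> y \<in> V \<Longrightarrow> f (x + y) = f x + f y"
  by (auto simp: endo_def)

lemma endo_zero: "addsub V \<Longrightarrow> endo V f \<Longrightarrow> f 0 = 0"
  using endo_add[of V f 0 0] addsub_zero[of V] by simp

lemma endo_uminus: "addsub V \<Longrightarrow> endo V f \<Longrightarrow> x \<in> V \<Longrightarrow> f (- x) = - f x"
  using endo_add[of V f x "- x"] addsub_uminus[of V x] endo_zero[of V f]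
  by (simp add: eq_neg_iff_add_eq_0 add.commute)

lemma endo_diff: "addsub V \<Longrightarrow> endo V f \<Longrightarrow> x \<in> V \<Longrightarrow> y \<in> V \<Longrightarrow> f (x - y) = f x - f y"
  using endo_add[of V f x "- y"] addsub_uminus[of V y] endo_uminus[of V f y] by simp

lemma endo_sum: "addsub V \<Longrightarrow> endo V f \<Longrightarrow> (\<And>i. i \<in> S \<Longrightarrow> g i \<in> V) \<Longrightarrow> f (sum g S) = (\<Sum>i\<in>S. f (g i))"
  by (induction S rule: infinite_finite_induct)
     (auto simp: endo_zero endo_add addsub_sum)

lemma endo_of_nat: "addsub V \<Longrightarrow> endo V f \<Longrightarrow> x \<in> V \<Longrightarrow>
    f (of_nat n * x) = of_nat n * f (x::'v::{semiring_1,ab_group_add})"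
  by (induction n) (auto simp: endo_zero endo_add addsub_of_nat distrib_right)

lemma endo_comp: "endo V f \<Longrightarrow> endo V g \<Longrightarrow> endo V (\<lambda>x. f (g x))"
  by (auto simp: endo_def)

lemma endo_plus: "addsub V \<Longrightarrow> endo V f \<Longrightarrow> endo V g \<Longrightarrow> endo V (\<lambda>x. f x + g x)"
  by (auto simp: endo_def addsub_add algebra_simps)

lemma endo_minus: "addsub V \<Longrightarrow> endo V f \<Longrightarrow> endo V g \<Longrightarrow> endo V (\<lambda>x. f x - g x)"
  by (auto simp: endo_def addsub_diff algebra_simps)

lemma endo_sum_fun: "addsub V \<Longrightarrow> (\<And>s. s \<in> S \<Longrightarrow> endo V (f s)) \<Longrightarrow> endo V (\<lambda>x. \<Sum>s\<in>S. f s x)"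
  by (auto simp: endo_def addsub_sum sum.distrib)

lemma endo_id: "endo V (\<lambda>x. x)"
  by (auto simp: endo_def)

lemma endo_funpow: "endo V f \<Longrightarrow> endo V (f ^^ n)"
  by (induction n) (auto simp: endo_def)

lemma funpow_cong_on:
  assumes "\<And>x. x \<in> V \<Longrightarrow> f x = g x" "\<And>x. x \<in> V \<Longrightarrow> g x \<in> V" "x \<in> V"
  shows "(f ^^ n) x = (g ^^ n) x"
proof -
  have "(f ^^ n) x = (g ^^ n) x \<and> (g ^^ n) x \<in> V"
    using assms by (induction n) auto
  thus ?thesis ..
qed

lemma commute_onD: "commute_on V f g \<Longrightarrow> x \<in> V \<Longrightarrow> f (g x) = g (f x)"
  by (auto simp: commute_on_def)

lemma commute_on_sym: "commute_on V f g \<Longrightarrow> commute_on V g f"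
  by (auto simp: commute_on_def)

lemma commute_on_refl: "commute_on V f f"
  by (auto simp: commute_on_def)

lemma commute_on_funpow: "commute_on V f g \<Longrightarrow> endo V g \<Longrightarrow> commute_on V f (g ^^ n)"
  using endo_in[OF endo_funpow[of V g]] by (induction n) (auto simp: commute_on_def)

lemma commute_on_comp: "commute_on V f g \<Longrightarrow> commute_on V f h \<Longrightarrow> endo V h \<Longrightarrow> commute_on V f (\<lambda>x. g (h x))"
  by (auto simp: commute_on_def endo_def)

lemma commute_on_sum: "addsub V \<Longrightarrow> endo V f \<Longrightarrow> (\<And>s. s \<in> S \<Longrightarrow> commute_on V f (g s)) \<Longrightarrow>
    (\<And>s. s \<in> S \<Longrightarrow> endo V (g s)) \<Longrightarrow> commute_on V f (\<lambda>x. \<Sum>s\<in>S. g s x)"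
  by (auto simp: commute_on_def endo_sum endo_in intro!: sum.cong)

lemma commute_on_plus: "endo V f \<Longrightarrow> endo V g \<Longrightarrow> endo V h \<Longrightarrow>
    commute_on V f g \<Longrightarrow> commute_on V f h \<Longrightarrow> commute_on V f (\<lambda>x. g x + h x)"
  by (auto simp: commute_on_def endo_def)

lemma funpow_add_on: "(f ^^ m) ((f ^^ n) x) = (f ^^ (m + n)) x"
  by (simp add: funpow_add)

text \<open>
  Additive maps defined on a subgroup do not form a ring type, so the binomial theorem for commuting
  operators is proved directly; \<open>of_nat\<close> makes the coefficients act on the values.
\<close>

lemma binomial_endo:
  fixes f g :: "'v::{semiring_1,ab_group_add} \<Rightarrow> 'v"
  assumes V: "addsub V" and f: "endo V f" and g: "endo V g" and fg: "commute_on V f g" and x: "x \<in> V"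
  shows "((\<lambda>x. f x + g x) ^^ n) x = (\<Sum>i\<le>n. of_nat (n choose i) * (f ^^ i) ((g ^^ (n - i)) x))"
proof (induction n)
  case (Suc n)
  define T where "T i j = (f ^^ i) ((g ^^ j) x)" for i j
  have T_in: "T i j \<in> V" for i j
    unfolding T_def using endo_in[OF endo_funpow[OF f]] endo_in[OF endo_funpow[OF g]] x by auto
  have fT: "f (T i j) = T (Suc i) j" for i j by (simp add: T_def)
  have gT: "g (T i j) = T i (Suc j)" for i j
  proof -
    have "commute_on V g (f ^^ i)" using commute_on_funpow[OF commute_on_sym[OF fg] f] .
    thus ?thesis unfolding T_def using endo_in[OF endo_funpow[OF g] x] by (simp add: commute_on_def)
  qed
  have IH: "((\<lambda>x. f x + g x) ^^ n) x = (\<Sum>i\<le>n. of_nat (n choose i) * T i (n - i))"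
    using Suc by (simp add: T_def)
  have in1: "of_nat c * T i j \<in> V" for c i j using addsub_of_nat[OF V T_in] .
  have "((\<lambda>x. f x + g x) ^^ Suc n) x =
      (\<Sum>i\<le>n. of_nat (n choose i) * T (Suc i) (n - i)) + (\<Sum>i\<le>n. of_nat (n choose i) * T i (Suc n - i))"
    by (simp add: IH endo_sum[OF V f in1] endo_sum[OF V g in1] endo_of_nat[OF V f T_in]
        endo_of_nat[OF V g T_in] fT gT Suc_diff_le)
  also have "(\<Sum>i\<le>n. of_nat (n choose i) * T (Suc i) (n - i)) =
      (\<Sum>i\<in>{1..Suc n}. of_nat (n choose (i - 1)) * T i (Suc n - i))"
    by (rule sum.reindex_bij_witness[of _ "\<lambda>i. i - 1" Suc]) auto
  also have "\<dots> = (\<Sum>i\<le>Suc n. (if i = 0 then 0 else of_nat (n choose (i - 1))) * T i (Suc n - i))"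
    by (rule sum.mono_neutral_cong_left) auto
  also have "(\<Sum>i\<le>n. of_nat (n choose i) * T i (Suc n - i)) =
     (\<Sum>i\<le>Suc n. of_nat (n choose i) * T i (Suc n - i))"
    by (simp add: binomial_eq_0)
  also have "(\<Sum>i\<le>Suc n. (if i = 0 then 0 else of_nat (n choose (i - 1))) * T i (Suc n - i)) + \<dots> =
     (\<Sum>i\<le>Suc n. of_nat (Suc n choose i) * T i (Suc n - i))"
    unfolding sum.distrib[symmetric]
    by (rule sum.cong[OF refl]) (auto simp: choose_reduce_nat distrib_right[symmetric] gr0_conv_Suc)
  finally show ?case by (simp add: T_def)
qed simp

lemma freshman_endo:
  fixes f g :: "'v::{semiring_1,ab_group_add} \<Rightarrow> 'v"
  assumes V: "addsub V" and f: "endo V f" and g: "endo V g" and fg: "commute_on V f g" and x: "x \<in> V"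
    and p: "prime p" "of_nat p = (0::'v)"
  shows "((\<lambda>x. f x + g x) ^^ p) x = (f ^^ p) x + (g ^^ p) x"
proof -
  have p2: "p \<ge> 2" using p(1) by (rule prime_ge_2_nat)
  have z: "of_nat (p choose i) = (0::'v)" if "i \<notin> {0,p}" "i \<le> p" for i
  proof -
    have "p dvd (p choose i)" using that p(1) by (intro dvd_choose_prime) auto
    then obtain c where "p choose i = p * c" by auto
    thus ?thesis by (simp add: p(2))
  qed
  have "((\<lambda>x. f x + g x) ^^ p) x = (\<Sum>i\<le>p. of_nat (p choose i) * (f ^^ i) ((g ^^ (p - i)) x))"
    by (rule binomial_endo) fact+
  also have "\<dots> = (\<Sum>i\<in>{0,p}. of_nat (p choose i) * (f ^^ i) ((g ^^ (p - i)) x))"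
    by (rule sum.mono_neutral_right) (use z in auto)
  also have "\<dots> = (f ^^ p) x + (g ^^ p) x" using p2 by (simp add: add.commute)
  finally show ?thesis .
qed

lemma freshman_endo_sum:
  fixes f :: "'s \<Rightarrow> 'v::{semiring_1,ab_group_add} \<Rightarrow> 'v"
  assumes V: "addsub V" and f: "\<And>s. s \<in> S \<Longrightarrow> endo V (f s)"
    and c: "\<And>s t. s \<in> S \<Longrightarrow> t \<in> S \<Longrightarrow> commute_on V (f s) (f t)"
    and p: "prime p" "of_nat p = (0::'v)" and x: "x \<in> V" and fin: "finite S"
  shows "((\<lambda>x. \<Sum>s\<in>S. f s x) ^^ p) x = (\<Sum>s\<in>S. (f s ^^ p) x)"
  using fin f c x
proof (induction S arbitrary: x)
  case empty
  have "p \<noteq> 0" using p(1) by auto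
  thus ?case by (cases p) auto
next
  case (insert s S)
  have e: "endo V (\<lambda>x. \<Sum>s\<in>S. f s x)" using insert.prems by (intro endo_sum_fun V) auto
  have "((\<lambda>x. \<Sum>s\<in>insert s S. f s x) ^^ p) x = ((\<lambda>x. f s x + (\<Sum>s\<in>S. f s x)) ^^ p) x"
    using insert.hyps by simp
  also have "\<dots> = (f s ^^ p) x + ((\<lambda>x. \<Sum>s\<in>S. f s x) ^^ p) x"
    by (rule freshman_endo[OF V _ e _ _ p]) (use insert.prems V in \<open>auto intro!: commute_on_sum\<close>)
  finally show ?case using insert by simp
qed

lemma freshman_endo_sum_power:
  fixes f :: "'s \<Rightarrow> 'v::{semiring_1,ab_group_add} \<Rightarrow> 'v"
  assumes V: "addsub V" and f: "\<And>s. s \<in> S \<Longrightarrow> endo V (f s)"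
    and c: "\<And>s t. s \<in> S \<Longrightarrow> t \<in> S \<Longrightarrow> commute_on V (f s) (f t)"
    and p: "prime p" "of_nat p = (0::'v)" and x: "x \<in> V" and fin: "finite S"
  shows "((\<lambda>x. \<Sum>s\<in>S. f s x) ^^ (p ^ N)) x = (\<Sum>s\<in>S. (f s ^^ (p ^ N)) x)"
  using x
proof (induction N arbitrary: x)
  case (Suc N)
  let ?F = "\<lambda>x. \<Sum>s\<in>S. f s x"
  have e: "endo V (f s ^^ n)" if "s \<in> S" for s n using f[OF that] by (rule endo_funpow)
  have cc: "commute_on V (f s ^^ n) (f t ^^ n)" if "s \<in> S" "t \<in> S" for s t n
    by (metis c commute_on_funpow commute_on_sym e f that)
  have "(?F ^^ (p ^ Suc N)) x = ((?F ^^ (p ^ N)) ^^ p) x"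
    by (simp add: funpow_mult mult.commute)
  also have "\<dots> = ((\<lambda>x. \<Sum>s\<in>S. (f s ^^ (p ^ N)) x) ^^ p) x"
    by (rule funpow_cong_on[where V = V]) (use Suc e V in \<open>auto simp: endo_in addsub_sum\<close>)
  also have "\<dots> = (\<Sum>s\<in>S. ((f s ^^ (p ^ N)) ^^ p) x)"
    by (rule freshman_endo_sum[OF V e cc p]) (use Suc fin in auto)
  finally show ?case by (simp add: funpow_mult mult.commute)
qed simp

text \<open>
  Both conditions compare a kernel with an image, with \<open>t\<close> and \<open>t\<^sup>p\<^sup>-\<^sup>1\<close> exchanged. Each is
  obtained from the other by correcting an element step by step along the powers of \<open>t\<close>.
\<close>

lemma p_exact_iff:
  assumes V: "addsub V" and t: "endo V t" and tp: "\<And>x. x \<in> V \<Longrightarrow> (t ^^ p) x = 0" and p: "p \<ge> 2"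
  shows "p_exact p V t \<longleftrightarrow> (\<forall>x\<in>V. (t ^^ (p - 1)) x = 0 \<longrightarrow> (\<exists>y\<in>V. x = t y))"
proof
  assume ex: "p_exact p V t"
  have "\<exists>y\<in>V. x = t y" if "x \<in> V" "(t ^^ j) x = 0" "j < p" for j x
    using that
  proof (induction j arbitrary: x)
    case 0
    thus ?case using endo_zero[OF V t] addsub_zero[OF V] by auto
  next
    case (Suc j)
    have inV: "(t ^^ j) x \<in> V" by (rule endo_in[OF endo_funpow[OF t] Suc.prems(1)])
    have "t ((t ^^ j) x) = 0" using Suc.prems by simp
    then obtain y where y: "y \<in> V" "(t ^^ j) x = (t ^^ (p - 1)) y"
      using ex inV unfolding p_exact_def by blast
    define y' where "y' = (t ^^ (p - 1 - j)) y"
    have y': "y' \<in> V" unfolding y'_def by (rule endo_in[OF endo_funpow[OF t] y(1)])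
    have "(t ^^ j) y' = (t ^^ (p - 1)) y" unfolding y'_def funpow_add_on using Suc.prems by simp
    hence "(t ^^ j) (x - y') = 0"
      using endo_diff[OF V endo_funpow[OF t] Suc.prems(1) y', of j] y(2) by simp
    with Suc obtain z where z: "z \<in> V" "x - y' = t z"
      using addsub_diff[OF V Suc.prems(1) y'] by auto
    have "y' = t ((t ^^ (p - 1 - Suc j)) y)"
    proof -
      have "p - 1 - j = Suc (p - 1 - Suc j)" using Suc.prems by simp
      thus ?thesis unfolding y'_def by (metis comp_apply funpow.simps(2))
    qed
    moreover have zz: "(t ^^ (p - 1 - Suc j)) y \<in> V" by (rule endo_in[OF endo_funpow[OF t] y(1)])
    ultimately have "x = t (z + (t ^^ (p - 1 - Suc j)) y)"
      using z endo_add[OF t z(1) zz] by (metis diff_add_cancel)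
    thus ?case using addsub_add[OF V z(1) zz] by blast
  qed
  thus "\<forall>x\<in>V. (t ^^ (p - 1)) x = 0 \<longrightarrow> (\<exists>y\<in>V. x = t y)" using p by (metis diff_less less_le_trans pos2 zero_less_one)
next
  assume ex: "\<forall>x\<in>V. (t ^^ (p - 1)) x = 0 \<longrightarrow> (\<exists>y\<in>V. x = t y)"
  show "p_exact p V t" unfolding p_exact_def
  proof (intro ballI impI)
    fix x assume x: "x \<in> V" "t x = 0"
    have "\<exists>y\<in>V. x = (t ^^ j) y" if "j \<le> p - 1" for j
      using that
    proof (induction j)
      case 0 thus ?case using x by auto
    next
      case (Suc j)
      then obtain y where y: "y \<in> V" "x = (t ^^ j) y" by auto
      have "(t ^^ Suc j) y = 0" using x y by simp
      hence "(t ^^ (p - 1)) y = (t ^^ (p - 1 - Suc j)) 0"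
        by (metis funpow_add_on Suc.prems le_add_diff_inverse2)
      hence "(t ^^ (p - 1)) y = 0" using endo_zero[OF V endo_funpow[OF t]] by simp
      then obtain z where "z \<in> V" "y = t z" using ex y by blast
      thus ?case using y by (auto simp: funpow_swap1)
    qed
    thus "\<exists>y\<in>V. x = (t ^^ (p - 1)) y" by blast
  qed
qed

lemma funpow_pred_apply: "p > 0 \<Longrightarrow> (f ^^ (p - 1)) (f x) = (f ^^ p) x"
  by (cases p) (auto simp: funpow_swap1)

text \<open>
  Consider \<open>d\<^sub>s = A + s B\<close> on power series in a central variable \<open>s\<close>. Since \<open>d\<^sub>0 = A\<close> is exact, \<open>d\<^sub>s\<close>
  is exact too (coefficientwise). If \<open>(A + B C) x = 0\<close> then \<open>d\<^sub>s x = (s - C) (B x)\<close>; as \<open>s - C\<close> is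
  injective and commutes with \<open>d\<^sub>s\<close>, the power \<open>d\<^sub>s\<^sup>p\<^sup>-\<^sup>1\<close> kills \<open>B x\<close>, whence \<open>B x = d\<^sub>s n\<close>. So \<open>d\<^sub>s\<close>
  kills \<open>x - (s - C) n\<close>, which is therefore \<open>d\<^sub>s\<^sup>p\<^sup>-\<^sup>1 q\<close>, and evaluating at \<open>s = C\<close> exhibits \<open>x\<close> as
  \<open>(A + B C)\<^sup>p\<^sup>-\<^sup>1\<close> of something. Nilpotency of \<open>C\<close> makes the evaluation a finite sum.
\<close>

lemma p_exact_perturb:
  fixes A B C :: "'v::ring_1 \<Rightarrow> 'v"
  assumes V: "addsub V" and A: "endo V A" and B: "endo V B" and C: "endo V C"
    and AB: "commute_on V A B" and AC: "commute_on V A C" and BC: "commute_on V B C"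
    and p: "prime p" "of_nat p = (0::'v)"
    and Ap: "\<And>x. x \<in> V \<Longrightarrow> (A ^^ p) x = 0" and Bp: "\<And>x. x \<in> V \<Longrightarrow> (B ^^ p) x = 0"
    and CN: "\<And>x. x \<in> V \<Longrightarrow> (C ^^ N) x = 0"
    and ex: "p_exact p V A"
  shows "p_exact p V (\<lambda>x. A x + B (C x))"
proof -
  have p2: "p \<ge> 2" using p(1) by (rule prime_ge_2_nat)
  define S where "S = {n::nat \<Rightarrow> 'v. \<forall>i. n i \<in> V}"
  define up where "up f = (\<lambda>(n::nat \<Rightarrow> 'v) i. f (n i) :: 'v)" for f
  \<comment> \<open>A power series is its sequence of coefficients and \<open>sh\<close> is multiplication by the variable.\<close>
  define sh where "sh = (\<lambda>(n::nat \<Rightarrow> 'v) i. if i = 0 then 0 else n (i - 1))"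
  define d where "d = (\<lambda>n. up A n + sh (up B n))"
  have S: "addsub S" unfolding addsub_def S_def
    by (simp add: addsub_zero[OF V] addsub_diff[OF V])
  have upS: "endo S (up f)" if "endo V f" for f
    unfolding endo_def S_def up_def by (simp add: endo_in[OF that] endo_add[OF that] fun_eq_iff)
  have shS: "endo S sh"
    unfolding endo_def S_def sh_def by (simp add: addsub_zero[OF V] fun_eq_iff)
  have BS: "endo S (\<lambda>n. sh (up B n))" by (rule endo_comp[OF shS upS[OF B]])
  have dS: "endo S d" unfolding d_def by (rule endo_plus[OF S upS[OF A] BS])
  have shup: "sh (up f n) = up f (sh n)" if "endo V f" for f n
    using endo_zero[OF V that] by (auto simp: sh_def up_def fun_eq_iff)
  have cA: "commute_on S (up A) (\<lambda>n. sh (up B n))"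
    using AB by (auto simp: commute_on_def S_def up_def sh_def fun_eq_iff endo_zero[OF V A])
  have uppow: "(up f ^^ n) x = up (f ^^ n) x" for f n x
    by (induction n) (auto simp: up_def fun_eq_iff)
  have shBpow: "((\<lambda>n. sh (up B n)) ^^ k) x = (sh ^^ k) (up (B ^^ k) x)" for x k
  proof (induction k)
    case (Suc k)
    have "up B ((sh ^^ k) y) = (sh ^^ k) (up B y)" for y
      by (induction k) (auto simp: shup[OF B, symmetric])
    with Suc show ?case by (simp add: up_def)
  qed (auto simp: up_def)
  have pz: "of_nat p = (0::nat \<Rightarrow> 'v)" using p(2) by (simp add: fun_eq_iff)
  have sh0: "sh 0 = 0" by (auto simp: sh_def fun_eq_iff)
  have dp: "(d ^^ p) x = 0" if x: "x \<in> S" for x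
  proof -
    have e1: "(d ^^ p) x = (up A ^^ p) x + ((\<lambda>n. sh (up B n)) ^^ p) x"
      unfolding d_def by (rule freshman_endo[OF S upS[OF A] BS cA x p(1) pz])
    have e2: "(up A ^^ p) x = 0" unfolding uppow using x Ap by (auto simp: up_def S_def fun_eq_iff)
    have e3: "up (B ^^ p) x = 0" using x Bp by (auto simp: up_def S_def fun_eq_iff)
    have e4: "((\<lambda>n. sh (up B n)) ^^ p) x = 0"
      unfolding shBpow e3 by (rule endo_zero[OF S endo_funpow[OF shS]])
    show ?thesis unfolding e1 e2 e4 by simp
  qed
  have kerA: "\<exists>y\<in>V. x = A y" if "x \<in> V" "(A ^^ (p - 1)) x = 0" for x
    using p_exact_iff[OF V A Ap p2] ex that by auto
  have dpow0: "(d ^^ k) x 0 = (A ^^ k) (x 0)" for k x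
    by (induction k) (auto simp: d_def up_def sh_def)
  have dexact2: "\<exists>n\<in>S. x = d n" if x: "x \<in> S" "(d ^^ (p - 1)) x = 0" for x
  proof -
    \<comment> \<open>A preimage under \<open>d\<close> is found one coefficient at a time: in a pair \<open>(y, n)\<close> the series \<open>y\<close> is what
      remains to be hit, divided by the power of the variable reached, and \<open>n\<close> is the next coefficient.\<close>
    let ?P = "\<lambda>(i::nat) (y :: nat \<Rightarrow> 'v, n :: 'v). y \<in> S \<and> (d ^^ (p - 1)) y = 0 \<and> n \<in> V \<and> y 0 = A n"
    let ?Q = "\<lambda>(i::nat) (y :: nat \<Rightarrow> 'v, n :: 'v) (y' :: nat \<Rightarrow> 'v, n' :: 'v).
        \<forall>i. y' i = y (Suc i) - (if i = 0 then B n else 0)"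
    have start: "\<exists>n\<in>V. y 0 = A n" if "y \<in> S" "(d ^^ (p - 1)) y = 0" for y
    proof -
      have "(A ^^ (p - 1)) (y 0) = 0" using dpow0[of "p - 1" y] that by simp
      thus ?thesis using kerA that by (auto simp: S_def)
    qed
    have "\<exists>f. \<forall>i. (?P i (f i) \<and> (i = 0 \<longrightarrow> fst (f i) = x)) \<and> ?Q i (f i) (f (Suc i))"
      proof (rule dependent_nat_choice)
        show "\<exists>z. ?P 0 z \<and> (0 = (0::nat) \<longrightarrow> fst z = x)" using start[OF x] x by auto
      next
        fix z i assume z: "?P i z \<and> (i = 0 \<longrightarrow> fst z = x)"
        obtain y n where zz: "z = (y, n)" by (cases z)
        have y: "y \<in> S" "(d ^^ (p - 1)) y = 0" and n: "n \<in> V" "y 0 = A n" using z zz by auto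
        define c :: "nat \<Rightarrow> 'v" where "c = (\<lambda>i. if i = 0 then n else 0)"
        have c: "c \<in> S" using n addsub_zero[OF V] by (auto simp: c_def S_def)
        define y' where "y' = (\<lambda>i. y (Suc i) - (if i = 0 then B n else 0))"
        have y': "y' \<in> S" using y n addsub_diff[OF V] endo_in[OF B] addsub_zero[OF V]
          by (auto simp: y'_def S_def)
        have eq: "y - d c = sh y'"
        proof (rule ext)
          fix i show "(y - d c) i = sh y' i" using n
            by (cases i) (auto simp: d_def up_def sh_def c_def y'_def endo_zero[OF V A] endo_zero[OF V B])
        qed
        have dsh: "d (sh z) = sh (d z)" for z
          by (rule ext) (simp add: d_def up_def sh_def endo_zero[OF V A] endo_zero[OF V B])
        have comm: "(d ^^ k) (sh z) = sh ((d ^^ k) z)" for z k by (induction k) (simp_all add: dsh)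
        have e1: "(d ^^ (p - 1)) (y - d c) = (d ^^ (p - 1)) y - (d ^^ (p - 1)) (d c)"
          by (rule endo_diff[OF S endo_funpow[OF dS] y(1) endo_in[OF dS c]])
        have e2: "(d ^^ (p - 1)) (d c) = (d ^^ p) c"
          by (rule funpow_pred_apply) (use p2 in simp)
        have sh0: "sh ((d ^^ (p - 1)) y') = 0"
          using e1 unfolding e2 y(2) dp[OF c] eq comm diff_self .
        have "(d ^^ (p - 1)) y' i = 0" for i
          using fun_cong[OF sh0, of "Suc i"] by (simp add: sh_def)
        hence "(d ^^ (p - 1)) y' = 0" by (simp add: fun_eq_iff)
        then obtain n' where "n' \<in> V" "y' 0 = A n'" using start[OF y'] by blast
        thus "\<exists>z'. (?P (Suc i) z' \<and> (Suc i = 0 \<longrightarrow> fst z' = x)) \<and> ?Q i z z'"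
          unfolding zz using y' \<open>(d ^^ (p - 1)) y' = 0\<close>
          by (intro exI[of _ "(y', n')"]) (simp only: y'_def prod.case nat.simps, blast)
      qed
    then obtain f where f: "\<forall>i. (?P i (f i) \<and> (i = 0 \<longrightarrow> fst (f i) = x)) \<and> ?Q i (f i) (f (Suc i))" ..
    define n where "n i = snd (f i)" for i
    define y where "y i = fst (f i)" for i
    have n: "n i \<in> V" "y i 0 = A (n i)" for i
      using spec[OF f, of i] unfolding n_def y_def case_prod_beta by blast+
    have y: "y (Suc i) j = y i (Suc j) - (if j = 0 then B (n i) else 0)" for i j
      using spec[OF f, of i] unfolding n_def y_def case_prod_beta by blast
    have y0: "y 0 = x" using spec[OF f, of 0] unfolding y_def by blast
    have yy: "y i (Suc j) = x (i + Suc j)" for i j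
      by (induction i arbitrary: j) (simp_all add: y0 y)
    have "x i = d n i" for i
    proof (cases i)
      case 0 thus ?thesis using n(2)[of 0] by (simp add: d_def up_def sh_def y0)
    next
      case (Suc j)
      thus ?thesis using n(2)[of i] y[of j 0] yy[of j 0] by (simp add: d_def up_def sh_def algebra_simps)
    qed
    thus ?thesis using n(1) by (intro bexI[of _ n]) (auto simp: S_def fun_eq_iff)
  qed
  have dexact1: "p_exact p S d"
    using p_exact_iff[OF S dS dp p2] dexact2 by blast
  define sC where "sC = (\<lambda>n. sh n - up C n)"
  have sCS: "endo S sC" unfolding sC_def by (rule endo_minus[OF S shS upS[OF C]])
  have d_sC: "commute_on S d sC"
  proof -
    have "commute_on S (up f) sC" if "endo V f" "commute_on V f C" for f
      using that shup[OF that(1)] endo_in[OF C] endo_zero[OF V that(1)]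
      by (auto simp: commute_on_def S_def sC_def up_def sh_def fun_eq_iff endo_diff[OF V that(1)]
        endo_uminus[OF V that(1)])
    from this[OF A AC] this[OF B BC]
    have cAB: "commute_on S (up A) sC" "commute_on S (up B) sC" .
    have "commute_on S sh sC" using endo_zero[OF V C]
      by (auto simp: commute_on_def sC_def sh_def up_def fun_eq_iff)
    hence "commute_on S sC (\<lambda>n. sh (up B n))"
      by (rule commute_on_comp[OF commute_on_sym commute_on_sym[OF cAB(2)] upS[OF B]])
    thus ?thesis unfolding d_def
      by (rule commute_on_sym[OF commute_on_plus[OF sCS upS[OF A] BS commute_on_sym[OF cAB(1)]]])
  qed
  have sC_inj: "y = 0" if y: "y \<in> S" "sC y = 0" for y
  proof -
    have s0: "y i = C (y (Suc i))" for i
      using fun_cong[OF y(2), of "Suc i"] by (simp add: sC_def sh_def up_def)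
    have step: "y i = (C ^^ k) (y (i + k))" for i k
    proof (induction k)
      case (Suc k)
      have "(C ^^ Suc k) (y (i + Suc k)) = (C ^^ k) (C (y (Suc (i + k))))" by (simp add: funpow_swap1)
      also have "\<dots> = (C ^^ k) (y (i + k))" unfolding s0[of "i + k"] ..
      finally show ?case using Suc by simp
    qed simp
    have "y i = 0" for i using step[of i N] CN[of "y (i + N)"] y by (auto simp: S_def)
    thus ?thesis by (simp add: fun_eq_iff)
  qed
  define D where "D = (\<lambda>x. A x + B (C x))"
  have DV: "endo V D" unfolding D_def by (rule endo_plus[OF V A endo_comp[OF B C]])
  \<comment> \<open>Evaluation of a series at \<open>C\<close>.\<close>
  define ev where "ev = (\<lambda>n. \<Sum>i<N. (C ^^ i) (n i))"
  have Cpow: "endo V (C ^^ i)" for i by (rule endo_funpow[OF C])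
  have ev_in: "ev n \<in> V" if "n \<in> S" for n
    using that unfolding ev_def by (intro addsub_sum V endo_in[OF Cpow]) (auto simp: S_def)
  have ev_add: "ev (m + n) = ev m + ev n" if "m \<in> S" "n \<in> S" for m n
    using that endo_add[OF Cpow] by (auto simp: ev_def S_def sum.distrib[symmetric])
  have ev_diff: "ev (m - n) = ev m - ev n" if "m \<in> S" "n \<in> S" for m n
    using that endo_diff[OF V Cpow] by (auto simp: ev_def S_def sum_subtractf[symmetric])
  have ev_up: "ev (up f n) = f (ev n)" if "n \<in> S" "endo V f" "commute_on V f C" for n f
  proof -
    have cf: "commute_on V f (C ^^ i)" for i by (rule commute_on_funpow[OF that(3) C])
    show ?thesis using that(1) endo_in[OF Cpow]
      by (auto simp: ev_def up_def S_def commute_onD[OF cf, symmetric] endo_sum[OF V that(2)])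
  qed
  have ev_sh: "ev (sh n) = C (ev n)" if n: "n \<in> S" for n
  proof -
    have nV: "n i \<in> V" for i using n by (auto simp: S_def)
    have z: "(C ^^ k) 0 = 0" for k using endo_zero[OF V Cpow] .
    have "ev (sh n) = (\<Sum>i<N. if i = 0 then 0 else (C ^^ i) (n (i - 1)))"
      unfolding ev_def sh_def by (rule sum.cong) (auto simp: z)
    also have "\<dots> = (\<Sum>i<N. (C ^^ Suc i) (n i))"
    proof (cases N)
      case (Suc M)
      have "(\<Sum>i<Suc M. if i = 0 then 0 else (C ^^ i) (n (i - 1))) = (\<Sum>i<M. (C ^^ Suc i) (n i))"
        unfolding sum.lessThan_Suc_shift by simp
      moreover have "(C ^^ Suc M) (n M) = 0" using CN[OF nV] Suc by blast
      ultimately show ?thesis using Suc by (simp del: funpow.simps)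
    qed simp
    also have "\<dots> = C (ev n)" unfolding ev_def using endo_in[OF Cpow] nV by (simp add: endo_sum[OF V C])
    finally show ?thesis .
  qed
  have ev_sC: "ev (sC n) = 0" if n: "n \<in> S" for n
    using ev_diff[OF endo_in[OF shS n] endo_in[OF upS[OF C] n]] ev_sh[OF n]
      ev_up[OF n C commute_on_refl] by (simp add: sC_def)
  have ev_d: "ev (d n) = D (ev n)" if n: "n \<in> S" for n
    using ev_add[OF endo_in[OF upS[OF A] n] endo_in[OF BS n]] ev_sh[OF endo_in[OF upS[OF B] n]]
      ev_up[OF n A AC] ev_up[OF n B BC] commute_onD[OF BC ev_in[OF n]]
    by (simp add: d_def D_def)
  have "p_exact p V D" unfolding p_exact_def
  proof (intro ballI impI)
    fix x assume x: "x \<in> V" "D x = 0"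
    define c where "c = (\<lambda>z (i::nat). if i = 0 then z else (0::'v))"
    have cS: "c z \<in> S" if "z \<in> V" for z using that addsub_zero[OF V] by (auto simp: c_def S_def)
    have Bx: "B x \<in> V" using endo_in[OF B x(1)] .
    have "A x = - C (B x)" using x(2) commute_onD[OF BC x(1)]
      by (simp add: D_def eq_neg_iff_add_eq_0)
    hence dc: "d (c x) = sC (c (B x))"
      using endo_zero[OF V A] endo_zero[OF V B] endo_zero[OF V C]
      by (auto simp: fun_eq_iff d_def sC_def c_def up_def sh_def)
    have "(d ^^ (p - 1)) (sC (c (B x))) = (d ^^ p) (c x)"
      unfolding dc[symmetric] by (rule funpow_pred_apply) (use p2 in simp)
    hence "sC ((d ^^ (p - 1)) (c (B x))) = 0"
      using dp[OF cS[OF x(1)]] commute_onD[OF commute_on_funpow[OF commute_on_sym[OF d_sC] dS] cS[OF Bx]]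
      by simp
    hence "(d ^^ (p - 1)) (c (B x)) = 0"
      using sC_inj endo_in[OF endo_funpow[OF dS] cS[OF Bx]] by blast
    then obtain n where n: "n \<in> S" "c (B x) = d n" using dexact2[OF cS[OF Bx]] by blast
    have "d (c x) = d (sC n)" using dc n commute_onD[OF d_sC n(1)] by simp
    hence "d (c x - sC n) = 0"
      using endo_diff[OF S dS cS[OF x(1)] endo_in[OF sCS n(1)]] by simp
    then obtain q where q: "q \<in> S" "c x - sC n = (d ^^ (p - 1)) q"
      using dexact1 addsub_diff[OF S cS[OF x(1)] endo_in[OF sCS n(1)]] unfolding p_exact_def by blast
    have evpow: "ev ((d ^^ k) q) = (D ^^ k) (ev q)" for k
      by (induction k) (auto simp: ev_d endo_in[OF endo_funpow[OF dS] q(1)])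
    show "\<exists>y\<in>V. x = (D ^^ (p - 1)) y"
    proof (cases "N = 0")
      case True
      hence "x = 0" using CN[OF x(1)] by simp
      thus ?thesis using endo_zero[OF V endo_funpow[OF DV]] addsub_zero[OF V] by metis
    next
      case False
      have "ev (c x) = (\<Sum>i<N. if i = 0 then x else 0)"
        unfolding ev_def c_def by (rule sum.cong) (auto simp: endo_zero[OF V Cpow])
      also have "\<dots> = x" using False by simp
      finally have "x = ev (c x - sC n)"
        using ev_diff[OF cS[OF x(1)] endo_in[OF sCS n(1)]] ev_sC[OF n(1)] by simp
      hence "x = (D ^^ (p - 1)) (ev q)" by (simp add: q(2) evpow)
      thus ?thesis using ev_in[OF q(1)] by blast
    qed
  qed
  thus ?thesis by (simp add: D_def)
qed

text \<open>
  With \<open>[v, L] = 1\<close> the operators behave like \<open>d/dx\<close> and multiplication by \<open>x\<close>: for \<open>v m = 0\<close> one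
  gets \<open>v\<^sup>p\<^sup>-\<^sup>1 (L\<^sup>p\<^sup>-\<^sup>1 m) = (p - 1)! m\<close>, and \<open>(p - 1)!\<close> is invertible modulo \<open>p\<close>.
\<close>

lemma p_exact_if_commutator_one:
  fixes v L :: "'v::ring_1 \<Rightarrow> 'v"
  assumes V: "addsub V" and v: "endo V v" and L: "endo V L"
    and comm: "\<And>x. x \<in> V \<Longrightarrow> v (L x) - L (v x) = x"
    and p: "prime p" "of_nat p = (0::'v)"
  shows "p_exact p V v"
  unfolding p_exact_def
proof (intro ballI impI)
  fix m assume m: "m \<in> V" "v m = 0"
  have Lm: "(L ^^ j) m \<in> V" for j by (rule endo_in[OF endo_funpow[OF L] m(1)])
  have one: "v ((L ^^ Suc j) m) = of_nat (Suc j) * (L ^^ j) m" for j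
  proof (induction j)
    case 0
    thus ?case using comm[OF m(1)] m endo_zero[OF V L] by simp
  next
    case (Suc j)
    have "v ((L ^^ Suc (Suc j)) m) = L (v ((L ^^ Suc j) m)) + (L ^^ Suc j) m"
      using comm[OF Lm[of "Suc j"]] by (simp add: algebra_simps)
    also have "\<dots> = of_nat (Suc (Suc j)) * (L ^^ Suc j) m"
      unfolding Suc endo_of_nat[OF V L Lm] by (simp add: distrib_right)
    finally show ?case .
  qed
  have all: "(v ^^ j) ((L ^^ j) m) = of_nat (fact j) * m" for j
  proof (induction j)
    case (Suc j)
    have "(v ^^ Suc j) ((L ^^ Suc j) m) = (v ^^ j) (of_nat (Suc j) * (L ^^ j) m)"
      unfolding one[symmetric] by (simp add: funpow_swap1)
    also have "\<dots> = of_nat (Suc j) * (of_nat (fact j) * m)"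
      unfolding endo_of_nat[OF V endo_funpow[OF v] Lm] Suc ..
    also have "\<dots> = of_nat (fact (Suc j)) * m" by (simp only: mult.assoc[symmetric] of_nat_mult[symmetric] fact_Suc of_nat_id)
    finally show ?case .
  qed simp
  have "coprime (fact (p - 1)) p"
    using p(1) by (metis coprime_commute diff_less prime_dvd_fact_iff prime_gt_0_nat prime_imp_coprime
        not_le zero_less_one)
  then obtain c where "[fact (p - 1) * c = 1] (mod p)" using cong_solve_coprime_nat[of _ p] by (metis One_nat_def)
  hence c: "(fact (p - 1) * c) mod p = 1" using prime_gt_1_nat[OF p(1)] by (simp add: cong_def)
  define e :: nat where "e = fact (p - 1) * c"
  have "e = p * (e div p) + 1" using c mult_div_mod_eq[of p e] by (simp add: e_def)
  hence "(of_nat e :: 'v) = of_nat (p * (e div p) + 1)" by (rule arg_cong)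
  hence c1: "(of_nat e :: 'v) = 1" by (simp add: p(2))
  define y where "y = of_nat c * (L ^^ (p - 1)) m"
  have y: "y \<in> V" unfolding y_def using addsub_of_nat[OF V Lm] .
  have "(v ^^ (p - 1)) y = of_nat c * (of_nat (fact (p - 1)) * m)"
    unfolding y_def endo_of_nat[OF V endo_funpow[OF v] Lm] all ..
  also have "\<dots> = of_nat e * m" 
    unfolding e_def mult.commute[of "fact (p - 1)" c] of_nat_mult mult.assoc ..
  finally show "\<exists>y\<in>V. m = (v ^^ (p - 1)) y" using y c1 by auto
qed

section \<open>Linear maps on function spaces\<close>

interpretation fvp: vector_space_pair fscale fscale by unfold_locales

abbreviation flin :: "(('b \<Rightarrow> 'k::field) \<Rightarrow> ('c \<Rightarrow> 'k)) \<Rightarrow> bool" where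
  "flin \<equiv> Vector_Spaces.linear fscale fscale"

lemma flin_add: "flin f \<Longrightarrow> f (x + y) = f x + f y"
  and flin_scale: "flin f \<Longrightarrow> f (fscale c x) = fscale c (f x)"
  and flin_diff: "flin f \<Longrightarrow> f (x - y) = f x - f y"
  and flin_zero: "flin f \<Longrightarrow> f 0 = 0"
  and flin_sum: "flin f \<Longrightarrow> f (sum g S) = (\<Sum>i\<in>S. f (g i))"
  by (erule fvp.linear_add fvp.linear_scale fvp.linear_diff fvp.linear_0 fvp.linear_sum)+

lemma flinI:
  "(\<And>x y. f (x + y) = f x + f y) \<Longrightarrow> (\<And>c x. f (fscale c x) = fscale c (f x)) \<Longrightarrow> flin f"
  by (simp add: Vector_Spaces.linear_iff fvs.vector_space_axioms)

lemma fscale_apply [simp]: "fscale c f x = c * f x"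
  by (simp add: fscale_def)

lemma sum_fun_apply [simp]: "(\<Sum>i\<in>S. f i) x = (\<Sum>i\<in>S. f i x)"
  by (induction S rule: infinite_finite_induct) auto

lemma addsub_subspace: "fvs.subspace V \<Longrightarrow> addsub V"
  by (simp add: addsub_def fvs.subspace_0 fvs.subspace_diff)

lemma subspace_fin_dim: "fin_dim V \<Longrightarrow> fvs.subspace V"
  by (auto simp: fin_dim_def)

lemma linear_onD:
  assumes "linear_on V f"
  shows "x \<in> V \<Longrightarrow> y \<in> V \<Longrightarrow> f (x + y) = f x + f y" "x \<in> V \<Longrightarrow> f (fscale c x) = fscale c (f x)"
  using assms by (auto simp: linear_on_def)

lemma linear_on_mono: "linear_on V f \<Longrightarrow> W \<subseteq> V \<Longrightarrow> linear_on W f"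
  unfolding linear_on_def by blast

lemma flin_linear_on: "flin f \<Longrightarrow> linear_on V f"
  unfolding linear_on_def by (blast intro: flin_add flin_scale)

lemma linear_on_zero: "fvs.subspace V \<Longrightarrow> linear_on V f \<Longrightarrow> f 0 = 0"
  using linear_onD(2)[of V f 0 0] fvs.subspace_0[of V] by (simp add: fscale_def zero_fun_def)

lemma linear_on_sum: "fvs.subspace V \<Longrightarrow> linear_on V f \<Longrightarrow> (\<And>i. i \<in> S \<Longrightarrow> g i \<in> V) \<Longrightarrow>
    f (sum g S) = (\<Sum>i\<in>S. f (g i))"
  by (induction S rule: infinite_finite_induct)
     (auto simp: linear_on_zero linear_onD(1) fvs.subspace_sum)

lemma linear_on_diff:
  assumes "fvs.subspace V" "linear_on V f" "x \<in> V" "y \<in> V"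
  shows "f (x - y) = f x - f y"
proof -
  have "f ((x - y) + y) = f (x - y) + f y"
    by (rule linear_onD(1)[OF assms(2)]) (use assms fvs.subspace_diff in auto)
  thus ?thesis by (simp add: algebra_simps)
qed

lemma linear_on_comp: "linear_on V f \<Longrightarrow> linear_on W g \<Longrightarrow> f ` V \<subseteq> W \<Longrightarrow> linear_on V (\<lambda>x. g (f x))"
  by (auto simp: linear_on_def image_subset_iff)

lemma linear_on_sum_fun: "(\<And>i. i \<in> S \<Longrightarrow> linear_on V (f i)) \<Longrightarrow> linear_on V (\<lambda>x. \<Sum>i\<in>S. f i x)"
  by (auto simp: linear_on_def sum.distrib fvs.scale_sum_right)

lemma linear_on_scale_fun: "linear_on V f \<Longrightarrow> linear_on V (\<lambda>x. fscale c (f x))"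
  by (auto simp: linear_on_def fun_eq_iff algebra_simps)

lemma linear_on_diff_fun: "linear_on V f \<Longrightarrow> linear_on V g \<Longrightarrow> linear_on V (\<lambda>x. f x - g x)"
  by (auto simp: linear_on_def fun_eq_iff algebra_simps)

lemma linear_on_id: "linear_on V (\<lambda>x. x)"
  by (auto simp: linear_on_def)

lemma linear_on_endo: "linear_on V f \<Longrightarrow> f ` V \<subseteq> V \<Longrightarrow> endo V f"
  by (auto simp: endo_def linear_on_def)

lemma linear_on_funpow:
  assumes "linear_on V f" "f ` V \<subseteq> V"
  shows "linear_on V (f ^^ n)" "(f ^^ n) ` V \<subseteq> V"
proof -
  have "linear_on V (f ^^ n) \<and> (f ^^ n) ` V \<subseteq> V"
    using assms by (induction n) (auto simp: linear_on_def image_subset_iff)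
  thus "linear_on V (f ^^ n)" "(f ^^ n) ` V \<subseteq> V" by auto
qed

lemma linear_on_extend:
  assumes V: "fvs.subspace V" and f: "linear_on V f"
  shows "\<exists>g. flin g \<and> (\<forall>x\<in>V. g x = f x)"
proof -
  obtain B where B: "B \<subseteq> V" "fvs.independent B" "V \<subseteq> fvs.span B"
    using fvs.maximal_independent_subset by blast
  obtain g where g: "flin g" "\<forall>x\<in>B. g x = f x"
    using fvp.linear_independent_extend[OF B(2)] by blast
  have "x \<in> V \<and> g x = f x" if "x \<in> fvs.span B" for x
    using that
  proof (induction rule: fvs.span_induct_alt)
    case base
    have "0 \<in> V \<and> g 0 = f 0" using fvs.subspace_0[OF V] by (simp add: flin_zero[OF g(1)] linear_on_zero[OF V f])
    thus ?case by (simp add: zero_fun_def)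
  next
    case (step c x y)
    have x: "x \<in> V" using step B by auto
    hence "fscale c x \<in> V" using V fvs.subspace_scale by blast
    hence "fscale c x + y \<in> V \<and> g (fscale c x + y) = f (fscale c x + y)"
      using step g(2) x linear_onD[OF f] fvs.subspace_add[OF V]
      by (simp only: flin_add[OF g(1)] flin_scale[OF g(1)])
    thus ?case by (simp add: plus_fun_def fscale_def)
  qed
  thus ?thesis using g B(3) by blast
qed

lemma linear_on_section:
  assumes V: "fvs.subspace V" and f: "linear_on V f"
  shows "\<exists>s. flin s \<and> range s \<subseteq> V \<and> (\<forall>w\<in>f ` V. f (s w) = w)"
proof -
  obtain g where g: "flin g" "\<forall>x\<in>V. g x = f x" using linear_on_extend[OF V f] by blast
  obtain s where s: "range s \<subseteq> V" "flin s" "\<forall>v\<in>g ` V. g (s v) = v"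
    using fvp.linear_exists_right_inverse_on[OF g(1) V] by blast
  have "f (s w) = w" if "w \<in> f ` V" for w
  proof -
    have "g (s w) = w" using s(3) that g(2) by (auto simp: image_iff)
    thus ?thesis using g(2) s(1) by (metis rangeI subsetD)
  qed
  thus ?thesis using s by blast
qed

lemma span_imageI:
  assumes "flin f" "x \<in> fvs.span S" "\<And>y. y \<in> S \<Longrightarrow> f y \<in> W" "fvs.subspace W"
  shows "f x \<in> W"
  using assms(2)
proof (induction rule: fvs.span_induct_alt)
  case base
  have "f 0 \<in> W" using fvs.subspace_0[OF assms(4)] by (simp add: flin_zero[OF assms(1)])
  thus ?case by (simp add: zero_fun_def)
next
  case (step c x y)
  hence "f (fscale c x + y) \<in> W" using assms(3) fvs.subspace_add[OF assms(4)] fvs.subspace_scale[OF assms(4)]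
    by (simp only: flin_add[OF assms(1)] flin_scale[OF assms(1)])
  thus ?case by (simp add: plus_fun_def fscale_def)
qed

lemma fin_dim_subset:
  assumes "fvs.subspace W" "W \<subseteq> V" "fin_dim V" shows "fin_dim W"
proof -
  obtain B where B: "finite B" "V = fvs.span B" using assms by (auto simp: fin_dim_def)
  obtain C where C: "C \<subseteq> W" "fvs.independent C" "W \<subseteq> fvs.span C"
    using fvs.maximal_independent_subset by blast
  have "finite C" using fvs.independent_span_bound[OF B(1) C(2)] C B assms by auto
  moreover have "W = fvs.span C" using C assms(1) by (simp add: fvs.span_minimal subset_antisym)
  ultimately show ?thesis by (auto simp: fin_dim_def)
qed

lemma fin_dim_image:
  assumes "fin_dim V" "linear_on V f" shows "fin_dim (f ` V)"
proof -
  obtain B where B: "finite B" "V = fvs.span B" using assms by (auto simp: fin_dim_def)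
  obtain g where g: "flin g" "\<forall>x\<in>V. g x = f x"
    using linear_on_extend[OF subspace_fin_dim] assms by blast
  have "f ` V = g ` V" using g by auto
  also have "\<dots> = fvs.span (g ` B)" unfolding B(2) by (rule fvp.linear_span_image[OF g(1), symmetric])
  finally show ?thesis using B(1) by (auto simp: fin_dim_def)
qed

definition supp_in :: "'x set \<Rightarrow> ('x \<Rightarrow> 'k::field) set" where
  "supp_in S = {f. \<forall>x. x \<notin> S \<longrightarrow> f x = 0}"

lemma subspace_supp: "fvs.subspace (supp_in S)"
  by (auto simp: fvs.subspace_def supp_in_def)

lemma dim_supp_in:
  assumes S: "finite S" shows "fvs.dim (supp_in S :: ('b \<Rightarrow> 'k::field) set) = card S" "fin_dim (supp_in S :: ('b \<Rightarrow> 'k) set)"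
proof -
  define dl where "dl x = (\<lambda>y. if y = x then 1 else (0::'k))" for x :: 'b
  have inj: "inj dl" by (rule injI) (metis dl_def zero_neq_one)
  have exp: "f = (\<Sum>x\<in>S. fscale (f x) (dl x))" if f: "f \<in> supp_in S" for f
  proof
    fix z
    have "(\<Sum>x\<in>S. f x * dl x z) = (\<Sum>x\<in>S. if x = z then f z else 0)" by (rule sum.cong) (auto simp: dl_def)
    thus "f z = (\<Sum>x\<in>S. fscale (f x) (dl x)) z" using f S by (auto simp: supp_in_def)
  qed
  have span: "supp_in S \<subseteq> fvs.span (dl ` S)"
  proof
    fix f :: "'b \<Rightarrow> 'k" assume "f \<in> supp_in S"
    from exp[OF this] show "f \<in> fvs.span (dl ` S)"
      by (metis (no_types, lifting) fvs.span_base fvs.span_scale fvs.span_sum imageI)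
  qed
  have sub: "dl ` S \<subseteq> supp_in S" by (auto simp: dl_def supp_in_def)
  have ind: "fvs.independent (dl ` S)"
  proof (rule fvs.independent_if_scalars_zero)
    fix c v assume z: "(\<Sum>x\<in>dl ` S. fscale (c x) x) = 0" and v: "v \<in> dl ` S"
    obtain y where y: "y \<in> S" "v = dl y" using v by blast
    have "(\<Sum>x\<in>dl ` S. fscale (c x) x) = (\<Sum>x\<in>S. fscale (c (dl x)) (dl x))"
      by (rule sum.reindex_cong[of dl]) (use inj in \<open>auto simp: inj_on_def inj_def\<close>)
    hence "0 = (\<Sum>x\<in>S. c (dl x) * dl x y)" using z by (metis (no_types, lifting) fscale_apply sum.cong sum_fun_apply zero_fun_apply)
    also have "\<dots> = (\<Sum>x\<in>S. if x = y then c (dl y) else 0)" by (rule sum.cong) (auto simp: dl_def)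
    also have "\<dots> = c v" using y S by simp
    finally show "c v = 0" ..
  qed (use S in simp)
  have "fvs.dim (supp_in S :: ('b \<Rightarrow> 'k) set) = card (dl ` S)"
    by (rule fvs.dim_unique[OF sub span ind refl])
  also have "\<dots> = card S" using inj by (intro card_image) (auto simp: inj_on_def inj_def)
  finally show "fvs.dim (supp_in S :: ('b \<Rightarrow> 'k) set) = card S" .
  have "supp_in S = fvs.span (dl ` S)" using span fvs.span_minimal[OF sub subspace_supp] by blast
  thus "fin_dim (supp_in S :: ('b \<Rightarrow> 'k) set)" using S by (auto simp: fin_dim_def)
qed

text \<open>
  The sum is the trace of \<open>h\<close> over \<open>k[t]/(t\<^sup>p)\<close>. Composing with \<open>t\<close> on either side only
  shifts the summation index, because the two boundary terms contain a \<open>p\<close>-th power.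
\<close>

lemma nilp_trace_commute:
  fixes t :: "('b \<Rightarrow> 'k::field) \<Rightarrow> 'b \<Rightarrow> 'k" and t' :: "('c \<Rightarrow> 'k) \<Rightarrow> 'c \<Rightarrow> 'k"
  assumes V: "x \<in> V" "fvs.subspace V" and tp: "(t ^^ p) x = 0" and W: "fvs.subspace W" and t': "linear_on W t'" "t' ` W \<subseteq> W"
    and t'p: "\<And>x. x \<in> W \<Longrightarrow> (t' ^^ p) x = 0" and h: "linear_on V h" "h ` V \<subseteq> W"
    and t: "t ` V \<subseteq> V"
  shows "(\<Sum>i<p. (t' ^^ i) (h ((t ^^ (p - 1 - i)) (t x)))) = t' (\<Sum>i<p. (t' ^^ i) (h ((t ^^ (p - 1 - i)) x)))"
proof (cases p)
  case (Suc q)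
  have tV: "(t ^^ i) x \<in> V" for i using V t by (induction i) auto
  have inW: "(t' ^^ i) (h ((t ^^ j) x)) \<in> W" for i j
    using linear_on_funpow(2)[OF t', of i] h(2) tV[of j] by (auto simp: image_subset_iff)
  have "(\<Sum>i<p. (t' ^^ i) (h ((t ^^ (p - 1 - i)) (t x)))) = (\<Sum>i<Suc q. (t' ^^ i) (h ((t ^^ (p - i)) x)))"
    by (rule sum.cong) (auto simp: Suc funpow_swap1 Suc_diff_le)
  also have "\<dots> = h ((t ^^ p) x) + (\<Sum>i<q. (t' ^^ Suc i) (h ((t ^^ (p - Suc i)) x)))"
    unfolding sum.lessThan_Suc_shift by simp
  also have "h ((t ^^ p) x) = 0" using tp linear_on_zero[OF V(2) h(1)] by simp
  also have "0 + (\<Sum>i<q. (t' ^^ Suc i) (h ((t ^^ (p - Suc i)) x))) = (\<Sum>i<q. t' ((t' ^^ i) (h ((t ^^ (p - 1 - i)) x))))"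
    by simp
  also have "\<dots> = (\<Sum>i<Suc q. t' ((t' ^^ i) (h ((t ^^ (p - 1 - i)) x))))"
  proof -
    have "h x \<in> W" using inW[of 0 0] by simp
    from t'p[OF this] show ?thesis by (simp add: Suc)
  qed
  also have "\<dots> = t' (\<Sum>i<p. (t' ^^ i) (h ((t ^^ (p - 1 - i)) x)))"
    unfolding linear_on_sum[OF W t'(1) inW] Suc ..
  finally show ?thesis .
qed (use linear_on_zero[OF W t'(1)] in simp)

text \<open>
  A criterion in the style of Higman: the identity of an exact \<open>V\<close> is a trace. Taking for
  \<open>h\<close> a section \<open>s\<close> of \<open>t\<^sup>p\<^sup>-\<^sup>1\<close>, the trace \<open>T\<close> is the identity on the kernel of \<open>t\<close>, so \<open>1 - T\<close> is
  nilpotent; composing \<open>s\<close> with the inverse \<open>Z\<close> of \<open>T\<close>, which commutes with \<open>t\<close>, corrects it.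
\<close>

lemma p_exact_trace:
  fixes t :: "('b \<Rightarrow> 'k::field) \<Rightarrow> 'b \<Rightarrow> 'k"
  assumes V: "fvs.subspace V" and t: "linear_on V t" "t ` V \<subseteq> V"
    and tp: "\<And>x. x \<in> V \<Longrightarrow> (t ^^ p) x = 0" and p: "p > 0" and ex: "p_exact p V t"
  shows "\<exists>h. linear_on V h \<and> h ` V \<subseteq> V \<and> (\<forall>x\<in>V. (\<Sum>i<p. (t ^^ i) (h ((t ^^ (p - 1 - i)) x))) = x)"
proof -
  note tl = linear_on_funpow[OF t]
  obtain s where s: "flin s" "range s \<subseteq> V" "\<forall>w\<in>(t ^^ (p - 1)) ` V. (t ^^ (p - 1)) (s w) = w"
    using linear_on_section[OF V tl(1)] by blast
  define T where "T x = (\<Sum>i<p. (t ^^ i) (s ((t ^^ (p - 1 - i)) x)))" for x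
  define R where "R x = x - T x" for x
  have sl: "linear_on V s" "s ` V \<subseteq> V" using s flin_linear_on by auto
  have tin: "(t ^^ i) x \<in> V" if "x \<in> V" for x i using tl(2)[of i] that by auto
  have T_in: "T x \<in> V" if "x \<in> V" for x unfolding T_def
    by (intro fvs.subspace_sum V tin) (use sl tin that in auto)
  have T_lin: "linear_on V T" unfolding T_def
  proof (intro linear_on_sum_fun)
    fix i
    show "linear_on V (\<lambda>x. (t ^^ i) (s ((t ^^ (p - 1 - i)) x)))"
      by (rule linear_on_comp[OF linear_on_comp[OF tl(1) sl(1)] tl(1)]) (use tin sl in auto)
  qed
  have T_t: "T (t x) = t (T x)" if "x \<in> V" for x
    unfolding T_def by (rule nilp_trace_commute[of _ V _ _ V]) (use that V t tp sl in auto)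
  have R: "linear_on V R" "R ` V \<subseteq> V"
    using T_in V unfolding R_def by (auto intro!: linear_on_diff_fun linear_on_id T_lin fvs.subspace_diff)
  note Rl = linear_on_funpow[OF R]
  have R_t: "R (t x) = t (R x)" if "x \<in> V" for x
    using that T_t T_in unfolding R_def by (simp add: linear_on_diff[OF V t(1)])
  have Rin: "(R ^^ i) x \<in> V" if "x \<in> V" for x i using Rl(2)[of i] that by auto
  have Ri_t: "(R ^^ i) (t x) = t ((R ^^ i) x)" if "x \<in> V" for x i
    using that by (induction i) (auto simp: R_t Rin)
  have R_ti: "R ((t ^^ i) x) = (t ^^ i) (R x)" if "x \<in> V" for x i
    using that by (induction i) (auto simp: R_t tin)
  have R_ker: "R x = 0" if x: "x \<in> V" "t x = 0" for x
  proof -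
    have "T x = (\<Sum>i\<in>{p - 1}. (t ^^ i) (s ((t ^^ (p - 1 - i)) x)))"
      unfolding T_def
    proof (rule sum.mono_neutral_right)
      show "\<forall>i\<in>{..<p} - {p - 1}. (t ^^ i) (s ((t ^^ (p - 1 - i)) x)) = 0"
      proof
        fix i assume i: "i \<in> {..<p} - {p - 1}"
        then obtain j where "p - 1 - i = Suc j" by (metis DiffE Suc_pred' diff_is_0_eq insertI1 lessThan_iff
              less_Suc_eq_le neq0_conv le_antisym p Suc_diff_1)
        hence "(t ^^ (p - 1 - i)) x = (t ^^ j) 0" using x(2) by (simp add: funpow_swap1)
        also have "\<dots> = 0" using linear_on_zero[OF V tl(1)] .
        finally show "(t ^^ i) (s ((t ^^ (p - 1 - i)) x)) = 0"
          using linear_on_zero[OF V tl(1)] flin_zero[OF s(1)] by simp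
      qed
    qed (use p in auto)
    also have "\<dots> = x" using ex x s(3) by (auto simp: p_exact_def)
    finally show ?thesis by (simp add: R_def)
  qed
  have R_nil: "(R ^^ j) x = 0" if "x \<in> V" "(t ^^ j) x = 0" for j x
    using that
  proof (induction j arbitrary: x)
    case (Suc j)
    have "R ((t ^^ j) x) = 0" by (rule R_ker) (use Suc tin in auto)
    hence "(t ^^ j) (R x) = 0" using R_ti Suc by simp
    hence "(R ^^ j) (R x) = 0" using Suc R by (intro Suc.IH) auto
    thus ?case by (simp add: funpow_swap1)
  qed simp
  \<comment> \<open>The inverse of \<open>T = 1 - R\<close>.\<close>
  define Z where "Z x = (\<Sum>j<p. (R ^^ j) x)" for x
  have Z: "linear_on V Z" unfolding Z_def by (intro linear_on_sum_fun Rl)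
  have Z_in: "Z x \<in> V" if "x \<in> V" for x unfolding Z_def by (intro fvs.subspace_sum V Rin that)
  have Z_t: "Z (t x) = t (Z x)" if "x \<in> V" for x
    using that Rin by (simp add: Z_def Ri_t linear_on_sum[OF V t(1)])
  have Z_ti: "Z ((t ^^ i) x) = (t ^^ i) (Z x)" if "x \<in> V" for x i
    using that by (induction i) (auto simp: Z_t tin)
  have TZ: "T (Z x) = x" if x: "x \<in> V" for x
  proof -
    have "Z x - R (Z x) = (\<Sum>j<p. (R ^^ j) x - (R ^^ Suc j) x)"
      unfolding Z_def using x Rin by (simp add: linear_on_sum[OF V R(1)] sum_subtractf)
    also have "\<dots> = x - (R ^^ p) x" using sum_lessThan_telescope'[of "\<lambda>j. (R ^^ j) x" p] by simp
    also have "\<dots> = x" using R_nil[OF x tp[OF x]] by simp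
    finally show ?thesis by (simp add: R_def)
  qed
  have "(\<Sum>i<p. (t ^^ i) (s (Z ((t ^^ (p - 1 - i)) x)))) = x" if "x \<in> V" for x
    using TZ[OF that] unfolding T_def by (simp add: Z_ti that)
  moreover have "linear_on V (\<lambda>x. s (Z x))" by (rule linear_on_comp[OF Z sl(1)]) (use Z_in in auto)
  moreover have "(\<lambda>x. s (Z x)) ` V \<subseteq> V" using s(2) by auto
  ultimately show ?thesis by (intro exI[of _ "\<lambda>x. s (Z x)"]) auto
qed

section \<open>Modules over the truncated polynomial algebra\<close>

definition tmon :: "nat \<Rightarrow> nat \<Rightarrow> 'k::field" where "tmon i = (\<lambda>n. if n = i then 1 else 0)"

definition tX :: "nat \<Rightarrow> 'k::field" where "tX = tmon 1"

lemma tmon_carrier: "i < CHAR('k) \<Longrightarrow> (tmon i :: nat \<Rightarrow> 'k::field) \<in> carrier trunc_poly"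
  by (auto simp: trunc_poly_def tmon_def)

lemma tmon_one: "(\<one>\<^bsub>trunc_poly\<^esub> :: nat \<Rightarrow> 'k::field) = tmon 0"
  by (auto simp: trunc_poly_def tmon_def)

lemma tmon_mult:
  fixes f :: "nat \<Rightarrow> 'k::field"
  shows "tmon i \<otimes>\<^bsub>trunc_poly\<^esub> f = (\<lambda>n. if n < CHAR('k) \<and> i \<le> n then f (n - i) else 0)"
proof
  fix n
  have "(\<Sum>j\<le>n. tmon i j * f (n - j)) = (\<Sum>j\<le>n. if j = i then f (n - i) else 0)"
    by (rule sum.cong) (auto simp: tmon_def)
  thus "(tmon i \<otimes>\<^bsub>trunc_poly\<^esub> f) n = (if n < CHAR('k) \<and> i \<le> n then f (n - i) else 0)"
    by (simp add: trunc_poly_def)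
qed

lemma trunc_poly_comm: "f \<otimes>\<^bsub>trunc_poly\<^esub> g = g \<otimes>\<^bsub>trunc_poly\<^esub> (f :: nat \<Rightarrow> 'k::field)"
proof -
  have "(\<Sum>i\<le>n. f i * g (n - i)) = (\<Sum>i\<le>n. g i * f (n - i))" for n
    by (rule sum.reindex_bij_witness[of _ "\<lambda>i. n - i" "\<lambda>i. n - i"]) auto
  thus ?thesis by (simp add: trunc_poly_def fun_eq_iff)
qed

lemma opposite_trunc_poly: "opposite trunc_poly = (trunc_poly :: (nat \<Rightarrow> 'k::field) monoid)"
  by (simp add: opposite_def trunc_poly_comm[symmetric]) 

lemma trunc_poly_expand:
  "f \<in> carrier trunc_poly \<Longrightarrow> f = (\<Sum>i<CHAR('k). fscale (f i) (tmon i :: nat \<Rightarrow> 'k::field))"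
proof
  fix n assume "f \<in> carrier trunc_poly"
  hence "n \<ge> CHAR('k) \<Longrightarrow> f n = 0" by (simp add: trunc_poly_def)
  moreover have "(\<Sum>i<CHAR('k). f i * (tmon i n :: 'k)) = (\<Sum>i<CHAR('k). if i = n then f n else 0)"
    by (rule sum.cong) (auto simp: tmon_def)
  ultimately show "f n = (\<Sum>i<CHAR('k). fscale (f i) (tmon i :: nat \<Rightarrow> 'k::field)) n" by (auto simp: not_less)
qed

lemma subspace_trunc: "fvs.subspace (carrier (trunc_poly :: (nat \<Rightarrow> 'k::field) monoid))"
  by (auto simp: fvs.subspace_def trunc_poly_def)

lemma fd_moduleD:
  assumes "fd_module A M"
  shows "fin_dim (space M)" "fvs.subspace (space M)"
    "a \<in> carrier A \<Longrightarrow> v \<in> space M \<Longrightarrow> act M a v \<in> space M"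
    "a \<in> carrier A \<Longrightarrow> linear_on (space M) (act M a)"
    "v \<in> space M \<Longrightarrow> linear_on (carrier A) (\<lambda>a. act M a v)"
    "v \<in> space M \<Longrightarrow> act M \<one>\<^bsub>A\<^esub> v = v"
    "a \<in> carrier A \<Longrightarrow> b \<in> carrier A \<Longrightarrow> v \<in> space M \<Longrightarrow> act M (a \<otimes>\<^bsub>A\<^esub> b) v = act M a (act M b v)"
  using assms by (auto simp: fd_module_def bilinear_on_def subspace_fin_dim)

lemma fd_moduleI:
  assumes "fin_dim (space M)"
    "\<And>a v. a \<in> carrier A \<Longrightarrow> v \<in> space M \<Longrightarrow> act M a v \<in> space M"
    "\<And>a. a \<in> carrier A \<Longrightarrow> linear_on (space M) (act M a)"
    "\<And>v. v \<in> space M \<Longrightarrow> linear_on (carrier A) (\<lambda>a. act M a v)"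
    "\<And>v. v \<in> space M \<Longrightarrow> act M \<one>\<^bsub>A\<^esub> v = v"
    "\<And>a b v. a \<in> carrier A \<Longrightarrow> b \<in> carrier A \<Longrightarrow> v \<in> space M \<Longrightarrow>
       act M (a \<otimes>\<^bsub>A\<^esub> b) v = act M a (act M b v)"
  shows "fd_module A M"
  using assms by (auto simp: fd_module_def bilinear_on_def)

lemma mod_homD:
  assumes "f \<in> mod_hom A M N"
  shows "f ` space M \<subseteq> space N" "linear_on (space M) f"
    "a \<in> carrier A \<Longrightarrow> v \<in> space M \<Longrightarrow> f (act M a v) = act N a (f v)"
  using assms by (auto simp: mod_hom_def)

context
  assumes char_prime: "prime CHAR('k::field)"
begin

lemma p_ge2: "CHAR('k) \<ge> 2" using char_prime by (rule prime_ge_2_nat)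

lemma trunc_act:
  fixes M :: "(nat \<Rightarrow> 'k, 'c, 'k) amod"
  assumes M: "fd_module trunc_poly M" and v: "v \<in> space M"
  shows "i < CHAR('k) \<Longrightarrow> act M (tmon i) v = (act M (tX) ^^ i) v"
    and "(act M (tX) ^^ CHAR('k)) v = 0"
    and "a \<in> carrier trunc_poly \<Longrightarrow> act M a v = (\<Sum>i<CHAR('k). fscale (a i) ((act M (tX) ^^ i) v))"
proof -
  note D = fd_moduleD[OF M]
  have c1: "(tX :: nat \<Rightarrow> 'k) \<in> carrier trunc_poly" unfolding tX_def using p_ge2 by (intro tmon_carrier) auto
  have step: "tX \<otimes>\<^bsub>trunc_poly\<^esub> tmon i = (if Suc i < CHAR('k) then tmon (Suc i) else (0::nat \<Rightarrow> 'k))" for i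
    unfolding tX_def tmon_mult by (auto simp: fun_eq_iff tmon_def)
  show *: "act M (tmon i) v = (act M (tX) ^^ i) v" if "i < CHAR('k)" for i
    using that
  proof (induction i)
    case 0
    thus ?case using D(6)[OF v] by (simp add: tmon_one)
  next
    case (Suc i)
    have "act M (tmon (Suc i)) v = act M (tX \<otimes>\<^bsub>trunc_poly\<^esub> tmon i) v" using Suc.prems by (simp add: step)
    also have "\<dots> = act M (tX) (act M (tmon i) v)"
      by (rule D(7)[OF c1 tmon_carrier v]) (use Suc in auto)
    finally show ?case using Suc by simp
  qed
  have "(act M (tX) ^^ CHAR('k)) v = act M (tX) ((act M (tX) ^^ (CHAR('k) - 1)) v)"
    using p_ge2 by (metis One_nat_def Suc_pred comp_apply funpow.simps(2) less_le_trans pos2)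
  also have "\<dots> = act M (tX) (act M (tmon (CHAR('k) - 1)) v)" using p_ge2 by (subst *) auto
  also have "\<dots> = act M (tX \<otimes>\<^bsub>trunc_poly\<^esub> tmon (CHAR('k) - 1)) v"
    using p_ge2 by (intro D(7)[OF c1 tmon_carrier v, symmetric]) auto
  also have "tX \<otimes>\<^bsub>trunc_poly\<^esub> tmon (CHAR('k) - 1) = (0::nat \<Rightarrow> 'k)" using p_ge2 by (subst step) auto
  also have "act M 0 v = 0" using linear_on_zero[OF subspace_trunc D(5)[OF v]] .
  finally show "(act M (tX) ^^ CHAR('k)) v = 0" .
  show "act M a v = (\<Sum>i<CHAR('k). fscale (a i) ((act M (tX) ^^ i) v))" if a: "a \<in> carrier trunc_poly"
  proof -
    have "act M a v = act M (\<Sum>i<CHAR('k). fscale (a i) (tmon i)) v" using trunc_poly_expand[OF a] by simp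
    also have "\<dots> = (\<Sum>i<CHAR('k). act M (fscale (a i) (tmon i)) v)"
      by (rule linear_on_sum[OF subspace_trunc D(5)[OF v]])
         (auto intro!: fvs.subspace_scale[OF subspace_trunc] tmon_carrier)
    also have "\<dots> = (\<Sum>i<CHAR('k). fscale (a i) ((act M (tX) ^^ i) v))"
      by (rule sum.cong) (auto simp: linear_onD(2)[OF D(5)[OF v] tmon_carrier] *)
    finally show ?thesis .
  qed
qed

lemma trunc_op:
  fixes M :: "(nat \<Rightarrow> 'k, 'c, 'k) amod"
  assumes M: "fd_module trunc_poly M"
  shows "linear_on (space M) (act M (tX))" "act M (tX) ` space M \<subseteq> space M"
  using fd_moduleD[OF M] tmon_carrier[of 1, where 'k='k] p_ge2 by (auto simp: tX_def)

text \<open>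
  The product in \<open>trunc_poly\<close> is truncated at \<open>p\<close>; the terms cut off act as zero because \<open>T\<^sup>p = 0\<close>.
\<close>

lemma trunc_mult_op:
  fixes T :: "('c \<Rightarrow> 'k) \<Rightarrow> 'c \<Rightarrow> 'k"
  assumes V: "fvs.subspace V" and T: "linear_on V T" "T ` V \<subseteq> V"
    and Tp: "\<And>x. x \<in> V \<Longrightarrow> (T ^^ CHAR('k)) x = 0" and v: "v \<in> V"
  shows "(\<Sum>n<CHAR('k). fscale ((a \<otimes>\<^bsub>trunc_poly\<^esub> b) n) ((T ^^ n) v)) =
    (\<Sum>i<CHAR('k). fscale (a i) ((T ^^ i) (\<Sum>j<CHAR('k). fscale (b j) ((T ^^ j) v))))"
proof -
  let ?p = "CHAR('k)"
  note Tl = linear_on_funpow[OF T]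
  have Tin: "(T ^^ i) x \<in> V" if "x \<in> V" for x i using Tl(2)[of i] that by auto
  have z: "(T ^^ n) v = 0" if "n \<ge> ?p" for n
  proof -
    have "(T ^^ n) v = (T ^^ ?p) ((T ^^ (n - ?p)) v)" using that by (simp add: funpow_add_on)
    thus ?thesis using Tp Tin v by simp
  qed
  have "(\<Sum>i<?p. fscale (a i) ((T ^^ i) (\<Sum>j<?p. fscale (b j) ((T ^^ j) v)))) =
     (\<Sum>i<?p. \<Sum>j<?p. fscale (a i * b j) ((T ^^ (i + j)) v))"
  proof (rule sum.cong[OF refl])
    fix i
    have "(T ^^ i) (\<Sum>j<?p. fscale (b j) ((T ^^ j) v)) = (\<Sum>j<?p. fscale (b j) ((T ^^ (i + j)) v))"
      using Tin[OF v] V by (simp add: linear_on_sum[OF V Tl(1)] fvs.subspace_scale linear_onD(2)[OF Tl(1)] funpow_add_on)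
    thus "fscale (a i) ((T ^^ i) (\<Sum>j<?p. fscale (b j) ((T ^^ j) v))) =
       (\<Sum>j<?p. fscale (a i * b j) ((T ^^ (i + j)) v))"
      by (simp add: fvs.scale_sum_right)
  qed
  also have "\<dots> = (\<Sum>(i, j)\<in>{..<?p} \<times> {..<?p}. fscale (a i * b j) ((T ^^ (i + j)) v))"
    by (simp add: sum.cartesian_product)
  also have "\<dots> = (\<Sum>(i, j)\<in>{(i, j). i + j < ?p}. fscale (a i * b j) ((T ^^ (i + j)) v))"
    by (rule sum.mono_neutral_right) (auto simp: z not_less)
  also have "\<dots> = (\<Sum>(n, i)\<in>(SIGMA n:{..<?p}. {..n}). fscale (a i * b (n - i)) ((T ^^ n) v))"
    by (rule sum.reindex_bij_witness[of _ "\<lambda>(n, i). (i, n - i)" "\<lambda>(i, j). (i + j, i)"]) auto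
  also have "\<dots> = (\<Sum>n<?p. \<Sum>i\<le>n. fscale (a i * b (n - i)) ((T ^^ n) v))"
    by (simp add: sum.Sigma)
  also have "\<dots> = (\<Sum>n<?p. fscale ((a \<otimes>\<^bsub>trunc_poly\<^esub> b) n) ((T ^^ n) v))"
    by (rule sum.cong) (auto simp: trunc_poly_def fvs.scale_sum_left)
  finally show ?thesis ..
qed

lemma fd_module_trunc_op:
  fixes T :: "('c \<Rightarrow> 'k) \<Rightarrow> 'c \<Rightarrow> 'k"
  assumes V: "fin_dim V" and T: "linear_on V T" "T ` V \<subseteq> V"
    and Tp: "\<And>x. x \<in> V \<Longrightarrow> (T ^^ CHAR('k)) x = 0"
  shows "fd_module trunc_poly \<lparr>space = V, act = (\<lambda>a v. \<Sum>i<CHAR('k). fscale (a i) ((T ^^ i) v))\<rparr>"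
    (is "fd_module _ ?M")
proof (rule fd_moduleI)
  note Tl = linear_on_funpow[OF T]
  note S = subspace_fin_dim[OF V]
  show "fin_dim (space ?M)" using V by simp
  show "act ?M a v \<in> space ?M" if "v \<in> space ?M" for a v
    using that Tl(2) by (auto intro!: fvs.subspace_sum S fvs.subspace_scale)
  show "linear_on (space ?M) (act ?M a)" for a
    by (auto intro!: linear_on_sum_fun linear_on_scale_fun Tl)
  show "linear_on (carrier trunc_poly) (\<lambda>a. act ?M a v)" for v
    by (auto simp: linear_on_def sum.distrib fvs.scale_sum_right fvs.scale_left_distrib)
  show "act ?M \<one>\<^bsub>trunc_poly\<^esub> v = v" if "v \<in> space ?M" for v
  proof -
    have "(\<Sum>i<CHAR('k). fscale (\<one>\<^bsub>trunc_poly\<^esub> i) ((T ^^ i) v)) = (\<Sum>i<CHAR('k). if i = 0 then v else 0)"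
      by (rule sum.cong) (auto simp: tmon_one tmon_def)
    thus ?thesis using p_ge2 by simp
  qed
  show "act ?M (a \<otimes>\<^bsub>trunc_poly\<^esub> b) v = act ?M a (act ?M b v)" if "v \<in> space ?M" for a b v
    using trunc_mult_op[OF S T Tp] that by simp
qed

lemma trunc_op_act:
  fixes T :: "('c \<Rightarrow> 'k) \<Rightarrow> 'c \<Rightarrow> 'k"
  shows "(\<Sum>i<CHAR('k). fscale (tX i) ((T ^^ i) v)) = T v"
proof -
  have "(\<Sum>i<CHAR('k). fscale (tX i) ((T ^^ i) v)) = (\<Sum>i<CHAR('k). if i = 1 then T v else 0)"
    by (rule sum.cong) (auto simp: tX_def tmon_def)
  thus ?thesis using p_ge2 by simp
qed

lemma mod_hom_truncI:
  fixes M :: "(nat \<Rightarrow> 'k, 'c, 'k) amod" and N :: "(nat \<Rightarrow> 'k, 'd, 'k) amod"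
  assumes M: "fd_module trunc_poly M" and N: "fd_module trunc_poly N"
    and f: "f ` space M \<subseteq> space N" "linear_on (space M) f"
    and t: "\<And>v. v \<in> space M \<Longrightarrow> f (act M (tX) v) = act N (tX) (f v)"
  shows "f \<in> mod_hom trunc_poly M N"
proof -
  note tl = linear_on_funpow[OF trunc_op[OF M]]
  have ti: "f ((act M (tX) ^^ i) v) = (act N (tX) ^^ i) (f v)" if "v \<in> space M" for i v
  proof (induction i)
    case (Suc i)
    have "(act M (tX) ^^ i) v \<in> space M" using tl(2) that by auto
    thus ?case using t Suc by simp
  qed simp
  have "f (act M a v) = act N a (f v)" if a: "a \<in> carrier trunc_poly" and v: "v \<in> space M" for a v
  proof -
    have fv: "f v \<in> space N" using f v by auto
    have "f (act M a v) = (\<Sum>i<CHAR('k). f (fscale (a i) ((act M (tX) ^^ i) v)))"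
      unfolding trunc_act(3)[OF M v a]
      by (rule linear_on_sum[OF fd_moduleD(2)[OF M] f(2)])
         (use tl(2) v in \<open>auto intro!: fvs.subspace_scale[OF fd_moduleD(2)[OF M]]\<close>)
    also have "\<dots> = (\<Sum>i<CHAR('k). fscale (a i) ((act N (tX) ^^ i) (f v)))"
      using tl(2) v by (intro sum.cong) (auto simp: linear_onD(2)[OF f(2)] ti image_subset_iff)
    also have "\<dots> = act N a (f v)" using trunc_act(3)[OF N fv a] by simp
    finally show ?thesis .
  qed
  thus ?thesis using f by (auto simp: mod_hom_def)
qed

lemma trunc_t_carrier: "(tX :: nat \<Rightarrow> 'k) \<in> carrier trunc_poly"
  unfolding tX_def using p_ge2 by (intro tmon_carrier) auto

text \<open>
  A linear lift of \<open>f\<close> along \<open>g\<close> exists over the field. Averaging its composite with \<open>h\<close> from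
  \<open>p_exact_trace\<close> gives a module homomorphism that is still a lift, since the trace of \<open>h\<close> is
  the identity.
\<close>

lemma p_exact_imp_projective:
  fixes M :: "(nat \<Rightarrow> 'k, 'c, 'k) amod"
  assumes M: "fd_module trunc_poly M" and ex: "p_exact CHAR('k) (space M) (act M (tX))"
  shows "projective trunc_poly M"
  unfolding projective_def
proof (intro conjI allI ballI impI M)
  fix X Y :: "(nat \<Rightarrow> 'k, nat, 'k) amod" and g f
  let ?p = "CHAR('k)"
  assume g: "g \<in> mod_hom trunc_poly X Y" and f: "f \<in> mod_hom trunc_poly M Y"
    and XY: "fd_module trunc_poly X \<and> fd_module trunc_poly Y \<and> g ` space X = space Y"
  hence X: "fd_module trunc_poly X" and Y: "fd_module trunc_poly Y" by auto
  note V = fd_moduleD(2)[OF M] and SX = fd_moduleD(2)[OF X]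
  note t = trunc_op[OF M] and tX = trunc_op[OF X]
  obtain h where h: "linear_on (space M) h" "h ` space M \<subseteq> space M"
    "\<And>x. x \<in> space M \<Longrightarrow> (\<Sum>i<?p. (act M (tX) ^^ i) (h ((act M (tX) ^^ (?p - 1 - i)) x))) = x"
    using p_exact_trace[OF V t trunc_act(2)[OF M] _ ex] p_ge2 by auto
  obtain s where s: "flin s" "range s \<subseteq> space X" "\<forall>w\<in>g ` space X. g (s w) = w"
    using linear_on_section[OF SX mod_homD(2)[OF g]] by blast
  define k where "k v = s (f (h v))" for v
  have k: "linear_on (space M) k" "k ` space M \<subseteq> space X"
  proof -
    show "k ` space M \<subseteq> space X" unfolding k_def using s(2) by auto
    show "linear_on (space M) k" unfolding k_def
      by (rule linear_on_comp[OF linear_on_comp[OF h(1) mod_homD(2)[OF f]] flin_linear_on[OF s(1), of UNIV]])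
         (use h(2) in auto)
  qed
  define H where "H v = (\<Sum>i<?p. (act X (tX) ^^ i) (k ((act M (tX) ^^ (?p - 1 - i)) v)))" for v
  have Min: "(act M (tX) ^^ i) v \<in> space M" if "v \<in> space M" for i v
    using linear_on_funpow(2)[OF t] that by auto
  have Xin: "(act X (tX) ^^ i) v \<in> space X" if "v \<in> space X" for i v
    using linear_on_funpow(2)[OF tX] that by auto
  have kin: "k v \<in> space X" if "v \<in> space M" for v using k that by auto
  have hom: "H \<in> mod_hom trunc_poly M X"
  proof (rule mod_hom_truncI[OF M X])
    show "H ` space M \<subseteq> space X" unfolding H_def
      by (auto intro!: fvs.subspace_sum SX Xin kin Min)
    show "linear_on (space M) H" unfolding H_def
    proof (intro linear_on_sum_fun)
      fix i
      show "linear_on (space M) (\<lambda>v. (act X (tX) ^^ i) (k ((act M (tX) ^^ (?p - 1 - i)) v)))"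
        by (rule linear_on_comp[OF linear_on_comp[OF linear_on_funpow(1)[OF t] k(1)] linear_on_funpow(1)[OF tX]])
           (use Min kin in auto)
    qed
    show "H (act M (tX) v) = act X (tX) (H v)" if "v \<in> space M" for v
      unfolding H_def by (rule nilp_trace_commute[OF that V _ SX tX _ k t(2)])
        (use trunc_act(2)[OF M] trunc_act(2)[OF X] that in auto)
  qed
  have gi: "g ((act X (tX) ^^ i) w) = (act Y (tX) ^^ i) (g w)" if "w \<in> space X" for i w
    by (induction i) (auto simp: mod_homD(3)[OF g trunc_t_carrier] Xin that)
  have fi: "f ((act M (tX) ^^ i) w) = (act Y (tX) ^^ i) (f w)" if "w \<in> space M" for i w
    by (induction i) (auto simp: mod_homD(3)[OF f trunc_t_carrier] Min that)
  have gk: "g (k v) = f (h v)" if "v \<in> space M" for v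
  proof -
    have "f (h v) \<in> g ` space X" using XY mod_homD(1)[OF f] h(2) that by auto
    thus ?thesis using s(3) unfolding k_def by blast
  qed
  have "g (H v) = f v" if v: "v \<in> space M" for v
  proof -
    have hM: "h w \<in> space M" if "w \<in> space M" for w using h that by auto
    have "g (H v) = (\<Sum>i<?p. (act Y (tX) ^^ i) (f (h ((act M (tX) ^^ (?p - 1 - i)) v))))"
      unfolding H_def by (simp add: linear_on_sum[OF SX mod_homD(2)[OF g]] Xin kin Min v gi gk)
    also have "\<dots> = f (\<Sum>i<?p. (act M (tX) ^^ i) (h ((act M (tX) ^^ (?p - 1 - i)) v)))"
      by (simp add: linear_on_sum[OF V mod_homD(2)[OF f]] Min hM v fi)
    finally show ?thesis using h(3)[OF v] by simp
  qed
  thus "\<exists>h\<in>mod_hom trunc_poly M X. \<forall>v\<in>space M. g (h v) = f v" using hom by blast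
qed

end

text \<open>
  A function on \<open>nat\<close> is read as a sequence of functions on \<open>nat\<close>. This provides direct sums and
  tensor products with coordinates in \<open>nat\<close>, where the test modules live.
\<close>

definition slice :: "nat \<Rightarrow> (nat \<Rightarrow> 'k) \<Rightarrow> nat \<Rightarrow> 'k" where
  "slice i F = (\<lambda>x. F (prod_encode (i, x)))"

definition from_slices :: "(nat \<Rightarrow> nat \<Rightarrow> 'k) \<Rightarrow> nat \<Rightarrow> 'k" where
  "from_slices G = (\<lambda>j. G (fst (prod_decode j)) (snd (prod_decode j)))"

lemma slice_from_slices [simp]: "slice i (from_slices G) = G i"
  by (simp add: slice_def from_slices_def)

lemma slice_eqI: "(\<And>i. slice i F = slice i G) \<Longrightarrow> F = G"
proof
  fix j assume "\<And>i. slice i F = slice i G"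
  hence "slice (fst (prod_decode j)) F (snd (prod_decode j)) = slice (fst (prod_decode j)) G (snd (prod_decode j))"
    by simp
  thus "F j = G j" by (simp add: slice_def)
qed

lemma slice_linear:
  "slice i (F + G) = slice i F + slice i (G :: nat \<Rightarrow> 'k::field)"
  "slice i (fscale c F) = fscale c (slice i F)" "slice i (0::nat \<Rightarrow> 'k) = 0"
  "slice i (sum H S) = (\<Sum>s\<in>S. slice i (H s :: nat \<Rightarrow> 'k))"
  by (auto simp: slice_def fun_eq_iff)

text \<open>
  The tensor product of two linear maps in coordinates.
\<close>

definition tmap :: "(('b \<Rightarrow> 'k) \<Rightarrow> 'b2 \<Rightarrow> 'k) \<Rightarrow> (('c \<Rightarrow> 'k) \<Rightarrow> 'c2 \<Rightarrow> 'k) \<Rightarrow> ('b \<times> 'c \<Rightarrow> 'k) \<Rightarrow> 'b2 \<times> 'c2 \<Rightarrow> 'k" where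
  "tmap f g F = (\<lambda>(i, x). g (\<lambda>x'. f (\<lambda>i'. F (i', x')) i) x)"

lemma flin_pointwise:
  fixes f :: "('b \<Rightarrow> 'k::field) \<Rightarrow> 'c \<Rightarrow> 'k"
  assumes "flin f"
  shows "f (\<lambda>i. x i + y i) = (\<lambda>j. f x j + f y j)" "f (\<lambda>i. c * x i) = (\<lambda>j. c * f x j)"
  using flin_add[OF assms, of x y] flin_scale[OF assms, of c x]
  by (simp_all add: plus_fun_def fscale_def)

lemma tmap_flin:
  fixes f :: "('b \<Rightarrow> 'k::field) \<Rightarrow> 'b2 \<Rightarrow> 'k" and g :: "('c \<Rightarrow> 'k) \<Rightarrow> 'c2 \<Rightarrow> 'k"
  assumes "flin f" "flin g" shows "flin (tmap f g)"
  by (rule flinI) (auto simp: tmap_def fun_eq_iff flin_pointwise[OF assms(1)] flin_pointwise[OF assms(2)])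

lemma tmap_tens:
  fixes f :: "('b \<Rightarrow> 'k::field) \<Rightarrow> 'b2 \<Rightarrow> 'k" and g :: "('c \<Rightarrow> 'k) \<Rightarrow> 'c2 \<Rightarrow> 'k"
  assumes "flin f" "flin g" shows "tmap f g (tens x y) = tens (f x) (g y)"
proof -
  have 1: "f (\<lambda>i. x i * c) = (\<lambda>j. c * f x j)" for c
    using flin_pointwise(2)[OF assms(1), of c x] by (simp add: mult.commute)
  have 2: "g (\<lambda>i. y i * c) = (\<lambda>j. c * g y j)" for c
    using flin_pointwise(2)[OF assms(2), of c y] by (simp add: mult.commute)
  show ?thesis by (auto simp: tmap_def tens_def fun_eq_iff 1 2)
qed

lemma tens_flin_left: "flin (\<lambda>x. tens x (y::'c \<Rightarrow> 'k::field))"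
  and tens_flin_right: "flin (\<lambda>y. tens (x::'b \<Rightarrow> 'k::field) y)"
  by (rule flinI; auto simp: tens_def fun_eq_iff algebra_simps)+

context
  assumes char_prime: "prime CHAR('k::field)"
begin

text \<open>
  The free module on the space \<open>M\<close>, namely \<open>p\<close> copies of \<open>M\<close> with \<open>t\<close> shifting the copies, maps onto \<open>M\<close>.
  It is exact, and projectivity makes \<open>M\<close> a direct summand of it.
\<close>

lemma projective_imp_p_exact:
  fixes M :: "(nat \<Rightarrow> 'k, nat, 'k) amod"
  assumes pr: "projective trunc_poly M"
  shows "p_exact CHAR('k) (space M) (act M tX)"
proof -
  let ?p = "CHAR('k)"
  note p2 = p_ge2[OF char_prime]
  have M: "fd_module trunc_poly M" using pr by (simp add: projective_def)
  define V where "V = space M"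
  define t where "t = act M (tX :: nat \<Rightarrow> 'k)"
  have fV: "fin_dim V" and V: "fvs.subspace V" using fd_moduleD[OF M] by (auto simp: V_def)
  have t: "linear_on V t" "t ` V \<subseteq> V" using trunc_op[OF char_prime M] by (auto simp: V_def t_def)
  have tp: "(t ^^ ?p) x = 0" if "x \<in> V" for x using trunc_act(2)[OF char_prime M] that by (auto simp: V_def t_def)
  note tl = linear_on_funpow[OF t]
  have tin: "(t ^^ i) x \<in> V" if "x \<in> V" for x i using tl(2) that by auto
  \<comment> \<open>The free module: \<open>p\<close> copies of \<open>V\<close>, indexed by the powers of the variable.\<close>
  define X where "X = {F. (\<forall>i<?p. slice i F \<in> V) \<and> (\<forall>i\<ge>?p. slice i F = 0)}"
  define T where "T F = from_slices (\<lambda>i. if i = 0 \<or> i \<ge> ?p then 0 else slice (i - 1) F)" for F :: "nat \<Rightarrow> 'k"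
  define inj where "inj i v = from_slices (\<lambda>j. if j = i then v else (0::nat \<Rightarrow> 'k))" for i v
  define g where "g F = (\<Sum>i<?p. (t ^^ i) (slice i F))" for F :: "nat \<Rightarrow> 'k"
  have XV: "slice i F \<in> V" if "F \<in> X" for i F
    using that V fvs.subspace_0[OF V] by (cases "i < ?p") (auto simp: X_def)
  have sX: "fvs.subspace X"
    unfolding fvs.subspace_def X_def
    using V fvs.subspace_0[OF V] fvs.subspace_add[OF V] fvs.subspace_scale[OF V] by (auto simp: slice_linear)
  have inj_lin: "flin (inj i)" for i
    by (rule flinI; rule slice_eqI) (auto simp: inj_def slice_linear fun_eq_iff)
  have inj_X: "inj i v \<in> X" if "v \<in> V" "i < ?p" for i v
    using that fvs.subspace_0[OF V] by (auto simp: X_def inj_def)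
  have finX: "fin_dim X"
  proof -
    obtain B where B: "finite B" "V = fvs.span B" using fV by (auto simp: fin_dim_def)
    define B' where "B' = (\<Union>i<?p. inj i ` B)"
    have "B' \<subseteq> X" using inj_X B fvs.span_base unfolding B'_def by auto
    hence "fvs.span B' \<subseteq> X" using sX by (rule fvs.span_minimal)
    moreover have "F \<in> fvs.span B'" if F: "F \<in> X" for F
    proof -
      have "F = (\<Sum>i<?p. inj i (slice i F))"
      proof (rule slice_eqI)
        fix i
        have "(\<Sum>j<?p. slice i (inj j (slice j F))) = (\<Sum>j<?p. if j = i then slice i F else 0)"
          by (rule sum.cong) (auto simp: inj_def)
        thus "slice i F = slice i (\<Sum>i<?p. inj i (slice i F))"
          using F by (auto simp: slice_linear X_def)
      qed
      moreover have "inj i (slice i F) \<in> fvs.span B'" if i: "i < ?p" for i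
        by (rule span_imageI[OF inj_lin, of _ B]) (use XV[OF F] B i in \<open>auto simp: B'_def intro: fvs.span_base\<close>)
      ultimately show ?thesis by (metis (no_types, lifting) fvs.span_sum lessThan_iff)
    qed
    ultimately have "X = fvs.span B'" by blast
    moreover have "finite B'" using B(1) by (simp add: B'_def)
    ultimately show ?thesis by (auto simp: fin_dim_def)
  qed
  have TX: "T F \<in> X" if "F \<in> X" for F
    using XV[OF that] fvs.subspace_0[OF V] by (auto simp: T_def X_def)
  have Tlin: "linear_on X T"
    unfolding linear_on_def
    by (intro conjI ballI allI; rule slice_eqI) (auto simp: T_def slice_linear fun_eq_iff)
  have Tpow: "slice i ((T ^^ n) F) = (if n \<le> i \<and> i < ?p then slice (i - n) F else 0)" if "F \<in> X" for F n i
  proof (induction n arbitrary: i)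
    case 0 thus ?case using that by (auto simp: X_def)
  next
    case (Suc n)
    have "slice i ((T ^^ Suc n) F) = (if i = 0 \<or> i \<ge> ?p then 0 else slice (i - 1) ((T ^^ n) F))"
      by (simp add: T_def)
    thus ?case using Suc[of "i - 1"] by auto
  qed
  have Tp: "(T ^^ ?p) F = 0" if "F \<in> X" for F
    by (rule slice_eqI) (use Tpow[OF that] in \<open>auto simp: slice_linear\<close>)
  define XM where "XM = \<lparr>space = X, act = (\<lambda>a v. \<Sum>i<?p. fscale (a i) ((T ^^ i) v))\<rparr>"
  have XM: "fd_module trunc_poly XM"
    unfolding XM_def by (rule fd_module_trunc_op[OF char_prime finX Tlin _ Tp]) (use TX in auto)
  have XMt: "act XM tX v = T v" for v using trunc_op_act[OF char_prime, of T v] by (simp add: XM_def)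
  have sXM: "space XM = X" by (simp add: XM_def)
  have g_in: "g F \<in> V" if "F \<in> X" for F unfolding g_def by (intro fvs.subspace_sum V tin XV that)
  have g_lin: "linear_on X g"
    unfolding g_def
  proof (intro linear_on_sum_fun)
    fix i
    have "linear_on X (slice i)" by (simp add: linear_on_def slice_linear)
    thus "linear_on X (\<lambda>F. (t ^^ i) (slice i F))" by (rule linear_on_comp[OF _ tl(1)]) (use XV in auto)
  qed
  have gT: "g (T F) = t (g F)" if F: "F \<in> X" for F
  proof -
    obtain q where q: "?p = Suc q" using p2 by (cases ?p) auto
    have "g (T F) = (\<Sum>i<Suc q. (t ^^ i) (if i = 0 then 0 else slice (i - 1) F))"
      unfolding g_def q by (rule sum.cong) (auto simp: T_def q)
    also have "\<dots> = (\<Sum>i<q. (t ^^ Suc i) (slice i F))"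
      unfolding sum.lessThan_Suc_shift by simp
    also have "\<dots> = (\<Sum>i<Suc q. (t ^^ Suc i) (slice i F))"
      using tp[OF XV[OF F, of q]] unfolding q by simp
    also have "\<dots> = t (g F)" unfolding g_def q
      by (simp only: linear_on_sum[OF V t(1) tin[OF XV[OF F]]] funpow.simps comp_apply)
    finally show ?thesis .
  qed
  have g_hom: "g \<in> mod_hom trunc_poly XM M"
    by (rule mod_hom_truncI[OF char_prime XM M])
       (use g_in g_lin gT in \<open>auto simp: sXM XMt V_def[symmetric] t_def[symmetric]\<close>)
  have g_inj: "g (inj 0 v) = v" if "v \<in> V" for v
  proof -
    have "g (inj 0 v) = (\<Sum>i<?p. if i = 0 then v else 0)"
      unfolding g_def by (rule sum.cong) (auto simp: inj_def linear_on_zero[OF V tl(1)])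
    thus ?thesis using p2 by simp
  qed
  have g_surj: "g ` space XM = space M"
  proof
    show "g ` space XM \<subseteq> space M" using g_in by (auto simp: sXM V_def)
    have "v \<in> g ` X" if "v \<in> V" for v
      by (rule image_eqI[of _ _ "inj 0 v"]) (use g_inj inj_X that p2 in auto)
    thus "space M \<subseteq> g ` space XM" by (auto simp: sXM V_def)
  qed
  have id: "(\<lambda>v. v) \<in> mod_hom trunc_poly M M" by (auto simp: mod_hom_def linear_on_id)
  have lift: "\<forall>g\<in>mod_hom trunc_poly XM M. \<forall>f\<in>mod_hom trunc_poly M M. fd_module trunc_poly XM \<and> fd_module trunc_poly M \<and>
      g ` space XM = space M \<longrightarrow> (\<exists>h\<in>mod_hom trunc_poly M XM. \<forall>v\<in>space M. g (h v) = f v)"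
    using pr unfolding projective_def by blast
  have "\<exists>h\<in>mod_hom trunc_poly M XM. \<forall>v\<in>space M. g (h v) = v"
    by (rule lift[rule_format, OF g_hom id]) (use XM M g_surj in blast)
  then obtain s where s: "s \<in> mod_hom trunc_poly M XM" "\<And>v. v \<in> V \<Longrightarrow> g (s v) = v"
    unfolding V_def by blast
  show ?thesis unfolding p_exact_def V_def[symmetric] t_def[symmetric]
  proof (intro ballI impI)
    fix m assume m: "m \<in> V" "t m = 0"
    have sm: "s m \<in> X" using mod_homD(1)[OF s(1)] m by (auto simp: sXM V_def)
    have "T (s m) = s (t m)"
      using mod_homD(3)[OF s(1) trunc_t_carrier[OF char_prime], of m] m by (simp add: XMt V_def t_def)
    also have "\<dots> = 0"
      using m linear_on_zero[OF V] mod_homD(2)[OF s(1)] by (simp add: V_def)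
    finally have T0: "T (s m) = 0" .
    have z: "slice i (s m) = 0" if "i < ?p - 1" for i
    proof -
      have "slice (Suc i) (T (s m)) = slice i (s m)" using that by (auto simp: T_def)
      thus ?thesis using T0 by (simp add: slice_linear)
    qed
    define y where "y = inj 0 (slice (?p - 1) (s m))"
    have y: "y \<in> X" unfolding y_def by (rule inj_X[OF XV[OF sm]]) (use p2 in simp)
    have "s m = (T ^^ (?p - 1)) y"
    proof (rule slice_eqI)
      fix i
      consider "i < ?p - 1" | "i = ?p - 1" | "i \<ge> ?p" using p2 by linarith
      hence "slice i (s m) = (if ?p - 1 \<le> i \<and> i < ?p then slice (i - (?p - 1)) y else 0)"
        using sm p2 by cases (auto simp: z y_def inj_def X_def)
      thus "slice i (s m) = slice i ((T ^^ (?p - 1)) y)" unfolding Tpow[OF y] .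
    qed
    moreover have "g ((T ^^ n) y) = (t ^^ n) (g y)" for n
    proof (induction n)
      case (Suc n)
      have "(T ^^ n) y \<in> X" using y TX by (induction n) auto
      thus ?case using Suc gT by simp
    qed simp
    ultimately have "m = (t ^^ (?p - 1)) (g y)" using s(2)[OF m(1)] by metis
    thus "\<exists>y\<in>V. m = (t ^^ (?p - 1)) y" using g_in[OF y] by blast
  qed
qed

lemma projective_iff_p_exact:
  fixes M :: "(nat \<Rightarrow> 'k, nat, 'k) amod"
  assumes "fd_module trunc_poly M"
  shows "projective trunc_poly M \<longleftrightarrow> p_exact CHAR('k) (space M) (act M tX)"
  using projective_imp_p_exact p_exact_imp_projective[OF char_prime assms] by blast

text \<open>
  For \<open>h\<close> as in \<open>p_exact_trace\<close>, the map \<open>x \<otimes> y \<mapsto> \<Sum> t\<^sup>i x \<otimes> h (t\<^sup>p\<^sup>-\<^sup>1\<^sup>-\<^sup>i y)\<close> vanishes on balanced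
  tensors of \<open>N\<close>. Modulo balanced tensors of \<open>W\<close> it is the identity on \<open>W \<otimes> M\<close>, because there
  the powers of \<open>t\<close> may be moved to the second factor.
\<close>

lemma p_exact_imp_flat:
  fixes M :: "(nat \<Rightarrow> 'k, 'c, 'k) amod"
  assumes M: "fd_module trunc_poly M" and ex: "p_exact CHAR('k) (space M) (act M tX)"
  shows "flat trunc_poly M"
  unfolding flat_def
proof (intro conjI allI impI M)
  fix N :: "(nat \<Rightarrow> 'k, nat, 'k) amod" and W
  let ?p = "CHAR('k)"
  assume "fd_right_module trunc_poly N \<and> submod (opposite trunc_poly) N W"
  hence N: "fd_module trunc_poly N" and W: "submod trunc_poly N W"
    by (auto simp: fd_right_module_def opposite_trunc_poly)
  note p2 = p_ge2[OF char_prime]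
  note V = fd_moduleD(2)[OF M] and SN = fd_moduleD(2)[OF N]
  define t where "t = act M tX"
  define r where "r = act N tX"
  note t = trunc_op[OF char_prime M, folded t_def] and r = trunc_op[OF char_prime N, folded r_def]
  have tin: "(t ^^ i) v \<in> space M" if "v \<in> space M" for i v using linear_on_funpow(2)[OF t] that by auto
  have rin: "(r ^^ i) v \<in> space N" if "v \<in> space N" for i v using linear_on_funpow(2)[OF r] that by auto
  obtain h where h: "linear_on (space M) h" "h ` space M \<subseteq> space M"
    "\<And>x. x \<in> space M \<Longrightarrow> (\<Sum>i<?p. (t ^^ i) (h ((t ^^ (?p - 1 - i)) x))) = x"
  proof -
    have tp: "(t ^^ ?p) v = 0" if "v \<in> space M" for v
      using trunc_act(2)[OF char_prime M that] by (simp add: t_def)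
    show ?thesis using p_exact_trace[OF V t tp _ ex[folded t_def]] p2 that by auto
  qed
  have "\<exists>f. flin f \<and> (\<forall>x\<in>space N. f x = (r ^^ i) x)" for i
    by (rule linear_on_extend[OF SN linear_on_funpow(1)[OF r]])
  then obtain f where f: "\<And>i. flin (f i)" "\<And>i x. x \<in> space N \<Longrightarrow> f i x = (r ^^ i) x" by metis
  have "\<exists>g. flin g \<and> (\<forall>x\<in>space M. g x = h ((t ^^ (?p - 1 - i)) x))" for i
    by (rule linear_on_extend[OF V linear_on_comp[OF linear_on_funpow(1)[OF t] h(1)]]) (use tin in auto)
  then obtain g where g: "\<And>i. flin (g i)" "\<And>i x. x \<in> space M \<Longrightarrow> g i x = h ((t ^^ (?p - 1 - i)) x)" by metis
  define Th where "Th F = (\<Sum>i<?p. tmap (f i) (g i) F)" for F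
  have tml: "flin (tmap (f i) (g i))" for i by (rule tmap_flin[OF f(1) g(1)])
  have Th_lin: "flin Th"
    unfolding Th_def by (rule flinI) (simp_all add: flin_add[OF tml] flin_scale[OF tml] sum.distrib fvs.scale_sum_right)
  have Th_tens: "Th (tens x y) = (\<Sum>i<?p. tens ((r ^^ i) x) (h ((t ^^ (?p - 1 - i)) y)))"
    if "x \<in> space N" "y \<in> space M" for x y
    unfolding Th_def using that by (simp add: tmap_tens[OF f(1) g(1)] f(2) g(2))
  have Th_t: "Th (tens (r x) y) = Th (tens x (t y))" if x: "x \<in> space N" and y: "y \<in> space M" for x y
  proof -
    obtain q where q: "?p = Suc q" using p2 by (cases ?p) auto
    have rx: "r x \<in> space N" and ty: "t y \<in> space M" using rin[OF x, of 1] tin[OF y, of 1] by auto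
    have "Th (tens x (t y)) = (\<Sum>i<Suc q. tens ((r ^^ i) x) (h ((t ^^ (?p - i)) y)))"
      unfolding Th_tens[OF x ty] q by (rule sum.cong) (auto simp: funpow_swap1 Suc_diff_le)
    also have "\<dots> = tens x (h ((t ^^ ?p) y)) + (\<Sum>i<q. tens ((r ^^ Suc i) x) (h ((t ^^ (?p - Suc i)) y)))"
      unfolding sum.lessThan_Suc_shift by simp
    also have "(t ^^ ?p) y = 0" using trunc_act(2)[OF char_prime M y] by (simp add: t_def)
    also have "tens x (h 0) = 0" unfolding linear_on_zero[OF V h(1)] by (rule flin_zero[OF tens_flin_right])
    also have "0 + (\<Sum>i<q. tens ((r ^^ Suc i) x) (h ((t ^^ (?p - Suc i)) y))) =
        (\<Sum>i<Suc q. tens ((r ^^ Suc i) x) (h ((t ^^ (?p - Suc i)) y)))"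
    proof -
      have "(r ^^ Suc q) x = 0" using trunc_act(2)[OF char_prime N x] by (simp add: r_def q)
      thus ?thesis using flin_zero[OF tens_flin_left] by (simp del: funpow.simps)
    qed
    also have "\<dots> = Th (tens (r x) y)"
      unfolding Th_tens[OF rx y] q by (rule sum.cong) (auto simp: funpow_swap1)
    finally show ?thesis ..
  qed
  have Th_ti: "Th (tens ((r ^^ i) x) y) = Th (tens x ((t ^^ i) y))"
    if x: "x \<in> space N" and y: "y \<in> space M" for x y i
    using y
  proof (induction i arbitrary: y)
    case (Suc i)
    have "Th (tens ((r ^^ Suc i) x) y) = Th (tens ((r ^^ i) x) (t y))"
      using Th_t[OF rin[OF x] Suc.prems] by simp
    also have "\<dots> = Th (tens x ((t ^^ i) (t y)))" using tin[OF Suc.prems, of 1] by (intro Suc.IH) simp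
    finally show ?case by (simp add: funpow_swap1)
  qed simp
  have Th_a: "Th (tens (act N a x) y - tens x (act M a y)) = 0"
    if a: "a \<in> carrier trunc_poly" and x: "x \<in> space N" and y: "y \<in> space M" for a x y
  proof -
    have 1: "act N a x = (\<Sum>i<?p. fscale (a i) ((r ^^ i) x))" using trunc_act(3)[OF char_prime N x a] by (simp add: r_def)
    have 2: "act M a y = (\<Sum>i<?p. fscale (a i) ((t ^^ i) y))" using trunc_act(3)[OF char_prime M y a] by (simp add: t_def)
    show ?thesis unfolding 1 2 flin_sum[OF tens_flin_left] flin_scale[OF tens_flin_left]
        flin_sum[OF tens_flin_right] flin_scale[OF tens_flin_right]
      by (simp add: flin_diff[OF Th_lin] flin_sum[OF Th_lin] flin_scale[OF Th_lin] Th_ti[OF x y])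
  qed
  have bal0: "Th z = 0" if "z \<in> balanced trunc_poly N M" for z
  proof -
    have "Th z \<in> {0}"
      by (rule span_imageI[OF Th_lin that[unfolded balanced_def]])
         (use Th_a fvs.subspace_single_0 in auto)
    thus ?thesis by simp
  qed
  let ?B = "balanced trunc_poly (N\<lparr>space := W\<rparr>) M"
  have WN: "W \<subseteq> space N" using W by (auto simp: submod_def)
  have sB: "fvs.subspace ?B" by (simp add: balanced_def)
  have pure: "tens w y - Th (tens w y) \<in> ?B" if w: "w \<in> W" and y: "y \<in> space M" for w y
  proof -
    have wN: "w \<in> space N" using w WN by auto
    define z where "z i = h ((t ^^ (?p - 1 - i)) y)" for i
    have z: "z i \<in> space M" for i using h(2) tin[OF y] by (auto simp: z_def)
    have "tens w y = (\<Sum>i<?p. tens w ((t ^^ i) (z i)))"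
      unfolding flin_sum[OF tens_flin_right, symmetric] z_def h(3)[OF y] ..
    hence "tens w y - Th (tens w y) = - (\<Sum>i<?p. tens ((r ^^ i) w) (z i) - tens w ((t ^^ i) (z i)))"
      unfolding Th_tens[OF wN y] z_def by (simp add: sum_subtractf)
    moreover have "tens ((r ^^ i) w) (z i) - tens w ((t ^^ i) (z i)) \<in> ?B" if i: "i < ?p" for i
    proof -
      have a: "(tmon i :: nat \<Rightarrow> 'k) \<in> carrier trunc_poly" using tmon_carrier[OF i] .
      have "tens ((r ^^ i) w) (z i) - tens w ((t ^^ i) (z i)) =
         tens (act (N\<lparr>space := W\<rparr>) (tmon i) w) (z i) - tens w (act M (tmon i) (z i))"
        using trunc_act(1)[OF char_prime N wN i] trunc_act(1)[OF char_prime M z i] by (simp add: r_def t_def)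
      thus ?thesis unfolding balanced_def using a w z by (intro fvs.span_base) auto
    qed
    ultimately show ?thesis by (auto intro!: fvs.subspace_neg[OF sB] fvs.subspace_sum[OF sB])
  qed
  show "tensor_space W (space M) \<inter> balanced trunc_poly N M \<subseteq> ?B"
  proof
    fix z assume z: "z \<in> tensor_space W (space M) \<inter> balanced trunc_poly N M"
    have "flin (\<lambda>F. F - Th F)"
      by (rule flinI) (simp_all add: flin_add[OF Th_lin] flin_scale[OF Th_lin] fvs.scale_right_diff_distrib)
    hence "z - Th z \<in> ?B"
      by (rule span_imageI[of _ _ "{tens x y |x y. x \<in> W \<and> y \<in> space M}"])
         (use z pure sB in \<open>auto simp: tensor_space_def\<close>)
    thus "z \<in> ?B" using bal0 z by simp
  qed
qed

text \<open>
  Flatness is tested on the ideal \<open>W\<close> spanned by \<open>t\<^sup>p\<^sup>-\<^sup>1\<close> of the regular module. If \<open>t\<^sup>p\<^sup>-\<^sup>1 m = 0\<close> then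
  \<open>t\<^sup>p\<^sup>-\<^sup>1 \<otimes> m\<close> is balanced, hence balanced over \<open>W\<close>, where \<open>t\<close> acts as zero; this forces \<open>m\<close> into
  the image of \<open>t\<close>.
\<close>

lemma flat_imp_p_exact:
  fixes M :: "(nat \<Rightarrow> 'k, 'c, 'k) amod"
  assumes fl: "flat trunc_poly M"
  shows "p_exact CHAR('k) (space M) (act M tX)"
proof -
  let ?p = "CHAR('k)"
  note p2 = p_ge2[OF char_prime]
  have M: "fd_module trunc_poly M" using fl by (simp add: flat_def)
  note V = fd_moduleD(2)[OF M]
  define t where "t = act M tX"
  note t = trunc_op[OF char_prime M, folded t_def]
  have tin: "(t ^^ i) v \<in> space M" if "v \<in> space M" for i v using linear_on_funpow(2)[OF t] that by auto
  have tp: "(t ^^ ?p) v = 0" if "v \<in> space M" for v using trunc_act(2)[OF char_prime M that] by (simp add: t_def)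
  define T :: "nat \<Rightarrow> 'k" where "T = tmon (?p - 1)"
  have Tc: "T \<in> carrier trunc_poly" unfolding T_def by (rule tmon_carrier) (use p2 in simp)
  define shift where "shift = (\<lambda>(f::nat \<Rightarrow> 'k) n. if n = 0 \<or> n \<ge> ?p then 0 else f (n - 1))"
  define C where "C = (carrier trunc_poly :: (nat \<Rightarrow> 'k) set)"
  have C: "f \<in> C \<longleftrightarrow> (\<forall>n\<ge>?p. f n = 0)" for f by (auto simp: C_def trunc_poly_def)
  have "C = supp_in {..<?p}" by (auto simp: C supp_in_def)
  hence finC: "fin_dim C" using dim_supp_in(2)[of "{..<?p}", where 'k = 'k] by simp
  have shift_in: "shift f \<in> C" for f by (auto simp: C shift_def)
  have shift_lin: "linear_on C shift" by (auto simp: linear_on_def shift_def fun_eq_iff)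
  have shift_pow: "(shift ^^ n) f = (\<lambda>i. if i < n \<or> i \<ge> ?p then 0 else f (i - n))" if "f \<in> C" for n f
    using that by (induction n) (auto simp: fun_eq_iff shift_def C)
  define N where "N = \<lparr>space = C, act = (\<lambda>a v. \<Sum>i<?p. fscale (a i) ((shift ^^ i) v))\<rparr>"
  have N: "fd_module trunc_poly N"
    unfolding N_def by (rule fd_module_trunc_op[OF char_prime finC shift_lin])
      (use shift_in in \<open>auto simp: shift_pow fun_eq_iff\<close>)
  have Nt: "act N tX v = shift v" for v using trunc_op_act[OF char_prime, of shift v] by (simp add: N_def)
  define W where "W = range (\<lambda>c. fscale c T)"
  have NT: "act N a (fscale c T) = fscale (a 0 * c) T" for a c
  proof -
    have TC: "fscale c T \<in> C" using fvs.subspace_scale[OF subspace_trunc] Tc by (auto simp: C_def)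
    have "act N a (fscale c T) = (\<Sum>i<?p. if i = 0 then fscale (a 0 * c) T else 0)"
      unfolding N_def amod.simps
    proof (rule sum.cong[OF refl])
      fix i assume "i \<in> {..<?p}"
      show "fscale (a i) ((shift ^^ i) (fscale c T)) = (if i = 0 then fscale (a 0 * c) T else 0)"
        unfolding shift_pow[OF TC] using p2 by (auto simp: fun_eq_iff T_def tmon_def)
    qed
    thus ?thesis using p2 by simp
  qed
  have W: "submod trunc_poly N W"
    unfolding submod_def
  proof (intro conjI ballI)
    show "fvs.subspace W" unfolding fvs.subspace_def W_def
    proof (intro conjI ballI allI)
      show "0 \<in> range (\<lambda>c. fscale c T)" by (rule range_eqI[of _ _ 0]) (simp add: fun_eq_iff)
      show "x + y \<in> range (\<lambda>c. fscale c T)" if "x \<in> range (\<lambda>c. fscale c T)" "y \<in> range (\<lambda>c. fscale c T)" for x y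
        using that fvs.scale_left_distrib[symmetric] by fastforce
      show "fscale d x \<in> range (\<lambda>c. fscale c T)" if "x \<in> range (\<lambda>c. fscale c T)" for x d
        using that by auto
    qed
    show "W \<subseteq> space N" using Tc fvs.subspace_scale[OF subspace_trunc] by (auto simp: W_def N_def C_def)
    show "act N a w \<in> W" if "w \<in> W" for a w using that NT by (auto simp: W_def)
  qed
  have key: "\<exists>y\<in>space M. m = t y" if m: "m \<in> space M" "(t ^^ (?p - 1)) m = 0" for m
  proof -
    have one: "tmon 0 \<in> space N" using tmon_carrier[of 0, where 'k='k] p2 by (simp add: N_def C_def)
    have "act N T (tmon 0) = T"
    proof -
      have "act N T (tmon 0) = (act N tX ^^ (?p - 1)) (tmon 0)"
        unfolding T_def by (rule trunc_act(1)[OF char_prime N one]) (use p2 in simp)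
      also have "\<dots> = (shift ^^ (?p - 1)) (tmon 0)" by (simp add: Nt[abs_def])
      also have "\<dots> = T" using one p2 by (subst shift_pow) (auto simp: N_def T_def tmon_def fun_eq_iff)
      finally show ?thesis .
    qed
    moreover have "act M T m = 0"
      using trunc_act(1)[OF char_prime M m(1), of "?p - 1"] m(2) p2 by (simp add: T_def t_def)
    ultimately have "tens T m = tens (act N T (tmon 0)) m - tens (tmon 0) (act M T m)"
      using flin_zero[OF tens_flin_right] by simp
    hence "tens T m \<in> balanced trunc_poly N M"
      unfolding balanced_def using Tc one m by (intro fvs.span_base) blast
    moreover have "tens T m \<in> tensor_space W (space M)"
      unfolding tensor_space_def W_def using m
      by (intro fvs.span_base CollectI exI[of _ T] exI[of _ m]) (auto intro!: range_eqI[of _ _ 1] simp: fun_eq_iff)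
    ultimately have bal: "tens T m \<in> balanced trunc_poly (N\<lparr>space := W\<rparr>) M"
      using fl N W unfolding flat_def fd_right_module_def opposite_trunc_poly by blast
    define sl where "sl F = (\<lambda>x. F (?p - 1, x))" for F :: "nat \<times> 'c \<Rightarrow> 'k"
    have sl: "flin sl" by (rule flinI) (auto simp: sl_def fun_eq_iff)
    have tVsub: "fvs.subspace (t ` space M)"
      using fvs.subspace_0[OF V] subspace_fin_dim[OF fin_dim_image[OF fd_moduleD(1)[OF M] t(1)]] by simp
    have "sl (tens T m) \<in> t ` space M"
    proof (rule span_imageI[OF sl bal[unfolded balanced_def] _ tVsub])
      fix z assume "z \<in> {tens (act (N\<lparr>space := W\<rparr>) a x) y - tens x (act M a y) |a x y.
                 a \<in> carrier trunc_poly \<and> x \<in> space (N\<lparr>space := W\<rparr>) \<and> y \<in> space M}"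
      then obtain a c y where a: "a \<in> carrier trunc_poly" and y: "y \<in> space M"
        and z: "z = tens (act N a (fscale c T)) y - tens (fscale c T) (act M a y)"
        by (auto simp: W_def)
      obtain q where q: "?p = Suc q" using p2 by (cases ?p) auto
      define b where "b = (\<Sum>i<q. fscale (a (Suc i)) ((t ^^ i) y))"
      have b: "b \<in> space M" unfolding b_def by (intro fvs.subspace_sum V fvs.subspace_scale tin y)
      have "act M a y = fscale (a 0) y + (\<Sum>i<q. fscale (a (Suc i)) ((t ^^ Suc i) y))"
        unfolding trunc_act(3)[OF char_prime M y a] q sum.lessThan_Suc_shift t_def by simp
      also have "(\<Sum>i<q. fscale (a (Suc i)) ((t ^^ Suc i) y)) = t b"
        unfolding b_def using V tin[OF y]
        by (simp add: linear_on_sum[OF V t(1)] fvs.subspace_scale linear_onD(2)[OF t(1)])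
      finally have aM: "act M a y = fscale (a 0) y + t b" .
      have "T (?p - 1) = 1" by (simp add: T_def tmon_def)
      hence "sl z = fscale (- c) (t b)"
        unfolding z NT aM by (auto simp: sl_def tens_def fun_eq_iff algebra_simps)
      also have "\<dots> \<in> t ` space M" using tVsub b by (intro fvs.subspace_scale) auto
      finally show "sl z \<in> t ` space M" .
    qed
    moreover have "sl (tens T m) = m" by (simp add: sl_def tens_def T_def tmon_def)
    ultimately show ?thesis by auto
  qed
  have "p_exact ?p (space M) t"
    using p_exact_iff[OF addsub_subspace[OF V] linear_on_endo[OF t] tp p2] key by blast
  thus ?thesis by (simp add: t_def)
qed

end

section \<open>Transport of modules to natural number coordinates\<close>

text \<open>
  The test modules in \<open>projective\<close> and \<open>p_equiv\<close> live in functions on \<open>nat\<close>. A module of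
  functions supported on a set \<open>S\<close> is moved there along an injection \<open>e\<close> of \<open>S\<close> into \<open>nat\<close>.
\<close>

definition pushf :: "('x \<Rightarrow> nat) \<Rightarrow> 'x set \<Rightarrow> ('x \<Rightarrow> 'k::field) \<Rightarrow> nat \<Rightarrow> 'k" where
  "pushf e S F = (\<lambda>j. if j \<in> e ` S then F (inv_into S e j) else 0)"

definition pullf :: "('x \<Rightarrow> nat) \<Rightarrow> 'x set \<Rightarrow> (nat \<Rightarrow> 'k::field) \<Rightarrow> 'x \<Rightarrow> 'k" where
  "pullf e S f = (\<lambda>x. if x \<in> S then f (e x) else 0)"

lemma pull_push: "inj_on e S \<Longrightarrow> F \<in> supp_in S \<Longrightarrow> pullf e S (pushf e S F) = F"
  by (auto simp: pullf_def pushf_def supp_in_def fun_eq_iff)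

lemma push_pull: "inj_on e S \<Longrightarrow> f \<in> supp_in (e ` S) \<Longrightarrow> pushf e S (pullf e S f) = f"
  by (auto simp: pullf_def pushf_def supp_in_def fun_eq_iff)

lemma push_flin: "flin (pushf e S)" and pull_flin: "flin (pullf e S)"
  by (rule flinI; auto simp: pushf_def pullf_def fun_eq_iff)+

definition push_mod :: "('x \<Rightarrow> nat) \<Rightarrow> 'x set \<Rightarrow> ('a, 'x, 'k::field) amod \<Rightarrow> ('a, nat, 'k) amod" where
  "push_mod e S M = \<lparr>space = pushf e S ` space M, act = (\<lambda>a v. pushf e S (act M a (pullf e S v)))\<rparr>"

lemma push_mod_act:
  "inj_on e S \<Longrightarrow> space M \<subseteq> supp_in S \<Longrightarrow> v \<in> space M \<Longrightarrow>
     act (push_mod e S M) a (pushf e S v) = pushf e S (act M a v)"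
  using pull_push[of e S v] by (auto simp: push_mod_def)

lemma push_space: "space (push_mod e S M) = pushf e S ` space M"
  by (simp add: push_mod_def)

lemma push_mod_hom:
  assumes e: "inj_on e S" and S: "space M \<subseteq> supp_in S"
  shows "pushf e S \<in> mod_hom A M (push_mod e S M)"
  using flin_linear_on[OF push_flin] push_mod_act[OF e S] by (auto simp: mod_hom_def push_space)

lemma push_eq_0:
  assumes e: "inj_on e S" and F: "F \<in> supp_in S"
  shows "pushf e S F = 0 \<longleftrightarrow> F = 0"
proof
  assume z: "pushf e S F = 0"
  have "F = pullf e S (pushf e S F)" using pull_push[OF e F] ..
  also have "\<dots> = 0" unfolding z by (rule flin_zero[OF pull_flin])
  finally show "F = 0" .
qed (simp add: flin_zero[OF push_flin])

lemma push_mod_fd: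
  assumes e: "inj_on e S" and S: "space M \<subseteq> supp_in S" and M: "fd_module A M"
  shows "fd_module A (push_mod e S M)"
proof (rule fd_moduleI)
  note D = fd_moduleD[OF M]
  note add = flin_add[OF push_flin[of e S], symmetric] and sc = flin_scale[OF push_flin[of e S], symmetric]
  have sp: "space (push_mod e S M) = pushf e S ` space M" by (simp add: push_mod_def)
  show "fin_dim (space (push_mod e S M))"
    unfolding sp by (rule fin_dim_image[OF D(1) flin_linear_on[OF push_flin]])
  show "act (push_mod e S M) a v \<in> space (push_mod e S M)" if "a \<in> carrier A" "v \<in> space (push_mod e S M)" for a v
    using that D(3) by (auto simp: sp push_mod_act[OF e S])
  show "linear_on (space (push_mod e S M)) (act (push_mod e S M) a)" if a: "a \<in> carrier A" for a
    unfolding linear_on_def sp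
    using linear_onD[OF D(4)[OF a]] fvs.subspace_add[OF D(2)] fvs.subspace_scale[OF D(2)]
    by (auto simp: add sc push_mod_act[OF e S])
  show "linear_on (carrier A) (\<lambda>a. act (push_mod e S M) a v)" if "v \<in> space (push_mod e S M)" for v
    using that linear_onD[OF D(5)] unfolding linear_on_def
    by (auto simp: add sc push_mod_act[OF e S] sp)
  show "act (push_mod e S M) \<one>\<^bsub>A\<^esub> v = v" if "v \<in> space (push_mod e S M)" for v
    using that D(6) by (auto simp: push_mod_act[OF e S] sp)
  show "act (push_mod e S M) (a \<otimes>\<^bsub>A\<^esub> b) v = act (push_mod e S M) a (act (push_mod e S M) b v)"
    if "a \<in> carrier A" "b \<in> carrier A" "v \<in> space (push_mod e S M)" for a b v
    using that D(7) D(3) by (auto simp: push_mod_act[OF e S] sp)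
qed

text \<open>
  Induction on the set: the kernel of one nilpotent operator is non-zero and stable under the
  commuting ones.
\<close>

lemma common_kernel:
  assumes V: "addsub V" and fin: "finite S" and f: "\<And>s. s \<in> S \<Longrightarrow> endo V (f s)"
    and c: "\<And>s t. s \<in> S \<Longrightarrow> t \<in> S \<Longrightarrow> commute_on V (f s) (f t)"
    and nil: "\<And>s x. s \<in> S \<Longrightarrow> x \<in> V \<Longrightarrow> (f s ^^ N) x = 0"
    and v: "v \<in> V" "v \<noteq> 0"
  shows "\<exists>w\<in>V. w \<noteq> 0 \<and> (\<forall>s\<in>S. f s w = 0)"
  using fin f c nil
proof (induction S)
  case (insert s S)
  then obtain w where w: "w \<in> V" "w \<noteq> 0" "\<forall>s\<in>S. f s w = 0" by auto
  define k where "k = (LEAST k. (f s ^^ k) w = 0)"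
  have k: "(f s ^^ k) w = 0" unfolding k_def by (rule LeastI[of _ N]) (use insert w in auto)
  then obtain j where j: "k = Suc j" using w by (cases k) auto
  have nz: "(f s ^^ j) w \<noteq> 0" using not_less_Least[of j "\<lambda>k. (f s ^^ k) w = 0"] j by (auto simp: k_def[symmetric])
  have e: "endo V (f s ^^ j)" by (rule endo_funpow) (use insert in auto)
  have "f t ((f s ^^ j) w) = 0" if t: "t \<in> S" for t
  proof -
    have "commute_on V (f t) (f s ^^ j)" by (rule commute_on_funpow) (use insert t in auto)
    hence "f t ((f s ^^ j) w) = (f s ^^ j) (f t w)" using w by (auto simp: commute_on_def)
    thus ?thesis using w t endo_zero[OF V e] by simp
  qed
  moreover have "f s ((f s ^^ j) w) = 0" using k j by simp
  ultimately show ?case using nz endo_in[OF e w(1)] by auto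
qed (use v in auto)

lemma freshman_endo_power:
  fixes f g :: "'v::{semiring_1,ab_group_add} \<Rightarrow> 'v"
  assumes V: "addsub V" and f: "endo V f" and g: "endo V g" and fg: "commute_on V f g" and x: "x \<in> V"
    and p: "prime p" "of_nat p = (0::'v)"
  shows "((\<lambda>x. f x + g x) ^^ (p ^ N)) x = (f ^^ (p ^ N)) x + (g ^^ (p ^ N)) x"
proof -
  have "((\<lambda>x. \<Sum>b\<in>UNIV. (if b then f else g) x) ^^ (p ^ N)) x = (\<Sum>b\<in>UNIV. ((if b then f else g) ^^ (p ^ N)) x)"
    by (rule freshman_endo_sum_power[OF V _ _ p x])
       (use f g fg commute_on_sym[OF fg] in \<open>auto intro: commute_on_refl\<close>)
  thus ?thesis by (simp add: UNIV_bool add.commute)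
qed

section \<open>Group algebras\<close>

text \<open>
  The argument \<open>ty\<close> only records the field: \<open>H\<close> is determined by \<open>G\<close> and a type. The group
  algebra of a subgroup \<open>K\<close> is realised inside that of \<open>G\<close> as the functions supported on \<open>K\<close>.
\<close>

locale fin_group_alg = group G for G :: "('g, 'm) monoid_scheme" (structure) +
  fixes ty :: "'k::field itself" and p :: nat
  assumes fin: "finite (carrier G)" and char_p: "CHAR('k) = p" and prime_p: "prime p"
begin

lemma char_prime: "prime CHAR('k)"
  using prime_p char_p by simp

abbreviation H :: "('g, 'k) hopf" where "H \<equiv> constant_scheme G"
abbreviation conv :: "('g \<Rightarrow> 'k) \<Rightarrow> ('g \<Rightarrow> 'k) \<Rightarrow> 'g \<Rightarrow> 'k" (infixl "\<star>" 70) where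
  "f \<star> h \<equiv> f \<otimes>\<^bsub>constant_scheme G\<^esub> h"
abbreviation kS :: "'g set \<Rightarrow> ('g \<Rightarrow> 'k) set" where "kS K \<equiv> supp_in K"
definition dl :: "'g \<Rightarrow> 'g \<Rightarrow> 'k" where "dl x = (\<lambda>y. if y = x then 1 else 0)"
definition HK :: "'g set \<Rightarrow> ('g, 'k) hopf" where "HK K = H\<lparr>carrier := kS K\<rparr>"

lemma carrier_H: "carrier H = kS (carrier G)"
  by (auto simp: constant_scheme_def supp_in_def)

lemma HK_G: "HK (carrier G) = H"
  by (simp add: HK_def carrier_H[symmetric])

lemma one_H: "\<one>\<^bsub>H\<^esub> = dl \<one>"
  by (simp add: constant_scheme_def dl_def)

lemma HK_simps [simp]: "carrier (HK K) = kS K" "monoid.mult (HK K) = monoid.mult H" "\<one>\<^bsub>HK K\<^esub> = dl \<one>"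
   "comult (HK K) = comult H" "counit (HK K) = counit H" "antipode (HK K) = antipode H"
  by (simp_all add: HK_def one_H)

lemma kS_mono: "K \<subseteq> L \<Longrightarrow> kS K \<subseteq> kS L"
  by (auto simp: supp_in_def)

lemma dl_kS: "x \<in> K \<Longrightarrow> dl x \<in> kS K"
  by (auto simp: dl_def supp_in_def)

lemma conv_apply:
  assumes x: "x \<in> carrier G"
  shows "(f \<star> h) x = (\<Sum>y\<in>carrier G. f y * h (inv y \<otimes> x))"
proof -
  have "(f \<star> h) x = (\<Sum>(y, z) | y \<in> carrier G \<and> z \<in> carrier G \<and> y \<otimes> z = x. f y * h z)"
    by (simp add: constant_scheme_def)
  also have "\<dots> = (\<Sum>y\<in>carrier G. f y * h (inv y \<otimes> x))"
    by (rule sum.reindex_bij_witness[of _ "\<lambda>y. (y, inv y \<otimes> x)" fst])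
       (use x in \<open>auto simp: m_assoc[symmetric]\<close>)
  finally show ?thesis .
qed

lemma conv_outside: "x \<notin> carrier G \<Longrightarrow> (f \<star> h) x = 0"
proof -
  assume "x \<notin> carrier G"
  hence e: "{(y, z). y \<in> carrier G \<and> z \<in> carrier G \<and> y \<otimes> z = x} = {}" by auto
  have "(f \<star> h) x = (\<Sum>(y, z) | y \<in> carrier G \<and> z \<in> carrier G \<and> y \<otimes> z = x. f y * h z)"
    by (simp add: constant_scheme_def)
  thus ?thesis unfolding e by simp
qed

lemma conv_kS_G: "f \<star> h \<in> kS (carrier G)"
  by (simp add: supp_in_def conv_outside)

lemma conv_eqI: "f \<in> kS (carrier G) \<Longrightarrow> h \<in> kS (carrier G) \<Longrightarrow> (\<And>x. x \<in> carrier G \<Longrightarrow> f x = h x) \<Longrightarrow> f = h"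
  by (rule ext, rename_tac x, case_tac "x \<in> carrier G") (simp_all add: supp_in_def)

lemma conv_kS:
  assumes K: "subgroup K G" and f: "f \<in> kS K" and h: "h \<in> kS K"
  shows "f \<star> h \<in> kS K"
  unfolding supp_in_def
proof (intro CollectI allI impI)
  fix x assume x: "x \<notin> K"
  show "(f \<star> h) x = 0"
  proof (cases "x \<in> carrier G")
    case True
    have "f y * h (inv y \<otimes> x) = 0" if "y \<in> carrier G" for y
    proof (cases "y \<in> K")
      case y: True
      have "inv y \<otimes> x \<notin> K"
      proof
        assume "inv y \<otimes> x \<in> K"
        hence "y \<otimes> (inv y \<otimes> x) \<in> K" using y subgroup.m_closed[OF K] by blast
        thus False using x that True by (simp add: m_assoc[symmetric])
      qed
      thus ?thesis using h by (auto simp: supp_in_def)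
    qed (use f in \<open>auto simp: supp_in_def\<close>)
    thus ?thesis unfolding conv_apply[OF True] by (intro sum.neutral) blast
  qed (simp add: conv_outside)
qed

lemma conv_flin_left: "flin (\<lambda>f. f \<star> h)" and conv_flin_right: "flin (\<lambda>h. f \<star> h)"
proof -
  show "flin (\<lambda>f. f \<star> h)"
    by (rule flinI; rule ext; rename_tac x; case_tac "x \<in> carrier G")
       (auto simp: conv_apply conv_outside algebra_simps sum.distrib sum_distrib_left)
  show "flin (\<lambda>h. f \<star> h)"
    by (rule flinI; rule ext; rename_tac x; case_tac "x \<in> carrier G")
       (auto simp: conv_apply conv_outside algebra_simps sum.distrib sum_distrib_left)
qed

lemmas conv_left = flin_add[OF conv_flin_left] flin_scale[OF conv_flin_left] flin_diff[OF conv_flin_left]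
   flin_zero[OF conv_flin_left] flin_sum[OF conv_flin_left]
lemmas conv_right = flin_add[OF conv_flin_right] flin_scale[OF conv_flin_right] flin_diff[OF conv_flin_right]
   flin_zero[OF conv_flin_right] flin_sum[OF conv_flin_right]

lemma dl_conv:
  assumes x: "x \<in> carrier G" and z: "z \<in> carrier G"
  shows "(dl x \<star> f) z = f (inv x \<otimes> z)"
proof -
  have "(dl x \<star> f) z = (\<Sum>y\<in>carrier G. if y = x then f (inv x \<otimes> z) else 0)"
    unfolding conv_apply[OF z] by (rule sum.cong) (auto simp: dl_def)
  thus ?thesis using x fin by simp
qed

lemma conv_dl:
  assumes x: "x \<in> carrier G" and z: "z \<in> carrier G"
  shows "(f \<star> dl x) z = f (z \<otimes> inv x)"
proof -
  have "(f \<star> dl x) z = (\<Sum>y\<in>carrier G. if y = z \<otimes> inv x then f y else 0)"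
    unfolding conv_apply[OF z]
  proof (rule sum.cong[OF refl])
    fix y assume y: "y \<in> carrier G"
    have "inv y \<otimes> z = x \<longleftrightarrow> y = z \<otimes> inv x"
    proof
      assume e: "inv y \<otimes> z = x"
      show "y = z \<otimes> inv x" unfolding e[symmetric] using y z
        by (simp add: inv_mult_group m_assoc[symmetric])
    next
      assume e: "y = z \<otimes> inv x"
      show "inv y \<otimes> z = x" unfolding e using x z by (simp add: inv_mult_group m_assoc)
    qed
    thus "f y * dl x (inv y \<otimes> z) = (if y = z \<otimes> inv x then f y else 0)" by (auto simp: dl_def)
  qed
  thus ?thesis using x z fin by simp
qed

lemma dl_dl:
  assumes x: "x \<in> carrier G" and y: "y \<in> carrier G"
  shows "dl x \<star> dl y = dl (x \<otimes> y)"
proof (rule conv_eqI[OF conv_kS_G dl_kS])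
  fix z assume z: "z \<in> carrier G"
  have iff: "inv x \<otimes> z = y \<longleftrightarrow> z = x \<otimes> y"
  proof
    assume e: "inv x \<otimes> z = y"
    show "z = x \<otimes> y" unfolding e[symmetric] using x z by (simp add: m_assoc[symmetric])
  next
    assume e: "z = x \<otimes> y"
    show "inv x \<otimes> z = y" unfolding e using x y by (simp add: m_assoc[symmetric])
  qed
  have "(dl x \<star> dl y) z = dl y (inv x \<otimes> z)" by (rule dl_conv[OF x z])
  also have "\<dots> = dl (x \<otimes> y) z" unfolding dl_def iff ..
  finally show "(dl x \<star> dl y) z = dl (x \<otimes> y) z" .
qed (use x y in simp)

lemma kS_expand:
  assumes "f \<in> kS K" "K \<subseteq> carrier G"
  shows "f = (\<Sum>x\<in>K. fscale (f x) (dl x))"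
proof
  fix z
  have fK: "finite K" using assms fin finite_subset by blast
  have "(\<Sum>x\<in>K. f x * dl x z) = (\<Sum>x\<in>K. if x = z then f z else 0)"
    by (rule sum.cong) (auto simp: dl_def)
  thus "f z = (\<Sum>x\<in>K. fscale (f x) (dl x)) z" using assms fK by (auto simp: supp_in_def)
qed

lemma conv_expand: "f \<star> h = (\<Sum>x\<in>carrier G. fscale (f x) (dl x \<star> h))"
proof (rule conv_eqI[OF conv_kS_G])
  show "(\<Sum>x\<in>carrier G. fscale (f x) (dl x \<star> h)) \<in> kS (carrier G)"
    by (auto simp: supp_in_def conv_outside)
  fix z assume z: "z \<in> carrier G"
  show "(f \<star> h) z = (\<Sum>x\<in>carrier G. fscale (f x) (dl x \<star> h)) z"
    unfolding conv_apply[OF z, of f h] sum_fun_apply fscale_apply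
    by (rule sum.cong[OF refl]) (simp only: dl_conv[OF _ z])
qed

lemma conv_assoc: "(f \<star> g) \<star> h = f \<star> (g \<star> h)"
proof -
  have 1: "(dl x \<star> g) \<star> h = dl x \<star> (g \<star> h)" if x: "x \<in> carrier G" for x
  proof (rule conv_eqI[OF conv_kS_G conv_kS_G])
    fix z assume z: "z \<in> carrier G"
    have "((dl x \<star> g) \<star> h) z = (\<Sum>y\<in>carrier G. g (inv x \<otimes> y) * h (inv y \<otimes> z))"
      unfolding conv_apply[OF z] by (rule sum.cong) (auto simp: dl_conv x)
    also have "\<dots> = (\<Sum>y\<in>carrier G. g y * h (inv y \<otimes> (inv x \<otimes> z)))"
    proof (rule sum.reindex_bij_witness[of _ "\<lambda>y. x \<otimes> y" "\<lambda>y. inv x \<otimes> y"])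
      fix y assume y: "y \<in> carrier G"
      have "inv (inv x \<otimes> y) \<otimes> (inv x \<otimes> z) = inv y \<otimes> z"
        using x y z by (simp add: inv_mult_group m_assoc) (simp add: m_assoc[symmetric])
      thus "g (inv x \<otimes> y) * h (inv (inv x \<otimes> y) \<otimes> (inv x \<otimes> z)) = g (inv x \<otimes> y) * h (inv y \<otimes> z)" by simp
    qed (use x in \<open>auto simp: m_assoc[symmetric]\<close>)
    also have "\<dots> = (dl x \<star> (g \<star> h)) z" unfolding dl_conv[OF x z] using x z by (simp add: conv_apply)
    finally show "((dl x \<star> g) \<star> h) z = (dl x \<star> (g \<star> h)) z" .
  qed
  have "(f \<star> g) \<star> h = (\<Sum>x\<in>carrier G. fscale (f x) ((dl x \<star> g) \<star> h))"
    by (subst conv_expand[of f g]) (simp add: conv_left)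
  also have "\<dots> = (\<Sum>x\<in>carrier G. fscale (f x) (dl x \<star> (g \<star> h)))" by (simp add: 1)
  also have "\<dots> = f \<star> (g \<star> h)" by (rule conv_expand[symmetric])
  finally show ?thesis .
qed

lemma one_conv:
  assumes f: "f \<in> kS (carrier G)" shows "dl \<one> \<star> f = f"
  by (rule conv_eqI[OF conv_kS_G f]) (simp add: dl_conv[OF one_closed])

lemma conv_one:
  assumes f: "f \<in> kS (carrier G)" shows "f \<star> dl \<one> = f"
  by (rule conv_eqI[OF conv_kS_G f]) (simp add: conv_dl[OF one_closed])

lemma kS_fin_dim: "K \<subseteq> carrier G \<Longrightarrow> fin_dim (kS K)"
  by (rule dim_supp_in(2)[OF finite_subset[OF _ fin]])

lemma HK_monoid:
  assumes K: "subgroup K G" shows "monoid (HK K)"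
proof
  have KG: "kS K \<subseteq> kS (carrier G)" using subgroup.subset[OF K] by (rule kS_mono)
  show "\<one>\<^bsub>HK K\<^esub> \<in> carrier (HK K)" by (simp add: dl_kS subgroup.one_closed[OF K])
  show "x \<otimes>\<^bsub>HK K\<^esub> y \<in> carrier (HK K)" if "x \<in> carrier (HK K)" "y \<in> carrier (HK K)" for x y
    using that conv_kS[OF K] by simp
  show "\<one>\<^bsub>HK K\<^esub> \<otimes>\<^bsub>HK K\<^esub> x = x" "x \<otimes>\<^bsub>HK K\<^esub> \<one>\<^bsub>HK K\<^esub> = x" if "x \<in> carrier (HK K)" for x
    using that KG by (auto simp: one_conv conv_one)
qed (simp add: conv_assoc)

lemma HK_algebra:
  assumes K: "subgroup K G" shows "fd_algebra (HK K)"
  unfolding fd_algebra_def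
proof (intro conjI)
  show "fin_dim (carrier (HK K))" using kS_fin_dim[OF subgroup.subset[OF K]] by simp
  show "bilinear_on (carrier (HK K)) (carrier (HK K)) (monoid.mult (HK K))"
    using flin_linear_on[OF conv_flin_right] flin_linear_on[OF conv_flin_left] by (auto simp: bilinear_on_def)
qed (rule HK_monoid[OF K])

lemma comult_eq: "comult H f (u, v) = (if u = v then f u else 0)"
  and counit_eq: "counit H f = (\<Sum>x\<in>carrier G. f x)"
  and antipode_eq: "antipode H f x = (if x \<in> carrier G then f (inv x) else 0)"
  by (simp_all add: constant_scheme_def)

lemma counit_dl: "x \<in> carrier G \<Longrightarrow> counit H (dl x) = 1"
  using fin by (simp add: counit_eq dl_def)

lemma sweedler_apply:
  "sweedler (HK K) a n x y \<Longrightarrow> (\<Sum>i<n. x i u * y i v) = (if u = v then a u else 0)"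
  using comult_eq[of a u v] by (auto simp: sweedler_def tens_def)

text \<open>
  The comultiplication restricts to the diagonal, so a presentation of it as a sum of tensors is a
  matrix identity (\<open>sweedler_apply\<close>). Each Hopf axiom is reduced to that identity by evaluating at
  group elements.
\<close>

lemma HK_scheme:
  assumes K: "subgroup K G" shows "finite_group_scheme (HK K)"
proof
  have KG: "K \<subseteq> carrier G" using subgroup.subset[OF K] .
  have G0: "a u = 0" if "a \<in> kS K" "u \<notin> carrier G" for a u using that KG by (auto simp: supp_in_def)
  show "fd_algebra (HK K)" by (rule HK_algebra[OF K])
  show "comult (HK K) a \<in> tensor_space (carrier (HK K)) (carrier (HK K))" if a: "a \<in> carrier (HK K)" for a
  proof -
    have "comult H a = (\<Sum>x\<in>K. fscale (a x) (tens (dl x) (dl x)))"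
    proof
      fix w :: "'g \<times> 'g" obtain u v where w: "w = (u, v)" by (cases w)
      have "(\<Sum>x\<in>K. a x * (dl x u * dl x v)) = (\<Sum>x\<in>K. if x = u then a u * (if u = v then 1 else 0) else 0)"
        by (rule sum.cong) (auto simp: dl_def)
      thus "comult H a w = (\<Sum>x\<in>K. fscale (a x) (tens (dl x) (dl x))) w"
        using a finite_subset[OF KG fin] by (auto simp: w comult_eq tens_def supp_in_def)
    qed
    also have "\<dots> \<in> tensor_space (kS K) (kS K)" unfolding tensor_space_def
      by (intro fvs.span_sum fvs.span_scale fvs.span_base) (auto intro!: dl_kS)
    finally show ?thesis by simp
  qed
  show "linear_on (carrier (HK K)) (comult (HK K))"
    by (auto simp: linear_on_def comult_eq fun_eq_iff)
  show "linear_form_on (carrier (HK K)) (counit (HK K))"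
    by (auto simp: linear_form_on_def counit_eq sum.distrib sum_distrib_left)
  show "(\<Sum>i<n. tens (comult (HK K) (x i)) (y i)) ((u, v), w) =
          (\<Sum>i<n. tens (x i) (comult (HK K) (y i))) (u, (v, w))"
    if "a \<in> carrier (HK K)" and s: "sweedler (HK K) a n x y" for a n x y u v w
  proof -
    have "(\<Sum>i<n. tens (comult (HK K) (x i)) (y i)) ((u, v), w) = (if u = v then \<Sum>i<n. x i u * y i w else 0)"
      by (simp add: tens_def comult_eq)
    also have "\<dots> = (if v = w then \<Sum>i<n. x i u * y i v else 0)" by (simp add: sweedler_apply[OF s])
    also have "\<dots> = (\<Sum>i<n. tens (x i) (comult (HK K) (y i))) (u, (v, w))" by (simp add: tens_def comult_eq)
    finally show ?thesis .
  qed
  show "(\<Sum>i<n. fscale (counit (HK K) (x i)) (y i)) = a"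
    if a: "a \<in> carrier (HK K)" and s: "sweedler (HK K) a n x y" for a n x y
  proof
    fix v
    have "(\<Sum>i<n. (\<Sum>g\<in>carrier G. x i g) * y i v) = (\<Sum>g\<in>carrier G. \<Sum>i<n. x i g * y i v)"
      unfolding sum_distrib_right by (rule sum.swap)
    also have "\<dots> = a v" using a fin G0 by (auto simp: sweedler_apply[OF s])
    finally show "(\<Sum>i<n. fscale (counit (HK K) (x i)) (y i)) v = a v" by (simp add: counit_eq)
  qed
  show "(\<Sum>i<n. fscale (counit (HK K) (y i)) (x i)) = a"
    if a: "a \<in> carrier (HK K)" and s: "sweedler (HK K) a n x y" for a n x y
  proof
    fix v
    have "(\<Sum>i<n. (\<Sum>g\<in>carrier G. y i g) * x i v) = (\<Sum>g\<in>carrier G. \<Sum>i<n. x i v * y i g)"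
      unfolding sum_distrib_right by (subst sum.swap) (simp add: mult.commute)
    also have "\<dots> = a v" using a fin G0 by (auto simp: sweedler_apply[OF s])
    finally show "(\<Sum>i<n. fscale (counit (HK K) (y i)) (x i)) v = a v" by (simp add: counit_eq)
  qed
  show "comult (HK K) (a \<otimes>\<^bsub>HK K\<^esub> b) = (\<Sum>i<n. \<Sum>j<m. tens (x i \<otimes>\<^bsub>HK K\<^esub> x' j) (y i \<otimes>\<^bsub>HK K\<^esub> y' j))"
    if s: "sweedler (HK K) a n x y" and s': "sweedler (HK K) b m x' y'" for a b n x y m x' y'
  proof
    fix w :: "'g \<times> 'g" obtain u v where w: "w = (u, v)" by (cases w)
    show "comult (HK K) (a \<otimes>\<^bsub>HK K\<^esub> b) w = (\<Sum>i<n. \<Sum>j<m. tens (x i \<otimes>\<^bsub>HK K\<^esub> x' j) (y i \<otimes>\<^bsub>HK K\<^esub> y' j)) w"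
    proof (cases "u \<in> carrier G \<and> v \<in> carrier G")
      case True
      hence u: "u \<in> carrier G" and v: "v \<in> carrier G" by auto
      have "(\<Sum>i<n. \<Sum>j<m. (x i \<star> x' j) u * (y i \<star> y' j) v) =
         (\<Sum>i<n. \<Sum>j<m. \<Sum>g\<in>carrier G. \<Sum>h\<in>carrier G. (x i g * y i h) * (x' j (inv g \<otimes> u) * y' j (inv h \<otimes> v)))"
        using u v by (simp add: conv_apply sum_product mult_ac)
      also have "\<dots> = (\<Sum>i<n. \<Sum>g\<in>carrier G. \<Sum>h\<in>carrier G. \<Sum>j<m. (x i g * y i h) * (x' j (inv g \<otimes> u) * y' j (inv h \<otimes> v)))"
        by (rule sum.cong[OF refl], subst sum.swap, rule sum.cong[OF refl], subst sum.swap) simp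
      also have "\<dots> = (\<Sum>g\<in>carrier G. \<Sum>h\<in>carrier G. \<Sum>i<n. \<Sum>j<m. (x i g * y i h) * (x' j (inv g \<otimes> u) * y' j (inv h \<otimes> v)))"
        by (subst sum.swap, rule sum.cong[OF refl], subst sum.swap) simp
      also have "\<dots> = (\<Sum>g\<in>carrier G. \<Sum>h\<in>carrier G. (\<Sum>i<n. x i g * y i h) * (\<Sum>j<m. x' j (inv g \<otimes> u) * y' j (inv h \<otimes> v)))"
        by (simp add: sum_product)
      also have "\<dots> = (\<Sum>g\<in>carrier G. \<Sum>h\<in>carrier G. if h = g then (if u = v then a g * b (inv g \<otimes> u) else 0) else 0)"
        by (intro sum.cong refl) (use u v in \<open>auto simp: sweedler_apply[OF s] sweedler_apply[OF s']\<close>)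
      also have "\<dots> = comult H (a \<star> b) (u, v)"
        using fin u v by (simp add: comult_eq conv_apply[OF u] conv_apply[OF v])
      finally show ?thesis by (simp add: w tens_def)
    next
      case False
      thus ?thesis by (auto simp: w tens_def comult_eq conv_outside)
    qed
  qed
  show "comult (HK K) \<one>\<^bsub>HK K\<^esub> = tens \<one>\<^bsub>HK K\<^esub> \<one>\<^bsub>HK K\<^esub>"
    by (auto simp: fun_eq_iff comult_eq tens_def dl_def)
  show "counit (HK K) (a \<otimes>\<^bsub>HK K\<^esub> b) = counit (HK K) a * counit (HK K) b" for a b
  proof -
    have "counit H (a \<star> b) = (\<Sum>y\<in>carrier G. \<Sum>x\<in>carrier G. a y * b (inv y \<otimes> x))"
      by (simp add: counit_eq conv_apply) (rule sum.swap)
    also have "\<dots> = (\<Sum>y\<in>carrier G. \<Sum>x\<in>carrier G. a y * b x)"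
    proof (rule sum.cong[OF refl])
      fix y assume y: "y \<in> carrier G"
      show "(\<Sum>x\<in>carrier G. a y * b (inv y \<otimes> x)) = (\<Sum>x\<in>carrier G. a y * b x)"
        by (rule sum.reindex_bij_witness[of _ "\<lambda>x. y \<otimes> x" "\<lambda>x. inv y \<otimes> x"])
           (use y in \<open>auto simp: m_assoc[symmetric]\<close>)
    qed
    finally show ?thesis by (simp add: counit_eq sum_product)
  qed
  show "counit (HK K) \<one>\<^bsub>HK K\<^esub> = 1" by (simp add: counit_dl)
  show "antipode (HK K) a \<in> carrier (HK K)" if a: "a \<in> carrier (HK K)" for a
  proof -
    have "a (inv x) = 0" if "x \<notin> K" "x \<in> carrier G" for x
    proof -
      have "inv x \<notin> K" using subgroup.m_inv_closed[OF K, of "inv x"] that by auto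
      thus ?thesis using a by (auto simp: supp_in_def)
    qed
    thus ?thesis by (auto simp: supp_in_def antipode_eq)
  qed
  show "linear_on (carrier (HK K)) (antipode (HK K))"
    by (auto simp: linear_on_def antipode_eq fun_eq_iff)
  show "(\<Sum>i<n. antipode (HK K) (x i) \<otimes>\<^bsub>HK K\<^esub> y i) = fscale (counit (HK K) a) \<one>\<^bsub>HK K\<^esub>"
    if s: "sweedler (HK K) a n x y" for a n x y
  proof
    fix v
    show "(\<Sum>i<n. antipode (HK K) (x i) \<otimes>\<^bsub>HK K\<^esub> y i) v = fscale (counit (HK K) a) \<one>\<^bsub>HK K\<^esub> v"
    proof (cases "v \<in> carrier G")
      case True
      have "(\<Sum>i<n. (antipode H (x i) \<star> y i) v) = (\<Sum>g\<in>carrier G. \<Sum>i<n. x i (inv g) * y i (inv g \<otimes> v))"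
        using True by (subst sum.swap) (simp add: conv_apply antipode_eq)
      also have "\<dots> = (\<Sum>g\<in>carrier G. if v = \<one> then a (inv g) else 0)"
        by (intro sum.cong refl) (use True in \<open>auto simp: sweedler_apply[OF s]\<close>)
      also have "\<dots> = (if v = \<one> then \<Sum>g\<in>carrier G. a (inv g) else 0)" by simp
      also have "(\<Sum>g\<in>carrier G. a (inv g)) = counit H a"
        unfolding counit_eq by (rule sum.reindex_bij_witness[of _ "\<lambda>x. inv x" "\<lambda>x. inv x"]) auto
      finally show ?thesis by (simp add: dl_def)
    qed (auto simp: conv_outside dl_def)
  qed
  show "(\<Sum>i<n. x i \<otimes>\<^bsub>HK K\<^esub> antipode (HK K) (y i)) = fscale (counit (HK K) a) \<one>\<^bsub>HK K\<^esub>"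
    if s: "sweedler (HK K) a n x y" for a n x y
  proof
    fix v
    show "(\<Sum>i<n. x i \<otimes>\<^bsub>HK K\<^esub> antipode (HK K) (y i)) v = fscale (counit (HK K) a) \<one>\<^bsub>HK K\<^esub> v"
    proof (cases "v \<in> carrier G")
      case True
      have "(\<Sum>i<n. (x i \<star> antipode H (y i)) v) = (\<Sum>g\<in>carrier G. \<Sum>i<n. x i g * y i (inv v \<otimes> g))"
        using True by (subst sum.swap) (simp add: conv_apply antipode_eq inv_mult_group)
      also have "\<dots> = (\<Sum>g\<in>carrier G. if v = \<one> then a g else 0)"
        by (intro sum.cong refl) (use True in \<open>auto simp: sweedler_apply[OF s]\<close>)
      finally show ?thesis by (auto simp: dl_def counit_eq)
    qed (auto simp: conv_outside dl_def)
  qed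
  show "comult (HK K) a (u, v) = comult (HK K) a (v, u)" for a u v by (simp add: comult_eq)
qed

lemma subgroup_scheme_HK: "subgroup K G \<Longrightarrow> subgroup_scheme (HK K) H"
  using HK_scheme[of K] kS_mono[OF subgroup.subset, of K G]
  by (auto simp: subgroup_scheme_def carrier_H) (simp add: HK_def)

section \<open>Abelian unipotent subgroup schemes\<close>

lemma of_nat_p: "of_nat p = (0::'x \<Rightarrow> 'k)"
proof -
  have "of_nat p = (0::'k)" using char_p of_nat_CHAR[where 'a='k] by simp
  thus ?thesis by (simp add: fun_eq_iff)
qed

lemma subgroup_nat_pow: "subgroup K G \<Longrightarrow> x \<in> K \<Longrightarrow> x [^] (n::nat) \<in> K"
  by (induction n) (auto simp: subgroup.one_closed subgroup.m_closed)

text \<open>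
  For \<open>a\<close> in a Hopf subalgebra, a slice of the comultiplication of \<open>a\<close> is \<open>a y\<close> times the group
  element \<open>y\<close>. Thus the subalgebra contains every group element in the support of its members and
  is spanned by them.
\<close>

lemma subgroup_scheme_imp_HK:
  assumes U: "subgroup_scheme U H"
  shows "\<exists>K. subgroup K G \<and> U = HK K"
proof -
  define C where "C = carrier U"
  have UC: "U = H\<lparr>carrier := C\<rparr>" and CG: "C \<subseteq> kS (carrier G)" and fgs: "finite_group_scheme U"
    using U by (auto simp: subgroup_scheme_def C_def carrier_H[symmetric])
  interpret U: finite_group_scheme U by fact
  have comult: "comult U = comult H" and mult: "monoid.mult U = monoid.mult H" and one: "\<one>\<^bsub>U\<^esub> = dl \<one>"
    and anti: "antipode U = antipode H"
    by (subst UC; simp add: one_H)+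
  have mon: "monoid U" and sC: "fvs.subspace C"
    using U.algebra by (auto simp: fd_algebra_def C_def subspace_fin_dim)
  have dlC: "dl y \<in> C" if a: "a \<in> C" and y: "a y \<noteq> 0" for a y
  proof -
    define sl where "sl F = (\<lambda>x. F (x, y))" for F :: "'g \<times> 'g \<Rightarrow> 'k"
    have sl: "flin sl" by (rule flinI) (auto simp: sl_def fun_eq_iff)
    have "comult H a \<in> tensor_space C C" using U.comult_closed a by (simp add: C_def comult)
    hence "sl (comult H a) \<in> C" unfolding tensor_space_def
    proof (rule span_imageI[OF sl _ _ sC])
      fix z assume "z \<in> {tens x y |x y. x \<in> C \<and> y \<in> C}"
      then obtain u v where z: "z = tens u v" "u \<in> C" by blast
      have "sl z = fscale (v y) u" by (simp add: z sl_def tens_def fun_eq_iff)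
      thus "sl z \<in> C" using z sC fvs.subspace_scale by auto
    qed
    hence "fscale (inverse (a y)) (sl (comult H a)) \<in> C" using sC fvs.subspace_scale by blast
    moreover have "fscale (inverse (a y)) (sl (comult H a)) = dl y"
      using y by (auto simp: sl_def comult_eq dl_def fun_eq_iff)
    ultimately show ?thesis by simp
  qed
  define K where "K = {y \<in> carrier G. dl y \<in> C}"
  have KG: "K \<subseteq> carrier G" by (auto simp: K_def)
  have CK: "C = kS K"
  proof
    show "C \<subseteq> kS K"
    proof
      fix a assume a: "a \<in> C"
      have "a y = 0" if "y \<notin> K" for y using dlC[OF a, of y] that a CG by (auto simp: K_def supp_in_def)
      thus "a \<in> kS K" by (simp add: supp_in_def)
    qed
    show "kS K \<subseteq> C"
    proof
      fix a assume "a \<in> kS K"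
      hence "a = (\<Sum>x\<in>K. fscale (a x) (dl x))" using KG by (rule kS_expand)
      also have "\<dots> \<in> C" by (intro fvs.subspace_sum fvs.subspace_scale sC) (auto simp: K_def)
      finally show "a \<in> C" .
    qed
  qed
  have "subgroup K G"
  proof
    show "K \<subseteq> carrier G" by fact
    show "\<one> \<in> K" using monoid.one_closed[OF mon] by (simp add: K_def one C_def)
    show "x \<otimes> y \<in> K" if "x \<in> K" "y \<in> K" for x y
      using monoid.m_closed[OF mon, of "dl x" "dl y"] that by (auto simp: K_def mult C_def dl_dl)
    show "inv x \<in> K" if "x \<in> K" for x
    proof -
      have "antipode H (dl x) = dl (inv x)"
        using that by (auto simp: antipode_eq fun_eq_iff dl_def K_def)
      thus ?thesis using U.antipode_closed[of "dl x"] that by (auto simp: K_def anti C_def)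
    qed
  qed
  moreover have "U = HK K" using UC CK by (simp add: HK_def)
  ultimately show ?thesis by blast
qed

lemma HK_act:
  assumes K: "subgroup K G" and M: "fd_module (HK K) M" and v: "v \<in> space M" and a: "a \<in> kS K"
  shows "act M a v = (\<Sum>x\<in>K. fscale (a x) (act M (dl x) v))"
proof -
  note D = fd_moduleD[OF M]
  have "act M a v = act M (\<Sum>x\<in>K. fscale (a x) (dl x)) v"
    using kS_expand[OF a subgroup.subset[OF K]] by simp
  also have "\<dots> = (\<Sum>x\<in>K. act M (fscale (a x) (dl x)) v)"
    using linear_on_sum[OF _ D(5)[OF v], of K "\<lambda>x. fscale (a x) (dl x)"] subspace_supp
    by (auto intro!: fvs.subspace_scale dl_kS)
  also have "\<dots> = (\<Sum>x\<in>K. fscale (a x) (act M (dl x) v))"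
    using linear_onD(2)[OF D(5)[OF v]] by (auto intro!: sum.cong dl_kS)
  finally show ?thesis .
qed

lemma HK_endo:
  assumes M: "fd_module (HK K) M" and a: "a \<in> kS K"
  shows "endo (space M) (act M a)"
  using fd_moduleD(3,4)[OF M] a by (intro linear_on_endo) auto

text \<open>
  The abelian \<open>p\<close>-subgroups. The exponent bound \<open>p ^ order G\<close> is generous but uniform, which
  gives one nilpotency degree for all elements.
\<close>

definition abp :: "'g set \<Rightarrow> bool" where
  "abp K \<longleftrightarrow> subgroup K G \<and> (\<forall>x\<in>K. \<forall>y\<in>K. x \<otimes> y = y \<otimes> x) \<and> (\<forall>x\<in>K. x [^] (p ^ order G) = \<one>)"

lemma HK_comm_iff:
  assumes K: "subgroup K G"
  shows "abelian_scheme (HK K) \<longleftrightarrow> (\<forall>x\<in>K. \<forall>y\<in>K. x \<otimes> y = y \<otimes> x)"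
proof
  note KG = subgroup.subset[OF K]
  assume "abelian_scheme (HK K)"
  hence c: "comm_monoid (HK K)" by (simp add: abelian_scheme_def)
  show "\<forall>x\<in>K. \<forall>y\<in>K. x \<otimes> y = y \<otimes> x"
  proof (intro ballI)
    fix x y assume xy: "x \<in> K" "y \<in> K"
    have "dl x \<star> dl y = dl y \<star> dl x" using comm_monoid.m_comm[OF c] xy dl_kS by auto
    hence "dl (x \<otimes> y) (x \<otimes> y) = dl (y \<otimes> x) (x \<otimes> y)" using xy KG by (auto simp: dl_dl subset_iff)
    thus "x \<otimes> y = y \<otimes> x" by (auto simp: dl_def split: if_splits)
  qed
next
  note KG = subgroup.subset[OF K]
  assume c: "\<forall>x\<in>K. \<forall>y\<in>K. x \<otimes> y = y \<otimes> x"
  have comm: "f \<star> h = h \<star> f" if f: "f \<in> kS K" and h: "h \<in> kS K" for f h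
  proof -
    have 1: "dl x \<star> h = h \<star> dl x" if x: "x \<in> K" for x
    proof -
      have "dl x \<star> h = dl x \<star> (\<Sum>y\<in>K. fscale (h y) (dl y))" using kS_expand[OF h KG] by simp
      also have "\<dots> = (\<Sum>y\<in>K. fscale (h y) (dl y)) \<star> dl x"
        unfolding conv_left conv_right using x KG c by (intro sum.cong) (auto simp: dl_dl subset_iff)
      also have "\<dots> = h \<star> dl x" using kS_expand[OF h KG] by simp
      finally show ?thesis .
    qed
    have "f \<star> h = (\<Sum>x\<in>K. fscale (f x) (dl x)) \<star> h" using kS_expand[OF f KG] by simp
    also have "\<dots> = h \<star> (\<Sum>x\<in>K. fscale (f x) (dl x))"
      unfolding conv_left conv_right by (intro sum.cong) (auto simp: 1)
    also have "\<dots> = h \<star> f" using kS_expand[OF f KG] by simp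
    finally show ?thesis .
  qed
  show "abelian_scheme (HK K)" unfolding abelian_scheme_def
    by (rule monoid.monoid_comm_monoidI[OF HK_monoid[OF K]]) (use comm in auto)
qed

lemma conv_comm_abp: "abp K \<Longrightarrow> f \<in> kS K \<Longrightarrow> h \<in> kS K \<Longrightarrow> f \<star> h = h \<star> f"
  using HK_comm_iff[of K] comm_monoid.m_comm[of "HK K" f h] by (auto simp: abp_def abelian_scheme_def)

lemma act_dl_pow:
  assumes K: "subgroup K G" and M: "fd_module (HK K) M" and v: "v \<in> space M" and x: "x \<in> K"
  shows "(act M (dl x) ^^ n) v = act M (dl (x [^] n)) v"
proof (induction n)
  case 0 thus ?case using fd_moduleD(6)[OF M v] by simp
next
  case (Suc n)
  have xG: "x \<in> carrier G" using x subgroup.subset[OF K] by auto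
  have xn: "x [^] n \<in> K" using subgroup_nat_pow[OF K x] .
  have "(act M (dl x) ^^ Suc n) v = act M (dl x) (act M (dl (x [^] n)) v)" using Suc by simp
  also have "\<dots> = act M (dl x \<star> dl (x [^] n)) v"
    using fd_moduleD(7)[OF M _ _ v, of "dl x" "dl (x [^] n)"] x xn by (simp add: dl_kS)
  also have "dl x \<star> dl (x [^] n) = dl (x [^] Suc n)" 
    unfolding nat_pow_Suc2[OF xG] using xG by (simp add: dl_dl)
  finally show ?case .
qed

text \<open>
  In characteristic \<open>p\<close> one has \<open>(x - 1)\<^sup>q = x\<^sup>q - 1\<close> for every power \<open>q\<close> of \<open>p\<close>. Hence the
  operators \<open>x - 1\<close> are commuting nilpotents, which yields fixed vectors and also Nakayama's lemma.
\<close>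

lemma translation_minus_one:
  assumes K: "abp K" and M: "fd_module (HK K) M"
  shows "x \<in> K \<Longrightarrow> endo (space M) (\<lambda>v. act M (dl x) v - v)"
    and "x \<in> K \<Longrightarrow> y \<in> K \<Longrightarrow> commute_on (space M) (\<lambda>v. act M (dl x) v - v) (\<lambda>v. act M (dl y) v - v)"
    and "x \<in> K \<Longrightarrow> w \<in> space M \<Longrightarrow> ((\<lambda>v. act M (dl x) v - v) ^^ (p ^ order G)) w = 0"
proof -
  have sK: "subgroup K G" using K by (simp add: abp_def)
  note D = fd_moduleD[OF M]
  have V: "addsub (space M)" by (rule addsub_subspace[OF D(2)])
  let ?f = "\<lambda>x v. act M (dl x) v - v"
  have e: "endo (space M) (act M (dl x))" if "x \<in> K" for x using HK_endo[OF M dl_kS[OF that]] .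
  show ef: "endo (space M) (?f x)" if "x \<in> K" for x by (rule endo_minus[OF V e[OF that] endo_id])
  show "commute_on (space M) (?f x) (?f y)" if x: "x \<in> K" and y: "y \<in> K" for x y
  proof -
    have "act M (dl x) (act M (dl y) w) = act M (dl y) (act M (dl x) w)" if "w \<in> space M" for w
      using D(7)[OF _ _ that, of "dl x" "dl y"] D(7)[OF _ _ that, of "dl y" "dl x"] x y
        conv_comm_abp[OF K dl_kS[OF x] dl_kS[OF y]] by (simp add: dl_kS)
    thus ?thesis
      using endo_in[OF e[OF x]] endo_in[OF e[OF y]]
      by (auto simp: commute_on_def endo_diff[OF V e[OF x]] endo_diff[OF V e[OF y]])
  qed
  show "(?f x ^^ (p ^ order G)) w = 0" if x: "x \<in> K" and w: "w \<in> space M" for x w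
  proof -
    have e1: "(act M (dl x) ^^ (p ^ order G)) w = w"
      using act_dl_pow[OF sK M w x, of "p ^ order G"] K x D(6)[OF w] by (simp add: abp_def)
    have e2: "act M (dl x) = (\<lambda>v. ?f x v + v)" by (rule ext) simp
    have "((\<lambda>v. ?f x v + v) ^^ (p ^ order G)) w = (?f x ^^ (p ^ order G)) w + ((\<lambda>v. v) ^^ (p ^ order G)) w"
      by (rule freshman_endo_power[OF V ef[OF x] endo_id _ w prime_p of_nat_p]) (simp add: commute_on_def)
    moreover have "((\<lambda>v. v) ^^ n) w = w" for n by (induction n) auto
    ultimately have "w = (?f x ^^ (p ^ order G)) w + w" using e1 unfolding e2[symmetric] by metis
    thus ?thesis by (metis add_cancel_left_left)
  qed
qed

lemma unipotent_HK:
  assumes K: "abp K" shows "unipotent_scheme (HK K)"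
  unfolding unipotent_scheme_def
proof (intro allI impI)
  fix M :: "('g \<Rightarrow> 'k, nat, 'k) amod"
  assume "fd_module (HK K) M \<and> space M \<noteq> {0}"
  hence M: "fd_module (HK K) M" and ne: "space M \<noteq> {0}" by auto
  have sK: "subgroup K G" using K by (simp add: abp_def)
  note KG = subgroup.subset[OF sK]
  note D = fd_moduleD[OF M]
  have V: "addsub (space M)" by (rule addsub_subspace[OF D(2)])
  obtain v where v: "v \<in> space M" "v \<noteq> 0" using ne fvs.subspace_0[OF D(2)] by auto
  have "\<exists>w\<in>space M. w \<noteq> 0 \<and> (\<forall>x\<in>K. act M (dl x) w - w = 0)"
    by (rule common_kernel[where f = "\<lambda>x v. act M (dl x) v - v", OF V finite_subset[OF KG fin] _ _ _ v])
      (rule translation_minus_one[OF K M]; assumption)+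
  then obtain w where w: "w \<in> space M" "w \<noteq> 0" "\<And>x. x \<in> K \<Longrightarrow> act M (dl x) w = w" by auto
  have "act M a w = fscale (counit (HK K) a) w" if a: "a \<in> carrier (HK K)" for a
  proof -
    have a': "a \<in> kS K" using a by simp
    have "counit H a = (\<Sum>x\<in>K. a x)" unfolding counit_eq
      by (rule sum.mono_neutral_right) (use a' KG fin in \<open>auto simp: supp_in_def\<close>)
    moreover have "act M a w = (\<Sum>x\<in>K. fscale (a x) w)" using HK_act[OF sK M w(1) a'] w(3) by simp
    ultimately show ?thesis by (simp add: fvs.scale_sum_left)
  qed
  thus "\<exists>v\<in>space M. v \<noteq> 0 \<and> (\<forall>a\<in>carrier (HK K). act M a v = fscale (counit (HK K) a) v)"
    using w by blast
qed

text \<open>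
  Otherwise a power \<open>b \<noteq> 1\<close> of \<open>a\<close> has order \<open>s\<close> prime to \<open>p\<close>. The elements of the group algebra
  killed by \<open>N = 1 + b + \<dots> + b\<^sup>s\<^sup>-\<^sup>1\<close> form a module, non-zero because it contains \<open>b - 1\<close>. A vector
  in it fixed by \<open>b\<close> is multiplied by \<open>s \<noteq> 0\<close> under \<open>N\<close>, hence zero, against unipotence.
\<close>

lemma unipotent_imp_p_elements:
  assumes K: "subgroup K G" and c: "\<And>x y. x \<in> K \<Longrightarrow> y \<in> K \<Longrightarrow> x \<otimes> y = y \<otimes> x"
    and u: "unipotent_scheme (HK K)" and a: "a \<in> K"
  shows "a [^] (p ^ order G) = \<one>"
proof -
  note KG = subgroup.subset[OF K]
  have aG: "a \<in> carrier G" using a KG by auto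
  have ord: "ord a > 0" "ord a \<le> order G"
    using ord_ge_1[OF fin aG] ord_le_group_order[OF fin aG] by auto
  obtain s where s: "ord a = p ^ multiplicity p (ord a) * s" "\<not> p dvd s"
    using multiplicity_decompose'[of "ord a" p] ord(1) prime_gt_1_nat[OF prime_p] by auto
  define k where "k = multiplicity p (ord a)"
  have "s = 1"
  proof (rule ccontr)
    assume s1: "s \<noteq> 1"
    define b where "b = a [^] (p ^ k)"
    have bK: "b \<in> K" and bG: "b \<in> carrier G" using subgroup_nat_pow[OF K a] KG by (auto simp: b_def)
    have bs: "b [^] s = \<one>" using s(1) aG pow_ord_eq_1[OF aG] by (simp add: b_def nat_pow_pow k_def)
    have b1: "b \<noteq> \<one>"
    proof
      assume "b = \<one>"
      hence "ord a dvd p ^ k" using pow_eq_id[OF aG] by (simp add: b_def)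
      hence "p ^ k * s dvd p ^ k * 1" using s(1) by (simp add: k_def)
      hence "s dvd 1" using prime_gt_0_nat[OF prime_p] by (subst (asm) dvd_times_left_cancel_iff) auto
      thus False using s1 by simp
    qed
    \<comment> \<open>The norm of \<open>b\<close>.\<close>
    define N where "N f = (\<Sum>j<s. dl (b [^] j) \<star> f)" for f
    have Nlin: "flin N" unfolding N_def by (rule flinI) (simp_all add: conv_right sum.distrib fvs.scale_sum_right)
    define W where "W = {f \<in> kS K. N f = 0}"
    have sW: "fvs.subspace W"
      using subspace_supp[of K] by (auto simp: W_def fvs.subspace_def flin_zero[OF Nlin] flin_add[OF Nlin] flin_scale[OF Nlin])
    have bj: "b [^] j \<in> K" for j :: nat using subgroup_nat_pow[OF K bK] .
    have comm: "f \<star> h = h \<star> f" if "f \<in> kS K" "h \<in> kS K" for f h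
      using HK_comm_iff[OF K] c comm_monoid.m_comm[of "HK K" f h] that by (auto simp: abelian_scheme_def)
    have N_conv: "N (g \<star> f) = g \<star> N f" if g: "g \<in> kS K" for f g
    proof -
      have "dl (b [^] j) \<star> (g \<star> f) = g \<star> (dl (b [^] j) \<star> f)" for j :: nat
        using comm[OF dl_kS[OF bj] g] by (simp add: conv_assoc[symmetric])
      thus ?thesis by (simp add: N_def conv_right)
    qed
    define M where "M = \<lparr>space = W, act = monoid.mult H\<rparr>"
    have M: "fd_module (HK K) M"
    proof (rule fd_moduleI)
      show "fin_dim (space M)"
        by (rule fin_dim_subset[of _ "kS K"]) (use sW kS_fin_dim[OF KG] in \<open>auto simp: M_def W_def\<close>)
      show "act M f v \<in> space M" if "f \<in> carrier (HK K)" "v \<in> space M" for f v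
        using that conv_kS[OF K] by (auto simp: M_def W_def N_conv conv_right)
      show "act M \<one>\<^bsub>HK K\<^esub> v = v" if "v \<in> space M" for v
        using that kS_mono[OF KG] by (auto simp: M_def W_def one_conv)
    qed (auto simp: M_def conv_assoc intro!: flin_linear_on conv_flin_left conv_flin_right)
    define e :: "'g \<Rightarrow> nat" where "e = to_nat_on (carrier G)"
    have e: "inj_on e (carrier G)" unfolding e_def by (rule inj_on_to_nat_on[OF countable_finite[OF fin]])
    have MS: "space M \<subseteq> supp_in (carrier G)" using kS_mono[OF KG] by (auto simp: M_def W_def)
    define v0 where "v0 = dl b - dl \<one>"
    have "v0 \<in> W"
    proof -
      have "N v0 = (\<Sum>j<s. dl (b [^] Suc j) - dl (b [^] j))"
        unfolding N_def v0_def using bG by (intro sum.cong) (auto simp: conv_right dl_dl)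
      also have "\<dots> = dl (b [^] s) - dl (b [^] (0::nat))" by (rule sum_lessThan_telescope)
      finally have "N v0 = 0" using bs by simp
      thus ?thesis using bK subgroup.one_closed[OF K] subspace_supp dl_kS
        by (auto simp: W_def v0_def intro!: fvs.subspace_diff)
    qed
    moreover have "v0 \<noteq> 0"
    proof
      assume "v0 = 0"
      hence "v0 b = 0" by simp
      thus False using b1 by (simp add: v0_def dl_def)
    qed
    ultimately have v0: "v0 \<in> space M" "v0 \<noteq> 0" by (simp_all add: M_def)
    have ne: "space (push_mod e (carrier G) M) \<noteq> {0}"
    proof
      assume "space (push_mod e (carrier G) M) = {0}"
      hence "pushf e (carrier G) v0 = 0" using v0(1) by (auto simp: push_mod_def)
      moreover have "pullf e (carrier G) (pushf e (carrier G) v0) = v0"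
        by (rule pull_push[OF e]) (use v0 MS in blast)
      ultimately have "v0 = 0" using flin_zero[OF pull_flin[of e "carrier G"]] by metis
      thus False using v0(2) by contradiction
    qed
    have "\<exists>v\<in>space (push_mod e (carrier G) M). v \<noteq> 0 \<and>
        (\<forall>a\<in>carrier (HK K). act (push_mod e (carrier G) M) a v = fscale (counit (HK K) a) v)"
      using u push_mod_fd[OF e MS M] ne unfolding unipotent_scheme_def by blast
    then obtain w where w: "w \<in> space (push_mod e (carrier G) M)" "w \<noteq> 0"
      "\<And>a. a \<in> kS K \<Longrightarrow> act (push_mod e (carrier G) M) a w = fscale (counit H a) w"
      unfolding HK_simps by blast
    then obtain f where f: "f \<in> W" "w = pushf e (carrier G) f" by (auto simp: push_mod_def M_def)
    have fM: "f \<in> space M" using f by (simp add: M_def)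
    have fix_: "dl (b [^] j) \<star> f = f" for j :: nat
    proof -
      have "pushf e (carrier G) (dl (b [^] j) \<star> f) = act (push_mod e (carrier G) M) (dl (b [^] j)) w"
        using push_mod_act[OF e MS fM] f by (simp add: M_def)
      also have "\<dots> = w" using w(3)[OF dl_kS[OF bj]] counit_dl[of "b [^] j"] bG by simp
      finally have "pushf e (carrier G) (dl (b [^] j) \<star> f) = pushf e (carrier G) f" using f by simp
      hence "pullf e (carrier G) (pushf e (carrier G) (dl (b [^] j) \<star> f)) = pullf e (carrier G) (pushf e (carrier G) f)"
        by simp
      thus ?thesis using pull_push[OF e conv_kS_G] pull_push[OF e, of f] MS fM by auto
    qed
    have "N f = of_nat s * f" by (simp add: N_def fix_ fun_eq_iff)
    hence "of_nat s * f = 0" using f by (simp add: W_def)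
    moreover have "(of_nat s :: 'k) \<noteq> 0" using s(2) by (simp add: of_nat_eq_0_iff_char_dvd char_p)
    ultimately have "f = 0" by (auto simp: fun_eq_iff)
    thus False using w f flin_zero[OF push_flin] by auto
  qed
  hence "ord a = p ^ k" using s by (simp add: k_def)
  moreover have "k \<le> order G"
  proof -
    have "k < p ^ k" using power_gt_expt[of p k] prime_gt_1_nat[OF prime_p] by simp
    thus ?thesis using ord(2) calculation by simp
  qed
  ultimately have "ord a dvd p ^ order G" by (simp add: le_imp_power_dvd)
  thus ?thesis using pow_eq_id[OF aG] by simp
qed

lemma au_iff: "U \<in> au_subgroup_schemes H \<longleftrightarrow> (\<exists>K. abp K \<and> U = HK K)"
proof
  assume "U \<in> au_subgroup_schemes H"
  hence U: "subgroup_scheme U H" "abelian_scheme U" "unipotent_scheme U" by (auto simp: au_subgroup_schemes_def)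
  then obtain K where K: "subgroup K G" "U = HK K" using subgroup_scheme_imp_HK by blast
  have c: "\<forall>x\<in>K. \<forall>y\<in>K. x \<otimes> y = y \<otimes> x" using HK_comm_iff[OF K(1)] U K by simp
  have "\<forall>x\<in>K. x [^] (p ^ order G) = \<one>" using unipotent_imp_p_elements[OF K(1)] c U K by blast
  thus "\<exists>K. abp K \<and> U = HK K" using K c by (auto simp: abp_def)
next
  assume "\<exists>K. abp K \<and> U = HK K"
  then obtain K where K: "abp K" "U = HK K" by blast
  have "subgroup K G" using K by (simp add: abp_def)
  thus "U \<in> au_subgroup_schemes H"
    using K unipotent_HK[OF K(1)] HK_comm_iff[of K] subgroup_scheme_HK[of K]
    by (auto simp: au_subgroup_schemes_def abp_def)
qed

lemma HK_carrier_subset: "kS K \<subseteq> kS L \<longleftrightarrow> K \<subseteq> L"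
proof
  assume s: "kS K \<subseteq> kS L"
  show "K \<subseteq> L"
  proof
    fix x assume "x \<in> K"
    hence "dl x \<in> kS L" using s by (blast intro: dl_kS)
    thus "x \<in> L" by (auto simp: supp_in_def dl_def split: if_splits)
  qed
qed (rule kS_mono)

lemma HK_inj: "HK K = HK L \<longleftrightarrow> K = L"
proof
  assume "HK K = HK L"
  hence "carrier (HK K) = carrier (HK L)" by simp
  thus "K = L" using HK_carrier_subset[of K L] HK_carrier_subset[of L K] by simp
qed simp

lemma Max_au_iff: "U \<in> Max_au H \<longleftrightarrow> (\<exists>A. abp A \<and> (\<forall>B. abp B \<and> A \<subseteq> B \<longrightarrow> B = A) \<and> U = HK A)"
proof
  assume U: "U \<in> Max_au H"
  then obtain A where A: "abp A" "U = HK A" unfolding Max_au_def mem_Collect_eq au_iff by blast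
  have "B = A" if B: "abp B" "A \<subseteq> B" for B
  proof -
    have "HK B \<in> au_subgroup_schemes H" unfolding au_iff using B by blast
    moreover have "carrier U \<subseteq> carrier (HK B)" using A(2) HK_carrier_subset B(2) by simp
    ultimately have "HK B = U" using U unfolding Max_au_def by blast
    thus ?thesis using A(2) HK_inj by simp
  qed
  thus "\<exists>A. abp A \<and> (\<forall>B. abp B \<and> A \<subseteq> B \<longrightarrow> B = A) \<and> U = HK A" using A by blast
next
  assume "\<exists>A. abp A \<and> (\<forall>B. abp B \<and> A \<subseteq> B \<longrightarrow> B = A) \<and> U = HK A"
  then obtain A where A: "abp A" "\<forall>B. abp B \<and> A \<subseteq> B \<longrightarrow> B = A" "U = HK A" by blast
  have "U' = U" if U': "U' \<in> au_subgroup_schemes H" "carrier U \<subseteq> carrier U'" for U'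
  proof -
    obtain B where B: "abp B" "U' = HK B" using U'(1) unfolding au_iff by blast
    have "A \<subseteq> B" using U'(2) A(3) B(2) HK_carrier_subset by simp
    thus ?thesis using A B by blast
  qed
  hence 1: "\<forall>U'\<in>au_subgroup_schemes H. carrier U \<subseteq> carrier U' \<longrightarrow> U' = U" by blast
  have 2: "U \<in> au_subgroup_schemes H" unfolding au_iff using A(1,3) by blast
  show "U \<in> Max_au H" unfolding Max_au_def using 1 2 by (intro CollectI conjI)
qed

lemma max_abp_exists:
  assumes "abp B" shows "\<exists>A. abp A \<and> B \<subseteq> A \<and> (\<forall>C. abp C \<and> A \<subseteq> C \<longrightarrow> C = A)"
proof -
  have "finite {A. abp A \<and> B \<subseteq> A}"
  proof (rule finite_subset)
    show "{A. abp A \<and> B \<subseteq> A} \<subseteq> Pow (carrier G)"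
      unfolding abp_def by (blast dest: subgroup.subset)
  qed (simp add: fin)
  moreover have "{A. abp A \<and> B \<subseteq> A} \<noteq> {}" using assms by blast
  ultimately have "\<exists>m\<in>{A. abp A \<and> B \<subseteq> A}. \<forall>b\<in>{A. abp A \<and> B \<subseteq> A}. m \<le> b \<longrightarrow> m = b"
    by (rule finite_has_maximal)
  then obtain A where A: "A \<in> {A. abp A \<and> B \<subseteq> A}"
      "\<forall>C\<in>{A. abp A \<and> B \<subseteq> A}. A \<subseteq> C \<longrightarrow> A = C" by (rule bexE)
  have "C = A" if "abp C" "A \<subseteq> C" for C
  proof -
    have "C \<in> {A. abp A \<and> B \<subseteq> A}" using A(1) that by blast
    thus ?thesis using A(2) that(2) by blast
  qed
  thus ?thesis using A(1) by (intro exI[of _ A]) simp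
qed

end

section \<open>Deformation into the subgroup of elements of order p\<close>

lemma funpow_comp_commute:
  assumes "endo V f" "endo V g" "commute_on V f g" "x \<in> V"
  shows "((\<lambda>x. f (g x)) ^^ n) x = (f ^^ n) ((g ^^ n) x)"
  using assms(4)
proof (induction n)
  case (Suc n)
  have gn: "(g ^^ n) x \<in> V" by (rule endo_in[OF endo_funpow[OF assms(2)] Suc.prems])
  have "commute_on V g (f ^^ n)" by (rule commute_on_funpow[OF commute_on_sym[OF assms(3)] assms(1)])
  hence "g ((f ^^ n) ((g ^^ n) x)) = (f ^^ n) (g ((g ^^ n) x))" by (rule commute_onD[OF _ gn])
  thus ?case using Suc by simp
qed simp

context fin_group_alg begin

lemma addsub_kS: "addsub (kS K)"
  by (rule addsub_subspace[OF subspace_supp])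

lemma conv_endo_G: "endo (kS (carrier G)) ((\<star>) u)"
  by (rule linear_on_endo[OF flin_linear_on[OF conv_flin_right]]) (use conv_kS_G in auto)

text \<open>
  Powers in the group algebra, as iterates of the multiplication operator; this lets statements on
  iterated operators apply to elements.
\<close>

definition pw :: "('g \<Rightarrow> 'k) \<Rightarrow> nat \<Rightarrow> 'g \<Rightarrow> 'k" where "pw u n = ((\<star>) u ^^ n) (dl \<one>)"

lemma pw_Suc: "pw u (Suc n) = u \<star> pw u n"
  by (simp add: pw_def)

lemma pw_kS: "subgroup K G \<Longrightarrow> u \<in> kS K \<Longrightarrow> pw u n \<in> kS K"
  by (induction n) (auto simp: pw_Suc conv_kS, simp add: pw_def dl_kS subgroup.one_closed)

lemma pw_G: "pw u n \<in> kS (carrier G)"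
  by (cases n) (auto simp: pw_Suc conv_kS_G, simp add: pw_def dl_kS)

lemma conv_funpow: "f \<in> kS (carrier G) \<Longrightarrow> ((\<star>) u ^^ n) f = pw u n \<star> f"
proof (induction n)
  case 0 thus ?case by (simp add: pw_def one_conv)
next
  case (Suc n) thus ?case by (simp add: pw_Suc conv_assoc)
qed

lemma commute_conv: "abp A \<Longrightarrow> x \<in> kS A \<Longrightarrow> y \<in> kS A \<Longrightarrow> commute_on V ((\<star>) x) ((\<star>) y)"
  unfolding commute_on_def by (simp add: conv_assoc[symmetric] conv_comm_abp)

lemma abp_subgroup: "abp A \<Longrightarrow> subgroup A G"
  and abp_sub: "abp A \<Longrightarrow> A \<subseteq> carrier G"
  by (auto simp: abp_def dest: subgroup.subset)

text \<open>
  The Frobenius map of a commutative algebra in characteristic \<open>p\<close> is additive.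
\<close>

lemma pw_char_power:
  assumes A: "abp A" and x: "x \<in> kS A"
  shows "pw x (p ^ N) = (\<Sum>a\<in>A. fscale (x a ^ (p ^ N)) (dl (a [^] (p ^ N))))"
proof -
  note AG = abp_sub[OF A]
  have one: "dl \<one> \<in> kS (carrier G)" by (simp add: dl_kS)
  have lin: "flin (\<lambda>f. fscale c (dl a \<star> f))" for c a
    by (rule flinI) (auto simp: conv_right fvs.scale_right_distrib mult.commute)
  have op: "endo (kS (carrier G)) (\<lambda>f. fscale (x a) (dl a \<star> f))" for a
    by (rule linear_on_endo[OF flin_linear_on[OF lin]])
       (auto intro!: fvs.subspace_scale[OF subspace_supp] conv_kS_G)
  have "(\<star>) x = (\<lambda>f. \<Sum>a\<in>A. fscale (x a) (dl a \<star> f))"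
  proof
    fix f
    have "x \<star> f = (\<Sum>a\<in>A. fscale (x a) (dl a)) \<star> f" using kS_expand[OF x AG] by simp
    thus "x \<star> f = (\<Sum>a\<in>A. fscale (x a) (dl a \<star> f))" by (simp only: conv_left)
  qed
  hence "pw x (p ^ N) = ((\<lambda>f. \<Sum>a\<in>A. fscale (x a) (dl a \<star> f)) ^^ (p ^ N)) (dl \<one>)" by (simp only: pw_def)
  also have "\<dots> = (\<Sum>a\<in>A. ((\<lambda>f. fscale (x a) (dl a \<star> f)) ^^ (p ^ N)) (dl \<one>))"
  proof (rule freshman_endo_sum_power[OF addsub_kS op _ prime_p of_nat_p one finite_subset[OF AG fin]])
    fix a b assume a: "a \<in> A" and b: "b \<in> A"
    have "dl a \<star> (dl b \<star> f) = dl b \<star> (dl a \<star> f)" for f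
      using conv_comm_abp[OF A dl_kS[OF a] dl_kS[OF b]] by (simp add: conv_assoc[symmetric])
    thus "commute_on (kS (carrier G)) (\<lambda>f. fscale (x a) (dl a \<star> f)) (\<lambda>f. fscale (x b) (dl b \<star> f))"
      by (simp add: commute_on_def conv_right mult.commute)
  qed
  also have "\<dots> = (\<Sum>a\<in>A. fscale (x a ^ (p ^ N)) (dl (a [^] (p ^ N))))"
  proof (rule sum.cong[OF refl])
    fix a assume "a \<in> A"
    hence a: "a \<in> carrier G" using AG by auto
    have "((\<lambda>f. fscale c (dl a \<star> f)) ^^ n) (dl \<one>) = fscale (c ^ n) (dl (a [^] n))" for c n
    proof (induction n)
      case (Suc n)
      have "dl a \<star> dl (a [^] n) = dl (a [^] Suc n)" unfolding nat_pow_Suc2[OF a] using a by (simp add: dl_dl)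
      thus ?case unfolding funpow.simps comp_apply Suc conv_right by (simp only: fvs.scale_scale power_Suc)
    qed (simp add: fscale_def)
    thus "((\<lambda>f. fscale (x a) (dl a \<star> f)) ^^ (p ^ N)) (dl \<one>) = fscale (x a ^ (p ^ N)) (dl (a [^] (p ^ N)))" .
  qed
  finally show ?thesis .
qed

lemma frob_sum: "(\<Sum>a\<in>S. x a :: 'k) ^ (p ^ N) = (\<Sum>a\<in>S. x a ^ (p ^ N))"
  using freshmans_dream_sum'[OF char_prime, of "p ^ N" N x S] char_p by simp

lemma pw_augmentation_zero:
  assumes A: "abp A" and x: "x \<in> kS A" and c: "(\<Sum>a\<in>A. x a) = 0" and e: "\<And>a. a \<in> A \<Longrightarrow> x a \<noteq> 0 \<Longrightarrow> a [^] (p ^ N) = \<one>"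
  shows "pw x (p ^ N) = 0"
proof -
  have "pw x (p ^ N) = (\<Sum>a\<in>A. fscale (x a ^ (p ^ N)) (dl \<one>))"
    unfolding pw_char_power[OF A x] using prime_gt_0_nat[OF prime_p]
    by (intro sum.cong refl) (metis e fvs.scale_zero_left power_0_left zero_less_power less_numeral_extra(3))
  also have "\<dots> = fscale ((\<Sum>a\<in>A. x a) ^ (p ^ N)) (dl \<one>)" by (simp add: frob_sum fvs.scale_sum_left)
  also have "\<dots> = 0" using c prime_gt_0_nat[OF prime_p] by (simp add: power_0_left)
  finally show ?thesis .
qed

text \<open>
  The subgroup \<open>\<Omega>\<^sub>1(A)\<close> when \<open>A\<close> is an abelian \<open>p\<close>-group.
\<close>

definition Om :: "'g set \<Rightarrow> 'g set" where "Om A = {a \<in> A. a [^] p = \<one>}"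

lemma abp_mono: "abp A \<Longrightarrow> subgroup B G \<Longrightarrow> B \<subseteq> A \<Longrightarrow> abp B"
  by (auto simp: abp_def)

lemma abp_pow_mult:
  assumes A: "abp A" and x: "x \<in> A" and y: "y \<in> A"
  shows "(x \<otimes> y) [^] (n::nat) = x [^] n \<otimes> y [^] n"
  by (rule pow_mult_distrib) (use A x y abp_sub[OF A] in \<open>auto simp: abp_def\<close>)

lemma Om_subgroup: assumes A: "abp A" shows "subgroup (Om A) G"
proof
  note s = abp_subgroup[OF A] and AG = abp_sub[OF A]
  show "Om A \<subseteq> carrier G" using AG by (auto simp: Om_def)
  show "\<one> \<in> Om A" using subgroup.one_closed[OF s] by (simp add: Om_def)
  show "x \<otimes> y \<in> Om A" if "x \<in> Om A" "y \<in> Om A" for x y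
    using that subgroup.m_closed[OF s] abp_pow_mult[OF A] by (auto simp: Om_def)
  show "inv x \<in> Om A" if "x \<in> Om A" for x
    using that subgroup.m_inv_closed[OF s] AG by (auto simp: Om_def nat_pow_inv)
qed

lemma Om_abp: "abp A \<Longrightarrow> abp (Om A)"
  by (rule abp_mono[OF _ Om_subgroup]) (auto simp: Om_def)

lemma act_linear:
  assumes M: "fd_module (HK A) M" and m: "m \<in> space M"
  shows "x \<in> kS A \<Longrightarrow> y \<in> kS A \<Longrightarrow> act M (x + y) m = act M x m + act M y m"
    "x \<in> kS A \<Longrightarrow> act M (fscale c x) m = fscale c (act M x m)"
  using linear_onD[OF fd_moduleD(5)[OF M m]] by auto

lemma act_funpow:
  assumes A: "subgroup A G" and M: "fd_module (HK A) M" and m: "m \<in> space M" and x: "x \<in> kS A"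
  shows "(act M x ^^ n) m = act M (pw x n) m"
proof (induction n)
  case 0 thus ?case using fd_moduleD(6)[OF M m] by (simp add: pw_def)
next
  case (Suc n)
  thus ?case using fd_moduleD(7)[OF M _ _ m, of x "pw x n"] x pw_kS[OF A x] by (simp add: pw_Suc)
qed

lemma act_zero: "subgroup A G \<Longrightarrow> fd_module (HK A) M \<Longrightarrow> m \<in> space M \<Longrightarrow> act M 0 m = 0"
  using linear_on_zero[OF _ fd_moduleD(5)[of "HK A" M m]] subspace_supp by auto

text \<open>
  The operators of \<open>x\<close>, \<open>y\<close> and \<open>g\<close> commute, so the perturbation lemma applies to \<open>x + y g\<close>.
\<close>

lemma p_exact_act_perturb:
  fixes M :: "('g \<Rightarrow> 'k, 'c, 'k) amod"
  assumes A: "abp A" and M: "fd_module (HK A) M"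
    and x: "x \<in> kS A" "pw x p = 0" and y: "y \<in> kS A" "pw y p = 0" and g: "g \<in> kS A" "pw g n = 0"
    and ex: "p_exact p (space M) (act M x)"
  shows "p_exact p (space M) (act M (x + y \<star> g))"
proof -
  note s = abp_subgroup[OF A]
  note D = fd_moduleD[OF M]
  have V: "addsub (space M)" by (rule addsub_subspace[OF D(2)])
  have e: "endo (space M) (act M z)" if "z \<in> kS A" for z by (rule HK_endo[OF M that])
  have c: "commute_on (space M) (act M z) (act M w)" if "z \<in> kS A" "w \<in> kS A" for z w
    unfolding commute_on_def
  proof
    fix m assume m: "m \<in> space M"
    show "act M z (act M w m) = act M w (act M z m)"
      using D(7)[OF _ _ m, of z w] D(7)[OF _ _ m, of w z] that conv_comm_abp[OF A that] by simp
  qed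
  have nil: "(act M z ^^ k) m = 0" if "z \<in> kS A" "pw z k = 0" "m \<in> space M" for z k m
    using act_funpow[OF s M that(3) that(1)] act_zero[OF s M that(3)] that(2) by simp
  have ex': "p_exact p (space M) (\<lambda>m. act M x m + act M y (act M g m))"
    by (rule p_exact_perturb[OF V e[OF x(1)] e[OF y(1)] e[OF g(1)] c[OF x(1) y(1)] c[OF x(1) g(1)] c[OF y(1) g(1)]
        prime_p of_nat_p nil[OF x] nil[OF y] nil[OF g] ex])
  have eq: "act M (x + y \<star> g) m = act M x m + act M y (act M g m)" if "m \<in> space M" for m
    using act_linear(1)[OF M that x(1) conv_kS[OF s y(1) g(1)]] D(7)[OF _ _ that, of y g] y g by simp
  have in1: "act M x m + act M y (act M g m) \<in> space M" if "m \<in> space M" for m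
    using that D(3) fvs.subspace_add[OF D(2)] x y g by auto
  have "(act M (x + y \<star> g) ^^ k) m = ((\<lambda>m. act M x m + act M y (act M g m)) ^^ k) m" if "m \<in> space M" for k m
    by (rule funpow_cong_on[where V = "space M"]) (use eq in1 that in auto)
  note pow = this
  show ?thesis unfolding p_exact_def
  proof (intro ballI impI)
    fix m assume m: "m \<in> space M" "act M (x + y \<star> g) m = 0"
    have "act M x m + act M y (act M g m) = 0" using eq[OF m(1)] m(2) by simp
    then obtain k where k: "k \<in> space M" "m = ((\<lambda>m. act M x m + act M y (act M g m)) ^^ (p - 1)) k"
      using ex' m(1) unfolding p_exact_def by blast
    show "\<exists>k\<in>space M. m = (act M (x + y \<star> g) ^^ (p - 1)) k"
      using k pow[OF k(1)] by (intro bexI[OF _ k(1)]) simp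
  qed
qed

lemma pw_perturb:
  assumes A: "abp A" and x: "x \<in> kS A" "pw x p = 0" and y: "y \<in> kS A" "pw y p = 0" and g: "g \<in> kS A"
  shows "pw (x + y \<star> g) p = 0"
proof -
  note s = abp_subgroup[OF A]
  have one: "dl \<one> \<in> kS (carrier G)" by (simp add: dl_kS)
  have gp: "pw g p \<in> kS (carrier G)" by (rule pw_G)
  have "(\<star>) (x + y \<star> g) = (\<lambda>f. x \<star> f + y \<star> (g \<star> f))" by (simp add: conv_left conv_assoc fun_eq_iff)
  hence 1: "pw (x + y \<star> g) p = ((\<lambda>f. x \<star> f + y \<star> (g \<star> f)) ^^ p) (dl \<one>)" by (simp only: pw_def)
  have 2: "((\<lambda>f. x \<star> f + y \<star> (g \<star> f)) ^^ p) (dl \<one>) = pw x p + ((\<lambda>f. y \<star> (g \<star> f)) ^^ p) (dl \<one>)"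
    unfolding pw_def
    by (rule freshman_endo[OF addsub_kS conv_endo_G endo_comp[OF conv_endo_G conv_endo_G]
        commute_on_comp[OF commute_conv[OF A x(1) y(1)] commute_conv[OF A x(1) g] conv_endo_G] one prime_p of_nat_p])
  have 3: "((\<lambda>f. y \<star> (g \<star> f)) ^^ p) (dl \<one>) = ((\<star>) y ^^ p) (pw g p)"
    unfolding pw_def by (rule funpow_comp_commute[OF conv_endo_G conv_endo_G commute_conv[OF A y(1) g] one])
  have 4: "((\<star>) y ^^ p) (pw g p) = 0" unfolding conv_funpow[OF gp] y(2) by (rule conv_left(4))
  show ?thesis unfolding 1 2 3 4 x(2) by simp
qed

lemma pw_difference_zero:
  assumes A: "abp A" and w: "w \<in> A" and e: "w [^] (p ^ N) = \<one>"
  shows "pw (dl w - dl \<one>) (p ^ N) = 0"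
proof (rule pw_augmentation_zero[OF A])
  note s = abp_subgroup[OF A]
  have fA: "finite A" using finite_subset[OF abp_sub[OF A] fin] .
  have 1: "\<one> \<in> A" using subgroup.one_closed[OF s] .
  show "dl w - dl \<one> \<in> kS A" by (intro fvs.subspace_diff subspace_supp dl_kS w 1)
  show "(\<Sum>a\<in>A. (dl w - dl \<one>) a) = 0" using fA w 1 by (simp add: sum_subtractf dl_def)
  show "a [^] (p ^ N) = \<one>" if "(dl w - dl \<one>) a \<noteq> 0" for a
    using that e by (auto simp: dl_def split: if_splits)
qed

text \<open>
  The data needed to pass from \<open>v\<close> to \<open>u\<close> by repeated perturbation. Both \<open>g a\<close> and \<open>- g a\<close> are
  required to be nilpotent because the passage is used in both directions.
\<close>

definition deforms :: "'g set \<Rightarrow> ('g \<Rightarrow> 'k) \<Rightarrow> ('g \<Rightarrow> 'k) \<Rightarrow> bool" where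
  "deforms A v u \<longleftrightarrow> (\<exists>y g. u = v + (\<Sum>a\<in>A. y a \<star> g a) \<and>
     (\<forall>a\<in>A. y a \<in> kS A \<and> pw (y a) p = 0 \<and> g a \<in> kS A \<and>
        pw (g a) (p ^ order G) = 0 \<and> pw (- g a) (p ^ order G) = 0))"

text \<open>
  The \<open>p\<close>-th power of \<open>u\<close> is \<open>\<Sum> (u a)\<^sup>p a\<^sup>p\<close>, so \<open>u\<^sup>p = 0\<close> says that the coefficients of \<open>u\<close> sum to zero
  on each fibre of \<open>a \<mapsto> a\<^sup>p\<close>, that is, on each coset of \<open>Om A\<close>. With representatives \<open>t a\<close> of the
  fibres and \<open>a = (w a) (t a)\<close>, this gives \<open>u = \<Sum> (u a) (w a - 1) (t a)\<close>, and \<open>t a = 1 + (t a - 1)\<close>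
  splits off the part \<open>v\<close> in \<open>k(Om A)\<close>.
\<close>

lemma p_nilpotent_reduce:
  assumes A: "abp A" and u: "u \<in> kS A" "pw u p = 0"
  shows "\<exists>v\<in>kS (Om A). pw v p = 0 \<and> deforms A v u"
proof -
  note s = abp_subgroup[OF A] and AG = abp_sub[OF A]
  have fA: "finite A" using finite_subset[OF AG fin] .
  have 1: "\<one> \<in> A" using subgroup.one_closed[OF s] .
  \<comment> \<open>The representative of a coset is chosen as a function of its \<open>p\<close>-th power \<open>b\<close>.\<close>
  define T where "T b = (SOME t. t \<in> A \<and> t [^] p = b)" for b
  define t where "t a = T (a [^] p)" for a
  have t: "t a \<in> A" "t a [^] p = a [^] p" if "a \<in> A" for a
    using someI[of "\<lambda>t. t \<in> A \<and> t [^] p = a [^] p" a] that by (auto simp: t_def T_def)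
  define w where "w a = inv (t a) \<otimes> a" for a
  have w: "w a \<in> Om A" "t a \<otimes> w a = a" if a: "a \<in> A" for a
  proof -
    have ta: "t a \<in> carrier G" and aG: "a \<in> carrier G" using t[OF a] a AG by auto
    have it: "inv (t a) \<in> A" using subgroup.m_inv_closed[OF s t(1)[OF a]] .
    have "w a [^] p = inv (t a) [^] p \<otimes> a [^] p" unfolding w_def by (rule abp_pow_mult[OF A it a])
    also have "\<dots> = \<one>" using t(2)[OF a] ta aG by (simp add: nat_pow_inv)
    finally show "w a \<in> Om A" using subgroup.m_closed[OF s it a] by (simp add: Om_def w_def)
    show "t a \<otimes> w a = a" unfolding w_def using ta aG by (simp add: m_assoc[symmetric])
  qed
  have wA: "w a \<in> A" and wp: "w a [^] (p ^ 1) = \<one>" if "a \<in> A" for a using w(1)[OF that] by (auto simp: Om_def)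
  have fib: "(\<Sum>a | a \<in> A \<and> a [^] p = b. u a) = 0" for b
  proof -
    have "0 = pw u (p ^ 1) b" using u(2) by simp
    also have "\<dots> = (\<Sum>a\<in>A. (u a ^ p) * dl (a [^] p) b)" unfolding pw_char_power[OF A u(1)] by simp
    also have "\<dots> = (\<Sum>a\<in>A. if a [^] p = b then u a ^ p else 0)"
      by (rule sum.cong) (auto simp: dl_def)
    also have "\<dots> = (\<Sum>a | a \<in> A \<and> a [^] p = b. u a ^ p)"
      using fA by (simp add: sum.inter_filter[symmetric] cong: conj_cong)
    also have "\<dots> = (\<Sum>a | a \<in> A \<and> a [^] p = b. u a) ^ p" using frob_sum[of u _ 1] by simp
    finally show ?thesis by (metis power_eq_0_iff)
  qed
  have zero: "(\<Sum>a\<in>A. fscale (u a) (dl (t a))) = 0"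
  proof
    fix x
    have "(\<Sum>a\<in>A. u a * dl (t a) x) = (\<Sum>b\<in>(\<lambda>a. a [^] p) ` A. \<Sum>a | a \<in> A \<and> a [^] p = b. u a * dl (t a) x)"
      by (rule sum.image_gen[OF fA])
    also have "\<dots> = (\<Sum>b\<in>(\<lambda>a. a [^] p) ` A. (\<Sum>a | a \<in> A \<and> a [^] p = b. u a) * dl (T b) x)"
      by (intro sum.cong refl) (auto simp: t_def sum_distrib_right)
    finally show "(\<Sum>a\<in>A. fscale (u a) (dl (t a))) x = 0 x" by (simp add: fib)
  qed
  define y where "y a = dl (w a) - dl \<one>" for a
  define g where "g a = fscale (u a) (dl (t a) - dl \<one>)" for a
  define v where "v = (\<Sum>a\<in>A. fscale (u a) (y a))"
  have yO: "y a \<in> kS (Om A)" if "a \<in> A" for a unfolding y_def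
    by (intro fvs.subspace_diff subspace_supp dl_kS w(1) that) (use subgroup.one_closed[OF Om_subgroup[OF A]] in simp)
  have OA: "Om A \<subseteq> A" by (auto simp: Om_def)
  have yA: "y a \<in> kS A" if "a \<in> A" for a using yO[OF that] kS_mono[OF OA] by blast
  have yp: "pw (y a) p = 0" if "a \<in> A" for a
    using pw_difference_zero[OF A wA[OF that] wp[OF that]] by (simp add: y_def)
  have gA: "g a \<in> kS A" if "a \<in> A" for a unfolding g_def
    by (intro fvs.subspace_scale fvs.subspace_diff subspace_supp dl_kS t(1) that 1)
  have gp: "pw (g a) (p ^ order G) = 0" "pw (- g a) (p ^ order G) = 0" if "a \<in> A" for a
  proof -
    have z: "(\<Sum>b\<in>A. (dl (t a) - dl \<one>) b) = 0" using fA t(1)[OF that] 1 by (simp add: sum_subtractf dl_def)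
    have "(\<Sum>b\<in>A. g a b) = u a * (\<Sum>b\<in>A. (dl (t a) - dl \<one>) b)" by (simp add: g_def sum_distrib_left)
    hence z: "(\<Sum>b\<in>A. g a b) = 0" using z by simp
    have pe: "b [^] (p ^ order G) = \<one>" if "b \<in> A" for b using A that by (simp add: abp_def)
    show "pw (g a) (p ^ order G) = 0" by (rule pw_augmentation_zero[OF A gA[OF that] z pe])
    show "pw (- g a) (p ^ order G) = 0"
      by (rule pw_augmentation_zero[OF A fvs.subspace_neg[OF subspace_supp gA[OF that]] _ pe])
         (simp add: sum_negf z)
  qed
  have uv: "u = v + (\<Sum>a\<in>A. y a \<star> g a)"
  proof -
    have "u = (\<Sum>a\<in>A. fscale (u a) (dl a))" by (rule kS_expand[OF u(1) AG])
    also have "\<dots> = (\<Sum>a\<in>A. fscale (u a) (dl (w a) \<star> dl (t a)))"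
    proof (rule sum.cong[OF refl])
      fix a assume a: "a \<in> A"
      have "dl (w a) \<star> dl (t a) = dl (t a) \<star> dl (w a)"
        by (rule conv_comm_abp[OF A dl_kS dl_kS]) (use wA t a in auto)
      also have "\<dots> = dl a" using w(2)[OF a] wA[OF a] t(1)[OF a] AG by (simp add: dl_dl subset_iff)
      finally show "fscale (u a) (dl a) = fscale (u a) (dl (w a) \<star> dl (t a))" by simp
    qed
    also have "\<dots> = (\<Sum>a\<in>A. y a \<star> fscale (u a) (dl (t a)) + fscale (u a) (dl (t a)))"
    proof (rule sum.cong[OF refl])
      fix a assume a: "a \<in> A"
      have "dl \<one> \<star> dl (t a) = dl (t a)" using t(1)[OF a] AG by (intro one_conv dl_kS) auto
      thus "fscale (u a) (dl (w a) \<star> dl (t a)) = y a \<star> fscale (u a) (dl (t a)) + fscale (u a) (dl (t a))"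
        by (simp add: y_def conv_left conv_right fvs.scale_right_diff_distrib)
    qed
    also have "\<dots> = (\<Sum>a\<in>A. y a \<star> fscale (u a) (dl (t a)))" by (simp add: sum.distrib zero)
    also have "\<dots> = (\<Sum>a\<in>A. fscale (u a) (y a) + y a \<star> g a)"
    proof (rule sum.cong[OF refl])
      fix a assume a: "a \<in> A"
      have "y a \<star> dl \<one> = y a" using yA[OF a] kS_mono[OF AG] by (intro conv_one) auto
      thus "y a \<star> fscale (u a) (dl (t a)) = fscale (u a) (y a) + y a \<star> g a"
        by (simp add: g_def conv_right fvs.scale_right_diff_distrib)
    qed
    finally show ?thesis by (simp add: sum.distrib v_def)
  qed
  have vO: "v \<in> kS (Om A)" unfolding v_def by (intro fvs.subspace_sum fvs.subspace_scale subspace_supp yO)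
  have vA: "v \<in> kS A" using vO kS_mono[OF OA] by blast
  have vp: "pw v p = 0"
  proof -
    have "pw v (p ^ 1) = 0"
    proof (rule pw_augmentation_zero[OF A vA])
      have "(\<Sum>b\<in>A. y a b) = 0" if "a \<in> A" for a
        using fA wA[OF that] 1 by (simp add: y_def sum_subtractf dl_def)
      moreover have "(\<Sum>b\<in>A. v b) = (\<Sum>a\<in>A. u a * (\<Sum>b\<in>A. y a b))"
        unfolding v_def by (simp add: sum_distrib_left) (rule sum.swap)
      ultimately show "(\<Sum>b\<in>A. v b) = 0" by simp
      show "a [^] (p ^ 1) = \<one>" if "v a \<noteq> 0" for a
        using that vO by (auto simp: supp_in_def Om_def)
    qed
    thus ?thesis by simp
  qed
  have "deforms A v u" unfolding deforms_def
    using uv yA yp gA gp by (intro exI[of _ y] exI[of _ g]) blast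
  thus ?thesis using vO vp by blast
qed

text \<open>
  The summands \<open>y a \<star> g a\<close> are added one at a time. Each partial sum still has \<open>p\<close>-th power zero, so
  the perturbation lemma can be applied at each step, with \<open>g a\<close> and then back with \<open>- g a\<close>.
\<close>

lemma p_exact_deforms:
  fixes M :: "('g \<Rightarrow> 'k, 'c, 'k) amod"
  assumes A: "abp A" and v: "v \<in> kS A" "pw v p = 0" and d: "deforms A v u" and M: "fd_module (HK A) M"
  shows "p_exact p (space M) (act M u) = p_exact p (space M) (act M v)"
proof -
  note s = abp_subgroup[OF A] and AG = abp_sub[OF A]
  have fA: "finite A" using finite_subset[OF AG fin] .
  obtain y g where uv: "u = v + (\<Sum>a\<in>A. y a \<star> g a)" and yg: "\<forall>a\<in>A. y a \<in> kS A \<and> pw (y a) p = 0 \<and> g a \<in> kS A \<and>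
        pw (g a) (p ^ order G) = 0 \<and> pw (- g a) (p ^ order G) = 0"
    using d unfolding deforms_def by blast
  have yA: "y a \<in> kS A" and yp: "pw (y a) p = 0" and gA: "g a \<in> kS A"
    and gp: "pw (g a) (p ^ order G) = 0" "pw (- g a) (p ^ order G) = 0" if "a \<in> A" for a
    using yg that by blast+
  define X where "X S = v + (\<Sum>a\<in>S. y a \<star> g a)" for S
  define nilp where "nilp x \<longleftrightarrow> x \<in> kS A \<and> pw x p = 0" for x
  have X0: "X {} = v" by (simp add: X_def)
  have XS: "X (insert a S) = X S + y a \<star> g a" if "finite S" "a \<notin> S" for a S
    unfolding X_def sum.insert[OF that] by (simp only: add.assoc add.commute[of "y a \<star> g a"])
  have step: "nilp (X S)" if "S \<subseteq> A" for S
    using finite_subset[OF that fA] that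
  proof (induction S)
    case (insert a S)
    have a: "a \<in> A" using insert by simp
    have x: "X S \<in> kS A" "pw (X S) p = 0" using insert by (auto simp: nilp_def)
    show ?case unfolding XS[OF insert.hyps(1,2)] nilp_def
      using pw_perturb[OF A x yA[OF a] yp[OF a] gA[OF a]]
        fvs.subspace_add[OF subspace_supp x(1) conv_kS[OF s yA[OF a] gA[OF a]]] by blast
  qed (use v in \<open>auto simp: X0 nilp_def\<close>)
    have exS: "p_exact p (space M) (act M (X S)) = p_exact p (space M) (act M v)" if "S \<subseteq> A" for S
      using finite_subset[OF that fA] that
    proof (induction S)
      case (insert a S)
      have a: "a \<in> A" and SA: "S \<subseteq> A" using insert by auto
      have x: "X S \<in> kS A" "pw (X S) p = 0" using step[OF SA] by (auto simp: nilp_def)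
      have x': "X S + y a \<star> g a \<in> kS A" "pw (X S + y a \<star> g a) p = 0"
        using step[OF insert.prems] XS[OF insert.hyps(1,2)] by (auto simp: nilp_def)
      have gm: "- g a \<in> kS A" using fvs.subspace_neg[OF subspace_supp gA[OF a]] .
      have "y a \<star> (- g a) = - (y a \<star> g a)"
        using conv_right(3)[of "y a" 0 "g a"] conv_right(4)[of "y a"] by simp
      hence bk: "X S + y a \<star> g a + y a \<star> (- g a) = X S" by simp
      have "p_exact p (space M) (act M (X S + y a \<star> g a)) = p_exact p (space M) (act M (X S))"
        using p_exact_act_perturb[OF A M x yA[OF a] yp[OF a] gA[OF a] gp(1)[OF a]]
          p_exact_act_perturb[OF A M x' yA[OF a] yp[OF a] gm gp(2)[OF a], unfolded bk] by blast
      thus ?case unfolding XS[OF insert.hyps(1,2)] using insert.IH[OF SA] by blast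
    qed (simp add: X0)
    have "X A = u" by (simp only: X_def uv[symmetric])
    thus ?thesis using exS[OF order_refl] by simp
qed

section \<open>Exactness on subgroups and double cosets\<close>

text \<open>
  The group algebra of \<open>G\<close> is the sum of its parts supported on the cosets of \<open>L\<close>, and an element
  of \<open>kL\<close> respects this sum; a preimage of an element of \<open>kL\<close> may be cut down to \<open>L\<close>.
\<close>

lemma p_exact_restrict:
  assumes L: "subgroup L G" and u: "u \<in> kS L" and ex: "p_exact p (kS (carrier G)) ((\<star>) u)"
  shows "p_exact p (kS L) ((\<star>) u)"
  unfolding p_exact_def
proof (intro ballI impI)
  note LG = subgroup.subset[OF L]
  fix m assume m: "m \<in> kS L" "u \<star> m = 0"
  have mG: "m \<in> kS (carrier G)" using m kS_mono[OF LG] by blast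
  then obtain n where n: "n \<in> kS (carrier G)" "m = ((\<star>) u ^^ (p - 1)) n" using ex m(2) unfolding p_exact_def by blast
  define q where "q = pw u (p - 1)"
  have q: "q \<in> kS L" unfolding q_def by (rule pw_kS[OF L u])
  have mq: "m = q \<star> n" using n conv_funpow[OF n(1)] by (simp add: q_def)
  define n' where "n' = (\<lambda>x. if x \<in> L then n x else 0)"
  have n': "n' \<in> kS L" by (simp add: n'_def supp_in_def)
  have n'G: "n' \<in> kS (carrier G)" using n' kS_mono[OF LG] by blast
  have "m = q \<star> n'"
  proof (rule conv_eqI[OF mG conv_kS_G])
    fix x assume x: "x \<in> carrier G"
    show "m x = (q \<star> n') x"
    proof (cases "x \<in> L")
      case True
      have "q y * n (inv y \<otimes> x) = q y * n' (inv y \<otimes> x)" for y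
      proof (cases "y \<in> L")
        case yL: True
        have "inv y \<otimes> x \<in> L" using subgroup.m_closed[OF L subgroup.m_inv_closed[OF L yL] True] .
        thus ?thesis by (simp add: n'_def)
      qed (use q in \<open>simp add: supp_in_def\<close>)
      thus ?thesis unfolding mq conv_apply[OF x] by (rule sum.cong[OF refl])
    next
      case False
      thus ?thesis using m(1) conv_kS[OF L q n'] by (simp add: supp_in_def)
    qed
  qed
  hence "m = ((\<star>) u ^^ (p - 1)) n'" using conv_funpow[OF n'G] by (simp add: q_def)
  thus "\<exists>n\<in>kS L. m = ((\<star>) u ^^ (p - 1)) n" using n' by blast
qed

definition dcoset :: "'g set \<Rightarrow> 'g set \<Rightarrow> 'g \<Rightarrow> 'g set" where
  "dcoset E L x = {e \<otimes> x \<otimes> l |e l. e \<in> E \<and> l \<in> L}"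

lemma dcoset_closed:
  assumes E: "subgroup E G" and L: "subgroup L G" and x: "x \<in> carrier G" and y: "y \<in> dcoset E L x"
    and e: "e \<in> E" and l: "l \<in> L"
  shows "e \<otimes> y \<otimes> l \<in> dcoset E L x"
proof -
  obtain e' l' where y': "y = e' \<otimes> x \<otimes> l'" "e' \<in> E" "l' \<in> L" using y by (auto simp: dcoset_def)
  have G: "e \<in> carrier G" "e' \<in> carrier G" "l \<in> carrier G" "l' \<in> carrier G"
    using subgroup.mem_carrier[OF E] subgroup.mem_carrier[OF L] e l y' by auto
  have "e \<otimes> y \<otimes> l = (e \<otimes> e') \<otimes> x \<otimes> (l' \<otimes> l)" using G x by (simp add: y'(1) m_assoc)
  thus ?thesis unfolding dcoset_def using subgroup.m_closed[OF E e y'(2)] subgroup.m_closed[OF L y'(3) l] by blast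
qed

lemma dcoset_sub:
  assumes E: "subgroup E G" and L: "subgroup L G" and x: "x \<in> carrier G"
  shows "dcoset E L x \<subseteq> carrier G" "x \<in> dcoset E L x"
proof -
  show "dcoset E L x \<subseteq> carrier G"
    using subgroup.mem_carrier[OF E] subgroup.mem_carrier[OF L] x by (auto simp: dcoset_def)
  have "x = \<one> \<otimes> x \<otimes> \<one>" using x by simp
  thus "x \<in> dcoset E L x" unfolding dcoset_def using subgroup.one_closed[OF E] subgroup.one_closed[OF L] by blast
qed

lemma dcoset_eq:
  assumes E: "subgroup E G" and L: "subgroup L G" and x: "x \<in> carrier G" and y: "y \<in> dcoset E L x"
  shows "dcoset E L y = dcoset E L x"
proof
  have sub: "dcoset E L b \<subseteq> dcoset E L a" if "a \<in> carrier G" "b \<in> dcoset E L a" for a b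
    using dcoset_closed[OF E L that] unfolding dcoset_def[of E L b] by blast
  show "dcoset E L y \<subseteq> dcoset E L x" by (rule sub[OF x y])
  obtain e l where y': "y = e \<otimes> x \<otimes> l" "e \<in> E" "l \<in> L" using y by (auto simp: dcoset_def)
  have G: "e \<in> carrier G" "l \<in> carrier G"
    using subgroup.mem_carrier[OF E] subgroup.mem_carrier[OF L] y' by auto
  have yG: "y \<in> carrier G" using dcoset_sub(1)[OF E L x] y by blast
  have "inv e \<otimes> y \<otimes> inv l = x" using G x by (simp add: y'(1) m_assoc) (simp add: m_assoc[symmetric])
  hence "x \<in> dcoset E L y" unfolding dcoset_def
    using subgroup.m_inv_closed[OF E y'(2)] subgroup.m_inv_closed[OF L y'(3)] by force
  thus "dcoset E L x \<subseteq> dcoset E L y" by (rule sub[OF yG])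
qed

text \<open>
  The right \<open>L\<close>-invariant functions form the permutation module \<open>k[G/L]\<close>, with \<open>G\<close> acting by left
  translation.
\<close>

definition rinv :: "'g set \<Rightarrow> ('g \<Rightarrow> 'k) set" where
  "rinv L = {m \<in> kS (carrier G). \<forall>x\<in>carrier G. \<forall>l\<in>L. m (x \<otimes> l) = m x}"

lemma rinv_subspace: "fvs.subspace (rinv L)"
  by (auto simp: rinv_def supp_in_def fvs.subspace_def)

lemma rinv_sub: "rinv L \<subseteq> kS (carrier G)"
  by (auto simp: rinv_def)

lemma rinv_conv:
  assumes L: "L \<subseteq> carrier G" and m: "m \<in> rinv L" shows "f \<star> m \<in> rinv L"
proof -
  have "(f \<star> m) (x \<otimes> l) = (f \<star> m) x" if x: "x \<in> carrier G" and l: "l \<in> L" for x l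
  proof -
    have lG: "l \<in> carrier G" using l L by auto
    have "m (inv y \<otimes> (x \<otimes> l)) = m (inv y \<otimes> x)" if y: "y \<in> carrier G" for y
    proof -
      have "inv y \<otimes> (x \<otimes> l) = inv y \<otimes> x \<otimes> l" using x y lG by (simp add: m_assoc)
      thus ?thesis using m x y l by (simp add: rinv_def)
    qed
    hence e: "f y * m (inv y \<otimes> (x \<otimes> l)) = f y * m (inv y \<otimes> x)" if "y \<in> carrier G" for y using that by simp
    have xl: "x \<otimes> l \<in> carrier G" using x lG by simp
    show ?thesis unfolding conv_apply[OF xl] conv_apply[OF x] by (rule sum.cong[OF refl e])
  qed
  thus ?thesis by (auto simp: rinv_def conv_kS_G)
qed

lemma rinv_one: "rinv {\<one>} = kS (carrier G)"
  by (auto simp: rinv_def)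

text \<open>
  The double cosets are stable under left multiplication by \<open>E\<close> and right multiplication by \<open>L\<close>, so
  preimages chosen independently on each of them combine to a right \<open>L\<close>-invariant function. The
  trivial \<open>L\<close> gives the regular module.
\<close>

lemma p_exact_glue:
  assumes E: "subgroup E G" and L: "subgroup L G" and v: "v \<in> kS E"
    and loc: "\<And>m x. m \<in> rinv L \<Longrightarrow> v \<star> m = 0 \<Longrightarrow> x \<in> carrier G \<Longrightarrow>
        \<exists>n\<in>rinv L. \<forall>y\<in>dcoset E L x. (pw v (p - 1) \<star> n) y = m y"
  shows "p_exact p (rinv L) ((\<star>) v)"
  unfolding p_exact_def
proof (intro ballI impI)
  fix m assume m: "m \<in> rinv L" "v \<star> m = 0"
  define q where "q = pw v (p - 1)"
  have q: "q \<in> kS E" unfolding q_def by (rule pw_kS[OF E v])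
  have LG: "L \<subseteq> carrier G" using subgroup.subset[OF L] .
  have "\<exists>N. \<forall>x\<in>carrier G. N x \<in> rinv L \<and> (\<forall>y\<in>dcoset E L x. (q \<star> N x) y = m y)"
    using loc[OF m] unfolding q_def by (intro bchoice) blast
  then obtain N where N: "\<And>x. x \<in> carrier G \<Longrightarrow> N x \<in> rinv L"
     "\<And>x y. x \<in> carrier G \<Longrightarrow> y \<in> dcoset E L x \<Longrightarrow> (q \<star> N x) y = m y" by blast
  define r where "r x = (SOME y. y \<in> dcoset E L x)" for x
  have r: "r x \<in> dcoset E L x" if "x \<in> carrier G" for x
    unfolding r_def using dcoset_sub(2)[OF E L that] by (rule someI)
  have rG: "r x \<in> carrier G" if "x \<in> carrier G" for x using r[OF that] dcoset_sub(1)[OF E L that] by blast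
  have rr: "r y = r x" if "x \<in> carrier G" "y \<in> dcoset E L x" for x y
    unfolding r_def dcoset_eq[OF E L that] ..
  define n where "n x = (if x \<in> carrier G then N (r x) x else 0)" for x
  have nL: "n \<in> rinv L"
  proof -
    have "n (x \<otimes> l) = n x" if x: "x \<in> carrier G" and l: "l \<in> L" for x l
    proof -
      have lG: "l \<in> carrier G" using l LG by auto
      have "\<one> \<otimes> x \<otimes> l \<in> dcoset E L x"
        by (rule dcoset_closed[OF E L x dcoset_sub(2)[OF E L x] subgroup.one_closed[OF E] l])
      hence "r (x \<otimes> l) = r x" using rr[OF x] x by simp
      thus ?thesis using N(1)[OF rG[OF x]] x l lG by (simp add: n_def rinv_def)
    qed
    thus ?thesis by (auto simp: rinv_def supp_in_def n_def)
  qed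
  have nG: "n \<in> kS (carrier G)" using nL rinv_sub by blast
  have mG: "m \<in> kS (carrier G)" using m rinv_sub by blast
  have "m = q \<star> n"
  proof (rule conv_eqI[OF mG conv_kS_G])
    fix x assume x: "x \<in> carrier G"
    have "q y * n (inv y \<otimes> x) = q y * N (r x) (inv y \<otimes> x)" if y: "y \<in> carrier G" for y
    proof (cases "y \<in> E")
      case True
      have "inv y \<otimes> x \<otimes> \<one> \<in> dcoset E L x"
        by (rule dcoset_closed[OF E L x dcoset_sub(2)[OF E L x] subgroup.m_inv_closed[OF E True] subgroup.one_closed[OF L]])
      hence "r (inv y \<otimes> x) = r x" using rr[OF x] x y by simp
      thus ?thesis using x y by (simp add: n_def)
    qed (use q in \<open>simp add: supp_in_def\<close>)
    hence "(q \<star> n) x = (q \<star> N (r x)) x" unfolding conv_apply[OF x] by (rule sum.cong[OF refl])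
    also have "\<dots> = m x"
    proof (rule N(2)[OF rG[OF x]])
      show "x \<in> dcoset E L (r x)"
        unfolding dcoset_eq[OF E L x r[OF x]] by (rule dcoset_sub(2)[OF E L x])
    qed
    finally show "m x = (q \<star> n) x" ..
  qed
  hence "m = ((\<star>) v ^^ (p - 1)) n" using conv_funpow[OF nG] by (simp add: q_def)
  thus "\<exists>n\<in>rinv L. m = ((\<star>) v ^^ (p - 1)) n" using nL by blast
qed

text \<open>
  On a coset of \<open>L\<close> the multiplication by an element of \<open>kL\<close> looks like the multiplication on \<open>L\<close>
  itself.
\<close>

lemma p_exact_induce:
  assumes L: "subgroup L G" and u: "u \<in> kS L" and ex: "p_exact p (kS L) ((\<star>) u)"
  shows "p_exact p (kS (carrier G)) ((\<star>) u)"
  unfolding rinv_one[symmetric]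
proof (rule p_exact_glue[OF L _ u])
  note LG = subgroup.subset[OF L]
  show "subgroup {\<one>} G" by (rule triv_subgroup)
  fix m x assume "m \<in> rinv {\<one>}" and um: "u \<star> m = 0" and x: "x \<in> carrier G"
  define m' where "m' a = (if a \<in> L then m (a \<otimes> x) else 0)" for a
  have m': "m' \<in> kS L" by (simp add: m'_def supp_in_def)
  have inv_in: "inv y \<otimes> a \<in> L" if "y \<in> L" "a \<in> L" for y a
    using subgroup.m_closed[OF L subgroup.m_inv_closed[OF L that(1)] that(2)] .
  have slice: "(f \<star> n) (a \<otimes> x) = (f \<star> n') a"
    if f: "f \<in> kS L" and n: "\<And>a. a \<in> L \<Longrightarrow> n (a \<otimes> x) = n' a" and a: "a \<in> L" for f n n' a
  proof -
    have aG: "a \<in> carrier G" using a LG by auto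
    have "f y * n (inv y \<otimes> (a \<otimes> x)) = f y * n' (inv y \<otimes> a)" if y: "y \<in> carrier G" for y
    proof (cases "y \<in> L")
      case True
      have "inv y \<otimes> (a \<otimes> x) = inv y \<otimes> a \<otimes> x" using x y aG by (simp add: m_assoc)
      thus ?thesis using n[OF inv_in[OF True a]] by simp
    qed (use f in \<open>simp add: supp_in_def\<close>)
    moreover have ax: "a \<otimes> x \<in> carrier G" using x aG by simp
    ultimately show ?thesis unfolding conv_apply[OF ax] conv_apply[OF aG] by (intro sum.cong refl)
  qed
  have "u \<star> m' = 0"
  proof
    fix a show "(u \<star> m') a = 0 a"
    proof (cases "a \<in> L")
      case True
      have "(u \<star> m) (a \<otimes> x) = (u \<star> m') a" by (rule slice[OF u _ True]) (simp add: m'_def)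
      thus ?thesis by (simp add: um)
    qed (use conv_kS[OF L u m'] in \<open>simp add: supp_in_def\<close>)
  qed
  then obtain n' where n': "n' \<in> kS L" "m' = ((\<star>) u ^^ (p - 1)) n'" using ex m' unfolding p_exact_def by blast
  have n'G: "n' \<in> kS (carrier G)" using n' kS_mono[OF LG] by blast
  have m'n: "m' = pw u (p - 1) \<star> n'" using n'(2) conv_funpow[OF n'G] by simp
  define n where "n y = (if y \<in> carrier G then n' (y \<otimes> inv x) else 0)" for y
  have "n \<in> rinv {\<one>}" unfolding rinv_one by (simp add: n_def supp_in_def)
  moreover have "(pw u (p - 1) \<star> n) y = m y" if y: "y \<in> dcoset L {\<one>} x" for y
  proof -
    obtain a where a: "a \<in> L" "y = a \<otimes> x" using y x LG by (auto simp: dcoset_def)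
    have nn: "n (b \<otimes> x) = n' b" if "b \<in> L" for b
      using that LG x by (auto simp: n_def m_assoc subset_iff)
    have "(pw u (p - 1) \<star> n) y = (pw u (p - 1) \<star> n') a"
      unfolding a(2) by (rule slice[where n = n and n' = n', OF pw_kS[OF L u] _ a(1)]) (rule nn)
    also have "\<dots> = m' a" by (simp only: m'n)
    also have "\<dots> = m y" using a by (simp add: m'_def)
    finally show ?thesis .
  qed
  ultimately show "\<exists>n\<in>rinv {\<one>}. \<forall>y\<in>dcoset L {\<one>} x. (pw u (p - 1) \<star> n) y = m y" by blast
qed

section \<open>The p-points of a group algebra\<close>

lemma regular_fd: "subgroup L G \<Longrightarrow> fd_module (HK L) (regular_module (HK L))"
proof (rule fd_moduleI)
  assume L: "subgroup L G"
  show "fin_dim (space (regular_module (HK L)))" using kS_fin_dim[OF subgroup.subset[OF L]] by (simp add: regular_module_def)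
  show "act (regular_module (HK L)) a v \<in> space (regular_module (HK L))"
    if "a \<in> carrier (HK L)" "v \<in> space (regular_module (HK L))" for a v
    using that conv_kS[OF L] by (simp add: regular_module_def)
  show "act (regular_module (HK L)) \<one>\<^bsub>HK L\<^esub> v = v" if "v \<in> space (regular_module (HK L))" for v
    using that one_conv kS_mono[OF subgroup.subset[OF L]] by (auto simp: regular_module_def)
qed (auto simp: regular_module_def conv_assoc intro!: flin_linear_on conv_flin_left conv_flin_right)

lemma pullback_fd:
  assumes \<alpha>: "\<alpha> \<in> alg_hom trunc_poly (HK L)" and M: "fd_module (HK L) M"
  shows "fd_module trunc_poly (pullback \<alpha> M)"
proof (rule fd_moduleI)
  note D = fd_moduleD[OF M]
  have hom: "\<And>f. f \<in> carrier trunc_poly \<Longrightarrow> \<alpha> f \<in> carrier (HK L)"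
    "\<And>f g. f \<in> carrier trunc_poly \<Longrightarrow> g \<in> carrier trunc_poly \<Longrightarrow> \<alpha> (f \<otimes>\<^bsub>trunc_poly\<^esub> g) = \<alpha> f \<otimes>\<^bsub>HK L\<^esub> \<alpha> g"
    "linear_on (carrier trunc_poly) \<alpha>" "\<alpha> \<one>\<^bsub>trunc_poly\<^esub> = \<one>\<^bsub>HK L\<^esub>"
    using \<alpha> by (auto simp: alg_hom_def hom_def)
  show "fin_dim (space (pullback \<alpha> M))" using D(1) by (simp add: pullback_def)
  show "act (pullback \<alpha> M) a v \<in> space (pullback \<alpha> M)" if "a \<in> carrier trunc_poly" "v \<in> space (pullback \<alpha> M)" for a v
    using D(3)[OF hom(1)] that by (simp add: pullback_def)
  show "linear_on (space (pullback \<alpha> M)) (act (pullback \<alpha> M) a)" if "a \<in> carrier trunc_poly" for a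
    using D(4)[OF hom(1)[OF that]] by (simp add: pullback_def)
  show "linear_on (carrier trunc_poly) (\<lambda>a. act (pullback \<alpha> M) a v)" if "v \<in> space (pullback \<alpha> M)" for v
    using linear_on_comp[OF hom(3) D(5)[of v]] hom(1) that by (auto simp: pullback_def)
  show "act (pullback \<alpha> M) \<one>\<^bsub>trunc_poly\<^esub> v = v" if "v \<in> space (pullback \<alpha> M)" for v
    using D(6) that by (simp add: pullback_def hom(4))
  show "act (pullback \<alpha> M) (a \<otimes>\<^bsub>trunc_poly\<^esub> b) v = act (pullback \<alpha> M) a (act (pullback \<alpha> M) b v)"
    if "a \<in> carrier trunc_poly" "b \<in> carrier trunc_poly" "v \<in> space (pullback \<alpha> M)" for a b v
    using D(7)[OF hom(1) hom(1)] that hom(2) by (simp add: pullback_def)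
qed

lemma pullback_simps: "space (pullback \<alpha> M) = space M" "act (pullback \<alpha> M) a = act M (\<alpha> a)"
  by (simp_all add: pullback_def)

lemma subgroup_scheme_HK_iff:
  "subgroup L G \<Longrightarrow> subgroup_scheme U (HK L) \<longleftrightarrow> subgroup_scheme U H \<and> carrier U \<subseteq> kS L"
  using kS_mono[OF subgroup.subset, of L G] by (auto simp: subgroup_scheme_def HK_def carrier_H)

lemma au_HK_iff:
  "subgroup L G \<Longrightarrow> U \<in> au_subgroup_schemes (HK L) \<longleftrightarrow> (\<exists>K. abp K \<and> K \<subseteq> L \<and> U = HK K)"
proof -
  assume L: "subgroup L G"
  have "U \<in> au_subgroup_schemes (HK L) \<longleftrightarrow> U \<in> au_subgroup_schemes H \<and> carrier U \<subseteq> kS L"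
    unfolding au_subgroup_schemes_def mem_Collect_eq subgroup_scheme_HK_iff[OF L] by blast
  also have "\<dots> \<longleftrightarrow> (\<exists>K. abp K \<and> K \<subseteq> L \<and> U = HK K)"
    unfolding au_iff by (metis HK_simps(1) HK_carrier_subset)
  finally show ?thesis .
qed

lemma p_points_elim:
  assumes L: "subgroup L G" and \<alpha>: "\<alpha> \<in> p_points (HK L)"
  shows "\<exists>A. abp A \<and> A \<subseteq> L \<and> \<alpha> tX \<in> kS A" "pw (\<alpha> tX) p = 0" "p_exact p (kS L) ((\<star>) (\<alpha> tX))"
    "\<alpha> \<in> alg_hom trunc_poly (HK L)"
proof -
  show ah: "\<alpha> \<in> alg_hom trunc_poly (HK L)" using \<alpha> by (simp add: p_points_def)
  obtain U where U: "U \<in> au_subgroup_schemes (HK L)" "\<alpha> ` carrier trunc_poly \<subseteq> carrier U"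
    using \<alpha> by (auto simp: p_points_def)
  then obtain A where "abp A" "A \<subseteq> L" "U = HK A" unfolding au_HK_iff[OF L] by blast
  thus "\<exists>A. abp A \<and> A \<subseteq> L \<and> \<alpha> tX \<in> kS A" using U(2) trunc_t_carrier[OF char_prime] by auto
  have fd: "fd_module trunc_poly (pullback \<alpha> (regular_module (HK L)))" by (rule pullback_fd[OF ah regular_fd[OF L]])
  have "flat trunc_poly (pullback \<alpha> (regular_module (HK L)))" using \<alpha> by (simp add: p_points_def)
  from flat_imp_p_exact[OF char_prime this] show "p_exact p (kS L) ((\<star>) (\<alpha> tX))"
    by (simp add: pullback_def regular_module_def char_p)
  show "pw (\<alpha> tX) p = 0"
    using trunc_act(2)[OF char_prime fd, of "dl \<one>"] subgroup.one_closed[OF L]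
    by (simp add: pullback_def regular_module_def char_p pw_def dl_kS)
qed

text \<open>
  The algebra homomorphism from \<open>trunc_poly\<close> with \<open>t \<mapsto> u\<close>.
\<close>

definition point :: "('g \<Rightarrow> 'k) \<Rightarrow> (nat \<Rightarrow> 'k) \<Rightarrow> 'g \<Rightarrow> 'k" where
  "point u f = (\<Sum>i<p. fscale (f i) (pw u i))"

lemma point_t: "point u tX = u" if "u \<in> kS (carrier G)"
  using trunc_op_act[OF char_prime, of "(\<star>) u" "dl \<one>"] that
  by (simp add: point_def pw_def char_p conv_one)

lemma point_p_point:
  assumes A: "abp A" and AL: "A \<subseteq> L" and L: "subgroup L G" and u: "u \<in> kS A" "pw u p = 0"
    and ex: "p_exact p (kS L) ((\<star>) u)"
  shows "point u \<in> p_points (HK L)"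
proof -
  note sA = abp_subgroup[OF A]
  note LG = subgroup.subset[OF L]
  have uL: "u \<in> kS L" using u kS_mono[OF AL] by blast
  have uG: "u \<in> kS (carrier G)" using uL kS_mono[OF LG] by blast
  have one: "dl \<one> \<in> kS (carrier G)" by (simp add: dl_kS)
  have inA: "point u f \<in> kS A" for f unfolding point_def
    by (intro fvs.subspace_sum fvs.subspace_scale subspace_supp pw_kS[OF sA u(1)])
  have inL: "point u f \<in> kS L" for f using inA kS_mono[OF AL] by blast
  have nil: "((\<star>) u ^^ CHAR('k)) f = 0" if "f \<in> kS (carrier G)" for f
    unfolding char_p conv_funpow[OF that] u(2) by (rule conv_left(4))
  have mult: "point u (f \<otimes>\<^bsub>trunc_poly\<^esub> g) = point u f \<star> point u g" for f g
  proof -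
    have gG: "point u g \<in> kS (carrier G)" using inL kS_mono[OF LG] by blast
    have "(\<Sum>n<CHAR('k). fscale ((f \<otimes>\<^bsub>trunc_poly\<^esub> g) n) (((\<star>) u ^^ n) (dl \<one>))) =
        (\<Sum>i<CHAR('k). fscale (f i) (((\<star>) u ^^ i) (\<Sum>j<CHAR('k). fscale (g j) (((\<star>) u ^^ j) (dl \<one>)))))"
      by (rule trunc_mult_op[OF char_prime subspace_supp flin_linear_on[OF conv_flin_right] _ nil one])
         (use conv_kS_G in auto)
    hence "point u (f \<otimes>\<^bsub>trunc_poly\<^esub> g) = (\<Sum>i<p. fscale (f i) (((\<star>) u ^^ i) (point u g)))"
      by (simp only: point_def pw_def char_p)
    also have "\<dots> = point u f \<star> point u g"
      unfolding conv_funpow[OF gG] by (simp add: point_def[of u f] conv_left)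
    finally show ?thesis .
  qed
  have p0: "p > 0" using prime_gt_0_nat[OF prime_p] .
  have "point u \<one>\<^bsub>trunc_poly\<^esub> = (\<Sum>i<p. if i = 0 then dl \<one> else 0)"
    unfolding point_def by (rule sum.cong) (auto simp: tmon_one tmon_def pw_def)
  hence pone: "point u \<one>\<^bsub>trunc_poly\<^esub> = dl \<one>" using p0 by simp
  have lin: "flin (point u)"
    by (rule flinI) (simp_all add: point_def fvs.scale_left_distrib sum.distrib fvs.scale_sum_right)
  have ah: "point u \<in> alg_hom trunc_poly (HK L)"
    using inL mult pone flin_linear_on[OF lin] by (auto simp: alg_hom_def hom_def)
  have fd: "fd_module trunc_poly (pullback (point u) (regular_module (HK L)))" by (rule pullback_fd[OF ah regular_fd[OF L]])
  have "flat trunc_poly (pullback (point u) (regular_module (HK L)))"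
    by (rule p_exact_imp_flat[OF char_prime fd])
       (use ex in \<open>simp add: pullback_def regular_module_def char_p point_t[OF uG]\<close>)
  moreover have "HK A \<in> au_subgroup_schemes (HK L)" using au_HK_iff[OF L] A AL by blast
  ultimately show ?thesis using ah inA by (auto simp: p_points_def intro!: bexI[of _ "HK A"])
qed

lemma p_equiv_iff:
  assumes L: "subgroup L G"
  shows "(\<alpha>, \<beta>) \<in> p_equiv (HK L) \<longleftrightarrow> \<alpha> \<in> p_points (HK L) \<and> \<beta> \<in> p_points (HK L) \<and>
     (\<forall>M :: ('g \<Rightarrow> 'k, nat, 'k) amod. fd_module (HK L) M \<longrightarrow>
        p_exact p (space M) (act M (\<alpha> tX)) = p_exact p (space M) (act M (\<beta> tX)))"
proof -
  have *: "projective trunc_poly (pullback \<gamma> M) = p_exact p (space M) (act M (\<gamma> tX))"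
    if "\<gamma> \<in> p_points (HK L)" "fd_module (HK L) M" for \<gamma> and M :: "('g \<Rightarrow> 'k, nat, 'k) amod"
    using projective_iff_p_exact[OF char_prime pullback_fd[OF _ that(2), of \<gamma>]] that(1)
    by (simp add: pullback_simps char_p p_points_def)
  show ?thesis unfolding p_equiv_def using * by blast
qed

lemma HK_module_restrict:
  assumes K: "K \<subseteq> L" and M: "fd_module (HK L) M" shows "fd_module (HK K) M"
proof (rule fd_moduleI)
  note D = fd_moduleD[OF M]
  have KL: "a \<in> kS L" if "a \<in> carrier (HK K)" for a using that kS_mono[OF K] by auto
  show "fin_dim (space M)" by (rule D(1))
  show "act M a v \<in> space M" if "a \<in> carrier (HK K)" "v \<in> space M" for a v
    using D(3)[of a v] KL[OF that(1)] that by simp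
  show "linear_on (space M) (act M a)" if "a \<in> carrier (HK K)" for a using D(4)[of a] KL[OF that] by simp
  show "linear_on (carrier (HK K)) (\<lambda>a. act M a v)" if "v \<in> space M" for v
    using linear_on_mono[OF D(5)[OF that]] kS_mono[OF K] by simp
  show "act M \<one>\<^bsub>HK K\<^esub> v = v" if "v \<in> space M" for v using D(6)[OF that] by simp
  show "act M (a \<otimes>\<^bsub>HK K\<^esub> b) v = act M a (act M b v)"
    if "a \<in> carrier (HK K)" "b \<in> carrier (HK K)" "v \<in> space M" for a b v
    using D(7)[of a b v] KL[OF that(1)] KL[OF that(2)] that(3) by simp
qed

lemma p_points_mono:
  assumes K: "subgroup K G" and L: "subgroup L G" and KL: "K \<subseteq> L" and \<alpha>: "\<alpha> \<in> p_points (HK K)"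
  shows "\<alpha> \<in> p_points (HK L)"
proof -
  note e = p_points_elim[OF K \<alpha>]
  obtain A where A: "abp A" "A \<subseteq> K" "\<alpha> tX \<in> kS A" using e(1) by blast
  have uK: "\<alpha> tX \<in> kS K" using A kS_mono by blast
  have uL: "\<alpha> tX \<in> kS L" using uK kS_mono[OF KL] by blast
  have ex: "p_exact p (kS L) ((\<star>) (\<alpha> tX))"
    by (rule p_exact_restrict[OF L uL p_exact_induce[OF K uK e(3)]])
  have ah: "\<alpha> \<in> alg_hom trunc_poly (HK L)" using e(4) kS_mono[OF KL] by (auto simp: alg_hom_def hom_def)
  have fd: "fd_module trunc_poly (pullback \<alpha> (regular_module (HK L)))" by (rule pullback_fd[OF ah regular_fd[OF L]])
  have "flat trunc_poly (pullback \<alpha> (regular_module (HK L)))"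
    by (rule p_exact_imp_flat[OF char_prime fd]) (use ex in \<open>simp add: pullback_def regular_module_def char_p\<close>)
  moreover obtain U where U: "U \<in> au_subgroup_schemes (HK K)" "\<alpha> ` carrier trunc_poly \<subseteq> carrier U"
    using \<alpha> by (auto simp: p_points_def)
  moreover have "U \<in> au_subgroup_schemes (HK L)" using U(1) au_HK_iff[OF K] au_HK_iff[OF L] KL by blast
  ultimately show ?thesis using ah by (auto simp: p_points_def)
qed

lemma p_equiv_mono:
  assumes K: "subgroup K G" and L: "subgroup L G" and KL: "K \<subseteq> L" and e: "(\<alpha>, \<beta>) \<in> p_equiv (HK K)"
  shows "(\<alpha>, \<beta>) \<in> p_equiv (HK L)"
  using e p_points_mono[OF K L KL] HK_module_restrict[OF KL] unfolding p_equiv_iff[OF K] p_equiv_iff[OF L] by blast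

lemma p_equiv_equiv: "subgroup L G \<Longrightarrow> equiv (p_points (HK L)) (p_equiv (HK L))"
  by (rule equivI) (auto simp: refl_on_def sym_def trans_def p_equiv_iff)

text \<open>
  Equivalence over a subgroup implies equivalence over \<open>G\<close> because modules restrict; so the image of
  a class of \<open>p\<close>-points of the subgroup lies in a single class.
\<close>

lemma P_incl_class:
  assumes K: "subgroup K G" and a: "\<alpha> \<in> p_points (HK K)"
  shows "P_incl H (p_equiv (HK K) `` {\<alpha>}) = p_equiv H `` {\<alpha>}"
proof -
  note eG = p_equiv_equiv[OF subgroup_self, unfolded HK_G]
  have sub: "(\<alpha>, \<beta>) \<in> p_equiv H" if "(\<alpha>, \<beta>) \<in> p_equiv (HK K)" for \<beta>
    using p_equiv_mono[OF K subgroup_self subgroup.subset[OF K] that] by (simp add: HK_G)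
  have self: "(\<alpha>, \<alpha>) \<in> p_equiv (HK K)" using p_equiv_equiv[OF K] a by (simp add: equiv_def refl_on_def)
  have sy: "sym (p_equiv H)" and tr: "trans (p_equiv H)" using eG by (auto simp: equiv_def)
  show ?thesis unfolding P_incl_def
  proof
    show "p_equiv H `` (p_equiv (HK K) `` {\<alpha>}) \<subseteq> p_equiv H `` {\<alpha>}"
      using sub tr by (auto dest: transD)
    show "p_equiv H `` {\<alpha>} \<subseteq> p_equiv H `` (p_equiv (HK K) `` {\<alpha>})" using self by blast
  qed
qed

lemma P_space_ge_eq:
  "P_space_ge H l = {p_equiv H `` {\<alpha>} |\<alpha> A. HK A \<in> Max_au_ge H l \<and> abp A \<and> \<alpha> \<in> p_points (HK A)}"
proof -
  have A: "\<exists>A. abp A \<and> U = HK A" if "U \<in> Max_au_ge H l" for U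
    using that by (auto simp: Max_au_ge_def Max_au_iff)
  show ?thesis
  proof (rule subset_antisym; rule subsetI)
    fix X assume "X \<in> P_space_ge H l"
    then obtain U Y where U: "U \<in> Max_au_ge H l" "Y \<in> P_space U" "X = P_incl H Y" by (auto simp: P_space_ge_def)
    obtain A where A: "abp A" "U = HK A" using A[OF U(1)] by blast
    obtain \<alpha> where \<alpha>: "\<alpha> \<in> p_points (HK A)" "Y = p_equiv (HK A) `` {\<alpha>}"
      using U(2) A by (auto simp: P_space_def quotient_def)
    have "X = p_equiv H `` {\<alpha>}" using P_incl_class[OF abp_subgroup[OF A(1)] \<alpha>(1)] U \<alpha> by simp
    thus "X \<in> {p_equiv H `` {\<alpha>} |\<alpha> A. HK A \<in> Max_au_ge H l \<and> abp A \<and> \<alpha> \<in> p_points (HK A)}"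
      using U A \<alpha> by blast
  next
    fix X assume "X \<in> {p_equiv H `` {\<alpha>} |\<alpha> A. HK A \<in> Max_au_ge H l \<and> abp A \<and> \<alpha> \<in> p_points (HK A)}"
    then obtain \<alpha> A where X: "X = p_equiv H `` {\<alpha>}" "HK A \<in> Max_au_ge H l" "abp A" "\<alpha> \<in> p_points (HK A)" by blast
    have "X = P_incl H (p_equiv (HK A) `` {\<alpha>})" using P_incl_class[OF abp_subgroup[OF X(3)] X(4)] X by simp
    moreover have "p_equiv (HK A) `` {\<alpha>} \<in> P_space (HK A)" using X(4) by (auto simp: P_space_def quotient_def)
    ultimately show "X \<in> P_space_ge H l" using X(2) by (auto simp: P_space_ge_def)
  qed
qed

lemma P_space_ge_sub: "P_space_ge H l \<subseteq> P_space H"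
proof
  fix X assume "X \<in> P_space_ge H l"
  then obtain \<alpha> A where X: "X = p_equiv H `` {\<alpha>}" "abp A" "\<alpha> \<in> p_points (HK A)" unfolding P_space_ge_eq by blast
  have "\<alpha> \<in> p_points H"
    using p_points_mono[OF abp_subgroup[OF X(2)] subgroup_self abp_sub[OF X(2)] X(3)] by (simp add: HK_G)
  thus "X \<in> P_space H" using X(1) by (auto simp: P_space_def quotient_def)
qed

text \<open>
  The element of the \<open>p\<close>-point is deformed to \<open>v\<close> in \<open>k(Om A)\<close>. Exactness on the regular module is
  preserved along with exactness on all other modules, so \<open>v\<close> again defines a \<open>p\<close>-point, equivalent
  to the given one.
\<close>

lemma p_point_reduce:
  assumes \<alpha>: "\<alpha> \<in> p_points H"
  shows "\<exists>A v. abp A \<and> v \<in> kS (Om A) \<and> pw v p = 0 \<and> p_exact p (kS (carrier G)) ((\<star>) v) \<and>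
     (\<alpha>, point v) \<in> p_equiv H"
proof -
  note e = p_points_elim[OF subgroup_self, unfolded HK_G, OF \<alpha>]
  obtain A where A: "abp A" "\<alpha> tX \<in> kS A" using e(1) by blast
  obtain v where v: "v \<in> kS (Om A)" "pw v p = 0" "deforms A v (\<alpha> tX)"
    using p_nilpotent_reduce[OF A e(2)] by blast
  have vA: "v \<in> kS A" using v(1) kS_mono[of "Om A" A] by (auto simp: Om_def)
  note ex_iff = p_exact_deforms[OF A(1) vA v(2,3)]
  have reg: "fd_module (HK A) (regular_module H)"
    using HK_module_restrict[OF abp_sub[OF A(1)] regular_fd[OF subgroup_self]] by (simp add: HK_G)
  have ex: "p_exact p (kS (carrier G)) ((\<star>) v)"
    using ex_iff[OF reg] e(3) by (simp add: regular_module_def carrier_H)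
  have pv: "point v \<in> p_points H"
    using point_p_point[OF Om_abp[OF A(1)] abp_sub[OF Om_abp[OF A(1)]] subgroup_self v(1,2) ex] by (simp add: HK_G)
  have vG: "v \<in> kS (carrier G)" using v(1) kS_mono[OF abp_sub[OF Om_abp[OF A(1)]]] by blast
  have "p_exact p (space M) (act M (\<alpha> tX)) = p_exact p (space M) (act M (point v tX))"
    if "fd_module H M" for M :: "('g \<Rightarrow> 'k, nat, 'k) amod"
    unfolding point_t[OF vG]
    by (rule ex_iff) (rule HK_module_restrict[OF abp_sub[OF A(1)]], use that in \<open>simp add: HK_G\<close>)
  hence "(\<alpha>, point v) \<in> p_equiv H"
    unfolding p_equiv_iff[OF subgroup_self, unfolded HK_G] using \<alpha> pv by blast
  thus ?thesis using A v ex by blast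
qed

section \<open>Bases of abelian p-groups\<close>

lemma p_gt0: "p > 0" and p_gt1: "p > 1"
  using prime_gt_0_nat[OF prime_p] prime_gt_1_nat[OF prime_p] by auto

lemma abp_comm: "abp A \<Longrightarrow> x \<in> A \<Longrightarrow> y \<in> A \<Longrightarrow> x \<otimes> y = y \<otimes> x"
  and abp_in: "abp A \<Longrightarrow> x \<in> A \<Longrightarrow> x \<in> carrier G"
  and abp_one: "abp A \<Longrightarrow> \<one> \<in> A"
  and abp_mult: "abp A \<Longrightarrow> x \<in> A \<Longrightarrow> y \<in> A \<Longrightarrow> x \<otimes> y \<in> A"
  and abp_inv: "abp A \<Longrightarrow> x \<in> A \<Longrightarrow> inv x \<in> A"
  and abp_pow: "abp A \<Longrightarrow> x \<in> A \<Longrightarrow> x [^] (n::nat) \<in> A"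
  and abp_exp: "abp A \<Longrightarrow> x \<in> A \<Longrightarrow> x [^] (p ^ order G) = \<one>"
  by (auto simp: abp_def subgroup.one_closed subgroup.m_closed subgroup.m_inv_closed subgroup_nat_pow
      dest: subgroup.mem_carrier)

lemma abp_ord_prime_power: "abp A \<Longrightarrow> x \<in> A \<Longrightarrow> \<exists>k. ord x = p ^ k"
  using abp_exp[of A x] pow_eq_id[OF abp_in[of A x]] divides_primepow_nat[OF prime_p] by auto

lemma pow_mod_ord: assumes "x \<in> carrier G" shows "x [^] (n mod ord x) = x [^] (n::nat)"
proof -
  have "x [^] n = x [^] (ord x * (n div ord x) + n mod ord x)" by simp
  also have "\<dots> = x [^] (ord x * (n div ord x)) \<otimes> x [^] (n mod ord x)" using assms by (simp only: nat_pow_mult)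
  also have "x [^] (ord x * (n div ord x)) = \<one>" using pow_eq_id[OF assms] by simp
  finally show ?thesis using assms by simp
qed

lemma abp_ac:
  assumes "abp A" "a \<in> A" "b \<in> A" "c \<in> A" "d \<in> A"
  shows "(a \<otimes> b) \<otimes> (c \<otimes> d) = (a \<otimes> c) \<otimes> (b \<otimes> d)"
proof -
  have G: "a \<in> carrier G" "b \<in> carrier G" "c \<in> carrier G" "d \<in> carrier G" using assms abp_in by auto
  have "(a \<otimes> b) \<otimes> (c \<otimes> d) = a \<otimes> ((b \<otimes> c) \<otimes> d)" using G by (simp add: m_assoc)
  also have "b \<otimes> c = c \<otimes> b" by (rule abp_comm[OF assms(1,3,4)])
  also have "a \<otimes> ((c \<otimes> b) \<otimes> d) = (a \<otimes> c) \<otimes> (b \<otimes> d)" using G by (simp add: m_assoc)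
  finally show ?thesis .
qed

lemma abp_adjoin:
  assumes A: "abp A" and B: "abp B" "B \<subseteq> A" and yA: "y \<in> A"
  shows "abp {c \<otimes> y [^] j |c (j::nat). c \<in> B}"
proof -
  note AG = abp_in[OF A] and BA = B(2) and B = B(1)
  define B' where "B' = {c \<otimes> y [^] j |c (j::nat). c \<in> B}"
  have yn: "y [^] (n::nat) \<in> A" for n by (rule abp_pow[OF A yA])
  have B'A: "B' \<subseteq> A" using BA yn abp_mult[OF A] by (auto simp: B'_def)
  have "subgroup B' G"
  proof
    show "B' \<subseteq> carrier G" using B'A AG by auto
    show "\<one> \<in> B'" unfolding B'_def using abp_one[OF B] by (auto intro!: exI[of _ \<one>] exI[of _ "0::nat"])
    show "u \<otimes> v \<in> B'" if in': "u \<in> B'" "v \<in> B'" for u v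
    proof -
      obtain c i d j where uv: "u = c \<otimes> y [^] (i::nat)" "c \<in> B" "v = d \<otimes> y [^] (j::nat)" "d \<in> B"
        using in' by (auto simp: B'_def)
      have "u \<otimes> v = (c \<otimes> d) \<otimes> (y [^] i \<otimes> y [^] j)" unfolding uv
        by (rule abp_ac[OF A _ yn _ yn]) (use uv BA in auto)
      also have "y [^] i \<otimes> y [^] j = y [^] (i + j)" using AG[OF yA] by (simp add: nat_pow_mult)
      finally show ?thesis using abp_mult[OF B uv(2,4)] by (auto simp: B'_def)
    qed
    show "inv u \<in> B'" if in': "u \<in> B'" for u
    proof -
      obtain c i where u: "u = c \<otimes> y [^] (i::nat)" "c \<in> B" using in' by (auto simp: B'_def)
      have cA: "c \<in> A" using u BA by auto
      have "p ^ order G > 0" using p_gt0 by simp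
      hence "i + i * (p ^ order G - 1) = p ^ order G * i" by (cases "p ^ order G") (auto simp: mult.commute)
      hence 1: "y [^] i \<otimes> y [^] (i * (p ^ order G - 1)) = (y [^] (p ^ order G)) [^] i"
        using AG[OF yA] by (simp add: nat_pow_mult nat_pow_pow)
      have "u \<otimes> (inv c \<otimes> y [^] (i * (p ^ order G - 1))) = (c \<otimes> inv c) \<otimes> (y [^] i \<otimes> y [^] (i * (p ^ order G - 1)))"
        unfolding u(1) by (rule abp_ac[OF A cA yn abp_inv[OF A cA] yn])
      also have "\<dots> = \<one>" unfolding 1 using abp_exp[OF A yA] AG[OF cA] by simp
      finally have uw: "u \<otimes> (inv c \<otimes> y [^] (i * (p ^ order G - 1))) = \<one>" .
      have uA: "u \<in> A" unfolding u(1) by (rule abp_mult[OF A cA yn])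
      have wA: "inv c \<otimes> y [^] (i * (p ^ order G - 1)) \<in> A" by (rule abp_mult[OF A abp_inv[OF A cA] yn])
      have "inv u = inv c \<otimes> y [^] (i * (p ^ order G - 1))"
        by (rule inv_equality[OF _ AG[OF uA] AG[OF wA]]) (use uw abp_comm[OF A uA wA] in simp)
      thus ?thesis using abp_inv[OF B u(2)] by (auto simp: B'_def)
    qed
  qed
  thus ?thesis using abp_mono[OF A] B'A by (simp add: B'_def)
qed

text \<open>
  Take \<open>B\<close> maximal among the subgroups that meet \<open>\<langle>g\<rangle>\<close> trivially. If \<open>\<langle>g\<rangle>B\<close> were not all of \<open>A\<close>, there
  would be \<open>x\<close> outside it with \<open>x\<^sup>p = g\<^sup>k b\<close> inside. Since the order of \<open>g\<close> is maximal, \<open>p\<close> divides \<open>k\<close>,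
  so dividing \<open>x\<close> by a power of \<open>g\<close> gives \<open>y\<close> outside \<open>\<langle>g\<rangle>B\<close> with \<open>y\<^sup>p \<in> B\<close>. Adjoining \<open>y\<close> to \<open>B\<close> then
  contradicts the maximality of \<open>B\<close>.
\<close>

lemma complement_of_maximal_order:
  assumes A: "abp A" and g: "g \<in> A" and mx: "\<And>a. a \<in> A \<Longrightarrow> ord a \<le> ord g"
  shows "\<exists>B. abp B \<and> B \<subseteq> A \<and> (\<forall>n::nat. g [^] n \<in> B \<longrightarrow> g [^] n = \<one>) \<and> (\<forall>a\<in>A. \<exists>n::nat. \<exists>b\<in>B. a = g [^] n \<otimes> b)"
proof -
  note AG = abp_in[OF A]
  have gG: "g \<in> carrier G" using AG g by blast
  obtain m where m: "ord g = p ^ m" using abp_ord_prime_power[OF A g] by blast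
  have expq: "a [^] ord g = \<one>" if a: "a \<in> A" for a
  proof -
    obtain k where k: "ord a = p ^ k" using abp_ord_prime_power[OF A a] by blast
    have "k \<le> m" using mx[OF a] m k p_gt1 by simp
    hence "ord a dvd ord g" using m k by (simp add: le_imp_power_dvd)
    thus ?thesis using pow_eq_id[OF AG[OF a]] by simp
  qed
  let ?X = "{B. abp B \<and> B \<subseteq> A \<and> (\<forall>n::nat. g [^] n \<in> B \<longrightarrow> g [^] n = \<one>)}"
  have "finite ?X" by (rule finite_subset[of _ "Pow A"]) (auto simp: finite_subset[OF abp_sub[OF A] fin])
  moreover have "{\<one>} \<in> ?X"
    using abp_one[OF A] abp_mono[OF A triv_subgroup] by auto
  hence "?X \<noteq> {}" by blast
  ultimately have "\<exists>B\<in>?X. \<forall>C\<in>?X. B \<le> C \<longrightarrow> B = C" by (rule finite_has_maximal)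
  then obtain B where BX: "B \<in> ?X" and Bmax: "\<forall>C\<in>?X. B \<le> C \<longrightarrow> B = C" by (rule bexE)
  have B: "abp B" and BA: "B \<subseteq> A" and Bg: "\<And>n::nat. g [^] n \<in> B \<Longrightarrow> g [^] n = \<one>" using BX by auto
  define S where "S = {g [^] n \<otimes> b |(n::nat) b. b \<in> B}"
  have gn: "g [^] (n::nat) \<in> A" for n by (rule abp_pow[OF A g])
  have S_pow: "s [^] (c::nat) \<in> S" if sS: "s \<in> S" for s c
  proof -
    obtain n :: nat and b where s: "s = g [^] n \<otimes> b" "b \<in> B" using sS by (auto simp: S_def)
    have "s [^] c = (g [^] n) [^] c \<otimes> b [^] c" unfolding s(1) by (rule abp_pow_mult[OF A gn]) (use s BA in auto)
    also have "\<dots> = g [^] (n * c) \<otimes> b [^] c" using gG by (simp add: nat_pow_pow)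
    finally show ?thesis using abp_pow[OF B s(2)] by (auto simp: S_def)
  qed
  have "A \<subseteq> S"
  proof (rule ccontr)
    assume "\<not> A \<subseteq> S"
    then obtain x0 where x0: "x0 \<in> A" "x0 \<notin> S" by blast
    \<comment> \<open>The last \<open>p\<close>-th power of \<open>x0\<close> outside \<open>S\<close> has its own \<open>p\<close>-th power inside.\<close>
    define j where "j = (LEAST j. x0 [^] (p ^ j) \<in> S)"
    have oneS: "\<one> \<in> S" using abp_one[OF B] unfolding S_def by (auto intro!: exI[of _ "0::nat"] exI[of _ \<one>])
    have j1: "x0 [^] (p ^ j) \<in> S" unfolding j_def by (rule LeastI[of _ "order G"]) (use abp_exp[OF A x0(1)] oneS in simp)
    have j0: "j \<noteq> 0" using j1 x0 AG by (cases j) auto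
    define x where "x = x0 [^] (p ^ (j - 1))"
    have xA: "x \<in> A" unfolding x_def by (rule abp_pow[OF A x0(1)])
    have xS: "x \<notin> S" unfolding x_def using not_less_Least[of "j - 1" "\<lambda>j. x0 [^] (p ^ j) \<in> S"] j0 by (simp add: j_def)
    have xp: "x [^] p \<in> S"
    proof -
      have "x [^] p = x0 [^] (p ^ (j - 1) * p)" unfolding x_def using AG[OF x0(1)] by (simp add: nat_pow_pow)
      also have "p ^ (j - 1) * p = p ^ j" using j0 by (cases j) auto
      finally show ?thesis using j1 by simp
    qed
    then obtain k :: nat and b where kb: "x [^] p = g [^] k \<otimes> b" "b \<in> B" by (auto simp: S_def)
    have bA: "b \<in> A" using kb BA by auto
    have m0: "m \<noteq> 0"
    proof
      assume "m = 0"
      hence "x = \<one>" using expq[OF xA] m AG[OF xA] by simp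
      thus False using xS oneS by simp
    qed
    define q' where "q' = p ^ (m - 1)"
    have q': "p * q' = ord g" unfolding q'_def m using m0 by (cases m) auto
    have "p dvd k"
    proof -
      have "\<one> = x [^] (p * q')" using expq[OF xA] by (simp add: q')
      also have "\<dots> = (x [^] p) [^] q'" using AG[OF xA] by (simp add: nat_pow_pow)
      also have "\<dots> = (g [^] k) [^] q' \<otimes> b [^] q'" unfolding kb(1) by (rule abp_pow_mult[OF A gn bA])
      also have "(g [^] k) [^] q' = g [^] (k * q')" using gG by (simp add: nat_pow_pow)
      finally have e: "g [^] (k * q') \<otimes> b [^] q' = \<one>" ..
      have bq: "b [^] q' \<in> B" by (rule abp_pow[OF B kb(2)])
      have "g [^] (k * q') = inv (b [^] q')" using e gG abp_in[OF B bq] by (simp add: inv_equality)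
      hence "g [^] (k * q') \<in> B" using abp_inv[OF B bq] by simp
      hence "g [^] (k * q') = \<one>" by (rule Bg)
      hence "p * q' dvd k * q'" using pow_eq_id[OF gG] by (simp add: q')
      moreover have "q' > 0" using p_gt0 by (simp add: q'_def)
      ultimately show ?thesis by simp
    qed
    then obtain k' where k': "k = p * k'" by auto
    define y where "y = x \<otimes> g [^] ((ord g - 1) * k')"
    have yA: "y \<in> A" unfolding y_def by (rule abp_mult[OF A xA gn])
    have og: "ord g > 0" using m p_gt0 by simp
    have gg: "g [^] ((ord g - 1) * n) \<otimes> g [^] n = \<one>" for n
    proof -
      have "(ord g - 1) * n + n = ord g * n" using og by (cases "ord g") auto
      hence "g [^] ((ord g - 1) * n) \<otimes> g [^] n = g [^] (ord g * n)" using gG by (simp add: nat_pow_mult)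
      also have "\<dots> = \<one>" using pow_eq_id[OF gG] by simp
      finally show ?thesis .
    qed
    have yx: "y \<otimes> g [^] k' = x" unfolding y_def using AG[OF xA] gG gg[of k'] by (simp add: m_assoc)
    have yS: "y \<notin> S"
    proof
      assume "y \<in> S"
      then obtain n :: nat and c where c: "y = g [^] n \<otimes> c" "c \<in> B" by (auto simp: S_def)
      have cA: "c \<in> A" using c BA by auto
      have "x = (g [^] n \<otimes> c) \<otimes> g [^] k'" using yx c by simp
      also have "\<dots> = g [^] n \<otimes> (c \<otimes> g [^] k')" using gG AG[OF cA] by (simp add: m_assoc)
      also have "c \<otimes> g [^] k' = g [^] k' \<otimes> c" by (rule abp_comm[OF A cA gn])
      also have "g [^] n \<otimes> (g [^] k' \<otimes> c) = g [^] (n + k') \<otimes> c"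
        using gG AG[OF cA] by (simp add: m_assoc[symmetric] nat_pow_mult)
      finally show False using xS c(2) by (auto simp: S_def)
    qed
    have yp: "y [^] p = b"
    proof -
      have "y [^] p = x [^] p \<otimes> (g [^] ((ord g - 1) * k')) [^] p" unfolding y_def by (rule abp_pow_mult[OF A xA gn])
      also have "(g [^] ((ord g - 1) * k')) [^] p = g [^] ((ord g - 1) * k)" using gG by (simp add: nat_pow_pow k' mult_ac)
      also have "x [^] p \<otimes> g [^] ((ord g - 1) * k) = g [^] ((ord g - 1) * k) \<otimes> x [^] p"
        by (rule abp_comm[OF A abp_pow[OF A xA] gn])
      also have "\<dots> = (g [^] ((ord g - 1) * k) \<otimes> g [^] k) \<otimes> b" unfolding kb(1) using gG AG[OF bA] by (simp add: m_assoc)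
      finally show ?thesis using gg AG[OF bA] by simp
    qed
    define B' where "B' = {c \<otimes> y [^] j |c (j::nat). c \<in> B}"
    have yn: "y [^] (n::nat) \<in> A" for n by (rule abp_pow[OF A yA])
    have B'A: "B' \<subseteq> A" using BA yn abp_mult[OF A] by (auto simp: B'_def)
    have B'abp: "abp B'" unfolding B'_def by (rule abp_adjoin[OF A B BA yA])
    have "B \<subseteq> B'"
    proof
      fix c assume c: "c \<in> B"
      have "c = c \<otimes> y [^] (0::nat)" using abp_in[OF B c] by simp
      thus "c \<in> B'" unfolding B'_def using c by blast
    qed
    moreover have "y \<in> B'"
    proof -
      have "y = \<one> \<otimes> y [^] (1::nat)" using AG[OF yA] by simp
      thus ?thesis unfolding B'_def using abp_one[OF B] by blast
    qed
    moreover have "B \<subseteq> S"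
    proof
      fix c assume c: "c \<in> B"
      have "c = g [^] (0::nat) \<otimes> c" using abp_in[OF B c] by simp
      thus "c \<in> S" unfolding S_def using c by blast
    qed
    ultimately have "B \<noteq> B'" "B \<subseteq> B'" using yS by auto
    hence "B' \<notin> ?X" using Bmax by blast
    then obtain n :: nat where n: "g [^] n \<in> B'" "g [^] n \<noteq> \<one>" using B'abp B'A by blast
    then obtain c j where cj: "g [^] n = c \<otimes> y [^] (j::nat)" "c \<in> B" by (auto simp: B'_def)
    have cA: "c \<in> A" using cj BA by auto
    show False
    proof (cases "p dvd j")
      case True
      then obtain i where "j = p * i" by auto
      hence "y [^] j = b [^] i" using AG[OF yA] by (simp add: nat_pow_pow[symmetric] yp)
      hence "g [^] n \<in> B" using cj abp_mult[OF B cj(2) abp_pow[OF B kb(2)]] by simp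
      thus False using Bg n by blast
    next
      case False
      hence "coprime j (p ^ order G)" using prime_imp_coprime[OF prime_p False] by (simp add: coprime_commute)
      then obtain d where d: "[j * d = 1] (mod (p ^ order G))" using cong_solve_coprime_nat by (metis One_nat_def)
      have e1: "y [^] j = g [^] n \<otimes> inv c"
        using inv_solve_right[of "y [^] j" "g [^] n" c] cj AG[OF cA] AG[OF yA] gG abp_comm[OF A cA yn] by simp
      have "(y [^] j) [^] d \<in> S" by (rule S_pow) (use e1 abp_inv[OF B cj(2)] in \<open>auto simp: S_def\<close>)
      moreover have "(y [^] j) [^] d = y"
      proof -
        have o: "ord y dvd p ^ order G" using abp_exp[OF A yA] pow_eq_id[OF AG[OF yA]] by simp
        have "[j * d = 1] (mod ord y)" using d o by (rule cong_dvd_modulus_nat)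
        hence "y [^] (j * d) = y [^] (1::nat)"
          using pow_mod_ord[OF AG[OF yA], of "j * d"] pow_mod_ord[OF AG[OF yA], of 1] by (simp add: cong_def)
        thus ?thesis using AG[OF yA] by (simp add: nat_pow_pow)
      qed
      ultimately show False using yS by simp
    qed
  qed
  hence "\<forall>a\<in>A. \<exists>n::nat. \<exists>b\<in>B. a = g [^] n \<otimes> b" unfolding S_def by blast
  thus ?thesis using B BA Bg by blast
qed

fun gp :: "'g list \<Rightarrow> nat list \<Rightarrow> 'g" where
  "gp (g # gs) (n # ns) = g [^] n \<otimes> gp gs ns"
| "gp _ _ = \<one>"

definition exps :: "'g list \<Rightarrow> nat list set" where
  "exps gs = {ns. list_all2 (\<lambda>g n. n < ord g) gs ns}"

definition is_basis :: "'g list \<Rightarrow> 'g set \<Rightarrow> bool" where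
  "is_basis gs A \<longleftrightarrow> set gs \<subseteq> A \<and> \<one> \<notin> set gs \<and> bij_betw (gp gs) (exps gs) A"

lemma gp_in: "abp A \<Longrightarrow> set gs \<subseteq> A \<Longrightarrow> gp gs ns \<in> A"
  by (induction gs ns rule: gp.induct) (auto simp: abp_one abp_mult abp_pow)

text \<open>
  An element of maximal order splits off as a direct factor, and the complement has a basis by
  induction. The factor \<open>\<langle>g\<rangle>\<close> contributes exactly \<open>p\<close> elements with \<open>p\<close>-th power one.
\<close>

lemma abp_has_basis:
  assumes A: "abp A"
  shows "\<exists>gs. is_basis gs A \<and> card (Om A) = p ^ length gs"
  using A
proof (induction "card A" arbitrary: A rule: less_induct)
  case less
  note A = less.prems
  note AG = abp_in[OF A]
  have fA: "finite A" using finite_subset[OF abp_sub[OF A] fin] .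
  show ?case
  proof (cases "A = {\<one>}")
    case True
    have "exps [] = {[]}" by (auto simp: exps_def)
    hence "is_basis [] A" using True by (auto simp: is_basis_def bij_betw_def)
    moreover have "Om A = {\<one>}" using True by (auto simp: Om_def)
    ultimately show ?thesis by (intro exI[of _ "[]"]) simp
  next
    case False
    have "Max (ord ` A) \<in> ord ` A" by (rule Max_in) (use fA abp_one[OF A] in auto)
    then obtain g where g0: "g \<in> A" "ord g = Max (ord ` A)" by auto
    have g: "g \<in> A" "\<And>a. a \<in> A \<Longrightarrow> ord a \<le> ord g" using g0 fA by auto
    have gG: "g \<in> carrier G" using AG g by blast
    have g1: "g \<noteq> \<one>"
    proof
      assume "g = \<one>"
      hence "ord a dvd 1" if "a \<in> A" for a using g(2)[OF that] ord_ge_1[OF fin AG[OF that]] by simp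
      hence "a [^] (1::nat) = \<one>" if "a \<in> A" for a using pow_eq_id[OF AG[OF that]] that by blast
      hence "a = \<one>" if "a \<in> A" for a using AG[OF that] that by force
      thus False using False abp_one[OF A] by blast
    qed
    define q where "q = ord g"
    obtain m where m: "q = p ^ m" using abp_ord_prime_power[OF A g(1)] by (auto simp: q_def)
    have m0: "m \<noteq> 0" using g1 m pow_ord_eq_1[OF gG] gG by (intro notI) (simp add: q_def)
    define q' where "q' = p ^ (m - 1)"
    have q': "q = q' * p" unfolding m q'_def using m0 by (cases m) auto
    have q'0: "q' > 0" using p_gt0 by (simp add: q'_def)
    have q0: "q > 0" using p_gt0 by (simp add: m)
    have geq: "g [^] (n::nat) = \<one> \<longleftrightarrow> q dvd n" for n using pow_eq_id[OF gG] by (simp add: q_def)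
    obtain B where B: "abp B" "B \<subseteq> A" and Bg: "\<And>n::nat. g [^] n \<in> B \<Longrightarrow> g [^] n = \<one>"
      and AB: "\<And>a. a \<in> A \<Longrightarrow> \<exists>n::nat. \<exists>b\<in>B. a = g [^] n \<otimes> b"
      using complement_of_maximal_order[OF A g] by blast
    have "g \<notin> B" using Bg[of 1] g1 gG by auto
    hence "card B < card A" using B g(1) fA by (intro psubset_card_mono) auto
    then obtain gs where gs: "is_basis gs B" "card (Om B) = p ^ length gs" using less.hyps[OF _ B(1)] by blast
    have gmod: "g [^] (n mod q) = g [^] n" for n :: nat unfolding q_def by (rule pow_mod_ord[OF gG])
    have AB': "\<exists>n<q. \<exists>b\<in>B. a = g [^] n \<otimes> b" if aA: "a \<in> A" for a
    proof -
      obtain n :: nat and b where "b \<in> B" "a = g [^] n \<otimes> b" using AB[OF aA] by blast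
      thus ?thesis using gmod[of n] q0 by (intro exI[of _ "n mod q"]) auto
    qed
    have uniq: "n = n' \<and> b = b'" if e: "g [^] n \<otimes> b = g [^] n' \<otimes> b'" and b: "b \<in> B" "b' \<in> B" and n: "n < q" "n' < q" for n n' b b'
    proof -
      have bG: "b \<in> carrier G" "b' \<in> carrier G" using b B abp_in by blast+
      have le: "n = n' \<and> b = b'" if "g [^] n \<otimes> b = g [^] n' \<otimes> b'" "b \<in> B" "b' \<in> B" "n < q" "n' \<le> n" for n n' b b'
      proof -
        have bG: "b \<in> carrier G" "b' \<in> carrier G" using that B abp_in by blast+
        have "g [^] n = g [^] n' \<otimes> g [^] (n - n')" using that gG by (simp add: nat_pow_mult)
        hence "g [^] n' \<otimes> (g [^] (n - n') \<otimes> b) = g [^] n' \<otimes> b'" using that gG bG by (simp add: m_assoc)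
        hence e2: "g [^] (n - n') \<otimes> b = b'" using gG bG by simp
        hence "g [^] (n - n') = b' \<otimes> inv b"
          using inv_solve_right[of "g [^] (n - n')" b' b] gG bG by simp
        hence "g [^] (n - n') \<in> B" using that abp_mult[OF B(1)] abp_inv[OF B(1)] by simp
        hence z: "g [^] (n - n') = \<one>" by (rule Bg)
        hence "q dvd n - n'" using geq by blast
        moreover have "n - n' < q" using that(4) by simp
        ultimately have "n - n' = 0" using nat_dvd_not_less by blast
        thus ?thesis using e2 z bG that(5) by simp
      qed
      show ?thesis
      proof (cases "n' \<le> n")
        case True thus ?thesis using le[OF e b n(1)] by blast
      next
        case False thus ?thesis using le[OF e[symmetric] b(2,1) n(2)] by simp
      qed
    qed
    have "is_basis (g # gs) A"
      unfolding is_basis_def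
    proof (intro conjI)
      show "set (g # gs) \<subseteq> A" using gs g B by (auto simp: is_basis_def)
      show "\<one> \<notin> set (g # gs)" using gs g1 by (auto simp: is_basis_def)
      have bij: "bij_betw (gp gs) (exps gs) B" using gs by (simp add: is_basis_def)
      have ex: "exps (g # gs) = (\<lambda>(n, ns). n # ns) ` ({..<q} \<times> exps gs)"
        by (auto simp: exps_def list_all2_Cons1 q_def image_iff)
      show "bij_betw (gp (g # gs)) (exps (g # gs)) A"
        unfolding bij_betw_def
      proof
        show "inj_on (gp (g # gs)) (exps (g # gs))"
        proof (rule inj_onI)
          fix x y assume xy: "x \<in> exps (g # gs)" "y \<in> exps (g # gs)" "gp (g # gs) x = gp (g # gs) y"
          obtain n ns k ks where x: "x = n # ns" "n < q" "ns \<in> exps gs" and y: "y = k # ks" "k < q" "ks \<in> exps gs"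
            using xy(1,2) unfolding ex by auto
          have "n = k \<and> gp gs ns = gp gs ks"
            by (rule uniq) (use xy(3) x y bij in \<open>auto simp: bij_betw_def\<close>)
          thus "x = y" using x y bij by (auto simp: bij_betw_def dest: inj_onD)
        qed
        show "gp (g # gs) ` exps (g # gs) = A"
        proof
          show "gp (g # gs) ` exps (g # gs) \<subseteq> A"
            using gp_in[OF A, of "g # gs"] gs(1) g(1) B(2) by (auto simp: is_basis_def)
          show "A \<subseteq> gp (g # gs) ` exps (g # gs)"
          proof
            fix a assume "a \<in> A"
            then obtain n b where nb: "n < q" "b \<in> B" "a = g [^] n \<otimes> b" using AB' by blast
            then obtain ns where "ns \<in> exps gs" "b = gp gs ns" using bij by (auto simp: bij_betw_def)
            thus "a \<in> gp (g # gs) ` exps (g # gs)" unfolding ex using nb by (intro image_eqI[of _ _ "n # ns"]) auto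
          qed
        qed
      qed
    qed
    moreover have "card (Om A) = p * card (Om B)"
    proof -
      have "Om A = (\<lambda>(i, b). g [^] (q' * i) \<otimes> b) ` ({..<p} \<times> Om B)"
      proof
        show "Om A \<subseteq> (\<lambda>(i, b). g [^] (q' * i) \<otimes> b) ` ({..<p} \<times> Om B)"
        proof
          fix a assume a: "a \<in> Om A"
          hence aA: "a \<in> A" and ap: "a [^] p = \<one>" by (auto simp: Om_def)
          obtain n b where nb: "n < q" "b \<in> B" "a = g [^] n \<otimes> b" using AB'[OF aA] by blast
          have bA: "b \<in> A" using nb B by auto
          have "(g [^] n) [^] p \<otimes> b [^] p = \<one>"
            using abp_pow_mult[OF A abp_pow[OF A g(1)] bA] ap nb(3) by simp
          hence e: "g [^] (n * p) \<otimes> b [^] p = \<one>" using gG by (simp add: nat_pow_pow)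
          have bp: "b [^] p \<in> B" by (rule abp_pow[OF B(1) nb(2)])
          have "g [^] (n * p) = inv (b [^] p)" using e gG AG[OF bA] by (simp add: inv_equality)
          hence "g [^] (n * p) \<in> B" using abp_inv[OF B(1) bp] by simp
          hence z: "g [^] (n * p) = \<one>" by (rule Bg)
          hence "b [^] p = \<one>" using e AG[OF bA] by simp
          hence "b \<in> Om B" using nb by (simp add: Om_def)
          have "q' * p dvd n * p" using z geq q' by simp
          hence "q' dvd n" using p_gt0 by simp
          then obtain i where i: "n = q' * i" by auto
          have "i < p" using nb(1) q' i q'0 by simp
          thus "a \<in> (\<lambda>(i, b). g [^] (q' * i) \<otimes> b) ` ({..<p} \<times> Om B)" using nb(3) i \<open>b \<in> Om B\<close> by force
        qed
        show "(\<lambda>(i, b). g [^] (q' * i) \<otimes> b) ` ({..<p} \<times> Om B) \<subseteq> Om A"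
        proof clarify
          fix i b assume "b \<in> Om B"
          hence b: "b \<in> B" "b [^] p = \<one>" by (auto simp: Om_def)
          have bA: "b \<in> A" using b B by auto
          have "(g [^] (q' * i) \<otimes> b) [^] p = (g [^] (q' * i)) [^] p \<otimes> b [^] p" by (rule abp_pow_mult[OF A abp_pow[OF A g(1)] bA])
          also have "(g [^] (q' * i)) [^] p = g [^] (q * i)" using gG by (simp add: nat_pow_pow q' mult_ac)
          also have "g [^] (q * i) = \<one>" by (simp add: geq)
          finally have "(g [^] (q' * i) \<otimes> b) [^] p = \<one>" using b by simp
          thus "g [^] (q' * i) \<otimes> b \<in> Om A" using abp_mult[OF A abp_pow[OF A g(1)] bA] by (simp add: Om_def)
        qed
      qed
      moreover have "inj_on (\<lambda>(i, b). g [^] (q' * i) \<otimes> b) ({..<p} \<times> Om B)"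
      proof (rule inj_onI)
        fix x y assume xy: "x \<in> {..<p} \<times> Om B" "y \<in> {..<p} \<times> Om B"
          "(case x of (i, b) \<Rightarrow> g [^] (q' * i) \<otimes> b) = (case y of (i, b) \<Rightarrow> g [^] (q' * i) \<otimes> b)"
        obtain i b j c where x: "x = (i, b)" and y: "y = (j, c)" by (cases x; cases y) blast
        have "g [^] (q' * i) \<otimes> b = g [^] (q' * j) \<otimes> c" using xy(3) by (simp add: x y)
        hence "q' * i = q' * j \<and> b = c"
          by (rule uniq) (use xy q' q'0 in \<open>auto simp: Om_def x y\<close>)
        thus "x = y" using q'0 by (simp add: x y)
      qed
      ultimately show ?thesis by (simp add: card_image card_cartesian_product)
    qed
    ultimately show ?thesis using gs(2) by (intro exI[of _ "g # gs"]) simp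
  qed
qed

section \<open>Elementary abelian subgroups\<close>

text \<open>
  A description by equations of the elementary abelian \<open>p\<close>-subgroups, which are introduced through
  an isomorphism; the two agree by \<open>elem_abelian_iff\<close>.
\<close>

definition eab :: "'g set \<Rightarrow> bool" where
  "eab E \<longleftrightarrow> subgroup E G \<and> (\<forall>x\<in>E. \<forall>y\<in>E. x \<otimes> y = y \<otimes> x) \<and> (\<forall>x\<in>E. x [^] p = \<one>)"

lemma eab_abp: assumes "eab E" shows "abp E"
proof -
  have "x [^] (p ^ order G) = \<one>" if "x \<in> E" for x
  proof -
    have xG: "x \<in> carrier G" using that assms subgroup.mem_carrier by (auto simp: eab_def)
    have "order G \<noteq> 0" using order_gt_0_iff_finite fin by simp
    hence "p ^ order G = p * p ^ (order G - 1)" by (cases "order G") auto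
    hence "x [^] (p ^ order G) = (x [^] p) [^] (p ^ (order G - 1))" using xG by (simp add: nat_pow_pow)
    thus ?thesis using assms that by (simp add: eab_def)
  qed
  thus ?thesis using assms by (simp add: abp_def eab_def)
qed

lemma Om_eab: "abp A \<Longrightarrow> eab (Om A)"
  using Om_subgroup[of A] by (auto simp: eab_def abp_def Om_def)

lemma eab_Om: "eab E \<Longrightarrow> Om E = E"
  by (auto simp: eab_def Om_def)

lemma gp_add_mod:
  assumes E: "eab E" and gs: "set gs \<subseteq> E"
    and len: "length ns = length gs" "length ms = length gs" "length ks = length gs"
    and k: "\<And>i. i < length gs \<Longrightarrow> ks ! i mod p = (ns ! i + ms ! i) mod p"
  shows "gp gs ks = gp gs ns \<otimes> gp gs ms"
  using gs len k
proof (induction gs arbitrary: ns ms ks)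
  case (Cons g gs)
  note A = eab_abp[OF E]
  obtain n ns' m ms' l ks' where s: "ns = n # ns'" "ms = m # ms'" "ks = l # ks'"
    using Cons.prems by (auto simp: length_Suc_conv)
  have gE: "g \<in> E" and gsE: "set gs \<subseteq> E" using Cons.prems by auto
  have gG: "g \<in> carrier G" using abp_in[OF A gE] .
  have gmod: "g [^] (i mod p) = g [^] i" for i :: nat
  proof -
    have "g [^] i = g [^] (p * (i div p) + i mod p)" by simp
    also have "\<dots> = (g [^] p) [^] (i div p) \<otimes> g [^] (i mod p)" using gG by (simp only: nat_pow_mult[symmetric] nat_pow_pow)
    also have "(g [^] p) = \<one>" using E gE by (simp add: eab_def)
    finally show ?thesis using gG by simp
  qed
  have IH: "gp gs ks' = gp gs ns' \<otimes> gp gs ms'"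
  proof (rule Cons.IH[OF gsE])
    fix i assume "i < length gs"
    thus "ks' ! i mod p = (ns' ! i + ms' ! i) mod p" using Cons.prems(5)[of "Suc i"] by (simp add: s)
  qed (use Cons.prems s in auto)
  have "l mod p = (n + m) mod p" using Cons.prems(5)[of 0] by (simp add: s)
  hence "g [^] l = g [^] (n + m)" using gmod[of l] gmod[of "n + m"] by simp
  hence gl: "g [^] l = g [^] n \<otimes> g [^] m" using gG by (simp add: nat_pow_mult)
  show ?case unfolding s gp.simps IH gl
    by (rule abp_ac[OF A abp_pow[OF A gE] abp_pow[OF A gE] gp_in[OF A gsE] gp_in[OF A gsE]])
qed simp

lemma eab_imp_rank:
  assumes E: "eab E" shows "\<exists>n. elem_abelian_of_rank p n G E \<and> card E = p ^ n"
proof -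
  note A = eab_abp[OF E]
  obtain gs where gs: "is_basis gs E" "card (Om E) = p ^ length gs" using abp_has_basis[OF A] by blast
  define n where "n = length gs"
  have gsE: "set gs \<subseteq> E" using gs by (simp add: is_basis_def)
  have ordp: "ord g = p" if "g \<in> set gs" for g
  proof -
    have g: "g \<in> E" "g \<noteq> \<one>" using gs that by (auto simp: is_basis_def)
    have gG: "g \<in> carrier G" using abp_in[OF A g(1)] .
    have "g [^] p = \<one>" using E g(1) by (simp add: eab_def)
    hence "ord g dvd p" using pow_eq_id[OF gG] by blast
    moreover have "ord g \<noteq> 1" using g(2) pow_ord_eq_1[OF gG] gG by force
    ultimately show ?thesis using prime_p prime_nat_iff by blast
  qed
  have ex: "exps gs = {ns. length ns = n \<and> (\<forall>i<n. ns ! i < p)}"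
    unfolding exps_def n_def list_all2_conv_all_nth using ordp by auto
  define P where "P = product_group {..<n} (\<lambda>_. integer_mod_group p)"
  define L where "L f = map (\<lambda>i. nat (f i)) [0..<n]" for f :: "nat \<Rightarrow> int"
  have cP: "carrier P = (\<Pi>\<^sub>E i\<in>{..<n}. {0..<int p})" using p_gt0 by (simp add: P_def carrier_integer_mod_group)
  have Lbij: "bij_betw L (carrier P) (exps gs)"
  proof (rule bij_betw_byWitness[where f' = "\<lambda>ns. \<lambda>i\<in>{..<n}. int (ns ! i)"])
    show "\<forall>f\<in>carrier P. (\<lambda>i\<in>{..<n}. int (L f ! i)) = f"
      unfolding cP L_def by (auto simp: fun_eq_iff PiE_def Pi_def extensional_def)
    show "\<forall>ns\<in>exps gs. L (\<lambda>i\<in>{..<n}. int (ns ! i)) = ns"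
      unfolding ex L_def by (auto intro!: nth_equalityI)
    show "L ` carrier P \<subseteq> exps gs" unfolding cP ex L_def by (auto simp: PiE_def Pi_def nat_less_iff)
    show "(\<lambda>ns. \<lambda>i\<in>{..<n}. int (ns ! i)) ` exps gs \<subseteq> carrier P"
      unfolding cP ex by (rule image_subsetI, simp only: restrict_PiE_iff) auto
  qed
  have bij: "bij_betw (\<lambda>f. gp gs (L f)) (carrier P) E"
    using bij_betw_trans[OF Lbij, of "gp gs" E] gs by (simp add: is_basis_def comp_def)
  have hom: "(\<lambda>f. gp gs (L f)) \<in> hom P (G\<lparr>carrier := E\<rparr>)"
  proof (rule homI)
    show "gp gs (L f) \<in> carrier (G\<lparr>carrier := E\<rparr>)" for f using gp_in[OF A gsE] by simp
    fix f h assume f: "f \<in> carrier P" and h: "h \<in> carrier P"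
    have "gp gs (L (f \<otimes>\<^bsub>P\<^esub> h)) = gp gs (L f) \<otimes> gp gs (L h)"
    proof (rule gp_add_mod[OF E gsE])
      fix i assume i: "i < length gs"
      have fi: "0 \<le> f i" "0 \<le> h i" using f h i by (auto simp: cP n_def PiE_def Pi_def)
      have "L (f \<otimes>\<^bsub>P\<^esub> h) ! i = nat ((f i + h i) mod int p)" using i by (simp add: L_def P_def n_def)
      also have "\<dots> = (nat (f i) + nat (h i)) mod p"
        using fi by (simp add: nat_mod_distrib nat_add_distrib)
      also have "\<dots> = (L f ! i + L h ! i) mod p" using i by (simp add: L_def n_def)
      finally show "L (f \<otimes>\<^bsub>P\<^esub> h) ! i mod p = (L f ! i + L h ! i) mod p" by simp
    qed (simp_all add: L_def n_def)
    thus "gp gs (L (f \<otimes>\<^bsub>P\<^esub> h)) = gp gs (L f) \<otimes>\<^bsub>G\<lparr>carrier := E\<rparr>\<^esub> gp gs (L h)" by simp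
  qed
  have gP: "group P" by (simp add: P_def)
  have "P \<cong> G\<lparr>carrier := E\<rparr>" unfolding is_iso_def iso_def using hom bij by auto
  hence "G\<lparr>carrier := E\<rparr> \<cong> P" by (rule group.iso_sym[OF gP])
  hence "elem_abelian_of_rank p n G E" using E by (simp add: elem_abelian_of_rank_def P_def eab_def)
  thus ?thesis using gs eab_Om[OF E] by (auto simp: n_def)
qed

lemma rank_imp_eab:
  assumes r: "elem_abelian_of_rank p n G E" shows "eab E" "card E = p ^ n"
proof -
  define P where "P = product_group {..<n} (\<lambda>_. integer_mod_group p)"
  have sE: "subgroup E G" using r by (simp add: elem_abelian_of_rank_def)
  obtain h where h: "h \<in> hom (G\<lparr>carrier := E\<rparr>) P" "bij_betw h E (carrier P)"
    using r by (auto simp: elem_abelian_of_rank_def is_iso_def iso_def P_def)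
  have cP: "carrier P = (\<Pi>\<^sub>E i\<in>{..<n}. {0..<int p})" using p_gt0 by (simp add: P_def carrier_integer_mod_group)
  have hm: "h (x \<otimes> y) = h x \<otimes>\<^bsub>P\<^esub> h y" if "x \<in> E" "y \<in> E" for x y using h(1) that by (auto simp: hom_def)
  have hx: "h x \<in> carrier P" if "x \<in> E" for x using h(2) that by (auto simp: bij_betw_def)
  have inj: "inj_on h E" using h(2) by (simp add: bij_betw_def)
  have comm: "x \<otimes> y = y \<otimes> x" if xy: "x \<in> E" "y \<in> E" for x y
  proof (rule inj_onD[OF inj])
    show "h (x \<otimes> y) = h (y \<otimes> x)" unfolding hm[OF xy] hm[OF xy(2,1)] by (simp add: P_def add.commute)
  qed (use xy subgroup.m_closed[OF sE] in auto)
  have pow: "i < n \<Longrightarrow> h (x [^] (k::nat)) i = (int k * h x i) mod int p" if x: "x \<in> E" for x i k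
  proof (induction k)
    case 0
    have one: "\<one> \<in> E" by (rule subgroup.one_closed[OF sE])
    have "h \<one> i = (h (\<one> \<otimes> \<one>)) i" by simp
    also have "\<dots> = (h \<one> i + h \<one> i) mod int p" unfolding hm[OF one one] using 0 by (simp add: P_def)
    finally have "h \<one> i = (h \<one> i + h \<one> i) mod int p" .
    hence "(h \<one> i + h \<one> i - h \<one> i) mod int p = (h \<one> i - h \<one> i) mod int p"
      by (metis mod_diff_left_eq)
    moreover have "0 \<le> h \<one> i" "h \<one> i < int p" using hx[OF one] 0 by (auto simp: cP PiE_def Pi_def)
    ultimately show ?case by simp
  next
    case (Suc k)
    have "h (x [^] Suc k) i = (h (x [^] k) i + h x i) mod int p"
      using hm[OF subgroup_nat_pow[OF sE x] x, of k] Suc.prems by (simp add: P_def)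
    also have "\<dots> = (int (Suc k) * h x i) mod int p" 
      using Suc by (simp add: mod_add_left_eq mod_add_right_eq algebra_simps)
    finally show ?case .
  qed
  have exp: "x [^] p = \<one>" if x: "x \<in> E" for x
  proof (rule inj_onD[OF inj])
    have xp: "x [^] p \<in> E" by (rule subgroup_nat_pow[OF sE x])
    have one: "\<one> \<in> E" by (rule subgroup.one_closed[OF sE])
    show "h (x [^] p) = h \<one>"
    proof (rule PiE_ext)
      show "h (x [^] p) \<in> (\<Pi>\<^sub>E i\<in>{..<n}. {0..<int p})" "h \<one> \<in> (\<Pi>\<^sub>E i\<in>{..<n}. {0..<int p})"
        using hx[OF xp] hx[OF one] by (auto simp: cP)
      fix i assume "i \<in> {..<n}"
      hence "h (x [^] p) i = (int p * h x i) mod int p" "h (x [^] (0::nat)) i = (int 0 * h x i) mod int p"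
        by (intro pow[OF x]; simp)+
      thus "h (x [^] p) i = h \<one> i" by simp
    qed
  qed (use subgroup_nat_pow[OF sE x] subgroup.one_closed[OF sE] in auto)
  show "eab E" using sE comm exp by (simp add: eab_def)
  have "card E = card (carrier P)" by (rule bij_betw_same_card[OF h(2)])
  thus "card E = p ^ n" by (simp add: cP card_PiE)
qed

lemma elem_abelian_iff: "elem_abelian p G E \<longleftrightarrow> eab E"
  unfolding elem_abelian_def using eab_imp_rank rank_imp_eab(1) by blast

lemma elem_rank_card: assumes "eab E" shows "card E = p ^ elem_rank p G E"
proof -
  obtain n where n: "elem_abelian_of_rank p n G E" "card E = p ^ n" using eab_imp_rank[OF assms] by blast
  have "elem_rank p G E = n" unfolding elem_rank_def
  proof (rule the_equality[where P = "\<lambda>n. elem_abelian_of_rank p n G E", OF n(1)])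
    fix k assume "elem_abelian_of_rank p k G E"
    hence "p ^ k = p ^ n" using rank_imp_eab(2) n(2) by simp
    thus "k = n" using p_gt1 by simp
  qed
  thus ?thesis using n by simp
qed

lemma eab_subset: "eab E \<Longrightarrow> E \<subseteq> carrier G"
  by (auto simp: eab_def dest: subgroup.subset)

lemma max_eab_exists:
  assumes "eab E" shows "\<exists>F. max_elem_abelian p G F \<and> E \<subseteq> F"
proof -
  let ?X = "{F. eab F \<and> E \<subseteq> F}"
  have "finite ?X" by (rule finite_subset[of _ "Pow (carrier G)"]) (auto simp: fin dest: eab_subset)
  moreover have "?X \<noteq> {}" using assms by blast
  ultimately have "\<exists>F\<in>?X. \<forall>C\<in>?X. F \<le> C \<longrightarrow> F = C" by (rule finite_has_maximal)
  then obtain F where F: "F \<in> ?X" "\<forall>C\<in>?X. F \<le> C \<longrightarrow> F = C" by (rule bexE)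
  have "C = F" if "eab C" "F \<subseteq> C" for C
  proof -
    have "C \<in> ?X" using that F(1) by blast
    thus ?thesis using F(2) that(2) by blast
  qed
  thus ?thesis using F(1) unfolding max_elem_abelian_def elem_abelian_iff by blast
qed

lemma max_eab_finite: "finite {E. max_elem_abelian p G E}"
  by (rule finite_subset[of _ "Pow (carrier G)"])
     (auto simp: fin max_elem_abelian_def elem_abelian_iff dest: eab_subset)

lemma max_eab_nonempty: "{E. max_elem_abelian p G E} \<noteq> {}"
proof -
  have "eab {\<one>}" using triv_subgroup by (auto simp: eab_def)
  thus ?thesis using max_eab_exists by blast
qed

text \<open>
  By Sylow's theorem \<open>G\<close> has an element of order \<open>p\<close>, and its powers form an elementary abelian subgroup.
\<close>

lemma max_eab_nontrivial:
  assumes d: "p dvd order G" and E: "max_elem_abelian p G E" shows "E \<noteq> {\<one>}"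
proof
  assume E1: "E = {\<one>}"
  obtain m where m: "order G = p ^ 1 * m" using d by auto
  obtain S where S: "subgroup S G" "card S = p ^ 1" using sylow_thm[OF prime_p is_group m fin] by blast
  have "\<exists>x\<in>S. x \<noteq> \<one>"
  proof (rule ccontr)
    assume "\<not> (\<exists>x\<in>S. x \<noteq> \<one>)"
    hence "S \<subseteq> {\<one>}" by auto
    hence "card S \<le> 1" using card_mono[of "{\<one>}" S] by simp
    thus False using S(2) p_gt1 by simp
  qed
  then obtain x where x: "x \<in> S" "x \<noteq> \<one>" by blast
  have xG: "x \<in> carrier G" using subgroup.mem_carrier[OF S(1) x(1)] .
  have xp: "x [^] p = \<one>"
  proof -
    have gS: "group (G\<lparr>carrier := S\<rparr>)" using subgroup.subgroup_is_group[OF S(1) is_group] .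
    have "x [^]\<^bsub>G\<lparr>carrier := S\<rparr>\<^esub> order (G\<lparr>carrier := S\<rparr>) = \<one>\<^bsub>G\<lparr>carrier := S\<rparr>\<^esub>"
      by (rule group.pow_order_eq_1[OF gS]) (use x in simp)
    thus ?thesis using S(2) by (simp add: order_def nat_pow_consistent[symmetric])
  qed
  define C where "C = range (\<lambda>n::nat. x [^] n)"
  have "eab C"
    unfolding eab_def
  proof (intro conjI ballI)
    show "subgroup C G"
    proof
      show "C \<subseteq> carrier G" using xG by (auto simp: C_def)
      show "\<one> \<in> C" unfolding C_def by (rule range_eqI[of _ _ 0]) simp
      show "a \<otimes> b \<in> C" if "a \<in> C" "b \<in> C" for a b using that xG by (auto simp: C_def nat_pow_mult)
      show "inv a \<in> C" if a: "a \<in> C" for a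
      proof -
        obtain n :: nat where n: "a = x [^] n" using a by (auto simp: C_def)
        have "(p - 1) * n + n = p * n" using p_gt0 by (cases p) auto
        hence "x [^] ((p - 1) * n) \<otimes> x [^] n = (x [^] p) [^] n" using xG by (simp add: nat_pow_mult nat_pow_pow)
        hence "inv a = x [^] ((p - 1) * n)" using xG xp n by (simp add: inv_equality)
        thus ?thesis by (auto simp: C_def)
      qed
    qed
    show "a \<otimes> b = b \<otimes> a" if "a \<in> C" "b \<in> C" for a b
      using that xG by (auto simp: C_def nat_pow_mult add.commute)
    show "a [^] p = \<one>" if "a \<in> C" for a
    proof -
      obtain n :: nat where n: "a = x [^] n" using \<open>a \<in> C\<close> by (auto simp: C_def)
      have "a [^] p = (x [^] p) [^] n" using xG by (simp add: n nat_pow_pow mult.commute)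
      thus ?thesis by (simp add: xp)
    qed
  qed
  moreover have "E \<subseteq> C" unfolding E1 C_def using nat_pow_0 by (auto intro: range_eqI[of _ _ 0])
  ultimately have "C = E" using E unfolding max_elem_abelian_def elem_abelian_iff by blast
  moreover have "x \<in> C" unfolding C_def using xG by (intro range_eqI[of _ _ 1]) simp
  ultimately show False using E1 x by blast
qed

end

section \<open>Generic elements\<close>

text \<open>
  Over a finite field the product of all linear factors plus one has no root.
\<close>

lemma infinite_alg_closed: "infinite (UNIV :: 'a::alg_closed_field set)"
proof
  assume fin: "finite (UNIV :: 'a set)"
  define P :: "'a poly" where "P = (\<Prod>a\<in>UNIV. [:- a, 1:]) + 1"
  have d: "degree (\<Prod>a\<in>UNIV. [:- a, 1::'a:]) = card (UNIV :: 'a set)"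
    by (subst degree_prod_eq_sum_degree) auto
  have "card (UNIV :: 'a set) > 0" using fin by (simp add: card_gt_0_iff)
  hence "degree P > 0" unfolding P_def using d by (subst degree_add_eq_left) auto
  then obtain x where "poly P x = 0" using alg_closed_imp_poly_has_root by blast
  moreover have "poly (\<Prod>a\<in>UNIV. [:- a, 1::'a:]) x = 0"
    unfolding poly_prod using fin by (subst prod_zero_iff) auto
  ultimately show False by (simp add: P_def)
qed

text \<open>
  Put \<open>c e = z ^ idx e\<close>. Each forbidden relation is a non-zero polynomial equation for \<open>z\<close>, and there are
  finitely many of them.
\<close>

lemma generic_coefficients:
  assumes inf: "infinite (UNIV :: 'k::field set)" and E: "finite E" and F: "finite F"
  shows "\<exists>c :: 'e \<Rightarrow> 'k. \<forall>\<psi>. (\<forall>e\<in>E. \<psi> e \<in> F) \<and> (\<exists>e\<in>E. \<psi> e \<noteq> 0) \<longrightarrow> (\<Sum>e\<in>E. c e * \<psi> e) \<noteq> 0"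
proof -
  obtain idx :: "'e \<Rightarrow> nat" where idx: "inj_on idx E" using finite_imp_inj_to_nat_seg[OF E] by blast
  define P where "P \<psi> = (\<Sum>e\<in>E. Polynomial.monom (\<psi> e) (idx e))" for \<psi> :: "'e \<Rightarrow> 'k"
  have co: "Polynomial.coeff (P \<psi>) (idx e) = \<psi> e" if e: "e \<in> E" for \<psi> e
  proof -
    have "Polynomial.coeff (P \<psi>) (idx e) = (\<Sum>a\<in>E. if a = e then \<psi> e else 0)"
      unfolding P_def coeff_sum using idx e by (intro sum.cong) (auto dest: inj_onD)
    thus ?thesis using e E by simp
  qed
  define Z where "Z = (\<Union>\<psi>\<in>{\<psi> \<in> PiE E (\<lambda>_. F). P \<psi> \<noteq> 0}. {x. poly (P \<psi>) x = 0})"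
  have "finite (PiE E (\<lambda>_. F))" using E F by (intro finite_PiE) auto
  hence "finite Z" unfolding Z_def by (intro finite_UN_I) (auto simp: poly_roots_finite)
  then obtain z where z: "z \<notin> Z" using inf ex_new_if_finite by blast
  have "(\<Sum>e\<in>E. z ^ idx e * \<psi> e) \<noteq> 0" if \<psi>: "\<forall>e\<in>E. \<psi> e \<in> F" "\<exists>e\<in>E. \<psi> e \<noteq> 0" for \<psi>
  proof -
    define \<psi>' where "\<psi>' = restrict \<psi> E"
    have "\<psi>' \<in> PiE E (\<lambda>_. F)" using \<psi>(1) by (auto simp: \<psi>'_def)
    moreover have "P \<psi>' \<noteq> 0"
    proof
      assume "P \<psi>' = 0"
      hence "\<psi>' e = 0" if "e \<in> E" for e using co[OF that, of \<psi>'] by simp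
      thus False using \<psi>(2) by (auto simp: \<psi>'_def)
    qed
    ultimately have "poly (P \<psi>') z \<noteq> 0" using z by (auto simp: Z_def)
    moreover have "poly (P \<psi>') z = (\<Sum>e\<in>E. z ^ idx e * \<psi> e)"
      unfolding P_def poly_sum by (rule sum.cong) (auto simp: poly_monom \<psi>'_def)
    ultimately show ?thesis by simp
  qed
  thus ?thesis by (intro exI[of _ "\<lambda>e. z ^ idx e"]) blast
qed

context fin_group_alg begin

text \<open>
  A maximal proper subgroup \<open>B\<close> of \<open>E\<close> containing \<open>D\<close> has index \<open>p\<close>; \<open>\<phi>\<close> reads off the exponent of \<open>g\<close>
  in the decomposition of \<open>E\<close> into \<open>B\<close> and the powers of some \<open>g\<close> outside \<open>B\<close>.
\<close>

lemma eab_functional: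
  assumes E: "eab E" and D: "subgroup D G" "D \<subseteq> E" "D \<noteq> E"
  shows "\<exists>\<phi> :: 'g \<Rightarrow> 'k. (\<forall>x\<in>E. \<forall>y\<in>E. \<phi> (x \<otimes> y) = \<phi> x + \<phi> y) \<and> (\<forall>x\<in>D. \<phi> x = 0) \<and>
    (\<forall>x\<in>E. \<phi> x \<in> of_nat ` {..<p}) \<and> (\<exists>x\<in>E. \<phi> x \<noteq> 0)"
proof -
  note A = eab_abp[OF E] and EG = eab_subset[OF E]
  let ?X = "{B. abp B \<and> D \<subseteq> B \<and> B \<subseteq> E \<and> B \<noteq> E}"
  have "finite ?X" by (rule finite_subset[of _ "Pow E"]) (auto simp: finite_subset[OF EG fin])
  moreover have "D \<in> ?X" using abp_mono[OF A D(1,2)] D by blast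
  hence "?X \<noteq> {}" by blast
  ultimately have "\<exists>B\<in>?X. \<forall>C\<in>?X. B \<le> C \<longrightarrow> B = C" by (rule finite_has_maximal)
  then obtain B where BX: "B \<in> ?X" and Bmax: "\<forall>C\<in>?X. B \<le> C \<longrightarrow> B = C" by (rule bexE)
  have B: "abp B" "B \<subseteq> E" "B \<noteq> E" "D \<subseteq> B" using BX by auto
  obtain g where g: "g \<in> E" "g \<notin> B" using B by blast
  have gG: "g \<in> carrier G" using g EG by blast
  define S where "S = {c \<otimes> g [^] j |c (j::nat). c \<in> B}"
  have S: "abp S" unfolding S_def by (rule abp_adjoin[OF A B(1,2) g(1)])
  have BS: "c \<otimes> g [^] (j::nat) \<in> S" if "c \<in> B" for c j using that by (auto simp: S_def)
  have "B \<subseteq> S" using BS[of _ 0] abp_in[OF B(1)] by force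
  moreover have gS: "g \<in> S" using BS[OF abp_one[OF B(1)], of 1] gG by simp
  moreover have "S \<subseteq> E" using B abp_mult[OF A] abp_pow[OF A g(1)] by (auto simp: S_def)
  ultimately have SE: "S = E" using Bmax S B(4) g(2) by blast
  have gB: "p dvd n" if "g [^] n \<in> B" for n :: nat
  proof (rule ccontr)
    assume "\<not> p dvd n"
    hence "coprime n p" using prime_imp_coprime[OF prime_p] by (simp add: coprime_commute)
    then obtain d where d: "[n * d = 1] (mod p)" using cong_solve_coprime_nat by (metis One_nat_def)
    have "ord g dvd p" using E g(1) pow_eq_id[OF gG] by (auto simp: eab_def)
    hence "[n * d = 1] (mod ord g)" using d by (metis cong_dvd_modulus_nat)
    hence "g [^] (n * d) = g [^] (1::nat)"
      using pow_mod_ord[OF gG, of "n * d"] pow_mod_ord[OF gG, of 1] by (simp add: cong_def)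
    hence "g = (g [^] n) [^] d" using gG by (simp add: nat_pow_pow)
    thus False using abp_pow[OF B(1) that, of d] g(2) by simp
  qed
  define \<phi> where "\<phi> x = (of_nat (SOME n. \<exists>b\<in>B. x = b \<otimes> g [^] n) :: 'k)" for x
  have le: "p dvd n - m" if e: "b \<otimes> g [^] n = c \<otimes> g [^] m" and bc: "b \<in> B" "c \<in> B" and mn: "m \<le> n" for b c and n m :: nat
  proof -
    have G: "b \<in> carrier G" "c \<in> carrier G" using bc abp_in[OF B(1)] by auto
    have "g [^] n = g [^] (n - m) \<otimes> g [^] m" using mn gG by (simp add: nat_pow_mult)
    hence "b \<otimes> g [^] (n - m) \<otimes> g [^] m = c \<otimes> g [^] m" using e G gG by (simp add: m_assoc)
    hence "b \<otimes> g [^] (n - m) = c" using G gG by simp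
    hence "g [^] (n - m) = inv b \<otimes> c" using G gG by (auto simp: m_assoc[symmetric])
    hence "g [^] (n - m) \<in> B" using abp_mult[OF B(1) abp_inv[OF B(1) bc(1)] bc(2)] by simp
    thus ?thesis by (rule gB)
  qed
  have ofn: "(of_nat n :: 'k) = of_nat m" if "p dvd n - m" "m \<le> n" for n m
  proof -
    have "(of_nat (n - m) :: 'k) = 0" using that(1) by (simp add: of_nat_eq_0_iff_char_dvd char_p)
    thus ?thesis using that(2) by (simp add: of_nat_diff)
  qed
  have \<phi>: "\<phi> (b \<otimes> g [^] n) = of_nat n" if b: "b \<in> B" for b n
  proof -
    define m :: nat where "m = (SOME m. \<exists>c\<in>B. b \<otimes> g [^] n = c \<otimes> g [^] m)"
    have "\<exists>c\<in>B. b \<otimes> g [^] n = c \<otimes> g [^] m" 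
      unfolding m_def by (rule someI[of "\<lambda>m::nat. \<exists>c\<in>B. b \<otimes> g [^] n = c \<otimes> g [^] m" n]) (use b in blast)
    then obtain c where c: "c \<in> B" "b \<otimes> g [^] n = c \<otimes> g [^] m" by blast
    have "(of_nat m :: 'k) = of_nat n"
    proof (cases "m \<le> n")
      case True thus ?thesis using ofn[OF le[OF c(2) b c(1) True] True] by simp
    next
      case False
      hence "n \<le> m" by simp
      thus ?thesis using ofn[OF le[OF c(2)[symmetric] c(1) b]] by blast
    qed
    thus ?thesis by (simp add: \<phi>_def m_def)
  qed
  have dec: "\<exists>b n. b \<in> B \<and> x = b \<otimes> g [^] (n::nat)" if "x \<in> E" for x using that SE by (auto simp: S_def)
  show ?thesis
  proof (intro exI[of _ \<phi>] conjI ballI)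
    fix x y assume x: "x \<in> E" and y: "y \<in> E"
    obtain b n c m where b: "b \<in> B" "x = b \<otimes> g [^] (n::nat)" and c: "c \<in> B" "y = c \<otimes> g [^] (m::nat)"
      using dec[OF x] dec[OF y] by blast
    have "x \<otimes> y = (b \<otimes> c) \<otimes> (g [^] n \<otimes> g [^] m)" unfolding b c
      by (rule abp_ac[OF A _ abp_pow[OF A g(1)] _ abp_pow[OF A g(1)]]) (use b c B in auto)
    hence "x \<otimes> y = (b \<otimes> c) \<otimes> g [^] (n + m)" using gG by (simp add: nat_pow_mult)
    thus "\<phi> (x \<otimes> y) = \<phi> x + \<phi> y" using \<phi>[OF abp_mult[OF B(1) b(1) c(1)]] \<phi>[OF b(1)] \<phi>[OF c(1)] b c by simp
  next
    fix x assume "x \<in> D"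
    hence "x \<in> B" using B by auto
    thus "\<phi> x = 0" using \<phi>[of x 0] abp_in[OF B(1)] by simp
  next
    fix x assume "x \<in> E"
    then obtain b n where b: "b \<in> B" "x = b \<otimes> g [^] (n::nat)" using dec by blast
    have "\<phi> x = of_nat (n mod p)" using \<phi>[OF b(1)] b(2) ofn[of "n mod p" n]
      by (metis dvd_minus_mod mod_less_eq_dividend ofn)
    thus "\<phi> x \<in> of_nat ` {..<p}" using p_gt0 by simp
  next
    show "\<exists>x\<in>E. \<phi> x \<noteq> 0" using \<phi>[OF abp_one[OF B(1)], of 1] gG g(1) by (intro bexI[of _ g]) auto
  qed
qed

text \<open>
  No non-trivial linear relation over the prime field, which is \<open>of_nat ` {..<p}\<close>. The
  functionals on \<open>E\<close> of \<open>eab_functional\<close> take their values there.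
\<close>

definition generic :: "'g set \<Rightarrow> ('g \<Rightarrow> 'k) \<Rightarrow> bool" where
  "generic E c \<longleftrightarrow> (\<forall>\<psi>. (\<forall>e\<in>E. \<psi> e \<in> of_nat ` {..<p}) \<and> (\<exists>e\<in>E. \<psi> e \<noteq> 0) \<longrightarrow> (\<Sum>e\<in>E. c e * \<psi> e) \<noteq> 0)"

definition gen_elt :: "'g set \<Rightarrow> ('g \<Rightarrow> 'k) \<Rightarrow> 'g \<Rightarrow> 'k" where
  "gen_elt E c = (\<Sum>e\<in>E. fscale (c e) (dl e - dl \<one>))"

lemma gen_elt_kS: "eab E \<Longrightarrow> gen_elt E c \<in> kS E"
  unfolding gen_elt_def
  by (intro fvs.subspace_sum fvs.subspace_scale fvs.subspace_diff subspace_supp dl_kS)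
     (auto simp: eab_def subgroup.one_closed)

lemma gen_elt_pw: assumes E: "eab E" shows "pw (gen_elt E c) p = 0"
proof -
  have fE: "finite E" using finite_subset[OF eab_subset[OF E] fin] .
  have 1: "\<one> \<in> E" using abp_one[OF eab_abp[OF E]] .
  have "pw (gen_elt E c) (p ^ 1) = 0"
  proof (rule pw_augmentation_zero[OF eab_abp[OF E] gen_elt_kS[OF E]])
    have "(\<Sum>b\<in>E. gen_elt E c b) = (\<Sum>e\<in>E. c e * (\<Sum>b\<in>E. (dl e - dl \<one>) b))"
      unfolding gen_elt_def by (simp add: sum_distrib_left) (rule sum.swap)
    also have "\<dots> = 0" by (rule sum.neutral) (use fE 1 in \<open>auto simp: sum_subtractf dl_def\<close>)
    finally show "(\<Sum>b\<in>E. gen_elt E c b) = 0" .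
    show "a [^] (p ^ 1) = \<one>" if "a \<in> E" for a using E that by (simp add: eab_def)
  qed
  thus ?thesis by simp
qed

lemma gen_elt_conv:
  assumes E: "eab E" and m: "m \<in> kS (carrier G)" and y: "y \<in> carrier G"
  shows "(gen_elt E c \<star> m) y = (\<Sum>e\<in>E. c e * (m (inv e \<otimes> y) - m y))"
proof -
  have "(gen_elt E c \<star> m) y = (\<Sum>e\<in>E. c e * ((dl e \<star> m) y - (dl \<one> \<star> m) y))"
    unfolding gen_elt_def conv_left by simp
  also have "\<dots> = (\<Sum>e\<in>E. c e * (m (inv e \<otimes> y) - m y))"
    using eab_subset[OF E] y by (intro sum.cong refl) (auto simp: dl_conv subset_iff one_conv[OF m])
  finally show ?thesis .
qed

text \<open>
  Let \<open>D\<close> be the subgroup of those \<open>e\<close> with \<open>e x L = x L\<close>. It is proper, so some non-zero functional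
  \<open>\<phi>\<close> on \<open>E\<close> kills it, and \<open>\<lambda> (e x l) = \<phi> e\<close> is a well-defined function on the double coset. Multiplication by
  \<open>\<lambda>\<close> has with \<open>v = \<Sum> c\<^sub>e (e - 1)\<close> the commutator \<open>- \<Sum> c\<^sub>e (\<phi> e) e\<close>, whose \<open>p\<close>-th power is the scalar
  \<open>- (\<Sum> c\<^sub>e (\<phi> e))\<^sup>p\<close>. This is non-zero by genericity, so the commutator is a unit commuting with \<open>v\<close>
  and after division by it the Weyl relation holds.
\<close>

lemma generic_local_exact:
  assumes E: "eab E" and L: "subgroup L G" and x: "x \<in> carrier G"
    and ne: "\<exists>e\<in>E. inv x \<otimes> e \<otimes> x \<notin> L" and c: "generic E c"
    and m: "m \<in> rinv L" "gen_elt E c \<star> m = 0"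
  shows "\<exists>n\<in>rinv L. \<forall>y\<in>dcoset E L x. (pw (gen_elt E c) (p - 1) \<star> n) y = m y"
proof -
  note A = eab_abp[OF E] and EG = eab_subset[OF E]
  note sE = abp_subgroup[OF A] and LG = subgroup.subset[OF L]
  define v where "v = gen_elt E c"
  have vE: "v \<in> kS E" unfolding v_def by (rule gen_elt_kS[OF E])
  define C where "C = dcoset E L x"
  have CG: "C \<subseteq> carrier G" unfolding C_def by (rule dcoset_sub(1)[OF sE L x])
  have Cl: "e \<otimes> y \<in> C" if "e \<in> E" "y \<in> C" for e y
    using dcoset_closed[OF sE L x, of y e \<one>] that subgroup.one_closed[OF L] EG CG by (auto simp: C_def subset_iff)
  have Cr: "y \<otimes> l \<in> C" if "l \<in> L" "y \<in> C" for l y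
    using dcoset_closed[OF sE L x, of y \<one> l] that subgroup.one_closed[OF sE] LG CG by (auto simp: C_def subset_iff)
  have Cl_iff: "inv e \<otimes> y \<in> C \<longleftrightarrow> y \<in> C" if e: "e \<in> E" and y: "y \<in> carrier G" for e y
  proof
    assume "inv e \<otimes> y \<in> C"
    hence "e \<otimes> (inv e \<otimes> y) \<in> C" by (rule Cl[OF e])
    thus "y \<in> C" using e y EG by (simp add: m_assoc[symmetric] subset_iff)
  qed (rule Cl[OF abp_inv[OF A e]])
  have Cr_iff: "y \<otimes> l \<in> C \<longleftrightarrow> y \<in> C" if l: "l \<in> L" and y: "y \<in> carrier G" for l y
  proof
    assume "y \<otimes> l \<in> C"
    hence "(y \<otimes> l) \<otimes> inv l \<in> C" by (rule Cr[OF subgroup.m_inv_closed[OF L l]])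
    thus "y \<in> C" using l y LG by (simp add: m_assoc subset_iff)
  qed (rule Cr[OF l])
  define D where "D = {e \<in> E. inv x \<otimes> e \<otimes> x \<in> L}"
  have conj_mult: "inv x \<otimes> (a \<otimes> b) \<otimes> x = (inv x \<otimes> a \<otimes> x) \<otimes> (inv x \<otimes> b \<otimes> x)"
    if "a \<in> carrier G" "b \<in> carrier G" for a b
    using that x by (simp add: m_assoc) (simp add: m_assoc[symmetric])
  have sD: "subgroup D G"
  proof
    show "D \<subseteq> carrier G" using EG by (auto simp: D_def)
    show "\<one> \<in> D" using x subgroup.one_closed[OF L] abp_one[OF A] by (simp add: D_def)
    show "a \<otimes> b \<in> D" if "a \<in> D" "b \<in> D" for a b
      using that conj_mult subgroup.m_closed[OF L] abp_mult[OF A] EG by (auto simp: D_def subset_iff)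
    show "inv a \<in> D" if a: "a \<in> D" for a
    proof -
      have aG: "a \<in> carrier G" using a EG by (auto simp: D_def)
      have "inv x \<otimes> inv a \<otimes> x = inv (inv x \<otimes> a \<otimes> x)" using aG x by (simp add: inv_mult_group m_assoc)
      thus ?thesis using a subgroup.m_inv_closed[OF L] abp_inv[OF A] by (auto simp: D_def)
    qed
  qed
  have "D \<subseteq> E" "D \<noteq> E" using ne by (auto simp: D_def)
  from eab_functional[OF E sD this] obtain \<phi> :: "'g \<Rightarrow> 'k" where \<phi>: "\<And>a b. a \<in> E \<Longrightarrow> b \<in> E \<Longrightarrow> \<phi> (a \<otimes> b) = \<phi> a + \<phi> b"
      "\<And>a. a \<in> D \<Longrightarrow> \<phi> a = 0" "\<forall>a\<in>E. \<phi> a \<in> of_nat ` {..<p}" "\<exists>a\<in>E. \<phi> a \<noteq> 0"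
    by blast
  have \<phi>inv: "\<phi> (inv a) = - \<phi> a" if "a \<in> E" for a
  proof -
    have "\<phi> (inv a \<otimes> a) = \<phi> (inv a) + \<phi> a" by (rule \<phi>(1)[OF abp_inv[OF A that] that])
    moreover have "\<phi> (\<one> \<otimes> \<one>) = \<phi> \<one> + \<phi> \<one>" by (rule \<phi>(1)[OF abp_one[OF A] abp_one[OF A]])
    hence "\<phi> \<one> = 0" unfolding l_one[OF one_closed] by (metis add_cancel_right_right)
    ultimately show ?thesis using that EG by (simp add: subset_iff eq_neg_iff_add_eq_0)
  qed
  define lam where "lam y = \<phi> (SOME e. e \<in> E \<and> (\<exists>l\<in>L. y = e \<otimes> x \<otimes> l))" for y
  have lam: "lam (e \<otimes> x \<otimes> l) = \<phi> e" if e: "e \<in> E" and l: "l \<in> L" for e l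
  proof -
    define e' where "e' = (SOME e'. e' \<in> E \<and> (\<exists>l'\<in>L. e \<otimes> x \<otimes> l = e' \<otimes> x \<otimes> l'))"
    have "e' \<in> E \<and> (\<exists>l'\<in>L. e \<otimes> x \<otimes> l = e' \<otimes> x \<otimes> l')" 
      unfolding e'_def
      by (rule someI[of "\<lambda>e'. e' \<in> E \<and> (\<exists>l'\<in>L. e \<otimes> x \<otimes> l = e' \<otimes> x \<otimes> l')" e]) (use e l in blast)
    then obtain l' where e': "e' \<in> E" "l' \<in> L" "e \<otimes> x \<otimes> l = e' \<otimes> x \<otimes> l'" by blast
    have G: "e \<in> carrier G" "l \<in> carrier G" "e' \<in> carrier G" "l' \<in> carrier G" using e l e' EG LG by auto
    have "e \<otimes> x = (e' \<otimes> x \<otimes> l') \<otimes> inv l"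
      using inv_solve_right[of "e \<otimes> x" "e' \<otimes> x \<otimes> l'" l] e'(3) G x by simp
    hence "inv e' \<otimes> (e \<otimes> x) = x \<otimes> (l' \<otimes> inv l)" using G x by (simp add: m_assoc inv_solve_left')
    hence "inv x \<otimes> (inv e' \<otimes> e) \<otimes> x = l' \<otimes> inv l" using G x by (simp add: m_assoc inv_solve_left')
    hence "inv e' \<otimes> e \<in> D" using abp_mult[OF A abp_inv[OF A e'(1)] e] subgroup.m_closed[OF L e'(2) subgroup.m_inv_closed[OF L l]]
      by (simp add: D_def)
    hence "\<phi> (inv e' \<otimes> e) = 0" by (rule \<phi>(2))
    hence "\<phi> e' = \<phi> e" using \<phi>(1)[OF abp_inv[OF A e'(1)] e] \<phi>inv[OF e'(1)] by simp
    thus ?thesis by (simp add: lam_def e'_def)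
  qed
  have lam_l: "lam (inv e \<otimes> y) = lam y - \<phi> e" if e: "e \<in> E" and y: "y \<in> C" for e y
  proof -
    obtain a l where a: "y = a \<otimes> x \<otimes> l" "a \<in> E" "l \<in> L" using y by (auto simp: C_def dcoset_def)
    have G: "e \<in> carrier G" "l \<in> carrier G" "a \<in> carrier G" using e a EG LG by auto
    have "inv e \<otimes> y = (inv e \<otimes> a) \<otimes> x \<otimes> l" using G x by (simp add: a m_assoc)
    hence "lam (inv e \<otimes> y) = \<phi> (inv e \<otimes> a)" using lam[OF abp_mult[OF A abp_inv[OF A e] a(2)] a(3)] by simp
    thus ?thesis using \<phi>(1)[OF abp_inv[OF A e] a(2)] \<phi>inv[OF e] lam[OF a(2,3)] a(1) by simp
  qed
  have lam_r: "lam (y \<otimes> l) = lam y" if l: "l \<in> L" and y: "y \<in> C" for l y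
  proof -
    obtain a l' where a: "y = a \<otimes> x \<otimes> l'" "a \<in> E" "l' \<in> L" using y by (auto simp: C_def dcoset_def)
    have G: "l \<in> carrier G" "l' \<in> carrier G" "a \<in> carrier G" using l a EG LG by auto
    have "y \<otimes> l = a \<otimes> x \<otimes> (l' \<otimes> l)" using G x by (simp add: a m_assoc)
    thus ?thesis using lam[OF a(2) subgroup.m_closed[OF L a(3) l]] lam[OF a(2,3)] a(1) by simp
  qed
  \<comment> \<open>The summand of the permutation module that is supported on the double coset.\<close>
  define V where "V = {f \<in> rinv L. \<forall>y. y \<notin> C \<longrightarrow> f y = 0}"
  have sV: "fvs.subspace V"
    unfolding V_def using fvs.subspace_0[OF rinv_subspace] fvs.subspace_add[OF rinv_subspace] fvs.subspace_scale[OF rinv_subspace]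
    by (simp add: fvs.subspace_def)
  have aV: "addsub V" by (rule addsub_subspace[OF sV])
  have VG: "f \<in> kS (carrier G)" if "f \<in> V" for f using that rinv_sub by (auto simp: V_def)
  have convV: "f \<star> w \<in> V" if f: "f \<in> kS E" and w: "w \<in> V" for f w
  proof -
    have "(f \<star> w) y = 0" if y: "y \<notin> C" for y
    proof (cases "y \<in> carrier G")
      case True
      have "f e * w (inv e \<otimes> y) = 0" if "e \<in> carrier G" for e
      proof (cases "e \<in> E")
        case True
        thus ?thesis using Cl_iff[OF True \<open>y \<in> carrier G\<close>] y w by (simp add: V_def)
      qed (use f in \<open>simp add: supp_in_def\<close>)
      thus ?thesis unfolding conv_apply[OF True] by (intro sum.neutral) blast
    qed (simp add: conv_outside)
    thus ?thesis using rinv_conv[OF LG] w by (simp add: V_def)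
  qed
  have eV: "endo V ((\<star>) f)" if "f \<in> kS E" for f
    using convV[OF that] by (auto simp: endo_def conv_right)
  define la where "la f = (\<lambda>y. if y \<in> C then lam y * f y else 0)" for f :: "'g \<Rightarrow> 'k"
  have laV: "la f \<in> V" if f: "f \<in> V" for f
  proof -
    have "la f (y \<otimes> l) = la f y" if y: "y \<in> carrier G" and l: "l \<in> L" for y l
      using f y l lam_r[OF l] Cr_iff[OF l y] by (simp add: la_def V_def rinv_def)
    thus ?thesis using CG by (auto simp: V_def rinv_def la_def supp_in_def)
  qed
  have ela: "endo V la" using laV by (auto simp: endo_def la_def fun_eq_iff algebra_simps)
  \<comment> \<open>The commutator of \<open>v\<close> with multiplication by \<open>lam\<close>, as an element of the group algebra of \<open>E\<close>.\<close>
  define dd where "dd = (\<Sum>e\<in>E. fscale (- (c e * \<phi> e)) (dl e))"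
  have ddE: "dd \<in> kS E" unfolding dd_def by (intro fvs.subspace_sum fvs.subspace_scale subspace_supp dl_kS)
  have fE: "finite E" using finite_subset[OF EG fin] .
  have dd_e: "dd e = - (c e * \<phi> e)" if "e \<in> E" for e
  proof -
    have "dd e = (\<Sum>a\<in>E. if a = e then - (c e * \<phi> e) else 0)"
      unfolding dd_def sum_fun_apply by (rule sum.cong) (auto simp: dl_def)
    thus ?thesis using fE that by simp
  qed
  have comm1: "v \<star> la f - la (v \<star> f) = dd \<star> f" if f: "f \<in> V" for f
  proof (rule conv_eqI[OF _ conv_kS_G])
    show "v \<star> la f - la (v \<star> f) \<in> kS (carrier G)"
      using VG[OF addsub_diff[OF aV convV[OF vE laV[OF f]] laV[OF convV[OF vE f]]]] .
    fix y assume y: "y \<in> carrier G"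
    show "(v \<star> la f - la (v \<star> f)) y = (dd \<star> f) y"
    proof (cases "y \<in> C")
      case True
      have "(v \<star> la f - la (v \<star> f)) y =
          (\<Sum>e\<in>E. c e * (la f (inv e \<otimes> y) - la f y)) - lam y * (\<Sum>e\<in>E. c e * (f (inv e \<otimes> y) - f y))"
        using True unfolding v_def by (simp add: la_def gen_elt_conv[OF E VG[OF f] y] gen_elt_conv[OF E VG[OF laV[OF f], unfolded la_def] y])
      also have "\<dots> = (\<Sum>e\<in>E. c e * (la f (inv e \<otimes> y) - la f y) - lam y * (c e * (f (inv e \<otimes> y) - f y)))"
        by (simp add: sum_subtractf sum_distrib_left)
      also have "\<dots> = (\<Sum>e\<in>E. - (c e * \<phi> e) * f (inv e \<otimes> y))"
      proof (rule sum.cong[OF refl])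
        fix e assume e: "e \<in> E"
        have la_eq: "la f (inv e \<otimes> y) = (lam y - \<phi> e) * f (inv e \<otimes> y)" "la f y = lam y * f y"
          using True Cl_iff[OF e y] lam_l[OF e True] by (simp_all add: la_def)
        show "c e * (la f (inv e \<otimes> y) - la f y) - lam y * (c e * (f (inv e \<otimes> y) - f y)) = - (c e * \<phi> e) * f (inv e \<otimes> y)"
          unfolding la_eq by (simp add: algebra_simps)
      qed
      also have "\<dots> = (dd \<star> f) y"
        unfolding dd_def conv_left using EG y by (simp add: dl_conv subset_iff)
      finally show ?thesis .
    next
      case False
      thus ?thesis using addsub_diff[OF aV convV[OF vE laV[OF f]] laV[OF convV[OF vE f]]] convV[OF ddE f]
        by (simp add: V_def)
    qed
  qed
  define s where "s = (\<Sum>e\<in>E. dd e) ^ p"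
  have s0: "s \<noteq> 0"
  proof -
    have "(\<Sum>e\<in>E. dd e) = - (\<Sum>e\<in>E. c e * \<phi> e)" by (simp add: dd_e sum_negf)
    moreover have "(\<Sum>e\<in>E. c e * \<phi> e) \<noteq> 0" using c \<phi>(3,4) unfolding generic_def by blast
    ultimately show ?thesis by (simp add: s_def)
  qed
  have ddp: "pw dd p = fscale s (dl \<one>)"
  proof -
    have "pw dd (p ^ 1) = (\<Sum>a\<in>E. fscale (dd a ^ (p ^ 1)) (dl (a [^] (p ^ 1))))" by (rule pw_char_power[OF A ddE])
    also have "\<dots> = (\<Sum>a\<in>E. fscale (dd a ^ (p ^ 1)) (dl \<one>))" using E by (intro sum.cong) (auto simp: eab_def)
    also have "\<dots> = fscale ((\<Sum>a\<in>E. dd a) ^ (p ^ 1)) (dl \<one>)" by (simp only: frob_sum fvs.scale_sum_left)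
    finally show ?thesis by (simp add: s_def)
  qed
  \<comment> \<open>The inverse of \<open>dd\<close>, because \<open>dd\<^sup>p\<close> is the scalar \<open>s\<close>.\<close>
  define di where "di = fscale (inverse s) (pw dd (p - 1))"
  have diE: "di \<in> kS E" unfolding di_def by (intro fvs.subspace_scale subspace_supp pw_kS[OF sE ddE])
  have didd: "di \<star> dd = dl \<one>"
  proof -
    have 1: "di \<star> dd = dd \<star> di" by (rule conv_comm_abp[OF A diE ddE])
    have 2: "dd \<star> di = fscale (inverse s) (pw dd (Suc (p - 1)))" unfolding di_def conv_right pw_Suc ..
    have 3: "Suc (p - 1) = p" using p_gt0 by simp
    show ?thesis unfolding 1 2 3 ddp fvs.scale_scale using s0 by simp
  qed
  have "p_exact p V ((\<star>) v)"
  proof (rule p_exact_if_commutator_one[OF aV eV[OF vE] _ _ prime_p of_nat_p])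
    show "endo V (\<lambda>f. di \<star> la f)" by (rule endo_comp[OF eV[OF diE] ela])
    fix f assume f: "f \<in> V"
    have "v \<star> (di \<star> la f) = di \<star> (v \<star> la f)"
      using conv_comm_abp[OF A vE diE] by (simp add: conv_assoc[symmetric])
    hence "v \<star> (di \<star> la f) - di \<star> la (v \<star> f) = di \<star> (v \<star> la f - la (v \<star> f))" by (simp only: conv_right)
    also have "\<dots> = (di \<star> dd) \<star> f" unfolding comm1[OF f] conv_assoc ..
    also have "\<dots> = f" unfolding didd by (rule one_conv[OF VG[OF f]])
    finally show "v \<star> (di \<star> la f) - di \<star> la (v \<star> f) = f" .
  qed
  note exV = this
  define m1 where "m1 y = (if y \<in> C then m y else 0)" for y
  have m1V: "m1 \<in> V"
  proof -
    have "m1 (y \<otimes> l) = m1 y" if "y \<in> carrier G" "l \<in> L" for y l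
      using Cr_iff[OF that(2,1)] m(1) that by (simp add: m1_def rinv_def)
    thus ?thesis using CG by (auto simp: V_def rinv_def supp_in_def m1_def)
  qed
  have mG: "m \<in> kS (carrier G)" using m(1) rinv_sub by blast
  have "v \<star> m1 = 0"
  proof
    fix y show "(v \<star> m1) y = 0 y"
    proof (cases "y \<in> C")
      case True
      hence y: "y \<in> carrier G" using CG by auto
      have "(v \<star> m1) y = (v \<star> m) y"
        unfolding v_def gen_elt_conv[OF E VG[OF m1V] y] gen_elt_conv[OF E mG y]
        using True Cl_iff[OF _ y] by (intro sum.cong) (auto simp: m1_def)
      thus ?thesis using m(2) by (simp add: v_def)
    qed (use convV[OF vE m1V] in \<open>simp add: V_def\<close>)
  qed
  then obtain n where n: "n \<in> V" "m1 = ((\<star>) v ^^ (p - 1)) n" using exV m1V unfolding p_exact_def by blast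
  have "m1 = pw v (p - 1) \<star> n" using n(2) conv_funpow[OF VG[OF n(1)]] by simp
  hence "(pw v (p - 1) \<star> n) y = m y" if "y \<in> C" for y using that by (metis m1_def)
  thus ?thesis using n(1) by (auto simp: V_def v_def C_def)
qed

lemma generic_exact:
  assumes E: "eab E" and L: "subgroup L G" and c: "generic E c"
    and ne: "\<And>x. x \<in> carrier G \<Longrightarrow> \<exists>e\<in>E. inv x \<otimes> e \<otimes> x \<notin> L"
  shows "p_exact p (rinv L) ((\<star>) (gen_elt E c))"
  by (rule p_exact_glue[OF abp_subgroup[OF eab_abp[OF E]] L gen_elt_kS[OF E]])
     (rule generic_local_exact[OF E L _ ne c])

lemma generic_exact_regular:
  assumes E: "eab E" "E \<noteq> {\<one>}" and c: "generic E c"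
  shows "p_exact p (kS (carrier G)) ((\<star>) (gen_elt E c))"
  unfolding rinv_one[symmetric]
proof (rule generic_exact[OF E(1) triv_subgroup c])
  fix x assume x: "x \<in> carrier G"
  obtain e where e: "e \<in> E" "e \<noteq> \<one>" using E abp_one[OF eab_abp[OF E(1)]] by blast
  have eG: "e \<in> carrier G" using e eab_subset[OF E(1)] by auto
  have "inv x \<otimes> e \<otimes> x \<noteq> \<one>"
  proof
    assume "inv x \<otimes> e \<otimes> x = \<one>"
    hence "x \<otimes> (inv x \<otimes> e \<otimes> x) \<otimes> inv x = x \<otimes> \<one> \<otimes> inv x" by simp
    hence "e = \<one>" using x eG by (simp add: m_assoc) (simp add: m_assoc[symmetric])
    thus False using e by simp
  qed
  thus "\<exists>e\<in>E. inv x \<otimes> e \<otimes> x \<notin> {\<one>}" using e by blast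
qed

text \<open>
  The coefficients of \<open>u\<close> sum to zero, so \<open>u \<star> w\<close> vanishes on \<open>A\<close> for each right \<open>A\<close>-invariant \<open>w\<close>. The
  characteristic function \<open>m\<close> of \<open>A\<close> is then killed by \<open>u\<close>, but it does not vanish on \<open>A\<close> and is not
  in the image of \<open>u\<close>.
\<close>

lemma rinv_not_exact:
  assumes A: "abp A" and u: "u \<in> kS A" "pw u p = 0"
  shows "\<not> p_exact p (rinv A) ((\<star>) u)"
proof
  assume ex: "p_exact p (rinv A) ((\<star>) u)"
  note s = abp_subgroup[OF A] and AG = abp_sub[OF A]
  have "(\<Sum>a\<in>A. u a) ^ p = (\<Sum>x\<in>carrier G. pw u (p ^ 1) x)"
  proof -
    have "(\<Sum>x\<in>carrier G. pw u (p ^ 1) x) = (\<Sum>a\<in>A. \<Sum>x\<in>carrier G. u a ^ p * dl (a [^] p) x)"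
      unfolding pw_char_power[OF A u(1)] by simp (rule sum.swap)
    also have "\<dots> = (\<Sum>a\<in>A. u a ^ p)"
      using AG fin by (intro sum.cong refl) (auto simp: dl_def sum_distrib_left[symmetric] subset_iff)
    finally show ?thesis using frob_sum[of u A 1] by simp
  qed
  hence "(\<Sum>a\<in>A. u a) ^ p = 0" using u(2) by simp
  hence eps: "(\<Sum>a\<in>A. u a) = 0" by (metis power_eq_0_iff)
  have act0: "(u \<star> w) a = 0" if w: "w \<in> rinv A" and a: "a \<in> A" for w a
  proof -
    have aG: "a \<in> carrier G" using a AG by auto
    have "(u \<star> w) a = (\<Sum>y\<in>A. u y * w (inv y \<otimes> a))"
      unfolding conv_apply[OF aG] by (rule sum.mono_neutral_right) (use u(1) AG fin in \<open>auto simp: supp_in_def\<close>)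
    also have "\<dots> = (\<Sum>y\<in>A. u y * w \<one>)"
    proof (rule sum.cong[OF refl])
      fix y assume y: "y \<in> A"
      have "w (\<one> \<otimes> (inv y \<otimes> a)) = w \<one>"
        using w abp_mult[OF A abp_inv[OF A y] a] by (simp add: rinv_def)
      thus "u y * w (inv y \<otimes> a) = u y * w \<one>" using abp_in[OF A y] aG by simp
    qed
    also have "\<dots> = (\<Sum>y\<in>A. u y) * w \<one>" by (rule sum_distrib_right[symmetric])
    finally show ?thesis by (simp add: eps)
  qed
  define m where "m x = (if x \<in> A then 1 else (0::'k))" for x
  have mA: "m \<in> rinv A"
  proof -
    have "x \<otimes> a \<in> A \<longleftrightarrow> x \<in> A" if x: "x \<in> carrier G" and a: "a \<in> A" for x a
    proof
      assume "x \<otimes> a \<in> A"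
      hence "x \<otimes> a \<otimes> inv a \<in> A" by (rule abp_mult[OF A _ abp_inv[OF A a]])
      thus "x \<in> A" using x abp_in[OF A a] by (simp add: m_assoc)
    qed (rule abp_mult[OF A _ a])
    thus ?thesis using AG by (auto simp: rinv_def supp_in_def m_def)
  qed
  have "u \<star> m = 0"
  proof
    fix x show "(u \<star> m) x = 0 x"
    proof (cases "x \<in> A")
      case True thus ?thesis using act0[OF mA] by simp
    next
      case False
      have "m \<in> kS A" by (simp add: m_def supp_in_def)
      thus ?thesis using conv_kS[OF s u(1)] False by (simp add: supp_in_def)
    qed
  qed
  then obtain n where n: "n \<in> rinv A" "m = ((\<star>) u ^^ (p - 1)) n" using ex mA unfolding p_exact_def by blast
  have "((\<star>) u ^^ k) n \<in> rinv A" for k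
    by (induction k) (auto simp: n(1) rinv_conv[OF AG])
  hence "(u \<star> ((\<star>) u ^^ (p - 2)) n) \<one> = 0" using act0 abp_one[OF A] by blast
  moreover have "p - 1 = Suc (p - 2)" using p_gt1 by simp
  ultimately have "m \<one> = 0" using n(2) by simp
  thus False using abp_one[OF A] by (simp add: m_def)
qed

lemma p_exact_push:
  fixes M :: "('g \<Rightarrow> 'k, 'x, 'k) amod"
  assumes e: "inj_on e S" and S: "space M \<subseteq> supp_in S" and M: "fd_module (HK K) M" and a: "a \<in> kS K"
  shows "p_exact p (space (push_mod e S M)) (act (push_mod e S M) a) \<longleftrightarrow> p_exact p (space M) (act M a)"
proof -
  note D = fd_moduleD[OF M]
  let ?N = "push_mod e S M" and ?P = "pushf e S"
  have sp: "space ?N = ?P ` space M" by (simp add: push_mod_def)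
  have pw: "(act ?N a ^^ n) (?P m) = ?P ((act M a ^^ n) m) \<and> (act M a ^^ n) m \<in> space M" if "m \<in> space M" for n m
    using that push_mod_act[OF e S] D(3) a by (induction n) auto
  have inj: "?P m = ?P m' \<longleftrightarrow> m = m'" if "m \<in> space M" "m' \<in> space M" for m m'
    using pull_push[OF e, of m] pull_push[OF e, of m'] that S by (metis subsetD)
  have z: "?P 0 = 0" by (rule flin_zero[OF push_flin])
  have 0: "0 \<in> space M" by (rule fvs.subspace_0[OF D(2)])
  have k: "act ?N a (?P m) = 0 \<longleftrightarrow> act M a m = 0" if "m \<in> space M" for m
    using pw[OF that, of 1] inj[of "act M a m" 0] 0 z by auto
  show ?thesis unfolding p_exact_def sp
  proof safe
    fix m assume h: "\<forall>x\<in>?P ` space M. act ?N a x = 0 \<longrightarrow> (\<exists>y\<in>?P ` space M. x = (act ?N a ^^ (p - 1)) y)"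
      and m: "m \<in> space M" "act M a m = 0"
    then obtain n where n: "n \<in> space M" "?P m = (act ?N a ^^ (p - 1)) (?P n)" using k by blast
    thus "\<exists>y\<in>space M. m = (act M a ^^ (p - 1)) y" using pw[OF n(1)] inj m by metis
  next
    fix m assume h: "\<forall>x\<in>space M. act M a x = 0 \<longrightarrow> (\<exists>y\<in>space M. x = (act M a ^^ (p - 1)) y)"
      and m: "act ?N a (?P m) = 0" "m \<in> space M"
    then obtain n where n: "n \<in> space M" "m = (act M a ^^ (p - 1)) n" using k by blast
    thus "\<exists>y\<in>?P ` space M. ?P m = (act ?N a ^^ (p - 1)) y" using pw[OF n(1)] by (metis imageI)
  qed
qed

text \<open>
  The permutation module on the cosets of \<open>A\<close> tells the two \<open>p\<close>-points apart.
\<close>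

lemma generic_not_equiv:
  assumes E: "eab E" and c: "generic E c" and A: "abp A"
    and ne: "\<And>x. x \<in> carrier G \<Longrightarrow> \<exists>e\<in>E. inv x \<otimes> e \<otimes> x \<notin> A"
    and \<beta>: "\<beta> \<in> p_points (HK A)"
  shows "(point (gen_elt E c), \<beta>) \<notin> p_equiv H"
proof
  assume eq: "(point (gen_elt E c), \<beta>) \<in> p_equiv H"
  define u where "u = \<beta> tX"
  have u: "u \<in> kS A" "pw u p = 0"
    using p_points_elim(1,2)[OF abp_subgroup[OF A] \<beta>] kS_mono[of _ A] unfolding u_def by blast+
  note AG = abp_sub[OF A]
  have uG: "u \<in> kS (carrier G)" using u kS_mono[OF AG] by blast
  define v where "v = gen_elt E c"
  have vG: "v \<in> kS (carrier G)" using gen_elt_kS[OF E] kS_mono[OF eab_subset[OF E]] unfolding v_def by blast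
  define M where "M = \<lparr>space = rinv A, act = monoid.mult H\<rparr>"
  have fd: "fd_module (HK (carrier G)) M"
  proof (rule fd_moduleI)
    show "fin_dim (space M)"
      using fin_dim_subset[OF rinv_subspace rinv_sub kS_fin_dim[OF order_refl]] by (simp add: M_def)
    show "act M f w \<in> space M" if "w \<in> space M" for f w using that rinv_conv[OF AG] by (simp add: M_def)
    show "act M \<one>\<^bsub>HK (carrier G)\<^esub> w = w" if "w \<in> space M" for w
      using that rinv_sub one_conv by (auto simp: M_def)
  qed (auto simp: M_def conv_assoc intro!: flin_linear_on conv_flin_left conv_flin_right)
  obtain e :: "'g \<Rightarrow> nat" where e: "inj_on e (carrier G)" using finite_imp_inj_to_nat_seg[OF fin] by blast
  have MS: "space M \<subseteq> supp_in (carrier G)" using rinv_sub by (simp add: M_def)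
  let ?N = "push_mod e (carrier G) M"
  have "p_exact p (space ?N) (act ?N v)" "\<not> p_exact p (space ?N) (act ?N u)"
    unfolding p_exact_push[OF e MS fd vG] p_exact_push[OF e MS fd uG]
    using generic_exact[OF E abp_subgroup[OF A] c ne] rinv_not_exact[OF A u] by (auto simp: M_def v_def)
  moreover have "p_exact p (space ?N) (act ?N (point v tX)) = p_exact p (space ?N) (act ?N u)"
    using eq push_mod_fd[OF e MS fd] unfolding p_equiv_iff[OF subgroup_self, unfolded HK_G] HK_G u_def v_def by blast
  ultimately show False by (simp add: point_t[OF vG])
qed

end

section \<open>Tensor products of periodic resolutions\<close>

text \<open>
  For a cyclic group of order \<open>q\<close> with generator \<open>g\<close>, the trivial module has the resolution by copies of the
  group algebra whose maps are alternately \<open>g - 1\<close> and the norm. A function \<open>\<phi>\<close> on exponents below \<open>q\<close>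
  is an element of the algebra in degree \<open>m + 1\<close>, and \<open>cyc_bd q m \<phi>\<close> is its boundary in degree \<open>m\<close>.
\<close>

definition cyc_bd :: "nat \<Rightarrow> nat \<Rightarrow> (nat \<Rightarrow> 'k::field) \<Rightarrow> nat \<Rightarrow> 'k" where
  "cyc_bd q m \<phi> n = (if even m then \<phi> ((n + q - 1) mod q) - \<phi> n else \<Sum>j<q. \<phi> j)"

text \<open>
  The contracting homotopy from degree \<open>m\<close> to degree \<open>m + 1\<close>.
\<close>

definition cyc_ht :: "nat \<Rightarrow> nat \<Rightarrow> (nat \<Rightarrow> 'k::field) \<Rightarrow> nat \<Rightarrow> 'k" where
  "cyc_ht q m \<phi> n = (if even m then \<Sum>j\<in>{n<..<q}. \<phi> j else if n = 0 then \<phi> (q - 1) else 0)"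

text \<open>
  For a product of cyclic groups of orders \<open>qs\<close>, a position \<open>(n, m)\<close> in a list records the exponent \<open>n\<close> of
  one generator and the degree \<open>m\<close> in the resolution of that factor. The boundary \<open>bd\<close> of the tensor product carries
  the usual signs, \<open>ht\<close> raises the degree of a single factor, the first one whose degree becomes positive, and \<open>au\<close> sums
  over all group elements.
\<close>

fun bd :: "nat list \<Rightarrow> ((nat \<times> nat) list \<Rightarrow> 'k::field) \<Rightarrow> (nat \<times> nat) list \<Rightarrow> 'k" where
  "bd (q # qs) f ((n, m) # \<sigma>) =
     cyc_bd q m (\<lambda>j. f ((j, Suc m) # \<sigma>)) n + (- 1) ^ m * bd qs (\<lambda>\<tau>. f ((n, m) # \<tau>)) \<sigma>"
| "bd _ _ _ = 0"

fun ht :: "nat list \<Rightarrow> ((nat \<times> nat) list \<Rightarrow> 'k::field) \<Rightarrow> (nat \<times> nat) list \<Rightarrow> 'k" where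
  "ht (q # qs) f ((n, 0) # \<sigma>) = (if n = 0 then ht qs (\<lambda>\<tau>. \<Sum>j<q. f ((j, 0) # \<tau>)) \<sigma> else 0)"
| "ht (q # qs) f ((n, Suc m) # \<sigma>) = cyc_ht q m (\<lambda>j. f ((j, m) # \<sigma>)) n"
| "ht _ _ _ = 0"

fun au :: "nat list \<Rightarrow> ((nat \<times> nat) list \<Rightarrow> 'k::field) \<Rightarrow> nat list \<Rightarrow> 'k" where
  "au (q # qs) f (m # \<mu>) = au qs (\<lambda>\<tau>. \<Sum>j<q. f ((j, m) # \<tau>)) \<mu>"
| "au [] f [] = f []"
| "au _ _ _ = 0"

text \<open>
  The composite of the augmentation with the inclusion of the scalars at the identity element. It is
  where the homotopy fails to be a contraction.
\<close>

definition aug_proj :: "nat list \<Rightarrow> ((nat \<times> nat) list \<Rightarrow> 'k::field) \<Rightarrow> (nat \<times> nat) list \<Rightarrow> 'k" where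
  "aug_proj qs f \<sigma> = (if \<forall>s\<in>set \<sigma>. s = (0, 0) then au qs f (map snd \<sigma>) else 0)"

definition valid :: "nat list \<Rightarrow> (nat \<times> nat) list \<Rightarrow> bool" where
  "valid qs \<sigma> \<longleftrightarrow> list_all2 (\<lambda>q s. fst s < q) qs \<sigma>"

abbreviation deg :: "(nat \<times> nat) list \<Rightarrow> nat" where "deg \<sigma> \<equiv> sum_list (map snd \<sigma>)"

lemma valid_Nil [simp]: "valid [] \<sigma> \<longleftrightarrow> \<sigma> = []" "valid qs [] \<longleftrightarrow> qs = []"
  and valid_Cons [simp]: "valid (q # qs) ((n, m) # \<sigma>) \<longleftrightarrow> n < q \<and> valid qs \<sigma>"
  by (auto simp: valid_def)

lemma valid_ConsE:
  assumes "valid (q # qs) \<sigma>" obtains n m \<sigma>' where "\<sigma> = (n, m) # \<sigma>'" "n < q" "valid qs \<sigma>'"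
  using assms by (cases \<sigma>) auto

lemma cyc_bd_sum: "cyc_bd q m (\<lambda>j. \<Sum>i\<in>I. c i * \<phi> i j) n = (\<Sum>i\<in>I. c i * cyc_bd q m (\<phi> i) n)"
proof (cases "even m")
  case False
  have "(\<Sum>j<q. \<Sum>i\<in>I. c i * \<phi> i j) = (\<Sum>i\<in>I. c i * (\<Sum>j<q. \<phi> i j))"
    unfolding sum_distrib_left by (rule sum.swap)
  thus ?thesis using False by (simp add: cyc_bd_def)
qed (simp add: cyc_bd_def sum_subtractf[symmetric] right_diff_distrib)

lemma bd_sum: "bd qs (\<lambda>\<tau>. \<Sum>i\<in>I. c i * f i \<tau>) \<sigma> = (\<Sum>i\<in>I. c i * bd qs (f i) \<sigma>)"
proof (induction qs arbitrary: f \<sigma>)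
  case (Cons q qs)
  show ?case
  proof (cases \<sigma>)
    case (Cons s \<sigma>')
    obtain n m where s: "s = (n, m)" by (cases s)
    show ?thesis unfolding Cons s bd.simps Cons.IH cyc_bd_sum
      by (simp add: sum.distrib distrib_left sum_distrib_left mult_ac)
  qed simp
qed simp

lemma au_sum: "au qs (\<lambda>\<tau>. \<Sum>i\<in>I. c i * f i \<tau>) \<mu> = (\<Sum>i\<in>I. c i * au qs (f i) \<mu>)"
proof (induction qs arbitrary: f \<mu>)
  case Nil thus ?case by (cases \<mu>) auto
next
  case (Cons q qs)
  show ?case
  proof (cases \<mu>)
    case (Cons m \<mu>')
    have "(\<lambda>\<tau>. \<Sum>j<q. \<Sum>i\<in>I. c i * f i ((j, m) # \<tau>)) = (\<lambda>\<tau>. \<Sum>i\<in>I. c i * (\<Sum>j<q. f i ((j, m) # \<tau>)))"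
      unfolding sum_distrib_left by (rule ext) (rule sum.swap)
    thus ?thesis unfolding Cons au.simps by (simp only: Cons.IH)
  qed simp
qed

lemma bd_add: "bd qs (\<lambda>\<tau>. f \<tau> + g \<tau>) \<sigma> = bd qs f \<sigma> + bd qs g \<sigma>"
  using bd_sum[of qs "\<lambda>_. 1" "\<lambda>b. if b then f else g" "{True, False}" \<sigma>] by simp

lemma bd_scale: "bd qs (\<lambda>\<tau>. c * f \<tau>) \<sigma> = c * bd qs f \<sigma>"
  using bd_sum[of qs "\<lambda>_. c" "\<lambda>_. f" "{()}" \<sigma>] by simp

lemma bd_zero: "bd qs (\<lambda>\<tau>. 0) \<sigma> = 0"
  using bd_scale[of qs 0 "\<lambda>_. 0" \<sigma>] by simp

lemma bd_sum1: "bd qs (\<lambda>\<tau>. \<Sum>i\<in>I. f i \<tau>) \<sigma> = (\<Sum>i\<in>I. bd qs (f i) \<sigma>)"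
  using bd_sum[of qs "\<lambda>_. 1" f I \<sigma>] by simp

lemma au_scale: "au qs (\<lambda>\<tau>. c * f \<tau>) \<mu> = c * au qs f \<mu>"
  using au_sum[of qs "\<lambda>_. c" "\<lambda>_. f" "{()}" \<mu>] by simp

lemma bd_diff: "bd qs (\<lambda>\<tau>. f \<tau> - g \<tau>) \<sigma> = bd qs f \<sigma> - bd qs g \<sigma>"
  using bd_add[of qs f "\<lambda>\<tau>. (- 1) * g \<tau>" \<sigma>] bd_scale[of qs "- 1" g \<sigma>] by simp

lemma bd_cyc_bd: "bd qs (\<lambda>\<tau>. cyc_bd q m (\<lambda>j. F j \<tau>) n) \<sigma> = cyc_bd q m (\<lambda>j. bd qs (F j) \<sigma>) n"
  by (cases "even m") (simp_all add: cyc_bd_def bd_diff bd_sum1)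

lemma bd_cyc_ht: "bd qs (\<lambda>\<tau>. cyc_ht q m (\<lambda>j. F j \<tau>) n) \<sigma> = cyc_ht q m (\<lambda>j. bd qs (F j) \<sigma>) n"
  by (cases "even m") (simp_all add: cyc_ht_def bd_sum1 bd_zero)

lemma cyc_bd_add_scale: "cyc_bd q m (\<lambda>j. \<phi> j + c * \<psi> j) n = cyc_bd q m \<phi> n + c * cyc_bd q m \<psi> n"
  using cyc_bd_sum[of q m "\<lambda>b. if b then 1 else c" "\<lambda>b. if b then \<phi> else \<psi>" "{True, False}" n] by simp

lemma cyc_ht_add_scale: "cyc_ht q m (\<lambda>j. \<phi> j + c * \<psi> j) n = cyc_ht q m \<phi> n + c * cyc_ht q m \<psi> n"
  by (auto simp: cyc_ht_def sum.distrib sum_distrib_left)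

lemma sum_rotate: "(\<Sum>j<q. \<phi> ((j + a) mod q)) = (\<Sum>j<q. \<phi> j :: 'k::field)" for a q :: nat
proof (cases "q = 0")
  case False
  have inj: "inj_on (\<lambda>j. (j + a) mod q) {..<q}"
  proof (rule inj_onI)
    fix i j assume ij: "i \<in> {..<q}" "j \<in> {..<q}" "(i + a) mod q = (j + a) mod q"
    hence "[i + a = j + a] (mod q)" by (simp add: cong_def)
    hence "[i = j] (mod q)" by (simp add: cong_add_rcancel_nat)
    thus "i = j" using ij by (simp add: cong_def)
  qed
  have "(\<lambda>j. (j + a) mod q) ` {..<q} = {..<q}"
    by (rule endo_inj_surj[OF _ _ inj]) (use False in auto)
  hence "bij_betw (\<lambda>j. (j + a) mod q) {..<q} {..<q}" using inj by (simp add: bij_betw_def)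
  thus ?thesis by (rule sum.reindex_bij_betw)
qed simp

lemma cyc_bd_even_sum: "(\<Sum>j<q. cyc_bd q m \<phi> j) = 0" if "even m"
proof (cases "q = 0")
  case False
  have "(\<Sum>j<q. \<phi> ((j + q - 1) mod q)) = (\<Sum>j<q. \<phi> ((j + (q - 1)) mod q))" using False by simp
  also have "\<dots> = (\<Sum>j<q. \<phi> j)" by (rule sum_rotate)
  finally show ?thesis using that by (simp add: cyc_bd_def sum_subtractf)
qed simp

lemma cyc_bd_cyc_bd: "cyc_bd q m (\<lambda>j. cyc_bd q (Suc m) \<phi> j) n = 0"
proof (cases "even m")
  case True thus ?thesis by (simp add: cyc_bd_def)
next
  case False
  hence "(\<Sum>j<q. cyc_bd q (Suc m) \<phi> j) = 0" by (intro cyc_bd_even_sum) simp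
  thus ?thesis using False by (simp add: cyc_bd_def[of q m])
qed

lemma bd_bd: "bd qs (bd qs f) \<sigma> = 0"
proof (induction qs arbitrary: f \<sigma>)
  case (Cons q qs)
  show ?case
  proof (cases \<sigma>)
    case (Cons s \<sigma>')
    obtain n m where s: "s = (n, m)" by (cases s)
    let ?B = "cyc_bd q m (\<lambda>j. bd qs (\<lambda>\<tau>. f ((j, Suc m) # \<tau>)) \<sigma>') n"
    have 1: "cyc_bd q m (\<lambda>j. bd (q # qs) f ((j, Suc m) # \<sigma>')) n = (- 1) ^ Suc m * ?B"
      unfolding bd.simps cyc_bd_add_scale cyc_bd_cyc_bd by simp
    have 2: "bd qs (\<lambda>\<tau>. bd (q # qs) f ((n, m) # \<tau>)) \<sigma>' = ?B"
      unfolding bd.simps bd_add bd_scale Cons.IH bd_cyc_bd by simp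
    show ?thesis unfolding Cons s bd.simps(1)[of q qs "bd (q # qs) f"] 1 2 by simp
  qed simp
qed simp

text \<open>
  In degree zero a function differs from a multiple of the point mass at \<open>0\<close> by a telescoping
  sum, which is where partial sums enter the homotopy.
\<close>

lemma cyc_ht_homotopy_zero:
  assumes n: "n < q"
  shows "cyc_bd q 0 (\<lambda>j. cyc_ht q 0 \<phi> j) n = \<phi> n - (if n = 0 then \<Sum>j<q. \<phi> j else 0)"
proof (cases "n = 0")
  case True
  have "{..<q} = insert 0 {0<..<q}" using n by auto
  hence "(\<Sum>j<q. \<phi> j) = \<phi> 0 + (\<Sum>j\<in>{0<..<q}. \<phi> j)" by simp
  moreover have "(q - 1) mod q = q - 1" using n by simp
  moreover have "{q - 1<..<q} = {}" by auto
  ultimately show ?thesis using True by (simp add: cyc_bd_def cyc_ht_def)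
next
  case False
  have "(n + q - 1) mod q = n - 1"
  proof -
    have "(n + q - 1) mod q = ((n - 1) + q) mod q" using False by simp
    also have "\<dots> = n - 1" using n by simp
    finally show ?thesis .
  qed
  moreover have "{n - 1<..<q} = insert n {n<..<q}" using False n by auto
  ultimately show ?thesis using False by (simp add: cyc_bd_def cyc_ht_def)
qed

lemma cyc_ht_homotopy_Suc:
  assumes n: "n < q"
  shows "cyc_bd q (Suc m) (\<lambda>j. cyc_ht q (Suc m) \<phi> j) n + cyc_ht q m (\<lambda>j. cyc_bd q m \<phi> j) n = \<phi> n"
proof (cases "even m")
  case True
  have "(\<Sum>j<q. if j = 0 then \<phi> (q - 1) else 0) = \<phi> (q - 1)" using n by simp
  moreover have "(\<Sum>j\<in>{n<..<q}. \<phi> ((j + q - 1) mod q) - \<phi> j) = \<phi> n - \<phi> (q - 1)"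
  proof -
    have "(\<Sum>j\<in>{n<..<q}. \<phi> ((j + q - 1) mod q) - \<phi> j) = (\<Sum>j\<in>{n<..<q}. \<phi> (j - 1) - \<phi> j)"
    proof (rule sum.cong[OF refl])
      fix j assume j: "j \<in> {n<..<q}"
      have "(j + q - 1) mod q = ((j - 1) + q) mod q" using j by simp
      also have "\<dots> = j - 1" using j by (simp only: mod_add_self2) (rule mod_less, auto)
      finally show "\<phi> ((j + q - 1) mod q) - \<phi> j = \<phi> (j - 1) - \<phi> j" by simp
    qed
    also have "\<dots> = (\<Sum>j\<in>{n..<q - 1}. \<phi> j - \<phi> (Suc j))"
      by (rule sum.reindex_bij_witness[of _ Suc "\<lambda>j. j - 1"]) auto
    also have "\<dots> = \<phi> n - \<phi> (q - 1)" using sum_Suc_diff'[of n "q - 1" "\<lambda>j. - \<phi> j"] n by (simp add: algebra_simps)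
    finally show ?thesis .
  qed
  ultimately show ?thesis using True by (simp add: cyc_bd_def cyc_ht_def)
next
  case False
  have "cyc_bd q (Suc m) (\<lambda>j. cyc_ht q (Suc m) \<phi> j) n = cyc_bd q 0 (\<lambda>j. cyc_ht q 0 \<phi> j) n"
    using False by (simp add: cyc_bd_def cyc_ht_def)
  moreover have "cyc_ht q m (\<lambda>j. cyc_bd q m \<phi> j) n = (if n = 0 then \<Sum>j<q. \<phi> j else 0)"
    using False by (simp add: cyc_bd_def cyc_ht_def)
  ultimately show ?thesis using cyc_ht_homotopy_zero[OF n, of \<phi>] by simp
qed

text \<open>
  Exactness of the tensor product complex, with an explicit preimage. In the first factor the cyclic homotopy
  is used in positive degree; the sign in \<open>bd\<close> cancels the contributions of the other factors.
\<close>

lemma bd_ht: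
  "valid qs \<sigma> \<Longrightarrow> bd qs (ht qs f) \<sigma> + ht qs (bd qs f) \<sigma> = f \<sigma> - aug_proj qs f \<sigma>"
proof (induction qs arbitrary: f \<sigma>)
  case (Cons q qs)
  obtain n m \<sigma>' where \<sigma>: "\<sigma> = (n, m) # \<sigma>'" "n < q" "valid qs \<sigma>'" using Cons.prems by (rule valid_ConsE)
  show ?case
  proof (cases m)
    case 0
    define Fs where "Fs = (\<lambda>\<tau>. \<Sum>j<q. f ((j, 0) # \<tau>))"
    have 1: "bd (q # qs) (ht (q # qs) f) \<sigma> =
        f \<sigma> - (if n = 0 then Fs \<sigma>' else 0) + (if n = 0 then bd qs (ht qs Fs) \<sigma>' else 0)"
      unfolding \<sigma>(1) 0 bd.simps ht.simps cyc_ht_homotopy_zero[OF \<sigma>(2)] by (auto simp: Fs_def bd_zero)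
    have "(\<Sum>j<q. bd (q # qs) f ((j, 0) # \<tau>)) = bd qs Fs \<tau>" for \<tau>
      unfolding bd.simps sum.distrib Fs_def bd_sum1 by (simp add: cyc_bd_even_sum)
    hence 2: "ht (q # qs) (bd (q # qs) f) \<sigma> = (if n = 0 then ht qs (bd qs Fs) \<sigma>' else 0)"
      unfolding \<sigma>(1) 0 ht.simps by presburger
    have 3: "aug_proj (q # qs) f \<sigma> = (if n = 0 then aug_proj qs Fs \<sigma>' else 0)"
      unfolding aug_proj_def \<sigma>(1) 0 by (auto simp: Fs_def)
    show ?thesis unfolding 1 2 3 using Cons.IH[OF \<sigma>(3), of Fs] by auto
  next
    case (Suc m')
    let ?B = "cyc_ht q m' (\<lambda>j. bd qs (\<lambda>\<tau>. f ((j, m') # \<tau>)) \<sigma>') n"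
    let ?\<phi> = "\<lambda>j. f ((j, Suc m') # \<sigma>')"
    have 1: "bd (q # qs) (ht (q # qs) f) \<sigma> = cyc_bd q (Suc m') (\<lambda>j. cyc_ht q (Suc m') ?\<phi> j) n + (- 1) ^ Suc m' * ?B"
      unfolding \<sigma>(1) Suc bd.simps ht.simps bd_cyc_ht ..
    have 2: "ht (q # qs) (bd (q # qs) f) \<sigma> = cyc_ht q m' (\<lambda>j. cyc_bd q m' ?\<phi> j) n + (- 1) ^ m' * ?B"
      unfolding \<sigma>(1) Suc bd.simps ht.simps cyc_ht_add_scale ..
    have 3: "aug_proj (q # qs) f \<sigma> = 0" by (simp add: aug_proj_def \<sigma>(1) Suc)
    show ?thesis unfolding 1 2 3 using cyc_ht_homotopy_Suc[OF \<sigma>(2), of m' ?\<phi>] by (simp add: \<sigma>(1) Suc)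
  qed
qed (simp add: aug_proj_def)

text \<open>
  The resolution is minimal: the sum of all coefficients of \<open>g - 1\<close> is zero, and that of the norm is
  the order of the group, which is zero in the field.
\<close>

lemma au_bd: "(\<And>q. q \<in> set qs \<Longrightarrow> of_nat q = (0::'k::field)) \<Longrightarrow> au qs (bd qs f) \<mu> = (0::'k)"
proof (induction qs arbitrary: f \<mu>)
  case Nil thus ?case by (cases \<mu>) auto
next
  case (Cons q qs)
  show ?case
  proof (cases \<mu>)
    case (Cons m \<mu>')
    have D: "(\<Sum>j<q. cyc_bd q m \<phi> j) = 0" for \<phi> :: "nat \<Rightarrow> 'k"
      using cyc_bd_even_sum[of m q \<phi>] Cons.prems[of q] by (cases "even m") (simp_all add: cyc_bd_def)
    have "(\<lambda>\<tau>. \<Sum>j<q. bd (q # qs) f ((j, m) # \<tau>)) = (\<lambda>\<tau>. (- 1) ^ m * bd qs (\<lambda>\<tau>. \<Sum>j<q. f ((j, m) # \<tau>)) \<tau>)"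
      unfolding bd.simps sum.distrib D bd_sum1 by (simp add: sum_distrib_left)
    hence "au (q # qs) (bd (q # qs) f) \<mu> = (- 1) ^ m * au qs (bd qs (\<lambda>\<tau>. \<Sum>j<q. f ((j, m) # \<tau>))) \<mu>'"
      unfolding Cons au.simps by (simp only: au_scale)
    also have "au qs (bd qs (\<lambda>\<tau>. \<Sum>j<q. f ((j, m) # \<tau>))) \<mu>' = 0" by (rule Cons.IH) (use Cons.prems in auto)
    finally show ?thesis by simp
  qed simp
qed

lemma bd_cong:
  assumes "valid qs \<sigma>" "\<And>\<tau>. valid qs \<tau> \<Longrightarrow> deg \<tau> = Suc (deg \<sigma>) \<Longrightarrow> f \<tau> = g \<tau>"
  shows "bd qs f \<sigma> = bd qs g \<sigma>"
  using assms
proof (induction qs arbitrary: f g \<sigma>)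
  case (Cons q qs)
  obtain n m \<sigma>' where \<sigma>: "\<sigma> = (n, m) # \<sigma>'" "n < q" "valid qs \<sigma>'" using Cons.prems(1) by (rule valid_ConsE)
  have fg: "f ((j, Suc m) # \<sigma>') = g ((j, Suc m) # \<sigma>')" if "j < q" for j using Cons.prems(2) that \<sigma> by simp
  have 1: "cyc_bd q m (\<lambda>j. f ((j, Suc m) # \<sigma>')) n = cyc_bd q m (\<lambda>j. g ((j, Suc m) # \<sigma>')) n"
    using fg \<sigma>(2) by (auto simp: cyc_bd_def)
  have 2: "bd qs (\<lambda>\<tau>. f ((n, m) # \<tau>)) \<sigma>' = bd qs (\<lambda>\<tau>. g ((n, m) # \<tau>)) \<sigma>'"
    by (rule Cons.IH[OF \<sigma>(3)]) (use Cons.prems(2) \<sigma> in auto)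
  show ?case unfolding \<sigma>(1) bd.simps 1 2 ..
qed simp

lemma ht_cong:
  assumes "valid qs \<sigma>" "\<And>\<tau>. valid qs \<tau> \<Longrightarrow> Suc (deg \<tau>) = deg \<sigma> \<Longrightarrow> f \<tau> = g \<tau>"
  shows "ht qs f \<sigma> = ht qs g \<sigma>"
  using assms
proof (induction qs arbitrary: f g \<sigma>)
  case (Cons q qs)
  obtain n m \<sigma>' where \<sigma>: "\<sigma> = (n, m) # \<sigma>'" "n < q" "valid qs \<sigma>'" using Cons.prems(1) by (rule valid_ConsE)
  show ?case
  proof (cases m)
    case 0
    have "ht qs (\<lambda>\<tau>. \<Sum>j<q. f ((j, 0) # \<tau>)) \<sigma>' = ht qs (\<lambda>\<tau>. \<Sum>j<q. g ((j, 0) # \<tau>)) \<sigma>'"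
      by (rule Cons.IH[OF \<sigma>(3)]) (use Cons.prems(2) \<sigma> 0 in \<open>auto intro!: sum.cong\<close>)
    thus ?thesis unfolding \<sigma>(1) 0 by simp
  next
    case (Suc m')
    have "f ((j, m') # \<sigma>') = g ((j, m') # \<sigma>')" if "j < q" for j using Cons.prems(2) that \<sigma> Suc by simp
    thus ?thesis unfolding \<sigma>(1) Suc ht.simps using \<sigma>(2) by (auto simp: cyc_ht_def intro!: sum.cong)
  qed
qed simp

lemma ht_zero: "ht qs (\<lambda>\<tau>. 0) \<sigma> = 0"
proof (induction qs arbitrary: \<sigma>)
  case (Cons q qs)
  show ?case
  proof (cases \<sigma>)
    case (Cons s \<sigma>')
    obtain n m where s: "s = (n, m)" by (cases s)
    show ?thesis unfolding Cons s by (cases m) (auto simp: cyc_ht_def Cons.IH)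
  qed simp
qed simp

text \<open>
  Translation by the inverse of the group element with exponents \<open>es\<close>.
\<close>

fun shift_exps :: "nat list \<Rightarrow> nat list \<Rightarrow> (nat \<times> nat) list \<Rightarrow> (nat \<times> nat) list" where
  "shift_exps (q # qs) (e # es) ((n, m) # \<sigma>) = ((n + (q - e)) mod q, m) # shift_exps qs es \<sigma>"
| "shift_exps _ _ \<sigma> = \<sigma>"

lemma cyc_bd_shift: "cyc_bd q m (\<lambda>j. \<phi> ((j + a) mod q)) n = cyc_bd q m \<phi> ((n + a) mod q)" if "n < q"
proof -
  have "((n + q - 1) mod q + a) mod q = (n + q - 1 + a) mod q" by (simp add: mod_add_left_eq)
  also have "\<dots> = ((n + a) + (q - 1)) mod q" using that by (simp add: algebra_simps)
  also have "\<dots> = ((n + a) mod q + (q - 1)) mod q" by (simp add: mod_add_left_eq)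
  also have "(n + a) mod q + (q - 1) = (n + a) mod q + q - 1" using that by simp
  finally have "((n + q - 1) mod q + a) mod q = ((n + a) mod q + q - 1) mod q" .
  thus ?thesis unfolding cyc_bd_def by (simp add: sum_rotate)
qed

lemma bd_shift:
  assumes "valid qs \<sigma>" "length es = length qs"
  shows "bd qs (\<lambda>\<tau>. f (shift_exps qs es \<tau>)) \<sigma> = bd qs f (shift_exps qs es \<sigma>)"
  using assms
proof (induction qs arbitrary: f \<sigma> es)
  case (Cons q qs)
  obtain n m \<sigma>' where \<sigma>: "\<sigma> = (n, m) # \<sigma>'" "n < q" "valid qs \<sigma>'" using Cons.prems(1) by (rule valid_ConsE)
  obtain e es' where es: "es = e # es'" "length es' = length qs" using Cons.prems(2) by (cases es) auto
  show ?case unfolding \<sigma>(1) es(1) shift_exps.simps bd.simps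
    using Cons.IH[OF \<sigma>(3) es(2), of "\<lambda>\<tau>. f (((n + (q - e)) mod q, m) # \<tau>)"]
      cyc_bd_shift[OF \<sigma>(2), of m "\<lambda>j. f ((j, Suc m) # shift_exps qs es' \<sigma>')" "q - e"] by simp
qed simp

section \<open>Uniqueness of minimal resolutions\<close>

lemma mod_hom_comp: "f \<in> mod_hom A M N \<Longrightarrow> g \<in> mod_hom A N L \<Longrightarrow> (\<lambda>v. g (f v)) \<in> mod_hom A M L"
proof -
  assume f: "f \<in> mod_hom A M N" and g: "g \<in> mod_hom A N L"
  note F = mod_homD[OF f] and g' = mod_homD[OF g]
  have "linear_on (space M) (\<lambda>v. g (f v))" by (rule linear_on_comp[OF F(2) g'(2) F(1)])
  thus ?thesis unfolding mod_hom_def using F g' by (auto simp: image_subset_iff)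
qed

lemma mod_hom_id: "(\<lambda>v. v) \<in> mod_hom A M M"
  by (auto simp: mod_hom_def linear_on_id)

lemma image_submod:
  assumes M: "fd_module A M" and f: "f \<in> mod_hom A M N"
  shows "submod A N (f ` space M)"
  unfolding submod_def
proof (intro conjI ballI)
  note F = mod_homD[OF f]
  show "fvs.subspace (f ` space M)" by (rule subspace_fin_dim[OF fin_dim_image[OF fd_moduleD(1)[OF M] F(2)]])
  show "f ` space M \<subseteq> space N" by (rule F(1))
  fix a w assume a: "a \<in> carrier A" and "w \<in> f ` space M"
  then obtain v where v: "v \<in> space M" "w = f v" by blast
  have "act N a w = f (act M a v)" using F(3)[OF a v(1)] v(2) by simp
  thus "act N a w \<in> f ` space M" using fd_moduleD(3)[OF M a v(1)] by blast
qed

lemma superfluousD: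
  assumes "superfluous A M K" "submod A M W" "\<And>v. v \<in> space M \<Longrightarrow> \<exists>w\<in>W. v - w \<in> K" "K \<subseteq> space M"
    "fvs.subspace (space M)"
  shows "W = space M"
proof -
  have "{w + x |w x. w \<in> W \<and> x \<in> K} = space M"
  proof
    show "{w + x |w x. w \<in> W \<and> x \<in> K} \<subseteq> space M"
      using assms(2,4) fvs.subspace_add[OF assms(5)] unfolding submod_def by blast
    show "space M \<subseteq> {w + x |w x. w \<in> W \<and> x \<in> K}"
    proof
      fix v assume "v \<in> space M"
      then obtain w where w: "w \<in> W" "v - w \<in> K" using assms(3) by blast
      have "v = w + (v - w)" by simp
      thus "v \<in> {w + x |w x. w \<in> W \<and> x \<in> K}" using w by blast
    qed
  qed
  thus ?thesis using assms(1,2) unfolding superfluous_def by blast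
qed

lemma ker_on_sub: "ker_on M f \<subseteq> space M"
  by (auto simp: ker_on_def)

lemma projectiveD:
  fixes X Y :: "('b \<Rightarrow> 'k::field, nat, 'k) amod"
  assumes "projective A M" "fd_module A X" "fd_module A Y" "g \<in> mod_hom A X Y" "g ` space X = space Y"
    "f \<in> mod_hom A M Y"
  obtains h where "h \<in> mod_hom A M X" "\<And>v. v \<in> space M \<Longrightarrow> g (h v) = f v"
proof -
  have "\<forall>(X :: ('b \<Rightarrow> 'k, nat, 'k) amod) (Y :: ('b \<Rightarrow> 'k, nat, 'k) amod).
      \<forall>g\<in>mod_hom A X Y. \<forall>f\<in>mod_hom A M Y. fd_module A X \<and> fd_module A Y \<and> g ` space X = space Y \<longrightarrow>
      (\<exists>h\<in>mod_hom A M X. \<forall>v\<in>space M. g (h v) = f v)"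
    using assms(1) unfolding projective_def by (rule conjunct2)
  from mp[OF bspec[OF bspec[OF spec[OF spec[OF this, of X], of Y] assms(4)] assms(6)]] assms(2,3,5)
  obtain h where h: "h \<in> mod_hom A M X" "\<forall>v\<in>space M. g (h v) = f v" by (auto elim: bexE)
  show ?thesis by (rule that[OF h(1) bspec[OF h(2)]])
qed

text \<open>
  Lift \<open>\<pi>\<close> to a map \<open>\<phi>\<close> between the projective modules. Its image together with the superfluous
  kernel of \<open>\<pi>'\<close> is everything, so \<open>\<phi>\<close> is onto and splits by projectivity. The image of the splitting fills \<open>X\<close> for the
  same reason, so \<open>\<phi>\<close> is injective.
\<close>

lemma cover_iso:
  fixes X X' Y :: "('b \<Rightarrow> 'k::field, nat, 'k) amod"
  assumes X: "projective A X" and X': "projective A X'" and Y: "fd_module A Y"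
    and \<pi>: "\<pi> \<in> mod_hom A X Y" "\<pi> ` space X = space Y" and \<pi>': "\<pi>' \<in> mod_hom A X' Y" "\<pi>' ` space X' = space Y"
    and s: "superfluous A X (ker_on X \<pi>)" and s': "superfluous A X' (ker_on X' \<pi>')"
  shows "\<exists>\<phi>\<in>mod_hom A X X'. bij_betw \<phi> (space X) (space X') \<and> (\<forall>v\<in>space X. \<pi>' (\<phi> v) = \<pi> v)"
proof -
  have fX: "fd_module A X" and fX': "fd_module A X'" using X X' by (auto simp: projective_def)
  note SX = fd_moduleD(2)[OF fX] and SX' = fd_moduleD(2)[OF fX']
  obtain \<phi> where \<phi>: "\<phi> \<in> mod_hom A X X'" "\<And>v. v \<in> space X \<Longrightarrow> \<pi>' (\<phi> v) = \<pi> v"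
    by (rule projectiveD[OF X fX' Y \<pi>' \<pi>(1)]) (rule that)
  note Fp = mod_homD[OF \<phi>(1)] and P' = mod_homD[OF \<pi>'(1)]
  have surj: "\<phi> ` space X = space X'"
  proof (rule superfluousD[OF s' image_submod[OF fX \<phi>(1)] _ ker_on_sub SX'])
    fix y assume y: "y \<in> space X'"
    then obtain x where x: "x \<in> space X" "\<pi>' y = \<pi> x" using \<pi>(2) P'(1) by blast
    have fx: "\<phi> x \<in> space X'" using Fp(1) x by blast
    have "y - \<phi> x \<in> ker_on X' \<pi>'"
      using y fx x \<phi>(2)[OF x(1)] fvs.subspace_diff[OF SX' y fx] linear_on_diff[OF SX' P'(2) y fx] by (simp add: ker_on_def)
    thus "\<exists>w\<in>\<phi> ` space X. y - w \<in> ker_on X' \<pi>'" using x by blast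
  qed
  obtain t where t: "t \<in> mod_hom A X' X" "\<And>v. v \<in> space X' \<Longrightarrow> \<phi> (t v) = v"
    by (rule projectiveD[OF X' fX fX' \<phi>(1) surj mod_hom_id]) (rule that)
  have "t ` space X' = space X"
  proof (rule superfluousD[OF s image_submod[OF fX' t(1)] _ ker_on_sub SX])
    fix x assume x: "x \<in> space X"
    have fx: "\<phi> x \<in> space X'" using Fp(1) x by blast
    have tx: "t (\<phi> x) \<in> space X" using mod_homD(1)[OF t(1)] fx by blast
    have d: "x - t (\<phi> x) \<in> space X" by (rule fvs.subspace_diff[OF SX x tx])
    have "\<phi> (x - t (\<phi> x)) = 0" using linear_on_diff[OF SX Fp(2) x tx] t(2)[OF fx] by simp
    hence "\<pi> (x - t (\<phi> x)) = 0" using \<phi>(2)[OF d] linear_on_zero[OF SX' P'(2)] by simp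
    hence "x - t (\<phi> x) \<in> ker_on X \<pi>" using d by (simp add: ker_on_def)
    thus "\<exists>w\<in>t ` space X'. x - w \<in> ker_on X \<pi>" using fx by blast
  qed
  hence tX: "t ` space X' = space X" .
  have "inj_on \<phi> (space X)"
  proof (rule inj_onI)
    fix x y assume xy: "x \<in> space X" "y \<in> space X" "\<phi> x = \<phi> y"
    obtain a b where "x = t a" "a \<in> space X'" "y = t b" "b \<in> space X'" using xy(1,2) unfolding tX[symmetric] by (auto elim!: imageE)
    thus "x = y" using xy(3) t(2) by simp
  qed
  thus ?thesis using \<phi> surj by (auto simp: bij_betw_def)
qed

lemma ker_on_image:
  assumes "\<phi> ` space M = space N" "\<And>v. v \<in> space M \<Longrightarrow> g (\<phi> v) = 0 \<longleftrightarrow> f v = 0"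
  shows "\<phi> ` ker_on M f = ker_on N g"
proof
  show "\<phi> ` ker_on M f \<subseteq> ker_on N g" unfolding ker_on_def assms(1)[symmetric] using assms(2) by auto
  show "ker_on N g \<subseteq> \<phi> ` ker_on M f" unfolding ker_on_def assms(1)[symmetric] using assms(2) by auto
qed

lemma kernel_fd:
  assumes M: "fd_module A M" and N: "fd_module A N" and f: "f \<in> mod_hom A M N"
  shows "fd_module A (M\<lparr>space := ker_on M f\<rparr>)"
proof (rule fd_moduleI)
  note D = fd_moduleD[OF M] and F = mod_homD[OF f]
  have sub: "ker_on M f \<subseteq> space M" by (rule ker_on_sub)
  have "fvs.subspace (ker_on M f)"
    unfolding fvs.subspace_def ker_on_def
    using fvs.subspace_0[OF D(2)] linear_on_zero[OF D(2) F(2)] fvs.subspace_add[OF D(2)] fvs.subspace_scale[OF D(2)]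
      linear_onD[OF F(2)] by auto
  thus "fin_dim (space (M\<lparr>space := ker_on M f\<rparr>))" using fin_dim_subset[OF _ sub D(1)] by simp
  show "act (M\<lparr>space := ker_on M f\<rparr>) a v \<in> space (M\<lparr>space := ker_on M f\<rparr>)"
    if "a \<in> carrier A" "v \<in> space (M\<lparr>space := ker_on M f\<rparr>)" for a v
  proof -
    have v: "v \<in> space M" "f v = 0" using that(2) by (auto simp: ker_on_def)
    have "act N a 0 = 0" using linear_on_zero[OF fd_moduleD(2,4)[OF N]] that(1) by blast
    hence "f (act M a v) = 0" using F(3)[OF that(1) v(1)] v(2) by simp
    thus ?thesis using D(3)[OF that(1) v(1)] by (simp add: ker_on_def)
  qed
  show "linear_on (space (M\<lparr>space := ker_on M f\<rparr>)) (act (M\<lparr>space := ker_on M f\<rparr>) a)" if "a \<in> carrier A" for a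
    using linear_on_mono[OF D(4)[OF that] sub] by simp
qed (use fd_moduleD[OF M] ker_on_sub[of M f] in auto)

text \<open>
  The isomorphisms are built degree by degree. In the induction they are also required to match the kernels, which
  are the modules covered in the next degree.
\<close>

lemma minimal_resolution_unique:
  fixes M :: "('b \<Rightarrow> 'k::field, unit, 'k) amod"
  assumes M: "fd_module A M" and P: "minimal_projective_resolution A M P d e" and P': "minimal_projective_resolution A M P' d' e'"
  shows "\<exists>\<phi>\<in>mod_hom A (P n) (P' n). bij_betw \<phi> (space (P n)) (space (P' n))"
proof -
  define K where "K n = (case n of 0 \<Rightarrow> ker_on (P 0) e | Suc m \<Rightarrow> ker_on (P (Suc m)) (d m))" for n
  define K' where "K' n = (case n of 0 \<Rightarrow> ker_on (P' 0) e' | Suc m \<Rightarrow> ker_on (P' (Suc m)) (d' m))" for n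
  have r: "\<And>n. projective A (P n)" "e \<in> mod_hom A (P 0) M" "\<And>n. d n \<in> mod_hom A (P (Suc n)) (P n)" "e ` space (P 0) = space M"
    "\<And>n. d n ` space (P (Suc n)) = K n" "\<And>n. superfluous A (P n) (K n)"
    using P unfolding minimal_projective_resolution_def K_def by (auto split: nat.split)
  have r': "\<And>n. projective A (P' n)" "e' \<in> mod_hom A (P' 0) M" "\<And>n. d' n \<in> mod_hom A (P' (Suc n)) (P' n)" "e' ` space (P' 0) = space M"
    "\<And>n. d' n ` space (P' (Suc n)) = K' n" "\<And>n. superfluous A (P' n) (K' n)"
    using P' unfolding minimal_projective_resolution_def K'_def by (auto split: nat.split)
  have fP: "fd_module A (P n)" "fd_module A (P' n)" for n using r(1) r'(1) by (auto simp: projective_def)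
  \<comment> \<open>The module \<open>M\<close> is moved to coordinates in \<open>nat\<close>, where projectivity is tested.\<close>
  define c :: "unit \<Rightarrow> nat" where "c = (\<lambda>_. 0)"
  have c: "inj_on c UNIV" by (simp add: c_def inj_on_def)
  have S: "space M \<subseteq> supp_in UNIV" by (simp add: supp_in_def)
  let ?Y = "push_mod c UNIV M"
  have pM: "pushf c UNIV \<in> mod_hom A M ?Y" by (rule push_mod_hom[OF c S])
  have p0: "pushf c UNIV v = 0 \<longleftrightarrow> v = 0" for v :: "unit \<Rightarrow> 'k"
    by (rule push_eq_0[OF c]) (simp add: supp_in_def)
  have kerp: "ker_on (Q :: ('b \<Rightarrow> 'k, nat, 'k) amod) (\<lambda>v. pushf c UNIV (f v)) = ker_on Q f" for Q f
    by (simp add: ker_on_def p0)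
  have "\<exists>\<phi>\<in>mod_hom A (P n) (P' n). bij_betw \<phi> (space (P n)) (space (P' n)) \<and> \<phi> ` K n = K' n" for n
  proof (induction n)
    case 0
    have sy: "space ?Y = pushf c UNIV ` space M" by (rule push_space)
    have "\<exists>\<phi>\<in>mod_hom A (P 0) (P' 0). bij_betw \<phi> (space (P 0)) (space (P' 0)) \<and>
        (\<forall>v\<in>space (P 0). pushf c UNIV (e' (\<phi> v)) = pushf c UNIV (e v))"
    proof (rule cover_iso[OF r(1) r'(1) push_mod_fd[OF c S M] mod_hom_comp[OF r(2) pM] _ mod_hom_comp[OF r'(2) pM]])
      show "(\<lambda>v. pushf c UNIV (e v)) ` space (P 0) = space ?Y" unfolding sy r(4)[symmetric] by (simp add: image_image)
      show "(\<lambda>v. pushf c UNIV (e' v)) ` space (P' 0) = space ?Y" unfolding sy r'(4)[symmetric] by (simp add: image_image)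
      show "superfluous A (P 0) (ker_on (P 0) (\<lambda>v. pushf c UNIV (e v)))" using r(6)[of 0] by (simp add: kerp K_def)
      show "superfluous A (P' 0) (ker_on (P' 0) (\<lambda>v. pushf c UNIV (e' v)))" using r'(6)[of 0] by (simp add: kerp K'_def)
    qed
    then obtain \<phi> where \<phi>: "\<phi> \<in> mod_hom A (P 0) (P' 0)" "bij_betw \<phi> (space (P 0)) (space (P' 0))"
      "\<And>v. v \<in> space (P 0) \<Longrightarrow> pushf c UNIV (e' (\<phi> v)) = pushf c UNIV (e v)" by blast
    have "e' (\<phi> v) = 0 \<longleftrightarrow> e v = 0" if "v \<in> space (P 0)" for v using p0 \<phi>(3)[OF that] by metis
    hence "\<phi> ` K 0 = K' 0" using ker_on_image[of \<phi> "P 0" "P' 0" e' e] \<phi>(2) by (simp add: K_def K'_def bij_betw_def)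
    thus ?case using \<phi> by blast
  next
    case (Suc n)
    then obtain \<phi> where \<phi>: "\<phi> \<in> mod_hom A (P n) (P' n)" "bij_betw \<phi> (space (P n)) (space (P' n))" "\<phi> ` K n = K' n" by blast
    have Kfd: "fd_module A ((P' n)\<lparr>space := K' n\<rparr>)"
    proof (cases n)
      case 0
      thus ?thesis using kernel_fd[OF fP(2) M r'(2)] by (simp add: K'_def)
    next
      case (Suc m)
      thus ?thesis using kernel_fd[OF fP(2) fP(2) r'(3), of m] by (simp add: K'_def)
    qed
    let ?Y = "(P' n)\<lparr>space := K' n\<rparr>"
    have KP: "K n \<subseteq> space (P n)" by (cases n) (auto simp: K_def ker_on_def)
    have h1: "(\<lambda>v. \<phi> (d n v)) \<in> mod_hom A (P (Suc n)) ?Y"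
      using mod_hom_comp[OF r(3) \<phi>(1)] r(5)[of n] \<phi>(3) by (auto simp: mod_hom_def)
    have h2: "d' n \<in> mod_hom A (P' (Suc n)) ?Y" using r'(3)[of n] r'(5)[of n] by (auto simp: mod_hom_def)
    have z: "\<phi> (d n v) = 0 \<longleftrightarrow> d n v = 0" if v: "v \<in> space (P (Suc n))" for v
    proof -
      note SP = fd_moduleD(2)[OF fP(1)]
      have dv: "d n v \<in> space (P n)" using r(5)[of n] KP v by blast
      have z0: "\<phi> 0 = 0" by (rule linear_on_zero[OF SP mod_homD(2)[OF \<phi>(1)]])
      show ?thesis
      proof
        assume "\<phi> (d n v) = 0"
        hence "\<phi> (d n v) = \<phi> 0" using z0 by simp
        thus "d n v = 0" using \<phi>(2) dv fvs.subspace_0[OF SP] unfolding bij_betw_def inj_on_def by blast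
      qed (simp add: z0)
    qed
    have k1: "ker_on (P (Suc n)) (\<lambda>v. \<phi> (d n v)) = K (Suc n)" using z by (auto simp: ker_on_def K_def)
    have k2: "ker_on (P' (Suc n)) (d' n) = K' (Suc n)" by (simp add: K'_def)
    have "\<exists>\<psi>\<in>mod_hom A (P (Suc n)) (P' (Suc n)). bij_betw \<psi> (space (P (Suc n))) (space (P' (Suc n))) \<and>
        (\<forall>v\<in>space (P (Suc n)). d' n (\<psi> v) = \<phi> (d n v))"
    proof (rule cover_iso[OF r(1) r'(1) Kfd h1 _ h2])
      show "(\<lambda>v. \<phi> (d n v)) ` space (P (Suc n)) = space ?Y" using r(5)[of n] \<phi>(3) by (simp add: image_image[symmetric])
      show "d' n ` space (P' (Suc n)) = space ?Y" using r'(5)[of n] by simp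
      show "superfluous A (P (Suc n)) (ker_on (P (Suc n)) (\<lambda>v. \<phi> (d n v)))" unfolding k1 by (rule r(6))
      show "superfluous A (P' (Suc n)) (ker_on (P' (Suc n)) (d' n))" unfolding k2 by (rule r'(6))
    qed
    then obtain \<psi> where \<psi>: "\<psi> \<in> mod_hom A (P (Suc n)) (P' (Suc n))" "bij_betw \<psi> (space (P (Suc n))) (space (P' (Suc n)))"
      "\<And>v. v \<in> space (P (Suc n)) \<Longrightarrow> d' n (\<psi> v) = \<phi> (d n v)" by blast
    have "d' n (\<psi> v) = 0 \<longleftrightarrow> d n v = 0" if "v \<in> space (P (Suc n))" for v using z[OF that] \<psi>(3)[OF that] by simp
    hence "\<psi> ` K (Suc n) = K' (Suc n)"
      using ker_on_image[of \<psi> "P (Suc n)" "P' (Suc n)" "d' n" "d n"] \<psi>(2) by (simp add: K_def K'_def bij_betw_def)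
    thus ?case using \<psi> by blast
  qed
  thus ?thesis by blast
qed

lemma dim_le_of_surj:
  assumes V: "fin_dim V" and f: "linear_on V f" and W: "f ` V = W"
  shows "fvs.dim W \<le> fvs.dim V"
proof -
  obtain B where B: "B \<subseteq> V" "fvs.independent B" "V \<subseteq> fvs.span B" "card B = fvs.dim V" by (rule fvs.basis_exists)
  obtain B0 where B0: "finite B0" "V = fvs.span B0" using V by (auto simp: fin_dim_def)
  have fB: "finite B" using fvs.independent_span_bound[OF B0(1) B(2)] B(1) B0(2) by auto
  obtain g where g: "flin g" "\<forall>x\<in>V. g x = f x" using linear_on_extend[OF subspace_fin_dim[OF V] f] by blast
  have "W \<subseteq> fvs.span (f ` B)"
  proof
    fix w assume "w \<in> W"
    then obtain x where x: "x \<in> V" "w = f x" using W by blast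
    have "g x \<in> fvs.span (f ` B)"
    proof (rule span_imageI[OF g(1), of _ B])
      show "x \<in> fvs.span B" using x(1) B(3) by blast
      show "g y \<in> fvs.span (f ` B)" if y: "y \<in> B" for y
      proof -
        have "g y = f y" using y B(1) g(2) by blast
        thus ?thesis using y by (simp add: fvs.span_base)
      qed
    qed (rule fvs.subspace_span)
    thus "w \<in> fvs.span (f ` B)" using g(2) x by simp
  qed
  hence "fvs.dim W \<le> card (f ` B)" using fB by (intro fvs.dim_le_card) auto
  also have "\<dots> \<le> card B" by (rule card_image_le[OF fB])
  finally show ?thesis using B(4) by simp
qed

section \<open>Free modules and the lemma of Nakayama\<close>

text \<open>
  For one nilpotent operator \<open>r\<close>, iterating \<open>V = W + r V\<close> gives \<open>V = W + r\<^sup>N V = W\<close>. The operators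
  are removed one after the other: the subgroup \<open>S = W + \<Sum> r\<^sub>a V\<close> over the remaining ones is again stable.
\<close>

lemma nakayama_ops:
  fixes r :: "'a \<Rightarrow> 'v::ab_group_add \<Rightarrow> 'v"
  assumes V: "addsub V" and T: "finite T" and W: "addsub W" "W \<subseteq> V"
    and r: "\<And>a. a \<in> T \<Longrightarrow> endo V (r a)"
    and comm: "\<And>a b. a \<in> T \<Longrightarrow> b \<in> T \<Longrightarrow> commute_on V (r a) (r b)"
    and nil: "\<And>a x. a \<in> T \<Longrightarrow> x \<in> V \<Longrightarrow> (r a ^^ N) x = 0"
    and rW: "\<And>a w. a \<in> T \<Longrightarrow> w \<in> W \<Longrightarrow> r a w \<in> W"
    and gen: "\<And>v. v \<in> V \<Longrightarrow> \<exists>w\<in>W. \<exists>u. (\<forall>a\<in>T. u a \<in> V) \<and> v = w + (\<Sum>a\<in>T. r a (u a))"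
  shows "V \<subseteq> W"
  using T r comm nil rW gen
proof (induction T rule: finite_induct)
  case empty
  show ?case
  proof
    fix v assume "v \<in> V"
    then obtain w where "w \<in> W" "v = w + (\<Sum>a\<in>{}. r a (undefined a))" using empty.prems(5) by auto
    thus "v \<in> W" by simp
  qed
next
  case (insert b T)
  define S where "S = {w + (\<Sum>a\<in>T. r a (u a)) |w u. w \<in> W \<and> (\<forall>a\<in>T. u a \<in> V)}"
  have eT: "endo V (r a)" if "a \<in> T" for a using insert.prems(1) that by simp
  have eb: "endo V (r b)" using insert.prems(1) by simp
  have rV: "r a x \<in> V" if "a \<in> insert b T" "x \<in> V" for a x using insert.prems(1)[OF that(1)] that(2) by (simp add: endo_def)
  have SI: "w + (\<Sum>a\<in>T. r a (u a)) \<in> S" if "w \<in> W" "\<And>a. a \<in> T \<Longrightarrow> u a \<in> V" for w u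
    unfolding S_def using that by blast
  have SE: "\<exists>w u. s = w + (\<Sum>a\<in>T. r a (u a)) \<and> w \<in> W \<and> (\<forall>a\<in>T. u a \<in> V)" if "s \<in> S" for s
    using that unfolding S_def by blast
  have sumV: "(\<Sum>a\<in>T. r a (u a)) \<in> V" if "\<And>a. a \<in> T \<Longrightarrow> u a \<in> V" for u
    by (rule addsub_sum[OF V]) (use that rV in auto)
  have S0: "0 \<in> S"
  proof -
    have "0 + (\<Sum>a\<in>T. r a 0) \<in> S" by (rule SI) (use W V in \<open>auto simp: addsub_def\<close>)
    moreover have "r a 0 = 0" if "a \<in> T" for a using endo_zero[OF V eT[OF that]] .
    ultimately show ?thesis by simp
  qed
  have Sadd: "s + s' \<in> S" if ss: "s \<in> S" "s' \<in> S" for s s'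
  proof -
    obtain w u where s: "s = w + (\<Sum>a\<in>T. r a (u a))" "w \<in> W" "\<forall>a\<in>T. u a \<in> V" using SE[OF ss(1)] by auto
    obtain w' u' where s': "s' = w' + (\<Sum>a\<in>T. r a (u' a))" "w' \<in> W" "\<forall>a\<in>T. u' a \<in> V" using SE[OF ss(2)] by auto
    have "(w + w') + (\<Sum>a\<in>T. r a (u a + u' a)) \<in> S"
      by (rule SI) (use s s' addsub_add[OF W(1)] addsub_add[OF V] in auto)
    moreover have "(\<Sum>a\<in>T. r a (u a + u' a)) = (\<Sum>a\<in>T. r a (u a)) + (\<Sum>a\<in>T. r a (u' a))"
      unfolding sum.distrib[symmetric] by (rule sum.cong[OF refl]) (use eT s(3) s'(3) in \<open>simp add: endo_def\<close>)
    ultimately show ?thesis unfolding s s' by (simp add: algebra_simps)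
  qed
  have Sb: "r b s \<in> S" if ss: "s \<in> S" for s
  proof -
    obtain w u where s: "s = w + (\<Sum>a\<in>T. r a (u a))" "w \<in> W" "\<forall>a\<in>T. u a \<in> V" using SE[OF ss(1)] by auto
    have "r b w + (\<Sum>a\<in>T. r a (r b (u a))) \<in> S"
      by (rule SI) (use s insert.prems(4) rV in auto)
    moreover have "r b s = r b w + (\<Sum>a\<in>T. r b (r a (u a)))"
    proof -
      have "r b s = r b w + r b (\<Sum>a\<in>T. r a (u a))"
        using eb sumV[of u] s W(2) unfolding s(1) by (auto simp: endo_def)
      also have "r b (\<Sum>a\<in>T. r a (u a)) = (\<Sum>a\<in>T. r b (r a (u a)))"
        by (rule endo_sum[OF V eb]) (use s(3) rV in auto)
      finally show ?thesis .
    qed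
    moreover have "r b (r a (u a)) = r a (r b (u a))" if "a \<in> T" for a
      using insert.prems(2)[of b a] that s(3) by (simp add: commute_on_def)
    ultimately show ?thesis by simp
  qed
  have Sbn: "(r b ^^ n) s \<in> S" if "s \<in> S" for s n using that Sb by (induction n) auto
  have SV: "S \<subseteq> V"
    unfolding S_def using sumV W(2) addsub_add[OF V] by auto
  have step: "\<exists>s\<in>S. \<exists>x\<in>V. v = s + (r b ^^ n) x" if v: "v \<in> V" for v n
    using v
  proof (induction n arbitrary: v)
    case 0 thus ?case using S0 by (intro bexI[of _ 0] bexI[of _ v]) auto
  next
    case (Suc n)
    obtain s x where s: "s \<in> S" "x \<in> V" "v = s + (r b ^^ n) x" using Suc.IH[OF Suc.prems] by auto
    obtain w u where w: "w \<in> W" "\<forall>a\<in>insert b T. u a \<in> V" "x = w + (\<Sum>a\<in>insert b T. r a (u a))"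
      using insert.prems(5)[OF s(2)] by (elim bexE exE conjE)
    define s' where "s' = w + (\<Sum>a\<in>T. r a (u a))"
    have s': "s' \<in> S" unfolding s'_def by (rule SI) (use w in auto)
    have ub: "u b \<in> V" using w(2) by simp
    have x: "x = s' + r b (u b)" unfolding w(3) s'_def using insert.hyps by (simp add: algebra_simps)
    have e: "endo V (r b ^^ n)" by (rule endo_funpow[OF eb])
    have "(r b ^^ n) x = (r b ^^ n) s' + (r b ^^ n) (r b (u b))"
      unfolding x using e s' SV rV[OF _ ub, of b] by (auto simp: endo_def)
    hence "v = (s + (r b ^^ n) s') + (r b ^^ Suc n) (u b)"
      using s(3) by (simp add: funpow_swap1 algebra_simps)
    moreover have "s + (r b ^^ n) s' \<in> S" by (rule Sadd[OF s(1) Sbn[OF s']])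
    ultimately show ?case using ub by (rule_tac bexI) (rule_tac bexI)
  qed
  show ?case
  proof (rule insert.IH)
    fix v assume v: "v \<in> V"
    obtain s x where s: "s \<in> S" "x \<in> V" "v = s + (r b ^^ N) x" using step[OF v, of N] by auto
    have "(r b ^^ N) x = 0" using insert.prems(3)[OF _ s(2)] by simp
    hence "v \<in> S" using s by simp
    thus "\<exists>w\<in>W. \<exists>u. (\<forall>a\<in>T. u a \<in> V) \<and> v = w + (\<Sum>a\<in>T. r a (u a))" using SE[of v] by auto
  qed (use insert.prems in auto)
qed

lemma push_image:
  assumes e: "inj_on e S" and T: "T \<subseteq> S"
  shows "pushf e S ` supp_in T = (supp_in (e ` T) :: (nat \<Rightarrow> 'k::field) set)"
proof
  show "pushf e S ` supp_in T \<subseteq> (supp_in (e ` T) :: (nat \<Rightarrow> 'k) set)"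
  proof -
    have "pushf e S F j = 0" if F: "F \<in> supp_in T" and j: "j \<notin> e ` T" for F :: "'a \<Rightarrow> 'k" and j
    proof (cases "j \<in> e ` S")
      case True
      then obtain x where x: "x \<in> S" "j = e x" by blast
      have "F x = 0" using F j x(2) by (auto simp: supp_in_def)
      thus ?thesis using x e by (simp add: pushf_def)
    qed (simp add: pushf_def)
    thus ?thesis by (auto simp: supp_in_def[of "e ` T"])
  qed
  show "(supp_in (e ` T) :: (nat \<Rightarrow> 'k) set) \<subseteq> pushf e S ` supp_in T"
  proof
    fix f :: "nat \<Rightarrow> 'k" assume f: "f \<in> supp_in (e ` T)"
    have "f \<in> supp_in (e ` S)" using f T by (auto simp: supp_in_def)
    hence "f = pushf e S (pullf e S f)" using push_pull[OF e] by metis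
    moreover have "pullf e S f \<in> supp_in T"
    proof -
      have "f (e x) = 0" if "x \<in> S" "x \<notin> T" for x
      proof -
        have "e x \<notin> e ` T" using e that T by (auto simp: inj_on_def)
        thus ?thesis using f by (simp add: supp_in_def)
      qed
      thus ?thesis by (auto simp: supp_in_def pullf_def)
    qed
    ultimately show "f \<in> pushf e S ` supp_in T" by (rule image_eqI)
  qed
qed

lemma pull_mod_hom:
  assumes e: "inj_on e S" and S: "space M \<subseteq> supp_in S" and M: "fd_module A M"
  shows "pullf e S \<in> mod_hom A (push_mod e S M) M"
proof -
  have pp: "pullf e S (pushf e S v) = v" if "v \<in> space M" for v using pull_push[OF e] S that by blast
  have "pullf e S (act (push_mod e S M) a (pushf e S v)) = act M a v" if "a \<in> carrier A" "v \<in> space M" for a v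
    using push_mod_act[OF e S that(2), of a] pp[OF fd_moduleD(3)[OF M that]] by simp
  thus ?thesis using flin_linear_on[OF pull_flin] pp by (auto simp: mod_hom_def push_space)
qed

lemma push_conj_mod_hom:
  assumes e: "inj_on e S" and S: "space M \<subseteq> supp_in S" "space N \<subseteq> supp_in S" and M: "fd_module A M"
    and f: "f \<in> mod_hom A M N"
  shows "(\<lambda>v. pushf e S (f (pullf e S v))) \<in> mod_hom A (push_mod e S M) (push_mod e S N)"
  by (rule mod_hom_comp[OF mod_hom_comp[OF pull_mod_hom[OF e S(1) M] f] push_mod_hom[OF e S(2)]])

lemma push_projective:
  fixes M :: "('b \<Rightarrow> 'k::field, 'x, 'k) amod"
  assumes e: "inj_on e S" and S: "space M \<subseteq> supp_in S" and M: "projective A M"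
  shows "projective A (push_mod e S M)"
  unfolding projective_def
proof (intro conjI allI ballI impI)
  have fM: "fd_module A M" using M by (simp add: projective_def)
  show "fd_module A (push_mod e S M)" by (rule push_mod_fd[OF e S fM])
  fix X Y :: "('b \<Rightarrow> 'k, nat, 'k) amod" and g f
  assume g: "g \<in> mod_hom A X Y" and f: "f \<in> mod_hom A (push_mod e S M) Y"
    and XY: "fd_module A X \<and> fd_module A Y \<and> g ` space X = space Y"
  obtain h where h: "h \<in> mod_hom A M X" "\<And>v. v \<in> space M \<Longrightarrow> g (h v) = f (pushf e S v)"
    by (rule projectiveD[OF M _ _ g _ mod_hom_comp[OF push_mod_hom[OF e S] f]]) (use XY in \<open>auto intro: that\<close>)
  show "\<exists>h\<in>mod_hom A (push_mod e S M) X. \<forall>v\<in>space (push_mod e S M). g (h v) = f v"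
  proof (rule bexI)
    show "(\<lambda>v. h (pullf e S v)) \<in> mod_hom A (push_mod e S M) X"
      by (rule mod_hom_comp[OF pull_mod_hom[OF e S fM] h(1)])
    show "\<forall>v\<in>space (push_mod e S M). g (h (pullf e S v)) = f v"
    proof
      fix v assume "v \<in> space (push_mod e S M)"
      then obtain w where w: "w \<in> space M" "v = pushf e S w" by (auto simp: push_space)
      have "pullf e S v = w" using pull_push[OF e] S w by blast
      thus "g (h (pullf e S v)) = f v" using h(2)[OF w(1)] w(2) by simp
    qed
  qed
qed

lemma push_ker_on:
  assumes e: "inj_on e S" and S: "space M \<subseteq> supp_in S"
    and fg: "\<And>v. v \<in> space M \<Longrightarrow> g (pushf e S v) = 0 \<longleftrightarrow> f v = 0"
  shows "ker_on (push_mod e S M) g = pushf e S ` ker_on M f"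
  by (rule ker_on_image[symmetric]) (use fg in \<open>auto simp: push_space\<close>)

lemma push_superfluous:
  assumes e: "inj_on e S" and S: "space M \<subseteq> supp_in S" and M: "fd_module A M"
    and K: "superfluous A M K" "K \<subseteq> space M"
  shows "superfluous A (push_mod e S M) (pushf e S ` K)"
  unfolding superfluous_def
proof (intro allI impI, elim conjE)
  fix W assume W: "submod A (push_mod e S M) W" and sum: "{w + x |w x. w \<in> W \<and> x \<in> pushf e S ` K} = space (push_mod e S M)"
  note SM = fd_moduleD(2)[OF M]
  have Ws: "fvs.subspace W" "W \<subseteq> space (push_mod e S M)"
    "\<And>a w. a \<in> carrier A \<Longrightarrow> w \<in> W \<Longrightarrow> act (push_mod e S M) a w \<in> W"
    using W by (auto simp: submod_def)
  define W' where "W' = {v \<in> space M. pushf e S v \<in> W}"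
  have "submod A M W'"
    unfolding submod_def
  proof (intro conjI ballI)
    show "fvs.subspace W'"
      unfolding fvs.subspace_def W'_def
      using fvs.subspace_0[OF SM] fvs.subspace_0[OF Ws(1)] fvs.subspace_add[OF SM] fvs.subspace_add[OF Ws(1)]
        fvs.subspace_scale[OF SM] fvs.subspace_scale[OF Ws(1)]
      by (auto simp: flin_zero[OF push_flin] flin_add[OF push_flin] flin_scale[OF push_flin])
    show "W' \<subseteq> space M" by (auto simp: W'_def)
    fix a w assume a: "a \<in> carrier A" and w: "w \<in> W'"
    thus "act M a w \<in> W'"
      using fd_moduleD(3)[OF M a, of w] push_mod_act[OF e S, of w a] Ws(3)[OF a, of "pushf e S w"] by (simp add: W'_def)
  qed
  moreover have "\<exists>w\<in>W'. v - w \<in> K" if v: "v \<in> space M" for v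
  proof -
    have "pushf e S v \<in> space (push_mod e S M)" using v by (simp add: push_space)
    then obtain w k where wk: "w \<in> W" "k \<in> K" "pushf e S v = w + pushf e S k" using sum by blast
    have "pushf e S (v - k) = w" using wk(3) by (simp add: flin_diff[OF push_flin])
    moreover have "v - k \<in> space M" using fvs.subspace_diff[OF SM v] K(2) wk(2) by blast
    ultimately have "v - k \<in> W'" using wk(1) by (simp add: W'_def)
    moreover have "v - (v - k) \<in> K" using wk(2) by simp
    ultimately show ?thesis by blast
  qed
  ultimately have "W' = space M" by (rule superfluousD[OF K(1) _ _ K(2) SM])
  hence "pushf e S ` space M \<subseteq> W" by (auto simp: W'_def)
  thus "W = space (push_mod e S M)" using Ws(2) by (simp add: push_space subset_antisym)
qed

definition col :: "('g \<times> 'i \<Rightarrow> 'k::field) \<Rightarrow> 'i \<Rightarrow> 'g \<Rightarrow> 'k" where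
  "col F \<mu> = (\<lambda>x. F (x, \<mu>))"

lemma col_add: "col (F + F') \<mu> = col F \<mu> + col F' \<mu>"
  and col_scale: "col (fscale c F) \<mu> = fscale c (col F \<mu>)"
  and col_diff: "col (F - F') \<mu> = col F \<mu> - col F' \<mu>"
  by (auto simp: col_def fun_eq_iff)

lemma col_sum: "col (\<Sum>i\<in>I. F i) \<mu> = (\<Sum>i\<in>I. col (F i) \<mu>)"
  by (auto simp: col_def fun_eq_iff)

lemma col_eqI: "(\<And>\<mu>. col F \<mu> = col F' \<mu>) \<Longrightarrow> F = F'"
  by (auto simp: col_def fun_eq_iff)

lemma col_supp: "F \<in> supp_in (A \<times> I) \<longleftrightarrow> (\<forall>\<mu>\<in>I. col F \<mu> \<in> supp_in A) \<and> (\<forall>\<mu>. \<mu> \<notin> I \<longrightarrow> col F \<mu> = 0)"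
  by (auto simp: col_def supp_in_def fun_eq_iff)

lemma col_in: "F \<in> supp_in (A \<times> I) \<Longrightarrow> col F \<mu> \<in> supp_in A"
  by (auto simp: supp_in_def col_def)

context fin_group_alg begin

text \<open>
  The free module with basis \<open>I\<close> over the group algebra of \<open>A\<close>: a column for each member of \<open>I\<close>.
\<close>

definition free_mod :: "'g set \<Rightarrow> 'i set \<Rightarrow> ('g \<Rightarrow> 'k, 'g \<times> 'i, 'k) amod" where
  "free_mod A I = \<lparr>space = supp_in (A \<times> I), act = (\<lambda>f F. \<lambda>(a, \<mu>). (f \<star> col F \<mu>) a)\<rparr>"

lemma free_space [simp]: "space (free_mod A I) = supp_in (A \<times> I)"
  by (simp add: free_mod_def)

lemma free_act_col [simp]: "col (act (free_mod A I) f F) \<mu> = f \<star> col F \<mu>"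
  by (simp add: free_mod_def col_def)

lemma free_act_dl:
  "x \<in> carrier G \<Longrightarrow> a \<in> carrier G \<Longrightarrow> act (free_mod A I) (dl x) F (a, \<mu>) = F (inv x \<otimes> a, \<mu>)"
  by (simp add: free_mod_def dl_conv) (simp add: col_def)

lemma free_mod_fd:
  assumes A: "subgroup A G" and I: "finite (I :: 'i set)"
  shows "fd_module (HK A) (free_mod A I)"
proof (rule fd_moduleI)
  have AG: "kS A \<subseteq> kS (carrier G)" using subgroup.subset[OF A] by (rule kS_mono)
  have "finite A" using finite_subset[OF subgroup.subset[OF A] fin] .
  thus "fin_dim (space (free_mod A I) :: ('g \<times> 'i \<Rightarrow> 'k) set)" using dim_supp_in(2)[of "A \<times> I"] I by simp
  show "act (free_mod A I) f F \<in> space (free_mod A I)" if "f \<in> carrier (HK A)" "F \<in> space (free_mod A I)" for f and F :: "'g \<times> 'i \<Rightarrow> 'k"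
    using that conv_kS[OF A] by (auto simp: col_supp conv_right)
  show "linear_on (space (free_mod A I)) (act (free_mod A I) f)" for f
    unfolding linear_on_def by (auto intro!: col_eqI simp: col_add col_scale conv_right)
  show "linear_on (carrier (HK A)) (\<lambda>f. act (free_mod A I) f F)" for F :: "'g \<times> 'i \<Rightarrow> 'k"
    unfolding linear_on_def by (auto intro!: col_eqI simp: col_add col_scale conv_left)
  show "act (free_mod A I) \<one>\<^bsub>HK A\<^esub> F = F" if F: "F \<in> space (free_mod A I)" for F :: "'g \<times> 'i \<Rightarrow> 'k"
  proof (rule col_eqI)
    fix \<mu>
    have "col F \<mu> \<in> kS (carrier G)" using col_in[of F A I \<mu>] F AG by auto
    thus "col (act (free_mod A I) \<one>\<^bsub>HK A\<^esub> F) \<mu> = col F \<mu>" by (simp add: one_conv)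
  qed
  show "act (free_mod A I) (f \<otimes>\<^bsub>HK A\<^esub> h) F = act (free_mod A I) f (act (free_mod A I) h F)" for f h and F :: "'g \<times> 'i \<Rightarrow> 'k"
    by (rule col_eqI) (simp add: conv_assoc)
qed

definition unit_at :: "'i \<Rightarrow> 'g \<times> 'i \<Rightarrow> 'k" where
  "unit_at \<mu> = (\<lambda>(a, \<nu>). if \<nu> = \<mu> then dl \<one> a else 0)"

lemma unit_at_col: "col (unit_at \<mu>) \<nu> = (if \<nu> = \<mu> then dl \<one> else 0)"
  by (auto simp: col_def unit_at_def fun_eq_iff)

lemma unit_at_supp: "subgroup A G \<Longrightarrow> \<mu> \<in> I \<Longrightarrow> unit_at \<mu> \<in> supp_in (A \<times> I)"
  by (auto simp: col_supp unit_at_col dl_kS subgroup.one_closed fvs.subspace_0[OF subspace_supp])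

lemma free_expand:
  assumes A: "subgroup A G" and I: "finite (I :: 'i set)" and F: "F \<in> supp_in (A \<times> I)"
  shows "F = (\<Sum>\<mu>\<in>I. act (free_mod A I) (col F \<mu>) (unit_at \<mu>))"
proof (rule col_eqI)
  fix \<nu>
  have AG: "kS A \<subseteq> kS (carrier G)" using subgroup.subset[OF A] by (rule kS_mono)
  have "col (\<Sum>\<mu>\<in>I. act (free_mod A I) (col F \<mu>) (unit_at \<mu>)) \<nu> = (\<Sum>\<mu>\<in>I. if \<mu> = \<nu> then col F \<nu> \<star> dl \<one> else 0)"
    unfolding col_sum free_act_col unit_at_col by (rule sum.cong) (auto simp: conv_right)
  also have "\<dots> = col F \<nu>"
  proof (cases "\<nu> \<in> I")
    case True
    thus ?thesis using F AG I conv_one[of "col F \<nu>"] by (auto simp: col_supp)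
  next
    case False
    thus ?thesis using F I by (simp add: col_supp)
  qed
  finally show "col F \<nu> = col (\<Sum>\<mu>\<in>I. act (free_mod A I) (col F \<mu>) (unit_at \<mu>)) \<nu>" ..
qed

text \<open>
  Group elements span the algebra, so equivariance needs to be checked on them only.
\<close>

lemma mod_hom_HKI:
  assumes A: "subgroup A G" and M: "fd_module (HK A) M" and N: "fd_module (HK A) N"
    and f: "f ` space M \<subseteq> space N" "linear_on (space M) f"
    and c: "\<And>x v. x \<in> A \<Longrightarrow> v \<in> space M \<Longrightarrow> f (act M (dl x) v) = act N (dl x) (f v)"
  shows "f \<in> mod_hom (HK A) M N"
  unfolding mod_hom_def
proof (intro CollectI conjI ballI)
  show "f \<in> space M \<rightarrow> space N" using f(1) by auto
  show "linear_on (space M) f" by (rule f(2))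
  fix a v assume a: "a \<in> carrier (HK A)" and v: "v \<in> space M"
  note SM = fd_moduleD(2)[OF M]
  have av: "act M (dl x) v \<in> space M" if "x \<in> A" for x using fd_moduleD(3)[OF M _ v] dl_kS[OF that] by simp
  have fv: "f v \<in> space N" using f(1) v by blast
  have ak: "a \<in> kS A" using a by simp
  have "f (act M a v) = f (\<Sum>x\<in>A. fscale (a x) (act M (dl x) v))" unfolding HK_act[OF A M v ak] ..
  also have "\<dots> = (\<Sum>x\<in>A. f (fscale (a x) (act M (dl x) v)))"
    by (rule linear_on_sum[OF SM f(2)]) (use av fvs.subspace_scale[OF SM] in auto)
  also have "\<dots> = (\<Sum>x\<in>A. fscale (a x) (act N (dl x) (f v)))"
    by (rule sum.cong[OF refl]) (use av linear_onD(2)[OF f(2)] c[OF _ v] in auto)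
  also have "\<dots> = act N a (f v)" unfolding HK_act[OF A N fv ak] ..
  finally show "f (act M a v) = act N a (f v)" .
qed

lemma free_projective:
  assumes A: "subgroup A G" and I: "finite (I :: 'i set)"
  shows "projective (HK A) (free_mod A I)"
  unfolding projective_def
proof (intro conjI allI ballI impI)
  show FF: "fd_module (HK A) (free_mod A I)" by (rule free_mod_fd[OF A I])
  fix X Y :: "('g \<Rightarrow> 'k, nat, 'k) amod" and g f
  assume g: "g \<in> mod_hom (HK A) X Y" and f: "f \<in> mod_hom (HK A) (free_mod A I) Y"
    and XY: "fd_module (HK A) X \<and> fd_module (HK A) Y \<and> g ` space X = space Y"
  have X: "fd_module (HK A) X" and Y: "fd_module (HK A) Y" using XY by auto
  note DX = fd_moduleD[OF X] and g' = mod_homD[OF g] and f' = mod_homD[OF f]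
  have colA: "col F \<mu> \<in> kS A" if "F \<in> supp_in (A \<times> I)" "\<mu> \<in> I" for F :: "'g \<times> 'i \<Rightarrow> 'k" and \<mu>
    using that by (simp add: col_supp)
  have u: "f (unit_at \<mu>) \<in> space Y" if "\<mu> \<in> I" for \<mu> using f'(1) unit_at_supp[OF A that] by auto
  define x where "x \<mu> = (SOME v. v \<in> space X \<and> g v = f (unit_at \<mu>))" for \<mu>
  have x: "x \<mu> \<in> space X" "g (x \<mu>) = f (unit_at \<mu>)" if m: "\<mu> \<in> I" for \<mu>
  proof -
    have "f (unit_at \<mu>) \<in> g ` space X" using u[OF m] XY by simp
    then obtain v where "v \<in> space X \<and> g v = f (unit_at \<mu>)" by (elim imageE) simp
    from someI[of "\<lambda>v. v \<in> space X \<and> g v = f (unit_at \<mu>)", OF this]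
    show "x \<mu> \<in> space X" "g (x \<mu>) = f (unit_at \<mu>)" unfolding x_def by blast+
  qed
  define h where "h F = (\<Sum>\<mu>\<in>I. act X (col F \<mu>) (x \<mu>))" for F
  have hX: "h F \<in> space X" if F: "F \<in> supp_in (A \<times> I)" for F
    unfolding h_def by (rule fvs.subspace_sum[OF DX(2)]) (rule DX(3), use colA[OF F] x in auto)
  have lin: "linear_on (supp_in (A \<times> I)) h"
    unfolding h_def
  proof (rule linear_on_sum_fun)
    fix \<mu> assume m: "\<mu> \<in> I"
    have "linear_on (supp_in (A \<times> I)) (\<lambda>F. col F \<mu>)" by (simp add: linear_on_def col_add col_scale)
    from linear_on_comp[OF this, of "carrier (HK A)" "\<lambda>a. act X a (x \<mu>)"] DX(5)[OF x(1)[OF m]] colA m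
    show "linear_on (supp_in (A \<times> I)) (\<lambda>F. act X (col F \<mu>) (x \<mu>))" by auto
  qed
  have hh: "h \<in> mod_hom (HK A) (free_mod A I) X"
    unfolding mod_hom_def
  proof (intro CollectI conjI ballI)
    show "h \<in> space (free_mod A I) \<rightarrow> space X" using hX by auto
    show "linear_on (space (free_mod A I)) h" using lin by simp
    fix a F assume a: "a \<in> carrier (HK A)" and F: "F \<in> space (free_mod A I)"
    have cF: "act X (col F \<mu>) (x \<mu>) \<in> space X" if "\<mu> \<in> I" for \<mu> using DX(3) colA F that x by auto
    have "act X a (h F) = (\<Sum>\<mu>\<in>I. act X a (act X (col F \<mu>) (x \<mu>)))"
      unfolding h_def by (rule linear_on_sum[OF DX(2) DX(4)[OF a] cF])
    also have "\<dots> = (\<Sum>\<mu>\<in>I. act X (a \<star> col F \<mu>) (x \<mu>))"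
      by (rule sum.cong[OF refl]) (use DX(7)[OF a] colA F x in auto)
    finally show "h (act (free_mod A I) a F) = act X a (h F)" unfolding h_def free_act_col by simp
  qed
  show "\<exists>h\<in>mod_hom (HK A) (free_mod A I) X. \<forall>v\<in>space (free_mod A I). g (h v) = f v"
  proof (rule bexI[OF _ hh], rule ballI)
    fix F :: "'g \<times> 'i \<Rightarrow> 'k" assume "F \<in> space (free_mod A I)"
    hence F: "F \<in> supp_in (A \<times> I)" by simp
    have "g (h F) = (\<Sum>\<mu>\<in>I. g (act X (col F \<mu>) (x \<mu>)))"
      unfolding h_def by (rule linear_on_sum[OF DX(2) g'(2)]) (rule DX(3), use colA[OF F] x in auto)
    also have "\<dots> = (\<Sum>\<mu>\<in>I. f (act (free_mod A I) (col F \<mu>) (unit_at \<mu>)))"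
    proof (rule sum.cong[OF refl])
      fix \<mu> assume m: "\<mu> \<in> I"
      have c: "col F \<mu> \<in> carrier (HK A)" using colA[OF F m] by simp
      have u: "unit_at \<mu> \<in> space (free_mod A I)" using unit_at_supp[OF A m] by simp
      show "g (act X (col F \<mu>) (x \<mu>)) = f (act (free_mod A I) (col F \<mu>) (unit_at \<mu>))"
        unfolding g'(3)[OF c x(1)[OF m]] f'(3)[OF c u] x(2)[OF m] ..
    qed
    also have "\<dots> = f (\<Sum>\<mu>\<in>I. act (free_mod A I) (col F \<mu>) (unit_at \<mu>))"
    proof (rule linear_on_sum[OF fd_moduleD(2)[OF FF] f'(2), symmetric])
      show "act (free_mod A I) (col F \<mu>) (unit_at \<mu>) \<in> space (free_mod A I)" if "\<mu> \<in> I" for \<mu>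
        by (rule fd_moduleD(3)[OF FF]) (use colA[OF F] unit_at_supp[OF A] that in auto)
    qed
    also have "\<dots> = f F" unfolding free_expand[OF A I F, symmetric] ..
    finally show "g (h F) = f F" .
  qed
qed

text \<open>
  Elements with column sums zero are combinations of elements \<open>(a - 1) y\<close>, and the operators \<open>a - 1\<close>
  are commuting nilpotents.
\<close>

lemma nakayama:
  assumes A: "abp A" and I: "finite (I :: 'i set)" and K: "K \<subseteq> supp_in (A \<times> I)"
    and z: "\<And>F \<mu>. F \<in> K \<Longrightarrow> (\<Sum>a\<in>A. F (a, \<mu>)) = 0"
  shows "superfluous (HK A) (free_mod A I) K"
  unfolding superfluous_def
proof (intro allI impI, elim conjE)
  fix W assume W: "submod (HK A) (free_mod A I) W"
    and sum: "{w + x |w x. w \<in> W \<and> x \<in> K} = space (free_mod A I)"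
  note sA = abp_subgroup[OF A]
  note AG = subgroup.subset[OF sA]
  have FF: "fd_module (HK A) (free_mod A I :: ('g \<Rightarrow> 'k, 'g \<times> 'i, 'k) amod)" by (rule free_mod_fd[OF sA I])
  let ?M = "free_mod A I :: ('g \<Rightarrow> 'k, 'g \<times> 'i, 'k) amod"
  let ?V = "supp_in (A \<times> I) :: ('g \<times> 'i \<Rightarrow> 'k) set"
  have W': "fvs.subspace W" "W \<subseteq> ?V" "\<And>a w. a \<in> kS A \<Longrightarrow> w \<in> W \<Longrightarrow> act ?M a w \<in> W"
    using W by (auto simp: submod_def)
  let ?r = "\<lambda>a F. act ?M (dl a) F - F"
  note R = translation_minus_one[OF A FF, unfolded free_space]
  have "?V \<subseteq> W"
  proof (rule nakayama_ops[where r = ?r and T = A and N = "p ^ order G"])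
    show "addsub ?V" by (rule addsub_subspace[OF subspace_supp])
    show "finite A" using finite_subset[OF AG fin] .
    show "addsub W" by (rule addsub_subspace[OF W'(1)])
    show "W \<subseteq> ?V" by (rule W'(2))
    show "?r a w \<in> W" if "a \<in> A" "w \<in> W" for a w
      by (rule fvs.subspace_diff[OF W'(1) W'(3)[OF dl_kS[OF that(1)] that(2)] that(2)])
    fix v assume v: "v \<in> ?V"
    have "v \<in> {w + x |w x. w \<in> W \<and> x \<in> K}" unfolding sum using v by simp
    then obtain w F where wF: "w \<in> W" "F \<in> K" "v = w + F" by (elim CollectE exE conjE)
    have FV: "F \<in> ?V" using K wF(2) by blast
    define y where "y a = (\<lambda>(b, \<mu>). F (a, \<mu>) * dl \<one> b)" for a
    have yc: "col (y a) \<mu> = fscale (F (a, \<mu>)) (dl \<one>)" for a \<mu> by (auto simp: y_def col_def fun_eq_iff)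
    have yV: "y a \<in> ?V" for a
    proof -
      have "F (a, \<mu>) = 0" if "\<mu> \<notin> I" for \<mu> using FV that by (simp add: supp_in_def)
      thus ?thesis
        unfolding col_supp yc using fvs.subspace_scale[OF subspace_supp dl_kS[OF abp_one[OF A]]]
        by (auto simp: fscale_def fun_eq_iff)
    qed
    have "F = (\<Sum>a\<in>A. ?r a (y a))"
    proof (rule col_eqI)
      fix \<mu>
      have cF: "col F \<mu> \<in> kS A" by (rule col_in[OF FV])
      have uG: "dl a \<in> kS (carrier G)" if "a \<in> A" for a using dl_kS[OF that] kS_mono[OF AG] by blast
      have "col (\<Sum>a\<in>A. ?r a (y a)) \<mu> = (\<Sum>a\<in>A. fscale (F (a, \<mu>)) (dl a) - fscale (F (a, \<mu>)) (dl \<one>))"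
        unfolding col_sum col_diff free_act_col yc by (rule sum.cong[OF refl]) (simp add: conv_right conv_one[OF uG])
      also have "\<dots> = (\<Sum>a\<in>A. fscale (F (a, \<mu>)) (dl a)) - fscale (\<Sum>a\<in>A. F (a, \<mu>)) (dl \<one>)"
        by (rule ext) (simp add: sum_subtractf sum_distrib_right)
      also have "\<dots> = (\<Sum>a\<in>A. fscale (col F \<mu> a) (dl a))" unfolding z[OF wF(2)] by (auto simp: col_def fun_eq_iff)
      also have "\<dots> = col F \<mu>" by (rule kS_expand[OF cF AG, symmetric])
      finally show "col F \<mu> = col (\<Sum>a\<in>A. ?r a (y a)) \<mu>" ..
    qed
    thus "\<exists>w\<in>W. \<exists>y. (\<forall>a\<in>A. y a \<in> ?V) \<and> v = w + (\<Sum>a\<in>A. ?r a (y a))"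
      using wF(1,3) yV by auto
  qed (rule R; assumption)+
  thus "W = space (free_mod A I)" using W'(2) by auto
qed

end

section \<open>The minimal resolution of the trivial module\<close>

lemma au_eq_sum:
  "length \<mu> = length qs \<Longrightarrow> au qs f \<mu> = (\<Sum>ns\<in>{ns. list_all2 (\<lambda>q n. n < q) qs ns}. f (zip ns \<mu>))"
proof (induction qs arbitrary: f \<mu>)
  case Nil
  have "{ns. list_all2 (\<lambda>q n. n < q) [] ns} = {[] :: nat list}" by auto
  thus ?case using Nil by (simp only: length_0_conv list.size) simp
next
  case (Cons q qs)
  obtain m \<mu>' where \<mu>: "\<mu> = m # \<mu>'" "length \<mu>' = length qs" using Cons.prems by (cases \<mu>) auto
  let ?S = "{ns. list_all2 (\<lambda>q n. n < q) qs ns}"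
  have S: "{ns. list_all2 (\<lambda>q n. n < q) (q # qs) ns} = (\<lambda>(j, ns). j # ns) ` ({..<q} \<times> ?S)"
    by (auto simp: list_all2_Cons1 image_iff)
  have inj: "inj_on (\<lambda>(j, ns). j # ns) ({..<q} \<times> ?S)" by (auto simp: inj_on_def)
  have "(\<Sum>ns\<in>{ns. list_all2 (\<lambda>q n. n < q) (q # qs) ns}. f (zip ns \<mu>)) = (\<Sum>(j, ns)\<in>{..<q} \<times> ?S. f ((j, m) # zip ns \<mu>'))"
    unfolding S sum.reindex[OF inj] \<mu>(1) by (rule sum.cong) auto
  also have "\<dots> = (\<Sum>ns\<in>?S. \<Sum>j<q. f ((j, m) # zip ns \<mu>'))"
    unfolding sum.cartesian_product[symmetric] by (rule sum.swap)
  also have "\<dots> = au (q # qs) f \<mu>" unfolding \<mu>(1) au.simps Cons.IH[OF \<mu>(2)] ..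
  finally show ?case ..
qed

lemma shift_exps_snd: "map snd (shift_exps qs es \<sigma>) = map snd \<sigma>"
  by (induction qs es \<sigma> rule: shift_exps.induct) auto

lemma shift_exps_valid: "valid qs \<sigma> \<Longrightarrow> valid qs (shift_exps qs es \<sigma>)"
  by (induction qs es \<sigma> rule: shift_exps.induct) auto

context fin_group_alg begin

lemma gp_shift:
  assumes A: "abp A"
  shows "set gs \<subseteq> A \<Longrightarrow> valid (map ord gs) \<sigma> \<Longrightarrow> es \<in> exps gs \<Longrightarrow>
    gp gs (map fst (shift_exps (map ord gs) es \<sigma>)) = inv (gp gs es) \<otimes> gp gs (map fst \<sigma>)"
proof (induction gs arbitrary: \<sigma> es)
  case (Cons g gs)
  obtain n m \<sigma>' where \<sigma>: "\<sigma> = (n, m) # \<sigma>'" "n < ord g" "valid (map ord gs) \<sigma>'"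
    using Cons.prems(2) by (auto elim: valid_ConsE)
  obtain e es' where es: "es = e # es'" "e < ord g" "es' \<in> exps gs"
    using Cons.prems(3) by (auto simp: exps_def list_all2_Cons1)
  have gA: "g \<in> A" and gG: "g \<in> carrier G" using Cons.prems(1) abp_in[OF A] by auto
  have gsA: "set gs \<subseteq> A" using Cons.prems(1) by simp
  let ?E = "gp gs es'" and ?S = "gp gs (map fst \<sigma>')"
  have E: "?E \<in> A" "?S \<in> A" using gp_in[OF A gsA] by auto
  have EG: "?E \<in> carrier G" using E abp_in[OF A] by blast
  have "g [^] (ord g - e) \<otimes> g [^] e = g [^] (ord g)" using gG es(2) by (simp add: nat_pow_mult)
  also have "\<dots> = \<one>" using pow_ord_eq_1[OF gG] .
  finally have i: "g [^] (ord g - e) = inv (g [^] e)" using gG inv_equality by auto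
  have "g [^] ((n + (ord g - e)) mod ord g) = g [^] (n + (ord g - e))" by (rule pow_mod_ord[OF gG])
  also have "\<dots> = g [^] n \<otimes> g [^] (ord g - e)" using gG by (simp add: nat_pow_mult)
  also have "\<dots> = inv (g [^] e) \<otimes> g [^] n"
    unfolding i by (rule abp_comm[OF A]) (use gA abp_pow[OF A] abp_inv[OF A] in auto)
  finally have 1: "g [^] ((n + (ord g - e)) mod ord g) = inv (g [^] e) \<otimes> g [^] n" .
  have "inv (g [^] e \<otimes> ?E) = inv ?E \<otimes> inv (g [^] e)" using gG EG by (simp add: inv_mult_group)
  also have "\<dots> = inv (g [^] e) \<otimes> inv ?E"
    by (rule abp_comm[OF A]) (use gA E abp_pow[OF A] abp_inv[OF A] in auto)
  finally have 2: "inv (g [^] e \<otimes> ?E) = inv (g [^] e) \<otimes> inv ?E" .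
  have "gp (g # gs) (map fst (shift_exps (map ord (g # gs)) es \<sigma>)) = (inv (g [^] e) \<otimes> g [^] n) \<otimes> (inv ?E \<otimes> ?S)"
    unfolding \<sigma>(1) es(1) using Cons.IH[OF gsA \<sigma>(3) es(3)] 1 by simp
  also have "\<dots> = (inv (g [^] e) \<otimes> inv ?E) \<otimes> (g [^] n \<otimes> ?S)"
    by (rule abp_ac[OF A]) (use gA E abp_pow[OF A] abp_inv[OF A] in auto)
  finally show ?case unfolding \<sigma>(1) es(1) by (simp add: 2)
qed (simp add: exps_def)

end

text \<open>
  A basis \<open>gs\<close> identifies \<open>A\<close> with lists of exponents. Under this identification the tensor product
  complex becomes a complex of free modules on \<open>Deg n\<close>, the multidegrees of total degree \<open>n\<close>.
\<close>

locale abp_basis = fin_group_alg G ty p for G :: "('g, 'm) monoid_scheme" (structure) and ty :: "'k::field itself" and p +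
  fixes A gs
  assumes A: "abp A" and basis: "is_basis gs A"
begin

abbreviation "qs \<equiv> map ord gs"
abbreviation "r \<equiv> length gs"
definition "ex = inv_into (exps gs) (gp gs)"
definition "Deg n = {\<mu> :: nat list. length \<mu> = r \<and> sum_list \<mu> = n}"

lemma gsA: "set gs \<subseteq> A" and gp_bij: "bij_betw (gp gs) (exps gs) A"
  using basis by (auto simp: is_basis_def)

lemma sub_A: "subgroup A G" by (rule abp_subgroup[OF A])
lemma A_G: "x \<in> A \<Longrightarrow> x \<in> carrier G" by (rule abp_in[OF A])
lemma fin_A: "finite A" using finite_subset[OF subgroup.subset[OF sub_A] fin] .

lemma ex_exps: "a \<in> A \<Longrightarrow> ex a \<in> exps gs" and gp_ex: "a \<in> A \<Longrightarrow> gp gs (ex a) = a"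
  and ex_gp: "ns \<in> exps gs \<Longrightarrow> ex (gp gs ns) = ns"
  unfolding ex_def using gp_bij
  by (auto simp: bij_betw_def inv_into_into f_inv_into_f)

lemma exps_eq: "exps gs = {ns. list_all2 (\<lambda>q n. n < q) qs ns}"
  by (simp add: exps_def list_all2_map1)

lemma exps_length: "ns \<in> exps gs \<Longrightarrow> length ns = r"
  by (auto simp: exps_def dest: list_all2_lengthD)

lemma valid_iff: "valid qs \<sigma> \<longleftrightarrow> map fst \<sigma> \<in> exps gs"
  by (simp add: valid_def exps_def list_all2_map1 list_all2_map2)

lemma valid_length: "valid qs \<sigma> \<Longrightarrow> length \<sigma> = r"
  using exps_length[of "map fst \<sigma>"] by (simp add: valid_iff)

definition cell :: "'g \<times> nat list \<Rightarrow> (nat \<times> nat) list" where "cell = (\<lambda>(a, \<mu>). zip (ex a) \<mu>)"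

lemma cell_simps:
  assumes "a \<in> A" "length \<mu> = r"
  shows "valid qs (cell (a, \<mu>))" "map snd (cell (a, \<mu>)) = \<mu>" "gp gs (map fst (cell (a, \<mu>))) = a"
  using assms exps_length[OF ex_exps[OF assms(1)]] ex_exps gp_ex by (simp_all add: cell_def valid_iff)

lemma cell_surj:
  assumes "valid qs \<sigma>" shows "cell (gp gs (map fst \<sigma>), map snd \<sigma>) = \<sigma>"
  using assms ex_gp[of "map fst \<sigma>"] by (simp add: cell_def valid_iff zip_map_fst_snd)

lemma gp_valid: "valid qs \<sigma> \<Longrightarrow> gp gs (map fst \<sigma>) \<in> A"
  by (rule gp_in[OF A gsA])

text \<open>
  The maps \<open>up\<close> and \<open>dn\<close> pass between functions on \<open>A\<close> times multidegrees and functions on lists of pairs.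
\<close>

definition up :: "('g \<times> nat list \<Rightarrow> 'k) \<Rightarrow> (nat \<times> nat) list \<Rightarrow> 'k" where
  "up F \<sigma> = F (gp gs (map fst \<sigma>), map snd \<sigma>)"

definition dn :: "((nat \<times> nat) list \<Rightarrow> 'k) \<Rightarrow> 'g \<times> nat list \<Rightarrow> 'k" where
  "dn f = (\<lambda>(a, \<mu>). if a \<in> A \<and> length \<mu> = r then f (cell (a, \<mu>)) else 0)"

definition bnd :: "('g \<times> nat list \<Rightarrow> 'k) \<Rightarrow> 'g \<times> nat list \<Rightarrow> 'k" where
  "bnd F = dn (bd qs (up F))"

lemma up_dn: "valid qs \<sigma> \<Longrightarrow> up (dn f) \<sigma> = f \<sigma>"
  using cell_surj[of \<sigma>] gp_valid[of \<sigma>] valid_length[of \<sigma>] by (simp add: up_def dn_def)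

lemma dn_up: "F \<in> supp_in (A \<times> Deg n) \<Longrightarrow> dn (up F) = F"
  by (rule ext) (auto simp: dn_def up_def supp_in_def Deg_def cell_simps)

lemma up_supp: "F \<in> supp_in (A \<times> Deg n) \<Longrightarrow> deg \<sigma> \<noteq> n \<Longrightarrow> up F \<sigma> = 0"
  by (auto simp: up_def supp_in_def Deg_def)

lemma dn_supp: "(\<And>\<sigma>. valid qs \<sigma> \<Longrightarrow> deg \<sigma> \<noteq> n \<Longrightarrow> f \<sigma> = 0) \<Longrightarrow> dn f \<in> supp_in (A \<times> Deg n)"
  by (auto simp: dn_def supp_in_def Deg_def cell_simps)

lemma dn_cong: "(\<And>\<sigma>. valid qs \<sigma> \<Longrightarrow> f \<sigma> = g \<sigma>) \<Longrightarrow> dn f = dn g"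
  by (rule ext) (auto simp: dn_def cell_simps)

lemma dn_zero: "(\<And>\<sigma>. valid qs \<sigma> \<Longrightarrow> f \<sigma> = 0) \<Longrightarrow> dn f = 0"
  by (rule ext) (auto simp: dn_def cell_simps)

lemma finite_Deg: "finite (Deg n)"
  unfolding Deg_def by (rule finite_subset[OF _ finite_lists_length_eq[of "{..n}" r]])
    (auto dest: member_le_sum_list)

lemma card_Deg: "card (Deg n) = (n + r - 1) choose n"
  unfolding Deg_def by (rule card_length_sum_list)

lemma bd_zero_on: "valid qs \<sigma> \<Longrightarrow> (\<And>\<tau>. valid qs \<tau> \<Longrightarrow> deg \<tau> = Suc (deg \<sigma>) \<Longrightarrow> f \<tau> = 0) \<Longrightarrow> bd qs f \<sigma> = (0::'k)"
  using bd_cong[of qs \<sigma> f "\<lambda>_. 0"] by (simp add: bd_zero)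

lemma ht_zero_on: "valid qs \<sigma> \<Longrightarrow> (\<And>\<tau>. valid qs \<tau> \<Longrightarrow> Suc (deg \<tau>) = deg \<sigma> \<Longrightarrow> f \<tau> = 0) \<Longrightarrow> ht qs f \<sigma> = (0::'k)"
  using ht_cong[of qs \<sigma> f "\<lambda>_. 0"] by (simp add: ht_zero)

lemma bnd_in: "F \<in> supp_in (A \<times> Deg (Suc n)) \<Longrightarrow> bnd F \<in> supp_in (A \<times> Deg n)"
  unfolding bnd_def by (rule dn_supp) (rule bd_zero_on, auto intro: up_supp)

lemma bnd_bnd: "bnd (bnd F) = 0"
  unfolding bnd_def
proof (rule dn_zero)
  fix \<sigma> assume v: "valid qs \<sigma>"
  have "bd qs (up (dn (bd qs (up F)))) \<sigma> = bd qs (bd qs (up F)) \<sigma>"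
    by (rule bd_cong[OF v]) (rule up_dn)
  thus "bd qs (up (dn (bd qs (up F)))) \<sigma> = 0" by (simp add: bd_bd)
qed

lemma bnd_flin: "flin bnd"
proof (rule flinI)
  fix F F' :: "'g \<times> nat list \<Rightarrow> 'k" and c
  have a: "up (F + F') = (\<lambda>\<tau>. up F \<tau> + up F' \<tau>)" by (rule ext) (simp add: up_def)
  show "bnd (F + F') = bnd F + bnd F'"
    unfolding bnd_def a by (auto simp: dn_def bd_add fun_eq_iff)
  have m: "up (fscale c F) = (\<lambda>\<tau>. c * up F \<tau>)" by (rule ext) (simp add: up_def)
  show "bnd (fscale c F) = fscale c (bnd F)"
    unfolding bnd_def m by (auto simp: dn_def bd_scale fun_eq_iff)
qed

text \<open>
  The homotopy supplies the preimage; the two conditions on \<open>F\<close> say that it is a cycle of the augmented complex.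
\<close>

lemma bnd_exact:
  assumes F: "F \<in> supp_in (A \<times> Deg n)" and z: "bnd F = 0" and e: "(\<Sum>a\<in>A. F (a, replicate r 0)) = 0"
  shows "\<exists>F'\<in>supp_in (A \<times> Deg (Suc n)). bnd F' = F"
proof (rule bexI)
  let ?F' = "dn (ht qs (up F))"
  show "?F' \<in> supp_in (A \<times> Deg (Suc n))"
    by (rule dn_supp) (rule ht_zero_on, auto intro: up_supp[OF F])
  have b0: "bd qs (up F) \<sigma> = 0" if v: "valid qs \<sigma>" for \<sigma>
  proof -
    have "bd qs (up F) \<sigma> = up (bnd F) \<sigma>" unfolding bnd_def using up_dn[OF v, of "bd qs (up F)"] by simp
    thus ?thesis unfolding z by (simp add: up_def)
  qed
  have au0: "au qs (up F) (replicate r 0) = 0"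
  proof -
    have "au qs (up F) (replicate r 0) = (\<Sum>ns\<in>exps gs. up F (zip ns (replicate r 0)))"
      unfolding exps_eq by (rule au_eq_sum) simp
    also have "\<dots> = (\<Sum>ns\<in>exps gs. F (gp gs ns, replicate r 0))"
      by (rule sum.cong[OF refl]) (simp add: up_def exps_length)
    also have "\<dots> = (\<Sum>a\<in>A. F (a, replicate r 0))"
      by (rule sum.reindex_bij_betw[OF gp_bij])
    finally show ?thesis using e by simp
  qed
  show "bnd ?F' = F"
  proof -
    have "bd qs (up ?F') \<sigma> = up F \<sigma>" if v: "valid qs \<sigma>" for \<sigma>
    proof -
      have "bd qs (up ?F') \<sigma> = bd qs (ht qs (up F)) \<sigma>" by (rule bd_cong[OF v]) (rule up_dn)
      moreover have "ht qs (bd qs (up F)) \<sigma> = 0" by (rule ht_zero_on[OF v]) (rule b0)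
      moreover have "aug_proj qs (up F) \<sigma> = 0"
      proof (cases "\<forall>s\<in>set \<sigma>. s = (0, 0)")
        case True
        hence "\<sigma> = replicate r (0, 0)" using valid_length[OF v] by (metis replicate_length_same)
        thus ?thesis using au0 by (simp add: aug_proj_def)
      qed (simp only: aug_proj_def if_False)
      ultimately show ?thesis using bd_ht[OF v, of "up F"] by simp
    qed
    hence "bnd ?F' = dn (up F)" unfolding bnd_def by (rule dn_cong)
    thus ?thesis using dn_up[OF F] by simp
  qed
qed

lemma order_zero: "q \<in> set qs \<Longrightarrow> of_nat q = (0::'k)"
proof -
  assume "q \<in> set qs"
  then obtain g where g: "g \<in> set gs" "q = ord g" by auto
  have gA: "g \<in> A" and g1: "g \<noteq> \<one>" using g basis by (auto simp: is_basis_def)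
  obtain k where k: "ord g = p ^ k" using abp_ord_prime_power[OF A gA] by auto
  have "k \<noteq> 0" using k g1 ord_eq_1[OF A_G[OF gA]] by (cases k) auto
  hence "p dvd q" using k g(2) by simp
  thus ?thesis using char_p of_nat_eq_0_iff_char_dvd[where 'a = 'k, of q] by simp
qed

lemma bnd_col_sum: "(\<Sum>a\<in>A. bnd F (a, \<mu>)) = 0"
proof (cases "length \<mu> = r")
  case True
  have "(\<Sum>a\<in>A. bnd F (a, \<mu>)) = (\<Sum>ns\<in>exps gs. bnd F (gp gs ns, \<mu>))"
    by (rule sum.reindex_bij_betw[OF gp_bij, symmetric])
  also have "\<dots> = (\<Sum>ns\<in>exps gs. bd qs (up F) (zip ns \<mu>))"
    by (rule sum.cong[OF refl])
      (use True gp_bij in \<open>auto simp: bnd_def dn_def cell_def ex_gp bij_betw_def\<close>)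
  also have "\<dots> = au qs (bd qs (up F)) \<mu>"
    unfolding exps_eq by (rule au_eq_sum[symmetric]) (use True in simp)
  also have "\<dots> = 0" by (rule au_bd[OF order_zero])
  finally show ?thesis .
qed (simp add: bnd_def dn_def)

abbreviation "Q n \<equiv> free_mod A (Deg n)"

lemma Q_fd: "fd_module (HK A) (Q n)"
  by (rule free_mod_fd[OF sub_A finite_Deg])

text \<open>
  It suffices to treat translation by \<open>y \<in> A\<close>. In exponents this is a cyclic shift in each factor, with
  which the boundary commutes.
\<close>

lemma bnd_mod_hom: "bnd \<in> mod_hom (HK A) (Q (Suc n)) (Q n)"
proof (rule mod_hom_HKI[OF sub_A Q_fd Q_fd])
  show "bnd ` space (Q (Suc n)) \<subseteq> space (Q n)" using bnd_in by auto
  show "linear_on (space (Q (Suc n))) bnd" by (rule flin_linear_on[OF bnd_flin])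
  fix y F assume y: "y \<in> A" and F: "F \<in> space (Q (Suc n))"
  have F': "F \<in> supp_in (A \<times> Deg (Suc n))" using F by simp
  let ?L = "act (Q (Suc n)) (dl y) F" and ?R = "act (Q n) (dl y) (bnd F)"
  have yk: "dl y \<in> carrier (HK A)" using dl_kS[OF y] by simp
  have L: "bnd ?L \<in> supp_in (A \<times> Deg n)"
    by (rule bnd_in) (use fd_moduleD(3)[OF Q_fd yk F] in simp)
  have R: "?R \<in> supp_in (A \<times> Deg n)" using fd_moduleD(3)[OF Q_fd yk, of "bnd F" n] bnd_in[OF F'] by simp
  show "bnd ?L = ?R"
  proof (rule ext, clarify)
    fix a \<mu>
    show "bnd ?L (a, \<mu>) = ?R (a, \<mu>)"
    proof (cases "a \<in> A \<and> length \<mu> = r")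
      case False
      hence "(a, \<mu>) \<notin> A \<times> Deg n" by (auto simp: Deg_def)
      thus ?thesis using L R by (simp add: supp_in_def)
    next
      case True
      hence a: "a \<in> A" and m: "length \<mu> = r" by auto
      let ?s = "cell (a, \<mu>)"
      note c = cell_simps[OF a m]
      let ?t = "shift_exps qs (ex y) ?s"
      have shift: "gp gs (map fst (shift_exps qs (ex y) \<tau>)) = inv y \<otimes> gp gs (map fst \<tau>)" if "valid qs \<tau>" for \<tau>
        using gp_shift[OF A gsA that ex_exps[OF y]] gp_ex[OF y] by simp
      have up: "up ?L \<tau> = up F (shift_exps qs (ex y) \<tau>)" if v: "valid qs \<tau>" for \<tau>
        unfolding up_def shift_exps_snd shift[OF v]
        by (rule free_act_dl) (use y gp_valid[OF v] A_G in auto)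
      have "bnd ?L (a, \<mu>) = bd qs (up ?L) ?s" using a m by (simp add: bnd_def dn_def)
      also have "\<dots> = bd qs (\<lambda>\<tau>. up F (shift_exps qs (ex y) \<tau>)) ?s" by (rule bd_cong[OF c(1)]) (rule up)
      also have "\<dots> = bd qs (up F) ?t"
        by (rule bd_shift[OF c(1)]) (simp add: exps_length[OF ex_exps[OF y]])
      also have "\<dots> = up (bnd F) ?t" unfolding bnd_def by (rule up_dn[OF shift_exps_valid[OF c(1)], symmetric])
      also have "\<dots> = bnd F (inv y \<otimes> a, \<mu>)" unfolding up_def shift_exps_snd shift[OF c(1)] c(2,3) ..
      also have "\<dots> = ?R (a, \<mu>)" by (rule free_act_dl[symmetric]) (use y a A_G in auto)
      finally show ?thesis .
    qed
  qed
qed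

definition aug :: "('g \<times> nat list \<Rightarrow> 'k) \<Rightarrow> unit \<Rightarrow> 'k" where
  "aug F = (\<lambda>_. \<Sum>a\<in>A. F (a, replicate r 0))"

lemma trivial_fd: "fd_module (HK A) (trivial_module (HK A))"
proof (rule fd_moduleI)
  have "(UNIV :: (unit \<Rightarrow> 'k) set) = supp_in UNIV" by (simp add: supp_in_def)
  thus "fin_dim (space (trivial_module (HK A)))"
    using dim_supp_in(2)[of "UNIV :: unit set", where 'k = 'k] unfolding trivial_module_def by simp
  interpret S: finite_group_scheme "HK A" by (rule HK_scheme[OF sub_A])
  show "linear_on (carrier (HK A)) (\<lambda>a. act (trivial_module (HK A)) a v)" for v
    using S.counit_linear unfolding linear_on_def linear_form_on_def trivial_module_def
    by (auto simp: fun_eq_iff algebra_simps)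
  show "act (trivial_module (HK A)) \<one>\<^bsub>HK A\<^esub> v = v" for v
    using S.counit_one by (auto simp: trivial_module_def fun_eq_iff)
  show "act (trivial_module (HK A)) (a \<otimes>\<^bsub>HK A\<^esub> b) v = act (trivial_module (HK A)) a (act (trivial_module (HK A)) b v)"
    if "a \<in> carrier (HK A)" "b \<in> carrier (HK A)" for a b v
    using S.counit_mult[OF that] by (auto simp: trivial_module_def fun_eq_iff)
qed (auto simp: trivial_module_def linear_on_def fun_eq_iff algebra_simps)

lemma aug_mod_hom: "aug \<in> mod_hom (HK A) (Q 0) (trivial_module (HK A))"
proof (rule mod_hom_HKI[OF sub_A Q_fd trivial_fd])
  show "aug ` space (Q 0) \<subseteq> space (trivial_module (HK A))" by (simp add: trivial_module_def)
  show "linear_on (space (Q 0)) aug"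
    by (auto simp: linear_on_def aug_def fun_eq_iff sum.distrib sum_distrib_left)
  fix y F assume y: "y \<in> A" and F: "F \<in> space (Q 0)"
  have b: "bij_betw (\<lambda>a. inv y \<otimes> a) A A"
    by (rule bij_betw_byWitness[where f' = "\<lambda>a. y \<otimes> a"])
      (use y A_G abp_mult[OF A] abp_inv[OF A] in \<open>auto simp: m_assoc[symmetric]\<close>)
  have "(\<Sum>a\<in>A. act (Q 0) (dl y) F (a, replicate r 0)) = (\<Sum>a\<in>A. F (inv y \<otimes> a, replicate r 0))"
    by (rule sum.cong[OF refl]) (rule free_act_dl, use y A_G in auto)
  also have "\<dots> = (\<Sum>a\<in>A. F (a, replicate r 0))" by (rule sum.reindex_bij_betw[OF b])
  finally show "aug (act (Q 0) (dl y) F) = act (trivial_module (HK A)) (dl y) (aug F)"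
    using counit_dl[OF A_G[OF y]] by (auto simp: aug_def trivial_module_def fun_eq_iff)
qed

lemma Deg_0: "Deg 0 = {replicate r 0}"
proof -
  have "\<mu> = replicate r 0" if "length \<mu> = r" "sum_list \<mu> = 0" for \<mu> :: "nat list"
    using that by (metis sum_list_eq_0_iff replicate_length_same)
  thus ?thesis by (auto simp: Deg_def sum_list_replicate)
qed

lemma aug_surj: "aug ` space (Q 0) = space (trivial_module (HK A))"
proof -
  have "\<exists>F\<in>supp_in (A \<times> Deg 0). v = aug F" for v :: "unit \<Rightarrow> 'k"
  proof (rule bexI)
    let ?u = "unit_at (replicate r 0) :: 'g \<times> nat list \<Rightarrow> 'k"
    have "?u \<in> supp_in (A \<times> Deg 0)" by (rule unit_at_supp[OF sub_A]) (simp add: Deg_0)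
    thus "fscale (v ()) ?u \<in> supp_in (A \<times> Deg 0)" by (rule fvs.subspace_scale[OF subspace_supp])
    show "v = aug (fscale (v ()) ?u)"
      using fin_A abp_one[OF A] by (auto simp: aug_def unit_at_def dl_def fun_eq_iff sum_distrib_left[symmetric])
  qed
  thus ?thesis by (auto simp: trivial_module_def)
qed

lemma aug_zero_iff: "aug F = 0 \<longleftrightarrow> (\<Sum>a\<in>A. F (a, replicate r 0)) = 0"
  by (auto simp: aug_def fun_eq_iff)

lemma image_aug: "bnd ` space (Q (Suc 0)) = ker_on (Q 0) aug"
proof
  show "bnd ` space (Q (Suc 0)) \<subseteq> ker_on (Q 0) aug"
    using bnd_in bnd_col_sum by (auto simp: ker_on_def aug_zero_iff)
  show "ker_on (Q 0) aug \<subseteq> bnd ` space (Q (Suc 0))"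
  proof
    fix F assume "F \<in> ker_on (Q 0) aug"
    hence F: "F \<in> supp_in (A \<times> Deg 0)" "(\<Sum>a\<in>A. F (a, replicate r 0)) = 0" by (auto simp: ker_on_def aug_zero_iff)
    have "bnd F = 0" unfolding bnd_def
      by (rule dn_zero) (rule bd_zero_on, auto intro: up_supp[OF F(1)])
    from bnd_exact[OF F(1) this F(2)] show "F \<in> bnd ` space (Q (Suc 0))" by auto
  qed
qed

lemma image_bnd: "bnd ` space (Q (Suc (Suc n))) = ker_on (Q (Suc n)) bnd"
proof
  show "bnd ` space (Q (Suc (Suc n))) \<subseteq> ker_on (Q (Suc n)) bnd"
    using bnd_in bnd_bnd by (auto simp: ker_on_def)
  show "ker_on (Q (Suc n)) bnd \<subseteq> bnd ` space (Q (Suc (Suc n)))"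
  proof
    fix F assume "F \<in> ker_on (Q (Suc n)) bnd"
    hence F: "F \<in> supp_in (A \<times> Deg (Suc n))" "bnd F = 0" by (auto simp: ker_on_def)
    have "F (a, replicate r 0) = 0" for a
      using F(1) by (simp add: supp_in_def Deg_def sum_list_replicate)
    from bnd_exact[OF F(1,2)] this show "F \<in> bnd ` space (Q (Suc (Suc n)))" by auto
  qed
qed

lemma image_superfluous: "superfluous (HK A) (Q n) (bnd ` space (Q (Suc n)))"
  by (rule nakayama[OF A finite_Deg]) (use bnd_in bnd_col_sum in auto)

text \<open>
  The boundaries have column sums zero, so Nakayama's lemma makes every kernel superfluous.
\<close>

lemma minimal_resolution:
  "\<exists>P d e. minimal_projective_resolution (HK A) (trivial_module (HK A)) P d e \<and>
     (\<forall>n. fvs.dim (space (P n)) = card A * ((n + r - 1) choose n))"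
proof -
  obtain idx :: "'g \<Rightarrow> nat" where idx: "inj_on idx A" using finite_imp_inj_to_nat_seg[OF fin_A] by auto
  define c where "c = (\<lambda>(a, \<mu> :: nat list). prod_encode (idx a, to_nat \<mu>))"
  define S where "S = A \<times> (UNIV :: nat list set)"
  have c: "inj_on c S" using idx by (auto simp: c_def S_def inj_on_def)
  have sub: "space (Q n) \<subseteq> supp_in S" for n by (auto simp: S_def supp_in_def)
  define P where "P n = push_mod c S (Q n)" for n
  define d where "d = (\<lambda>v. pushf c S (bnd (pullf c S v)))"
  define e where "e = (\<lambda>v. aug (pullf c S v))"
  have pull: "pullf c S (pushf c S F) = F" if "F \<in> space (Q n)" for F n using pull_push[OF c] that sub by blast
  have dP: "d ` space (P (Suc n)) = pushf c S ` (bnd ` space (Q (Suc n)))" for n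
    unfolding P_def push_space d_def image_image by (rule image_cong[OF refl]) (simp only: pull)
  have kd: "ker_on (P (Suc n)) d = pushf c S ` (bnd ` space (Q (Suc (Suc n))))" for n
    unfolding P_def image_bnd
  proof (rule push_ker_on[OF c sub])
    fix F assume F: "F \<in> space (Q (Suc n))"
    have b: "bnd F \<in> supp_in S" using bnd_in[of F n] F sub[of n] by auto
    show "d (pushf c S F) = 0 \<longleftrightarrow> bnd F = 0"
      unfolding d_def pull[OF F] by (rule push_eq_0[OF c b])
  qed
  have ke: "ker_on (P 0) e = pushf c S ` (bnd ` space (Q (Suc 0)))"
    unfolding P_def image_aug by (rule push_ker_on[OF c sub]) (simp only: e_def pull)
  have bs: "bnd ` space (Q (Suc n)) \<subseteq> space (Q n)" for n using bnd_in by auto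
  have sup: "superfluous (HK A) (P n) (pushf c S ` (bnd ` space (Q (Suc n))))" for n
    unfolding P_def by (rule push_superfluous[OF c sub Q_fd image_superfluous bs])
  have "minimal_projective_resolution (HK A) (trivial_module (HK A)) P (\<lambda>_. d) e"
    unfolding minimal_projective_resolution_def
  proof (intro conjI allI)
    show "projective (HK A) (P n)" for n
      unfolding P_def by (rule push_projective[OF c sub free_projective[OF sub_A finite_Deg]])
    show "e \<in> mod_hom (HK A) (P 0) (trivial_module (HK A))"
      unfolding P_def e_def by (rule mod_hom_comp[OF pull_mod_hom[OF c sub Q_fd] aug_mod_hom])
    show "d \<in> mod_hom (HK A) (P (Suc n)) (P n)" for n
      unfolding P_def d_def by (rule push_conj_mod_hom[OF c sub sub Q_fd bnd_mod_hom])
    show "e ` space (P 0) = space (trivial_module (HK A))"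
      unfolding aug_surj[symmetric] P_def push_space e_def image_image by (rule image_cong[OF refl]) (simp only: pull)
    show "d ` space (P 1) = ker_on (P 0) e" unfolding ke using dP[of 0] by simp
    show "d ` space (P (Suc (Suc n))) = ker_on (P (Suc n)) d" for n unfolding kd by (rule dP)
    show "superfluous (HK A) (P 0) (ker_on (P 0) e)" unfolding ke by (rule sup)
    show "superfluous (HK A) (P (Suc n)) (ker_on (P (Suc n)) d)" for n unfolding kd by (rule sup)
  qed
  moreover have "fvs.dim (space (P n)) = card A * ((n + r - 1) choose n)" for n
  proof -
    have T: "A \<times> Deg n \<subseteq> S" by (auto simp: S_def)
    have "space (P n) = supp_in (c ` (A \<times> Deg n))"
      unfolding P_def push_space free_space by (rule push_image[OF c T])
    hence "fvs.dim (space (P n)) = card (c ` (A \<times> Deg n))"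
      using dim_supp_in(1)[of "c ` (A \<times> Deg n)"] fin_A finite_Deg by simp
    also have "\<dots> = card (A \<times> Deg n)" by (rule card_image[OF inj_on_subset[OF c T]])
    also have "\<dots> = card A * ((n + r - 1) choose n)" by (simp add: card_cartesian_product card_Deg)
    finally show ?thesis .
  qed
  ultimately show ?thesis by blast
qed

end

section \<open>Growth and complexity\<close>

lemma choose_growth_upper:
  assumes r: "1 \<le> r" "r \<le> c" and n: "1 \<le> (n::nat)"
  shows "real ((n + r - 1) choose n) \<le> real r ^ (r - 1) * real n powi (int c - 1)"
proof -
  have "(n + r - 1) choose n = (n + r - 1) choose (r - 1)"
    using binomial_symmetric[of n "n + r - 1"] r by simp
  also have "\<dots> \<le> (n + r - 1) ^ (r - 1)" by (rule binomial_le_pow) (use r in simp)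
  also have "\<dots> \<le> (r * n) ^ (r - 1)"
  proof (rule power_mono)
    obtain a b where "r = Suc a" "n = Suc b" using r n by (metis Suc_le_D One_nat_def)
    thus "n + r - 1 \<le> r * n" by simp
  qed simp
  also have "\<dots> \<le> r ^ (r - 1) * n ^ (c - 1)"
    unfolding power_mult_distrib using r n by (intro mult_left_mono power_increasing) auto
  finally have "real ((n + r - 1) choose n) \<le> real (r ^ (r - 1) * n ^ (c - 1))" by (simp only: of_nat_le_iff)
  moreover have "real n powi (int c - 1) = real n ^ (c - 1)"
  proof -
    have "int c - 1 = int (c - 1)" using r by simp
    thus ?thesis by (simp only: power_int_of_nat)
  qed
  ultimately show ?thesis by simp
qed

text \<open>
  The binomial coefficient grows like \<open>n ^ (r - 1)\<close>, faster than \<open>n ^ (c - 1)\<close>. The latter has a negative exponent for \<open>c = 0\<close>.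
\<close>

lemma choose_growth_lower:
  assumes c: "c < r" and C: "\<And>n::nat. n \<ge> 1 \<Longrightarrow> real ((n + r - 1) choose n) \<le> C * real n powi (int c - 1)"
  shows False
proof -
  define k where "k = r - 1"
  have rk: "r = Suc k" and ck: "c \<le> k" using c by (auto simp: k_def)
  have n: "real n \<le> C * real k ^ k" if n: "n \<ge> 1" for n :: nat
  proof -
    have np: "real n > 0" using n by simp
    have "real n ^ k / real k ^ k \<le> (real (n + k) / real k) ^ k"
      unfolding power_divide[symmetric] by (rule power_mono) (simp_all add: divide_right_mono)
    also have "\<dots> \<le> real ((n + k) choose k)" using binomial_ge_n_over_k_pow_k[of k "n + k", where 'a = real] by simp
    also have "(n + k) choose k = (n + r - 1) choose n" using binomial_symmetric[of k "n + k"] rk by simp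
    also have "real \<dots> \<le> C * real n powi (int c - 1)" by (rule C[OF n])
    also have "real n powi (int c - 1) = real n ^ c / real n"
      using np by (simp add: power_int_diff)
    finally have 1: "real n ^ k / real k ^ k \<le> C * (real n ^ c / real n)" .
    have C0: "C \<ge> 0"
    proof (rule ccontr)
      assume "\<not> 0 \<le> C"
      moreover have "real n ^ c / real n > 0" using np by simp
      ultimately have "C * (real n ^ c / real n) < 0" by (intro mult_neg_pos) auto
      moreover have "0 \<le> real n ^ k / real k ^ k" by simp
      ultimately show False using 1 by linarith
    qed
    have "real n ^ c \<le> real n ^ k" using n ck by (intro power_increasing) auto
    hence "C * (real n ^ c / real n) \<le> C * (real n ^ k / real n)"
      by (intro mult_left_mono[OF _ C0] divide_right_mono) auto
    hence 2: "real n ^ k / real k ^ k \<le> C * (real n ^ k / real n)" using 1 by linarith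
    have kp: "real k ^ k > 0" by (cases "k = 0") auto
    have npk: "real n ^ k > 0" using np by simp
    from 2 have "real n ^ k * real n \<le> real n ^ k * (C * real k ^ k)"
      using kp np by (simp add: field_simps)
    thus ?thesis using npk by simp
  qed
  obtain m :: nat where m: "real m > C * real k ^ k" using reals_Archimedean2 by blast
  have "real (Suc m) \<le> C * real k ^ k" by (rule n) simp
  thus False using m by simp
qed

context abp_basis begin

lemma complexity_eq: "complexity (HK A) (trivial_module (HK A)) = enat r"
proof -
  let ?M = "trivial_module (HK A)"
  let ?S = "{enat c |c. \<exists>P d e. minimal_projective_resolution (HK A) ?M P d e \<and>
            (\<exists>C::real. \<forall>n\<ge>1. real (fvs.dim (space (P n))) \<le> C * real n powi (int c - 1))}"
  obtain P d e where P: "minimal_projective_resolution (HK A) ?M P d e"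
    "\<And>n. fvs.dim (space (P n)) = card A * ((n + r - 1) choose n)" using minimal_resolution by blast
  have A1: "card A \<ge> 1" using abp_one[OF A] fin_A by (metis One_nat_def Suc_leI card_gt_0_iff empty_iff)
  have "enat r \<in> ?S"
  proof -
    have "\<exists>C::real. \<forall>n\<ge>1. real (fvs.dim (space (P n))) \<le> C * real n powi (int r - 1)"
    proof (cases "r = 0")
      case True
      have "fvs.dim (space (P n)) = 0" if "n \<ge> 1" for n using that True by (simp add: P(2) binomial_eq_0)
      thus ?thesis by (intro exI[of _ 0]) auto
    next
      case False
      have "real (fvs.dim (space (P n))) \<le> (real (card A) * real r ^ (r - 1)) * real n powi (int r - 1)" if n: "n \<ge> 1" for n
      proof -
        have "real ((n + r - 1) choose n) \<le> real r ^ (r - 1) * real n powi (int r - 1)"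
          by (rule choose_growth_upper) (use False n in \<open>auto simp: Suc_le_eq\<close>)
        hence "real (card A) * real ((n + r - 1) choose n) \<le> real (card A) * (real r ^ (r - 1) * real n powi (int r - 1))"
          by (rule mult_left_mono) simp
        thus ?thesis by (simp add: P(2) mult.assoc)
      qed
      thus ?thesis by blast
    qed
    thus ?thesis using P(1) by blast
  qed
  moreover have "enat r \<le> x" if x: "x \<in> ?S" for x
  proof -
    obtain c P' d' e' C where c: "x = enat c" "minimal_projective_resolution (HK A) ?M P' d' e'"
      "\<And>n. n \<ge> 1 \<Longrightarrow> real (fvs.dim (space (P' n))) \<le> C * real n powi (int c - 1)" using x by blast
    have fP': "fd_module (HK A) (P' n)" for n using c(2) by (simp add: minimal_projective_resolution_def projective_def)
    have "\<not> c < r"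
    proof
      assume "c < r"
      have "real ((n + r - 1) choose n) \<le> C * real n powi (int c - 1)" if n: "n \<ge> 1" for n
      proof -
        obtain \<phi> where \<phi>: "\<phi> \<in> mod_hom (HK A) (P' n) (P n)" "bij_betw \<phi> (space (P' n)) (space (P n))"
          using minimal_resolution_unique[OF trivial_fd c(2) P(1)] by blast
        have "fvs.dim (space (P n)) \<le> fvs.dim (space (P' n))"
          by (rule dim_le_of_surj[OF fd_moduleD(1)[OF fP'] mod_homD(2)[OF \<phi>(1)]]) (use \<phi>(2) in \<open>simp add: bij_betw_def\<close>)
        moreover have "(n + r - 1) choose n \<le> card A * ((n + r - 1) choose n)" using A1 by simp
        ultimately have "(n + r - 1) choose n \<le> fvs.dim (space (P' n))" unfolding P(2) by (rule order_trans[rotated])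
        thus ?thesis using c(3)[OF n] by linarith
      qed
      thus False using choose_growth_lower[OF \<open>c < r\<close>] by blast
    qed
    thus ?thesis using c(1) by simp
  qed
  ultimately have "Inf ?S = enat r" by (intro antisym Inf_lower Inf_greatest)
  thus ?thesis unfolding complexity_def .
qed

end

context fin_group_alg begin

lemma complexity_Om:
  assumes A: "abp A" and c: "card (Om A) = p ^ r"
  shows "complexity (HK A) (trivial_module (HK A)) = enat r"
proof -
  obtain gs where gs: "is_basis gs A" "card (Om A) = p ^ length gs" using abp_has_basis[OF A] by blast
  interpret B: abp_basis G ty p A gs by unfold_locales (rule A, rule gs(1))
  have "length gs = r" using c gs(2) p_gt1 by simp
  thus ?thesis using B.complexity_eq by simp
qed

section \<open>The saturation rank\<close>

lemma conj_eab:
  assumes E: "eab E" and x: "x \<in> carrier G"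
  shows "eab ((\<lambda>y. x \<otimes> y \<otimes> inv x) ` E)" and "card ((\<lambda>y. x \<otimes> y \<otimes> inv x) ` E) = card E"
proof -
  define f where "f = (\<lambda>y. x \<otimes> y \<otimes> inv x)"
  note EG = eab_subset[OF E]
  have c: "inv x \<otimes> (x \<otimes> z) = z" if "z \<in> carrier G" for z using x that by (simp add: m_assoc[symmetric])
  have "f \<in> hom G G" by (rule homI) (use x in \<open>auto simp: f_def m_assoc c\<close>)
  then interpret f: group_hom G G f by unfold_locales
  have "subgroup (f ` E) G" by (rule f.subgroup_img_is_subgroup) (use E in \<open>simp add: eab_def\<close>)
  moreover have "f y \<otimes> f z = f z \<otimes> f y" if "y \<in> E" "z \<in> E" for y z
    using that EG E f.hom_mult by (metis eab_def subsetD)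
  moreover have "f y [^] p = \<one>" if "y \<in> E" for y
    using f.hom_nat_pow[of y p] that EG E f.hom_one by (auto simp: eab_def)
  ultimately show "eab ((\<lambda>y. x \<otimes> y \<otimes> inv x) ` E)" unfolding f_def[symmetric] eab_def by blast
  have "inj_on f E" using EG x by (auto simp: inj_on_def f_def subset_iff)
  thus "card ((\<lambda>y. x \<otimes> y \<otimes> inv x) ` E) = card E" unfolding f_def by (rule card_image)
qed

lemma max_eab_le: "max_elem_abelian p G E \<Longrightarrow> eab F \<Longrightarrow> E \<subseteq> F \<Longrightarrow> F = E"
  by (simp add: max_elem_abelian_def elem_abelian_iff)

lemma max_eab: "max_elem_abelian p G E \<Longrightarrow> eab E"
  by (simp add: max_elem_abelian_def elem_abelian_iff)

text \<open>
  A \<open>p\<close>-point is represented in \<open>k(Om A)\<close>. Enlarging \<open>Om A\<close> to a maximal elementary abelian \<open>E\<close> and \<open>E\<close> to a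
  maximal abelian \<open>p\<close>-subgroup \<open>B\<close> gives \<open>Om B = E\<close>, so the complexity of \<open>B\<close> is the rank of \<open>E\<close>.
\<close>

lemma P_space_covered:
  assumes l: "\<And>E. max_elem_abelian p G E \<Longrightarrow> l \<le> elem_rank p G E"
  shows "P_space H = P_space_ge H l"
proof
  show "P_space_ge H l \<subseteq> P_space H" by (rule P_space_ge_sub)
  show "P_space H \<subseteq> P_space_ge H l"
  proof
    fix X assume "X \<in> P_space H"
    then obtain \<alpha> where \<alpha>: "\<alpha> \<in> p_points H" "X = p_equiv H `` {\<alpha>}" by (auto simp: P_space_def quotient_def)
    obtain A v where A: "abp A" and v: "v \<in> kS (Om A)" "pw v p = 0" "p_exact p (kS (carrier G)) ((\<star>) v)"
      "(\<alpha>, point v) \<in> p_equiv H" using p_point_reduce[OF \<alpha>(1)] by auto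
    obtain E where E: "max_elem_abelian p G E" "Om A \<subseteq> E" using max_eab_exists[OF Om_eab[OF A]] by auto
    note eE = max_eab[OF E(1)]
    obtain B where B: "abp B" "E \<subseteq> B" "\<forall>C. abp C \<and> B \<subseteq> C \<longrightarrow> C = B" using max_abp_exists[OF eab_abp[OF eE]] by auto
    have "E \<subseteq> Om B" using B(2) eE by (auto simp: Om_def eab_def)
    hence "Om B = E" by (rule max_eab_le[OF E(1) Om_eab[OF B(1)]])
    hence "complexity (HK B) (trivial_module (HK B)) = enat (elem_rank p G E)"
      using complexity_Om[OF B(1)] elem_rank_card[OF eE] by simp
    hence mB: "HK B \<in> Max_au_ge H l" using l[OF E(1)] B by (auto simp: Max_au_ge_def Max_au_iff)
    have "kS (Om A) \<subseteq> kS B" using E(2) B(2) by (intro kS_mono) simp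
    hence vB: "v \<in> kS B" using v(1) by blast
    note sB = abp_subgroup[OF B(1)]
    have "point v \<in> p_points (HK B)"
      by (rule point_p_point[OF B(1) subset_refl sB vB v(2) p_exact_restrict[OF sB vB v(3)]])
    moreover have "X = p_equiv H `` {point v}"
      unfolding \<alpha>(2) by (rule equiv_class_eq[OF p_equiv_equiv[OF subgroup_self, unfolded HK_G] v(4)])
    ultimately show "X \<in> P_space_ge H l" unfolding P_space_ge_eq using mB B(1) by blast
  qed
qed

text \<open>
  The generic element of \<open>E\<close> would be equivalent to a \<open>p\<close>-point of some \<open>A\<close> of larger complexity, so
  \<open>E\<close> would be conjugate into \<open>A\<close>, hence equal to a conjugate of \<open>Om A\<close> by maximality. That contradicts the ranks.
\<close>

lemma P_space_not_covered:
  assumes inf: "infinite (UNIV :: 'k set)"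
    and E: "max_elem_abelian p G E" "E \<noteq> {\<one>}" and l: "elem_rank p G E < l"
  shows "P_space H \<noteq> P_space_ge H l"
proof
  assume eq: "P_space H = P_space_ge H l"
  note eE = max_eab[OF E(1)]
  note AE = eab_abp[OF eE] and EG = eab_subset[OF eE]
  obtain c :: "'g \<Rightarrow> 'k" where c: "generic E c"
    using generic_coefficients[OF inf finite_subset[OF EG fin], of "of_nat ` {..<p}"] unfolding generic_def by auto
  let ?v = "gen_elt E c"
  have pt: "point ?v \<in> p_points H"
    using point_p_point[OF AE EG subgroup_self gen_elt_kS[OF eE] gen_elt_pw[OF eE] generic_exact_regular[OF eE E(2) c]]
    unfolding HK_G .
  hence "p_equiv H `` {point ?v} \<in> P_space H" unfolding P_space_def by (rule quotientI)
  then obtain \<beta> A where A: "HK A \<in> Max_au_ge H l" "abp A" and \<beta>: "\<beta> \<in> p_points (HK A)"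
    and cl: "p_equiv H `` {point ?v} = p_equiv H `` {\<beta>}" unfolding eq P_space_ge_eq by blast
  have "\<beta> \<in> p_points H"
    using p_points_mono[OF abp_subgroup[OF A(2)] subgroup_self abp_sub[OF A(2)] \<beta>] by (simp add: HK_G)
  hence pe: "(point ?v, \<beta>) \<in> p_equiv H"
    by (rule eq_equiv_class[OF cl p_equiv_equiv[OF subgroup_self, unfolded HK_G]])
  have "\<exists>x\<in>carrier G. \<forall>e\<in>E. inv x \<otimes> e \<otimes> x \<in> A"
  proof (rule ccontr)
    assume "\<not> ?thesis"
    hence "\<exists>e\<in>E. inv x \<otimes> e \<otimes> x \<notin> A" if "x \<in> carrier G" for x using that by auto
    from generic_not_equiv[OF eE c A(2) this \<beta>] pe show False by simp
  qed
  then obtain x where x: "x \<in> carrier G" "\<And>e. e \<in> E \<Longrightarrow> inv x \<otimes> e \<otimes> x \<in> A" by auto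
  note OmA = Om_eab[OF A(2)]
  let ?F = "(\<lambda>y. x \<otimes> y \<otimes> inv x) ` Om A"
  have "E \<subseteq> ?F"
  proof
    fix e assume e: "e \<in> E"
    have eG: "e \<in> carrier G" using e EG by blast
    have cj: "eab ((\<lambda>y. inv x \<otimes> y \<otimes> inv (inv x)) ` E)" by (rule conj_eab(1)[OF eE]) (use x in simp)
    have "inv x \<otimes> e \<otimes> x \<in> Om A"
      using cj e x x(2)[OF e] by (simp add: Om_def eab_def)
    moreover have "e = x \<otimes> (inv x \<otimes> e \<otimes> x) \<otimes> inv x"
      using x(1) eG by (simp add: m_assoc[symmetric]) (simp add: m_assoc)
    ultimately show "e \<in> ?F" by (rule rev_image_eqI)
  qed
  hence "?F = E" by (rule max_eab_le[OF E(1) conj_eab(1)[OF OmA x(1)]])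
  hence "card (Om A) = p ^ elem_rank p G E" using conj_eab(2)[OF OmA x(1)] elem_rank_card[OF eE] by simp
  from complexity_Om[OF A(2) this] A(1) l show False by (simp add: Max_au_ge_def)
qed

lemma srk_eq_min_rank:
  assumes inf: "infinite (UNIV :: 'k set)" and d: "p dvd order G"
  shows "srk H = Min (elem_rank p G ` {E. max_elem_abelian p G E})"
proof -
  let ?X = "elem_rank p G ` {E. max_elem_abelian p G E}"
  define R where "R = Min ?X"
  have fX: "finite ?X" "?X \<noteq> {}" using max_eab_finite max_eab_nonempty by auto
  have le: "R \<le> elem_rank p G E" if "max_elem_abelian p G E" for E
    unfolding R_def by (rule Min_le[OF fX(1)]) (use that in simp)
  have "R \<in> ?X" unfolding R_def by (rule Min_in[OF fX])
  then obtain E where E: "max_elem_abelian p G E" "R = elem_rank p G E" by auto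
  have E1: "E \<noteq> {\<one>}" by (rule max_eab_nontrivial[OF d E(1)])
  have "R \<noteq> 0"
  proof
    assume "R = 0"
    hence "card E = 1" using elem_rank_card[OF max_eab[OF E(1)]] E(2) by simp
    then obtain y where "E = {y}" by (auto simp: card_1_singleton_iff)
    thus False using E1 abp_one[OF eab_abp[OF max_eab[OF E(1)]]] by simp
  qed
  have "P_space H = P_space_ge H l \<longleftrightarrow> l \<le> R" for l
  proof
    assume eq: "P_space H = P_space_ge H l"
    show "l \<le> R"
    proof (rule ccontr)
      assume "\<not> l \<le> R"
      hence "elem_rank p G E < l" using E(2) by simp
      from P_space_not_covered[OF inf E(1) E1 this] eq show False by simp
    qed
  next
    assume "l \<le> R"
    thus "P_space H = P_space_ge H l" using le by (intro P_space_covered) (meson order_trans)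
  qed
  hence "{l. l \<ge> 1 \<and> P_space H = P_space_ge H l} = {1..R}" by auto
  hence "srk H = Max {1..R}" unfolding srk_def by simp
  also have "\<dots> = R" using \<open>R \<noteq> 0\<close> by (intro Max_eqI) auto
  finally show ?thesis unfolding R_def .
qed

end

theorem corollary2p3:
  fixes G :: "('g, 'm) monoid_scheme" and p :: nat
  assumes "group G" and "finite (carrier G)"
    and "CHAR('k::alg_closed_field) = p" and "p > 0"
    and "p dvd order G"
  shows "srk (constant_scheme G :: ('g, 'k) hopf) =
         Min (elem_rank p G ` {E. max_elem_abelian p G E})"
proof -
  have "prime p" using prime_CHAR_semidom[where 'a = 'k] assms(3,4) by simp
  then interpret fin_group_alg G "TYPE('k)" p
    using assms by (simp add: fin_group_alg_def fin_group_alg_axioms_def)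
  show ?thesis by (rule srk_eq_min_rank[OF infinite_alg_closed assms(5)])
qed

end
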